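(* Assume (HV) and (HP), as defined in the context, and that $\lambda_0=0$ (critical case). Let $\nu=\mu_0/\mu_0(1)$, $A=\int\mu_0(dy)$, $B=\int\Theta_0^2(y)\,b(y)\,\mu_0(dy)$, and let $\xi$ be an exponential random variable with mean $1$. Then for every $x\in\mathbb R$ $$\lim_{t\to\infty}(t+1)\,\mathbb P_{\delta_x}(N_t>0)=\frac1B\,\Theta_0(x).$$ Moreover, there is a finite constant $C$ such that for all $t\ge0$ $$\sup_{x\in\mathbb R}\Big|(1+t)\,\mathbb P_{\delta_x}(N_t>0)-\frac1B\Theta_0(x)\Big|\le\frac{C\,\log(2+t)}{1+t}.$$ Furthermore, for every $f\in C_b(\mathbb R)$, every $n\ge1$ and every $x\in\mathbb R$, $$\lim_{t\to\infty}\mathbb E_{\delta_x}\!\left(\Big(\frac{\langle Z_t,f\rangle}{(t+1)AB}\Big)^n\,\Big|\,N_t>0\right)=\nu(f)^n\,\mathbb E(\xi^n).$$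
   Context: Setting and notation. $(X_t)_{t\ge 0}$ is a Markov process on $\mathbb R$ and $\mathbb E_x$ denotes expectation when $X_0=x$. Let $b,d:\mathbb R\to[0,\infty)$ be birth and death rates and $V=b-d$. Consider the branching Markov process started from one individual with trait $x$ (law $\mathbb P_{\delta_x}$, expectation $\mathbb E_{\delta_x}$): individuals behave independently, the trait of each individual moves as $X$, an individual with trait $y$ gives birth to one new individual with the same trait at rate $b(y)$ and dies at rate $d(y)$. If $\mathcal V_t$ is the set of individuals alive at time $t$ and $X^i_t$ is the trait of $i$, put $Z_t=\sum_{i\in\mathcal V_t}\delta_{X^i_t}$, $\langle Z_t,f\rangle=\sum_{i\in\mathcal V_t}f(X^i_t)$, $N_t=\langle Z_t,1\rangle$. The Feynman--Kac semigroup is $P_tf(x)=\mathbb E_{\delta_x}(\langle Z_t,f\rangle)=\mathbb E_x\big(e^{\int_0^tV(X_s)ds}f(X_t)\big)$. $C_b(\mathbb R)$ (bounded continuous), $C_0(\mathbb R)$ (continuous, tending to $0$ at infinity) and $\mathscr B$ (bounded measurable functions) carry the sup norm $\|\cdot\|_\infty$. For a measure $\nu$, $\nu(f)=\int f\,d\nu$. (HV): HV1) $b,d$ are nonnegative, nonzero and continuous. HV2) $b$ is bounded above by a finite number $b^*>0$. (HP): HP1) There exist a positive function $\Theta_0\in C_0(\mathbb R)$ and a real $\lambda_0$ with $P_t\Theta_0=e^{-\lambda_0t}\Theta_0$ for all $t\ge0$. HP2) There exist a positive finite measure $\mu_0$ charging every nonempty open set, and numbers $\lambda_1>\lambda_0$,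 $H>0$, such that $\int\Theta_0\,d\mu_0=1$ and, with $\Pi(g)=\Theta_0\int g\,d\mu_0$, $\|e^{\lambda_0t}P_t(g)-\Pi(g)\|_\infty\le H\|g\|_\infty e^{-(\lambda_1-\lambda_0)t}$ for all $g\in C_b(\mathbb R)$, $t\ge0$. HP3) $(P_t)$ is strongly continuous and irreducible in $C_0(\mathbb R)$ (irreducible: for every nonzero $f\ge0$ in $C_0(\mathbb R)$ and every nonzero positive finite measure $m$ there is $t\ge 0$ with $\int P_tf\,dm>0$), and $x\mapsto\int_0^tP_sf(x)\,ds$ belongs to $C_b(\mathbb R)$ for every $f\in\mathscr B$ and every $t$. HP4) For any $t>0$, $P_t$ maps $C_b(\mathbb R)$ to $C_0(\mathbb R)$. HP5) With $T_m=\inf\{s\ge0:\langle Z_s,\mathbf 1_{[-m,m]^c}\rangle>0\}$, for every $x\in\mathbb R$, $T_m\to+\infty$ $\mathbb P_{\delta_x}$-a.s. as $m\to\infty$. *)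

theory Defs
  imports "HOL-Probability.Probability"
begin

definition Cb :: "(real \<Rightarrow> real) set" where
  "Cb = {f. continuous_on UNIV f \<and> bounded (range f)}"

definition C0 :: "(real \<Rightarrow> real) set" where
  "C0 = {f. continuous_on UNIV f \<and> (f \<longlongrightarrow> 0) at_infinity}"

definition bdd_borel :: "(real \<Rightarrow> real) set" where
  "bdd_borel = {f. f \<in> borel_measurable borel \<and> bounded (range f)}"

text \<open>The supremum is taken in the extended nonnegative reals, so that \<open>sup_norm f \<le> c\<close> with
  \<open>c < \<infinity>\<close> includes the boundedness of \<open>f\<close>.\<close>

definition sup_norm :: "(real \<Rightarrow> real) \<Rightarrow> ennreal" where
  "sup_norm f = (SUP x. ennreal \<bar>f x\<bar>)"

text \<open>A (time-homogeneous, conservative) Markov process on the real line in the usual format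
  \<open>(\<Omega>, (F t), (X t), (Q x))\<close>: \<open>Q x\<close> is the law on \<open>\<Omega>\<close> under which the process starts at \<open>x\<close>.
  Only the sigma-algebra of the measure space \<open>\<Omega>\<close> matters. Progressive measurability, which is
  automatic for right-continuous adapted processes, gives sense to time integrals along the paths;
  no path regularity is imposed.\<close>

definition markov_process ::
  "'a measure \<Rightarrow> (real \<Rightarrow> 'a measure) \<Rightarrow> (real \<Rightarrow> 'a \<Rightarrow> real) \<Rightarrow> (real \<Rightarrow> 'a measure) \<Rightarrow> bool" where
  "markov_process \<Omega> F X Q \<longleftrightarrow>
     Q \<in> borel \<rightarrow>\<^sub>M prob_algebra \<Omega> \<and>
     (\<forall>t\<ge>0. subalgebra \<Omega> (F t)) \<and>
     (\<forall>s\<ge>0. \<forall>t\<ge>s. sets (F s) \<subseteq> sets (F t)) \<and>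
     (\<forall>t\<ge>0. (\<lambda>(s, w). X s w) \<in> borel_measurable (restrict_space borel {0..t} \<Otimes>\<^sub>M F t)) \<and>
     (\<forall>x. AE w in Q x. X 0 w = x) \<and>
     (\<forall>x. \<forall>s\<ge>0. \<forall>t\<ge>0. \<forall>A\<in>sets (F s). \<forall>B\<in>sets borel.
        emeasure (Q x) (A \<inter> {w \<in> space \<Omega>. X (s + t) w \<in> B}) =
        (\<integral>\<^sup>+w\<in>A. emeasure (Q (X s w)) {w' \<in> space \<Omega>. X t w' \<in> B} \<partial>Q x))"

definition feynman_kac ::
  "(real \<Rightarrow> 'a \<Rightarrow> real) \<Rightarrow> (real \<Rightarrow> 'a measure) \<Rightarrow> (real \<Rightarrow> real) \<Rightarrow>
   real \<Rightarrow> (real \<Rightarrow> real) \<Rightarrow> real \<Rightarrow> real" where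
  "feynman_kac X Q V t f x =
     (\<integral>w. exp (LINT s:{0..t}|lborel. V (X s w)) * f (X t w) \<partial>Q x)"

text \<open>The life of an individual, with time measured by its age, is encoded by a triple
  \<open>(w, \<eta>, \<epsilon>)\<close>: its trait at age \<open>a\<close> is \<open>X a w\<close>, \<open>\<eta>\<close> is the exponential clock of its death, and
  \<open>\<epsilon> 0, \<epsilon> 1, \<dots>\<close> are the exponential waiting times of the unit-rate Poisson process which, run
  with the internal clock \<open>a \<mapsto> \<integral>\<^sub>0\<^sup>a b (X s w) ds\<close>, yields its births.\<close>

type_synonym 'a life = "'a \<times> real \<times> (nat \<Rightarrow> real)"

definition unit_exp :: "real measure" where
  "unit_exp = density lborel (\<lambda>x. ennreal (exponential_density 1 x))"

definition life_space :: "'a measure \<Rightarrow> 'a life measure" where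
  "life_space \<Omega> = \<Omega> \<Otimes>\<^sub>M (borel \<Otimes>\<^sub>M (\<Pi>\<^sub>M k\<in>UNIV. borel))"

definition life_law :: "(real \<Rightarrow> 'a measure) \<Rightarrow> real \<Rightarrow> 'a life measure" where
  "life_law Q y = Q y \<Otimes>\<^sub>M (unit_exp \<Otimes>\<^sub>M (\<Pi>\<^sub>M k\<in>UNIV. unit_exp))"

text \<open>The age at which a clock of total charge \<open>e\<close>, consumed at rate \<open>r\<close> along the path, rings
  (\<open>\<infinity>\<close> if it never does).\<close>

definition ring_age ::
  "(real \<Rightarrow> 'a \<Rightarrow> real) \<Rightarrow> (real \<Rightarrow> real) \<Rightarrow> 'a \<Rightarrow> real \<Rightarrow> ereal" where
  "ring_age X r w e =
     Inf {ereal a |a. 0 \<le> a \<and> ennreal e \<le> (\<integral>\<^sup>+s\<in>{0..a}. ennreal (r (X s w)) \<partial>lborel)}"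

definition death_age :: "(real \<Rightarrow> 'a \<Rightarrow> real) \<Rightarrow> (real \<Rightarrow> real) \<Rightarrow> 'a life \<Rightarrow> ereal" where
  "death_age X d l = (case l of (w, \<eta>, \<epsilon>) \<Rightarrow> ring_age X d w \<eta>)"

definition birth_age :: "(real \<Rightarrow> 'a \<Rightarrow> real) \<Rightarrow> (real \<Rightarrow> real) \<Rightarrow> nat \<Rightarrow> 'a life \<Rightarrow> ereal" where
  "birth_age X b k l = (case l of (w, \<eta>, \<epsilon>) \<Rightarrow> ring_age X b w (\<Sum>i\<le>k. \<epsilon> i))"

text \<open>Individuals carry Ulam--Harris labels: \<open>[]\<close> is the ancestor and \<open>k # u\<close> is the \<open>k\<close>-th child
  of \<open>u\<close> (counted from 0). A realisation \<open>T\<close> attaches a life to every label, including labels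
  of individuals that are never born.\<close>

type_synonym 'a tree = "nat list \<Rightarrow> 'a life"

primrec born ::
  "(real \<Rightarrow> 'a \<Rightarrow> real) \<Rightarrow> (real \<Rightarrow> real) \<Rightarrow> (real \<Rightarrow> real) \<Rightarrow> 'a tree \<Rightarrow> nat list \<Rightarrow> bool" where
  "born X b d T [] = True"
| "born X b d T (k # u) = (born X b d T u \<and> birth_age X b k (T u) < death_age X d (T u))"

primrec birth_time ::
  "(real \<Rightarrow> 'a \<Rightarrow> real) \<Rightarrow> (real \<Rightarrow> real) \<Rightarrow> 'a tree \<Rightarrow> nat list \<Rightarrow> ereal" where
  "birth_time X b T [] = 0"
| "birth_time X b T (k # u) = birth_time X b T u + birth_age X b k (T u)"

text \<open>The trait at birth, which is the trait of the mother at that moment. The value is irrelevant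
  for labels whose birth age is infinite (\<open>real_of_ereal \<infinity> = 0\<close>), as they are never born.\<close>

primrec birth_trait ::
  "(real \<Rightarrow> 'a \<Rightarrow> real) \<Rightarrow> (real \<Rightarrow> real) \<Rightarrow> real \<Rightarrow> 'a tree \<Rightarrow> nat list \<Rightarrow> real" where
  "birth_trait X b x T [] = x"
| "birth_trait X b x T (k # u) = X (real_of_ereal (birth_age X b k (T u))) (fst (T u))"

definition alive ::
  "(real \<Rightarrow> 'a \<Rightarrow> real) \<Rightarrow> (real \<Rightarrow> real) \<Rightarrow> (real \<Rightarrow> real) \<Rightarrow> 'a tree \<Rightarrow> real \<Rightarrow> nat list set" where
  "alive X b d T t =
     {u. born X b d T u \<and> birth_time X b T u \<le> ereal t \<and>
         ereal t < birth_time X b T u + death_age X d (T u)}"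

definition trait_at ::
  "(real \<Rightarrow> 'a \<Rightarrow> real) \<Rightarrow> (real \<Rightarrow> real) \<Rightarrow> 'a tree \<Rightarrow> real \<Rightarrow> nat list \<Rightarrow> real" where
  "trait_at X b T t u = X (t - real_of_ereal (birth_time X b T u)) (fst (T u))"

text \<open>\<open>pairing X b d T t f\<close> is \<open>\<langle>Z\<^sub>t, f\<rangle>\<close>. It takes the value 0 if infinitely many individuals are
  alive at time \<open>t\<close>, an event of probability zero when \<open>b\<close> is bounded.\<close>

definition pairing ::
  "(real \<Rightarrow> 'a \<Rightarrow> real) \<Rightarrow> (real \<Rightarrow> real) \<Rightarrow> (real \<Rightarrow> real) \<Rightarrow> 'a tree \<Rightarrow> real \<Rightarrow>
   (real \<Rightarrow> real) \<Rightarrow> real" where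
  "pairing X b d T t f = (\<Sum>u\<in>alive X b d T t. f (trait_at X b T t u))"

definition pop_size ::
  "(real \<Rightarrow> 'a \<Rightarrow> real) \<Rightarrow> (real \<Rightarrow> real) \<Rightarrow> (real \<Rightarrow> real) \<Rightarrow> 'a tree \<Rightarrow> real \<Rightarrow> real" where
  "pop_size X b d T t = pairing X b d T t (\<lambda>_. 1)"

definition exit_time ::
  "(real \<Rightarrow> 'a \<Rightarrow> real) \<Rightarrow> (real \<Rightarrow> real) \<Rightarrow> (real \<Rightarrow> real) \<Rightarrow> 'a tree \<Rightarrow> real \<Rightarrow> ereal" where
  "exit_time X b d T m =
     Inf {ereal s |s. 0 \<le> s \<and> pairing X b d T s (indicator (- {-m..m})) > 0}"

definition past_generations ::
  "'a measure \<Rightarrow> 'w set \<Rightarrow> (nat list \<Rightarrow> 'w \<Rightarrow> 'a life) \<Rightarrow> nat \<Rightarrow> 'w measure" where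
  "past_generations \<Omega> S L n =
     vimage_algebra S (\<lambda>\<omega>. \<lambda>v\<in>{v. length v < n}. L v \<omega>)
       (\<Pi>\<^sub>M v\<in>{v. length v < n}. life_space \<Omega>)"

text \<open>\<open>Pr x\<close> is the law of the branching process started from one individual with trait \<open>x\<close>, and
  \<open>L u\<close> is the random life of \<open>u\<close>. Individuals behave independently: given all earlier
  generations, the lives of the individuals of generation \<open>n\<close> are independent, and the life of
  \<open>u\<close> is that of an individual whose motion starts from the trait of \<open>u\<close> at birth.\<close>

definition branching_markov_process ::
  "'a measure \<Rightarrow> (real \<Rightarrow> 'a \<Rightarrow> real) \<Rightarrow> (real \<Rightarrow> 'a measure) \<Rightarrow> (real \<Rightarrow> real) \<Rightarrow>
   (real \<Rightarrow> 'w measure) \<Rightarrow> (nat list \<Rightarrow> 'w \<Rightarrow> 'a life) \<Rightarrow> bool" where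
  "branching_markov_process \<Omega> X Q b Pr L \<longleftrightarrow>
     (\<forall>x. prob_space (Pr x) \<and>
          (\<forall>u. L u \<in> Pr x \<rightarrow>\<^sub>M life_space \<Omega>) \<and>
          (\<forall>n J D. \<forall>G\<in>sets (past_generations \<Omega> (space (Pr x)) L n).
             finite J \<longrightarrow> (\<forall>u\<in>J. length u = n \<and> D u \<in> sets (life_space \<Omega>)) \<longrightarrow>
             emeasure (Pr x) (G \<inter> {\<omega> \<in> space (Pr x). \<forall>u\<in>J. L u \<omega> \<in> D u}) =
             (\<integral>\<^sup>+\<omega>\<in>G. (\<Prod>u\<in>J. emeasure (life_law Q (birth_trait X b x (\<lambda>v. L v \<omega>) u)) (D u))
                \<partial>Pr x)))"

definition HV :: "(real \<Rightarrow> real) \<Rightarrow> (real \<Rightarrow> real) \<Rightarrow> bool" where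
  "HV b d \<longleftrightarrow>
     (\<forall>y. b y \<ge> 0) \<and> (\<forall>y. d y \<ge> 0) \<and> (\<exists>y. b y \<noteq> 0) \<and> (\<exists>y. d y \<noteq> 0) \<and>
     continuous_on UNIV b \<and> continuous_on UNIV d \<and>
     (\<exists>bmax>0. \<forall>y. b y \<le> bmax)"

text \<open>In the following, \<open>P t f x\<close> stands for the Feynman--Kac semigroup.\<close>

definition HP1 ::
  "(real \<Rightarrow> (real \<Rightarrow> real) \<Rightarrow> real \<Rightarrow> real) \<Rightarrow> (real \<Rightarrow> real) \<Rightarrow> real \<Rightarrow> bool" where
  "HP1 P \<Theta> lam0 \<longleftrightarrow>
     \<Theta> \<in> C0 \<and> (\<forall>x. \<Theta> x > 0) \<and> (\<forall>t\<ge>0. \<forall>x. P t \<Theta> x = exp (- lam0 * t) * \<Theta> x)"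

definition HP2 ::
  "(real \<Rightarrow> (real \<Rightarrow> real) \<Rightarrow> real \<Rightarrow> real) \<Rightarrow> (real \<Rightarrow> real) \<Rightarrow> real \<Rightarrow> real measure \<Rightarrow> bool" where
  "HP2 P \<Theta> lam0 \<mu> \<longleftrightarrow>
     sets \<mu> = sets borel \<and> finite_measure \<mu> \<and>
     (\<forall>U. open U \<longrightarrow> U \<noteq> {} \<longrightarrow> emeasure \<mu> U > 0) \<and>
     (\<integral>y. \<Theta> y \<partial>\<mu>) = 1 \<and>
     (\<exists>lam1>lam0. \<exists>H>0. \<forall>g\<in>Cb. \<forall>t\<ge>0.
        sup_norm (\<lambda>x. exp (lam0 * t) * P t g x - \<Theta> x * (\<integral>y. g y \<partial>\<mu>))
          \<le> ennreal H * sup_norm g * ennreal (exp (- (lam1 - lam0) * t)))"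

definition HP3 :: "(real \<Rightarrow> (real \<Rightarrow> real) \<Rightarrow> real \<Rightarrow> real) \<Rightarrow> bool" where
  "HP3 P \<longleftrightarrow>
     (\<forall>f\<in>C0. (\<forall>t\<ge>0. P t f \<in> C0) \<and>
              ((\<lambda>t. sup_norm (\<lambda>x. P t f x - f x)) \<longlongrightarrow> 0) (at_right 0)) \<and>
     (\<forall>f\<in>C0. \<forall>m. (\<forall>x. f x \<ge> 0) \<longrightarrow> (\<exists>x. f x \<noteq> 0) \<longrightarrow>
        sets m = sets borel \<longrightarrow> finite_measure m \<longrightarrow> emeasure m UNIV \<noteq> 0 \<longrightarrow>
        (\<exists>t\<ge>0. (\<integral>x. P t f x \<partial>m) > 0)) \<and>
     (\<forall>f\<in>bdd_borel. \<forall>t\<ge>0. (\<lambda>x. LINT s:{0..t}|lborel. P s f x) \<in> Cb)"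

definition HP4 :: "(real \<Rightarrow> (real \<Rightarrow> real) \<Rightarrow> real \<Rightarrow> real) \<Rightarrow> bool" where
  "HP4 P \<longleftrightarrow> (\<forall>t>0. \<forall>f\<in>Cb. P t f \<in> C0)"

definition HP5 ::
  "(real \<Rightarrow> 'a \<Rightarrow> real) \<Rightarrow> (real \<Rightarrow> real) \<Rightarrow> (real \<Rightarrow> real) \<Rightarrow> (real \<Rightarrow> 'w measure) \<Rightarrow>
   (nat list \<Rightarrow> 'w \<Rightarrow> 'a life) \<Rightarrow> bool" where
  "HP5 X b d Pr L \<longleftrightarrow>
     (\<forall>x. AE \<omega> in Pr x. ((\<lambda>m. exit_time X b d (\<lambda>u. L u \<omega>) m) \<longlongrightarrow> \<infinity>) at_top)"

end

theory Submission imports Defs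
begin

text \<open>Run the births along the path of an individual as a Poisson process and condition on its first
 point: this gives a renewal equation for the functionals \<open>E (\<Prod>\<^sub>i f (X\<^sup>i))\<close> of the branching process.
 Exchanging potentials along paths turns it into the Duhamel equation
 \<open>m\<^sub>t + \<integral>\<^sub>0\<^sup>t P\<^sub>s (b m\<^sub>t\<^sub>-\<^sub>s\<^sup>2) ds = P\<^sub>t (1 - f)\<close> for \<open>m = 1 - E (\<Prod>\<^sub>i f (X\<^sup>i))\<close>. For \<open>f = e\<^sup>-\<^sup>\<theta>\<^sup>g\<close>,
 iterated differences at \<open>\<theta> \<rightarrow> 0\<close> yield the recursion of the moments, and since \<open>P\<^sub>s\<close> is exponentially close to
 the projection \<open>\<Theta> \<mu>\<close>, the \<open>n\<close>-th moment grows like \<open>n! (B t)\<^sup>n\<^sup>-\<^sup>1 \<mu>(g)\<^sup>n \<Theta>\<close>. For \<open>f = 0\<close> the equation is that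
 of the survival probability \<open>u\<close>. Put \<open>y = \<mu>(u)\<close>; then \<open>y' = - \<mu>(b u\<^sup>2)\<close>, and comparing \<open>u\<close> with \<open>\<Theta> y\<close> over
 windows of fixed length gives first \<open>y \<rightarrow> 0\<close>, then \<open>u = \<Theta> y + O(y\<^sup>2)\<close>, hence \<open>(1 / y)' = B + O(y)\<close> and
 \<open>1 / y = B t + O(log t)\<close>. Signed test functions reduce to nonnegative ones by finite differences of
 \<open>z \<mapsto> \<langle>Z, f + z K\<rangle>\<^sup>n\<close>.\<close>

text \<open>Three obstacles shape the constructions. The Markov property is given at single times
  and without path regularity; functionals of whole paths such as exp(- integral of g) are therefore
  reached through powers of clocks, and derivatives in time are replaced by a change of variables
  for integrated rates that asks only for measurability. The rate \<open>d\<close> may be unbounded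
  and nothing is assumed about \<open>Pr x\<close> as a function of \<open>x\<close>; hence the
  functionals are first built in the extended nonnegative reals as limits of iterated operators on
  truncated trees (\<open>K\<close> children, \<open>n\<close> generations), which makes them
  measurable in time and trait, and only afterwards are they recognised as expectations and
  non-explosion is derived. Finally, the gap is assumed for continuous functions, while
  \<open>b u\<^sup>2\<close> is known to be measurable only, so it is carried over to Borel
  functions by regularity. Finite differences are preferred to derivatives in \<theta> because they
  produce powers of 1 - q, which are nonnegative: bounds on them pass through Fatou's lemma before
  any moment is known to exist.\<close>

abbreviation "borel2 \<equiv> borel \<Otimes>\<^sub>M borel"

lemmas lint_nonneg = Bochner_Integration.integral_nonneg

section \<open>The weight exp(-z) on the extended half-line\<close>

text \<open>The value 0 at infinity is the continuous extension. It is met in earnest, since the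
  clock of an unbounded death rate is only almost surely finite, and with it \<open>expm_add\<close>
  holds without side conditions.\<close>

definition expm :: "ennreal => ennreal" where
 "expm z = (if z = \<top> then 0 else ennreal (exp (- enn2real z)))"

lemma expm_ennreal: "0 \<le> r ==> expm (ennreal r) = ennreal (exp (- r))"
 by (simp add: expm_def)

lemma expm_top [simp]: "expm \<top> = 0"
 by (simp add: expm_def)

lemma expm_0 [simp]: "expm 0 = 1"
 by (simp add: expm_def)

lemma expm_add: "expm (x + y) = expm x * expm y"
 by (cases x; cases y)
   (auto simp: expm_ennreal ennreal_mult[symmetric] exp_add[symmetric] ennreal_plus[symmetric]
    simp del: ennreal_plus)

lemma expm_le_1: "expm z \<le> 1"
 by (cases z) (auto simp: expm_ennreal)

lemma expm_less_top [simp]: "expm z < \<top>"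
 using expm_le_1[of z] by (simp add: le_less_trans)

lemma expm_antimono: "x \<le> y ==> expm y \<le> expm x"
 by (cases x; cases y) (auto simp: expm_ennreal top_unique)

lemma measurable_expm [measurable]: "expm \<in> borel_measurable borel"
 unfolding expm_def by measurable

lemma tendsto_expm:
 fixes z :: "nat => ennreal"
 assumes z: "z \<longlonglongrightarrow> l"
 shows "(\<lambda>n. expm (z n)) \<longlonglongrightarrow> expm l"
proof (cases l)
 case (real r)
 have "eventually (\<lambda>n. z n < ennreal (r + 1)) sequentially"
  using z real by (intro order_tendstoD(2)[where y = l]) (auto simp: ennreal_less_iff)
 then have *: "eventually (\<lambda>n. expm (z n) = ennreal (exp (- enn2real (z n)))) sequentially"
  by eventually_elim (auto simp: expm_def)
 have "(\<lambda>n. enn2real (z n)) \<longlonglongrightarrow> r"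
  using z real tendsto_enn2real[of z r sequentially] by simp
 then have "(\<lambda>n. enn2real (z n)) \<longlonglongrightarrow> enn2real l"
  using real by simp
 then have "(\<lambda>n. ennreal (exp (- enn2real (z n)))) \<longlonglongrightarrow> ennreal (exp (- enn2real l))"
  by (intro tendsto_ennrealI tendsto_exp tendsto_minus)
 then have "(\<lambda>n. ennreal (exp (- enn2real (z n)))) \<longlonglongrightarrow> expm l"
  using real by (simp add: expm_def)
 with * show ?thesis
  by (simp cong: filterlim_cong)
next
 case top
 show ?thesis
 proof (rule order_tendstoI)
  fix a assume "a < expm l" then show "eventually (\<lambda>n. a < expm (z n)) sequentially"
   using top by simp
 next
  fix a assume a: "expm l < a"
  \<comment> \<open>Capping \<open>a\<close> at 1 keeps \<open>- ln e\<close> nonnegative, so that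
    it can be compared with \<open>z n\<close> inside the extended nonnegative reals.\<close>
  define e where "e = enn2real (min a 1)"
  have fin: "min a 1 < \<top>" by (simp add: min_less_iff_disj)
  then have "ennreal e = min a 1" by (simp add: e_def)
  then have e: "0 < e" "ennreal e \<le> a" "e \<le> 1"
   using a top fin by (auto simp: e_def enn2real_positive_iff intro!: enn2real_leI)
  then have "0 \<le> - ln e" using e by simp
  have "eventually (\<lambda>n. ennreal (- ln e) < z n) sequentially"
   using z top by (intro order_tendstoD(1)[where y = l]) auto
  then show "eventually (\<lambda>n. expm (z n) < a) sequentially"
  proof eventually_elim
   case (elim n)
   have "expm (z n) < ennreal e"
   proof (cases "z n")
    case (real s)
    then have "- ln e < s" using elim \<open>0 \<le> - ln e\<close> by (simp add: ennreal_less_iff)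
    then have "exp (- s) < exp (ln e)" by simp
    then have "exp (- s) < e" using e by simp
    then show ?thesis using real by (simp add: expm_ennreal ennreal_less_iff)
   qed (use e in auto)
   then show ?case using e by auto
  qed
 qed
qed

section \<open>Clocks and their change of variables\<close>

text \<open>One notion for every integrated rate: birth and death rates along a path, thinned
  Poisson intensities and later the loss rate \<open>\<beta>\<close> of the mean survival
  probability. Extended values allow it to be used before any integrability is known.\<close>

definition clk :: "(real => ennreal) => real => ennreal" where
 "clk g s = (\<integral>\<^sup>+r\<in>{0..s}. g r \<partial>lborel)"

lemma measurable_clk [measurable (raw)]:
 assumes [measurable]: "(\<lambda>(x, r). g x r) \<in> borel_measurable (N \<Otimes>\<^sub>M borel)" "f \<in> borel_measurable N"
 shows "(\<lambda>x. clk (g x) (f x)) \<in> borel_measurable N"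
 unfolding clk_def indicator_def atLeastAtMost_iff by measurable

lemma clk_mono: "s \<le> t ==> clk g s \<le> clk g t"
 unfolding clk_def by (intro nn_integral_mono) (auto split: split_indicator)

lemma clk_nonpos: "s \<le> 0 ==> clk g s = 0"
proof -
 assume "s \<le> 0"
 then have "clk g s \<le> (\<integral>\<^sup>+r\<in>{0}. g r \<partial>lborel)"
  unfolding clk_def by (intro nn_integral_mono) (auto split: split_indicator)
 also have "\<dots> = 0" by (simp add: nn_integral_null_set)
 finally show ?thesis by simp
qed

lemma clk_split:
 assumes [measurable]: "g \<in> borel_measurable borel" and "0 \<le> s" "s \<le> t"
 shows "clk g t = clk g s + (\<integral>\<^sup>+r\<in>{s<..t}. g r \<partial>lborel)"
proof -
 have "clk g t = (\<integral>\<^sup>+r. g r * indicator {0..s} r + g r * indicator {s<..t} r \<partial>lborel)"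
  unfolding clk_def using assms by (intro nn_integral_cong) (auto split: split_indicator)
 then show ?thesis by (simp add: nn_integral_add clk_def)
qed

lemma clk_shift:
 assumes [measurable]: "g \<in> borel_measurable borel" and "0 \<le> s" "0 \<le> t"
 shows "clk g (s + t) = clk g s + clk (\<lambda>r. g (s + r)) t"
proof -
 have "(\<integral>\<^sup>+r\<in>{s<..s+t}. g r \<partial>lborel) = (\<integral>\<^sup>+r. g (s + r) * indicator {s<..s+t} (s + r) \<partial>lborel)"
  using nn_integral_real_affine[of "\<lambda>r. g r * indicator {s<..s+t} r" 1 s] by simp
 also have "\<dots> = clk (\<lambda>r. g (s + r)) t"
  unfolding clk_def
 proof (rule nn_integral_cong_AE)
  have "AE r in lborel. r \<noteq> 0" by (rule AE_lborel_singleton)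
  then show "AE r in lborel. g (s + r) * indicator {s<..s+t} (s + r) = g (s + r) * indicator {0..t} r"
   by eventually_elim (auto split: split_indicator)
 qed
 finally show ?thesis using clk_split[of g s "s + t"] assms by simp
qed

text \<open>Dominated convergence: finiteness at \<open>x + 1\<close> supplies the dominating
  function, and the endpoint \<open>r = x\<close>, where the indicators may fail to converge, is a
  Lebesgue null set.\<close>

lemma clk_continuous:
 assumes [measurable]: "g \<in> borel_measurable borel" and fin: "\<And>t. clk g t < \<top>"
 shows "isCont (clk g) x"
 unfolding continuous_at_sequentially comp_def
proof (intro allI impI)
 fix X :: "nat => real" assume X: "X \<longlonglongrightarrow> x"
 then have "eventually (\<lambda>n. X n < x + 1) sequentially"
  by (intro order_tendstoD) auto
 then obtain N where N: "\<And>n. N \<le> n ==> X n < x + 1"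
  by (auto simp: eventually_sequentially)
 have "(\<lambda>n. clk g (X (n + N))) \<longlonglongrightarrow> clk g x"
  unfolding clk_def
 proof (rule nn_integral_dominated_convergence[where w="\<lambda>r. g r * indicator {0..x+1} r"])
  show "AE r in lborel. g r * indicator {0..X (n + N)} r \<le> g r * indicator {0..x + 1} r" for n
   using N[of "n + N"] by (auto split: split_indicator)
  have "AE r in lborel. r \<noteq> x" by (rule AE_lborel_singleton)
  then show "AE r in lborel. (\<lambda>n. g r * indicator {0..X (n + N)} r) \<longlonglongrightarrow> g r * indicator {0..x} r"
  proof eventually_elim
   case (elim r)
   have XN: "(\<lambda>n. X (n + N)) \<longlonglongrightarrow> x" using X by (rule LIMSEQ_ignore_initial_segment)
   have "eventually (\<lambda>n. g r * indicator {0..X (n + N)} r = g r * indicator {0..x} r) sequentially"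
   proof (cases "r < x")
    case True
    show ?thesis using order_tendstoD(1)[OF XN True] by eventually_elim (use True in \<open>auto split: split_indicator\<close>)
   next
    case False
    then have "x < r" using elim by simp
    show ?thesis using order_tendstoD(2)[OF XN \<open>x < r\<close>] by eventually_elim (use \<open>x < r\<close> in \<open>auto split: split_indicator\<close>)
   qed
   then show ?case by (rule tendsto_eventually)
  qed
  show "(\<integral>\<^sup>+r. g r * indicator {0..x+1} r \<partial>lborel) < \<infinity>"
   using fin[of "x + 1"] by (simp add: clk_def)
 qed auto
 then show "(\<lambda>n. clk g (X n)) \<longlonglongrightarrow> clk g x" by (rule LIMSEQ_offset)
qed

lemma clk_attains:
 assumes g: "g \<in> borel_measurable borel" "\<And>t. clk g t < \<top>" and t: "0 \<le> t" and c: "c \<le> clk g t"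
 obtains s where "0 \<le> s" "s \<le> t" "clk g s = c"
proof -
 have "\<exists>s. 0 \<le> s \<and> s \<le> t \<and> clk g s = c"
  using t c by (intro IVT) (auto simp: clk_nonpos intro!: clk_continuous g)
 then show ?thesis using that by blast
qed

text \<open>The level set of a continuous clock is an interval, and the clock does not advance on it.\<close>

lemma clk_superlevel:
 assumes g[measurable]: "g \<in> borel_measurable borel" and fin: "\<And>t. clk g t < \<top>"
  and t: "0 \<le> t"
 shows "(\<integral>\<^sup>+s\<in>{s\<in>{0..t}. c < clk g s}. g s \<partial>lborel) = clk g t - min c (clk g t)"
proof (cases "c < clk g t")
 case False
 have "{s\<in>{0..t}. c < clk g s} = {}"
  using clk_mono[of _ t g] False by (auto simp: not_less intro: order_trans)
 moreover have "clk g t - min c (clk g t) = 0" using False fin[of t] by (auto simp: min_def not_less intro!: diff_eq_0_ennreal)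
 ultimately show ?thesis by (simp only: indicator_simps) simp
next
 case True
 obtain s0 where "0 \<le> s0" "s0 \<le> t" "clk g s0 = c"
  by (rule clk_attains[OF g fin t less_imp_le[OF True]])
 define A where "A = {s. 0 \<le> s \<and> s \<le> t \<and> clk g s \<le> c}"
 have A: "s0 \<in> A" "A \<noteq> {}" "bdd_above A"
  using \<open>0 \<le> s0\<close> \<open>s0 \<le> t\<close> \<open>clk g s0 = c\<close> by (auto simp: A_def)
 have "closed {s. clk g s \<le> c}"
  by (intro closed_Collect_le continuous_intros)
    (auto intro!: continuous_at_imp_continuous_on clk_continuous fin)
 then have "closed ({0..t} \<inter> {s. clk g s \<le> c})"
  by (intro closed_Int) auto
 moreover have "A = {0..t} \<inter> {s. clk g s \<le> c}" by (auto simp: A_def)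
 ultimately have "closed A" by simp
 define s1 where "s1 = Sup A"
 have s1: "s1 \<in> A" using closed_contains_Sup[OF A(2,3) \<open>closed A\<close>] by (simp add: s1_def)
 have "s0 \<le> s1" using A unfolding s1_def by (intro cSup_upper)
 then have c: "clk g s1 = c" using \<open>clk g s0 = c\<close> s1 clk_mono[of s0 s1 g] by (auto simp: A_def)
 have "{s\<in>{0..t}. c < clk g s} = {s1<..t}"
 proof (intro set_eqI iffI)
  fix s assume s: "s \<in> {s\<in>{0..t}. c < clk g s}"
  then have "\<not> s \<le> s1" using clk_mono[of s s1 g] c by auto
  then show "s \<in> {s1<..t}" using s by auto
 next
  fix s assume s: "s \<in> {s1<..t}"
  then have "s \<notin> A" using cSup_upper[OF _ A(3), of s] by (auto simp: s1_def)
  then show "s \<in> {s\<in>{0..t}. c < clk g s}" using s s1 by (auto simp: A_def)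
 qed
 moreover have "clk g t = clk g s1 + (\<integral>\<^sup>+r\<in>{s1<..t}. g r \<partial>lborel)"
  using s1 by (intro clk_split) (auto simp: A_def)
 ultimately show ?thesis using True c fin[of s1] by (simp add: min_def)
qed

text \<open>The clock pushes the measure with density \<open>g\<close> on \<open>{0..t}\<close>
  forward to Lebesgue measure on the range of the clock: by \<open>clk_superlevel\<close> both give
  the same mass to every ray. This is the chain rule for a clock that is merely absolutely
  continuous.\<close>

lemma clk_substitution:
 assumes g[measurable]: "g \<in> borel_measurable borel" and fin: "\<And>t. clk g t < \<top>"
  and t: "0 \<le> t" and \<phi>[measurable]: "\<phi> \<in> borel_measurable borel"
 shows "(\<integral>\<^sup>+s\<in>{0..t}. \<phi> (clk g s) * g s \<partial>lborel) =
     (\<integral>\<^sup>+c\<in>{0..enn2real (clk g t)}. \<phi> (ennreal c) \<partial>lborel)"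
proof -
 define T where "T = enn2real (clk g t)"
 have T: "clk g t = ennreal T" "0 \<le> T" using fin[of t] by (auto simp: T_def)
 let ?M = "distr (density lborel (\<lambda>s. g s * indicator {0..t} s)) borel (\<lambda>s. enn2real (clk g s))"
 let ?N = "density lborel (indicator {0..T} :: real => ennreal)"
 have M: "emeasure ?M {x<..} = (\<integral>\<^sup>+s\<in>{s\<in>{0..t}. x < enn2real (clk g s)}. g s \<partial>lborel)" for x
  using measurable_sets[of "\<lambda>s. enn2real (clk g s)" borel borel "{x<..}"]
  by (subst emeasure_distr, simp, simp, subst emeasure_density)
    (auto intro!: nn_integral_cong split: split_indicator)
 have eq: "emeasure ?M {x<..} = emeasure ?N {x<..}" for x
 proof (cases "0 \<le> x")
  case True
  have "emeasure ?M {x<..} = (\<integral>\<^sup>+s\<in>{s\<in>{0..t}. ennreal x < clk g s}. g s \<partial>lborel)"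
   unfolding M
  proof (intro nn_integral_cong)
   fix s
   have "ennreal x < clk g s \<longleftrightarrow> x < enn2real (clk g s)"
    using True fin[of s] by (cases "clk g s") (auto simp: ennreal_less_iff)
   then show "g s * indicator {s \<in> {0..t}. x < enn2real (clk g s)} s =
     g s * indicator {s \<in> {0..t}. ennreal x < clk g s} s"
    by (auto split: split_indicator)
  qed
  also have "\<dots> = ennreal T - min (ennreal x) (ennreal T)"
   using clk_superlevel[OF g fin t, of "ennreal x"] unfolding T .
  also have "\<dots> = emeasure lborel ({0..T} \<inter> {x<..})"
  proof -
   have *: "{0..T} \<inter> {x<..} = {x<..T}" using True by auto
   show ?thesis unfolding * using True T(2)
    by (cases "x \<le> T") (auto simp: min_def ennreal_minus)
  qed
  also have "\<dots> = emeasure ?N {x<..}"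
   by (simp add: emeasure_density indicator_inter_arith[symmetric])
  finally show ?thesis .
 next
  case False
  have "emeasure ?M {x<..} = clk g t"
   unfolding M clk_def[of g t] using False
   by (intro nn_integral_cong) (auto split: split_indicator simp: less_le_trans[of x 0])
  moreover have "{0..T} \<inter> {x<..} = {0..T}" using False by auto
  then have "emeasure ?N {x<..} = ennreal T"
   using T(2)
   by (simp add: emeasure_density indicator_inter_arith[symmetric])
  ultimately show ?thesis using T by simp
 qed
 have "?M = ?N"
 proof (rule measure_eqI_lessThan)
  fix x
  have "emeasure ?N {x<..} \<le> emeasure lborel {0..T}"
   by (subst emeasure_density)
     (auto simp flip: nn_integral_indicator intro!: nn_integral_mono split: split_indicator)
  then show "emeasure ?M {x<..} < \<infinity>"
   unfolding eq using T(2) by (auto intro: order.strict_trans1)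
 qed (use eq in auto)
 then have "(\<integral>\<^sup>+c. \<phi> (ennreal c) \<partial>?M) = (\<integral>\<^sup>+c. \<phi> (ennreal c) \<partial>?N)" by simp
 then have "(\<integral>\<^sup>+s. g s * indicator {0..t} s * \<phi> (ennreal (enn2real (clk g s))) \<partial>lborel) =
   (\<integral>\<^sup>+c. indicator {0..T} c * \<phi> (ennreal c) \<partial>lborel)"
  by (simp add: nn_integral_distr nn_integral_density)
 then show ?thesis
  using fin by (simp add: T_def mult_ac)
qed

text \<open>The left-continuous generalised inverse of the clock. The infimum of the empty set is
  infinity, the age of a clock that never rings.\<close>

definition first_age :: "(real => ennreal) => real => ereal" where
 "first_age g e = Inf {ereal a |a. 0 \<le> a \<and> ennreal e \<le> clk g a}"

lemma first_age_nonneg: "0 \<le> first_age g e"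
 unfolding first_age_def by (rule Inf_greatest) auto

text \<open>The infimum is attained: every age slightly larger than \<open>s\<close> has already
  consumed the charge \<open>e\<close>, and continuity of the clock passes this to \<open>s\<close>
  itself.\<close>

lemma first_age_le_iff:
 assumes g[measurable]: "g \<in> borel_measurable borel" and fin: "\<And>t. clk g t < \<top>" and s: "0 \<le> s"
 shows "first_age g e \<le> ereal s \<longleftrightarrow> ennreal e \<le> clk g s"
proof
 assume "ennreal e \<le> clk g s"
 then show "first_age g e \<le> ereal s"
  unfolding first_age_def using s by (intro Inf_lower) auto
next
 assume le: "first_age g e \<le> ereal s"
 have "ennreal e \<le> clk g (s + 1 / Suc n)" for n
 proof -
  have "first_age g e < ereal (s + 1 / Suc n)" using le by (rule order.strict_trans1) simp
  then obtain a where "ennreal e \<le> clk g a" "a < s + 1 / Suc n"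
   unfolding first_age_def Inf_less_iff by auto
  then show ?thesis using clk_mono[of a "s + 1 / Suc n" g] by (auto intro: order_trans)
 qed
 moreover have "(\<lambda>n. clk g (s + 1 / Suc n)) \<longlonglongrightarrow> clk g s"
 proof (rule isCont_tendsto_compose[OF clk_continuous[OF g fin]])
  show "(\<lambda>n. s + 1 / Suc n) \<longlonglongrightarrow> s"
   using tendsto_add[OF tendsto_const[of s] LIMSEQ_inverse_real_of_nat] by (simp add: inverse_eq_divide)
 qed
 ultimately show "ennreal e \<le> clk g s" by (intro LIMSEQ_le_const) auto
qed

text \<open>Monotonicity of the clock lets the infimum be tested at rational ages, so each sublevel
  set is a countable union of measurable sets.\<close>

lemma measurable_first_age [measurable (raw)]:
 assumes [measurable]: "(\<lambda>(x, r). g x r) \<in> borel_measurable (N \<Otimes>\<^sub>M borel)" "f \<in> borel_measurable N"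
 shows "(\<lambda>x. first_age (g x) (f x)) \<in> borel_measurable N"
proof (rule borel_measurableI_less)
 fix y
 have "{x \<in> space N. first_age (g x) (f x) < y} =
  (\<Union>a\<in>{q\<in>\<rat>. 0 \<le> q \<and> ereal q < y}. {x \<in> space N. ennreal (f x) \<le> clk (g x) a})"
 proof (intro set_eqI iffI)
  fix x assume "x \<in> {x \<in> space N. first_age (g x) (f x) < y}"
  then obtain a where a: "x \<in> space N" "0 \<le> a" "ennreal (f x) \<le> clk (g x) a" "ereal a < y"
   unfolding first_age_def by (auto simp: Inf_less_iff)
  obtain z where z: "ereal a < ereal z" "ereal z < y" using ereal_dense2[OF a(4)] by auto
  obtain q where "q \<in> \<rat>" "a < q" "q < z" using Rats_dense_in_real[of a z] z by auto
  then show "x \<in> (\<Union>a\<in>{q\<in>\<rat>. 0 \<le> q \<and> ereal q < y}. {x \<in> space N. ennreal (f x) \<le> clk (g x) a})"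
   using a z clk_mono[of a q "g x"] by (auto intro!: bexI[of _ q] order_trans[OF a(3)] less_trans[OF _ z(2)])
 next
  fix x assume "x \<in> (\<Union>a\<in>{q\<in>\<rat>. 0 \<le> q \<and> ereal q < y}. {x \<in> space N. ennreal (f x) \<le> clk (g x) a})"
  then show "x \<in> {x \<in> space N. first_age (g x) (f x) < y}"
   unfolding first_age_def by (auto simp: Inf_less_iff)
 qed
 moreover have "countable {q\<in>\<rat>. 0 \<le> q \<and> ereal q < y}"
  by (rule countable_subset[OF _ countable_rat]) auto
 ultimately show "{x \<in> space N. first_age (g x) (f x) < y} \<in> sets N"
  by (auto intro!: sets.countable_UN')
qed

text \<open>The companion of \<open>clk_substitution\<close> for the inverse clock: Lebesgue measure
  in internal time becomes the measure with density \<open>g\<close> in age. It will convert the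
  unit-rate Poisson process of births back to real ages. Again the masses of rays are
  compared.\<close>

lemma first_age_substitution:
 assumes g[measurable]: "g \<in> borel_measurable borel" and fin: "\<And>t. clk g t < \<top>"
  and t: "0 \<le> t" and \<phi>[measurable]: "\<phi> \<in> borel_measurable borel"
 shows "(\<integral>\<^sup>+e\<in>{0..}. (if first_age g e \<le> ereal t then \<phi> (real_of_ereal (first_age g e)) else 0) \<partial>lborel) =
     (\<integral>\<^sup>+s\<in>{0..t}. \<phi> s * g s \<partial>lborel)"
proof -
 define f where "f e = real_of_ereal (first_age g e)" for e
 have [measurable]: "f \<in> borel_measurable borel" unfolding f_def by measurable
 define E where "E = {e. 0 \<le> e \<and> first_age g e \<le> ereal t}"
 have [measurable]: "E \<in> sets borel" unfolding E_def by measurable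
 have E: "E = {0..enn2real (clk g t)}"
  unfolding E_def first_age_le_iff[OF g fin t] using fin[of t]
  by (auto simp: le_ennreal_iff[OF enn2real_nonneg] ennreal_leI) (metis ennreal_enn2real ennreal_le_iff enn2real_nonneg)+
 have f: "first_age g e = ereal (f e)" if "e \<in> E" for e
  using that first_age_nonneg[of g e] unfolding E_def f_def
  by (cases "first_age g e") auto
 let ?M = "distr (density lborel (indicator E)) borel f"
 let ?N = "density lborel (\<lambda>s. g s * indicator {0..t} s)"
 have eq: "emeasure ?M {x<..} = emeasure ?N {x<..}" for x
 proof -
  have M: "emeasure ?M {x<..} = emeasure lborel {e\<in>E. x < f e}"
   using measurable_sets[of f borel borel "{x<..}"]
   by (subst emeasure_distr, simp, simp, subst emeasure_density)
     (auto intro!: nn_integral_cong split: split_indicator simp flip: nn_integral_indicator)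
  consider "x < 0" | "0 \<le> x" "x \<le> t" | "t < x" by linarith
  then show ?thesis
  proof cases
   case 1
   have "{e\<in>E. x < f e} = E"
    using 1 f first_age_nonneg[of g] by (auto simp: f_def intro!: less_le_trans[OF 1] real_of_ereal_pos)
   then have "emeasure ?M {x<..} = clk g t" using fin[of t] unfolding M by (simp add: E)
   moreover have "emeasure ?N {x<..} = clk g t"
    by (subst emeasure_density) (use 1 in \<open>auto simp: clk_def intro!: nn_integral_cong split: split_indicator\<close>)
   ultimately show ?thesis by simp
  next
   case 2
   have "{e\<in>E. x < f e} = {enn2real (clk g x)<..enn2real (clk g t)}"
   proof (intro set_eqI)
    fix e
    have "e \<in> E ==> x < f e \<longleftrightarrow> \<not> ennreal e \<le> clk g x"
     using f[of e] first_age_le_iff[OF g fin 2(1), of e] by auto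
    moreover have "ennreal e \<le> clk g x \<longleftrightarrow> e \<le> enn2real (clk g x)"
     using fin[of x] by (metis ennreal_enn2real ennreal_le_iff enn2real_nonneg)
    moreover have "0 \<le> enn2real (clk g x)" by simp
    ultimately have "e \<in> E ==> x < f e \<longleftrightarrow> enn2real (clk g x) < e" "0 \<le> enn2real (clk g x)" by auto
    then show "e \<in> {e\<in>E. x < f e} \<longleftrightarrow> e \<in> {enn2real (clk g x)<..enn2real (clk g t)}"
     unfolding E mem_Collect_eq atLeastAtMost_iff greaterThanAtMost_iff by linarith
   qed
   moreover have le: "clk g x \<le> clk g t" using 2 by (intro clk_mono)
   then have "enn2real (clk g x) \<le> enn2real (clk g t)" using fin[of t] by (intro enn2real_mono) auto
   ultimately have "emeasure ?M {x<..} = clk g t - clk g x"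
    using fin[of x] fin[of t] by (simp add: M ennreal_minus[symmetric])
   moreover have "emeasure ?N {x<..} = (\<integral>\<^sup>+r\<in>{x<..t}. g r \<partial>lborel)"
    by (subst emeasure_density) (use 2 in \<open>auto intro!: nn_integral_cong split: split_indicator\<close>)
   moreover have "clk g t = clk g x + (\<integral>\<^sup>+r\<in>{x<..t}. g r \<partial>lborel)"
    using 2 by (intro clk_split) auto
   ultimately show ?thesis using fin[of x] by simp
  next
   case 3
   have "{e\<in>E. x < f e} = {}" using f 3 by (force simp: E_def)
   then have "emeasure ?M {x<..} = 0" by (simp only: M emeasure_empty)
   moreover have "emeasure ?N {x<..} = (\<integral>\<^sup>+r. g r * indicator {0..t} r * indicator {x<..} r \<partial>lborel)"
    by (subst emeasure_density) auto
   moreover have "\<dots> = (\<integral>\<^sup>+r. 0 \<partial>(lborel :: real measure))"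
    by (rule nn_integral_cong) (use 3 in \<open>auto split: split_indicator\<close>)
   ultimately show ?thesis by simp
  qed
 qed
 have "?M = ?N"
 proof (rule measure_eqI_lessThan)
  fix x
  have "emeasure ?N {x<..} \<le> clk g t"
   by (subst emeasure_density) (auto simp: clk_def intro!: nn_integral_mono split: split_indicator)
  then show "emeasure ?M {x<..} < \<infinity>"
   unfolding eq using fin[of t] by (auto intro: order.strict_trans1)
 qed (use eq in auto)
 then have "(\<integral>\<^sup>+s. \<phi> s \<partial>?M) = (\<integral>\<^sup>+s. \<phi> s \<partial>?N)" by simp
 then have "(\<integral>\<^sup>+e. indicator E e * \<phi> (f e) \<partial>lborel) = (\<integral>\<^sup>+s. g s * indicator {0..t} s * \<phi> s \<partial>lborel)"
  by (simp add: nn_integral_distr nn_integral_density)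
 moreover have "(\<integral>\<^sup>+e. indicator E e * \<phi> (f e) \<partial>lborel) =
  (\<integral>\<^sup>+e\<in>{0..}. (if first_age g e \<le> ereal t then \<phi> (real_of_ereal (first_age g e)) else 0) \<partial>lborel)"
  by (intro nn_integral_cong) (auto simp: E_def f_def split: split_indicator)
 ultimately show ?thesis by (simp add: mult_ac)
qed

text \<open>Substitution reduces this to the fundamental theorem of calculus for exp(-c). Read
  probabilistically, a clock either rings in \<open>{0..t}\<close> or has not rung by
  \<open>t\<close>. The next two lemmas do the same for exp(c) and for powers.\<close>

lemma clk_expm:
 assumes g[measurable]: "g \<in> borel_measurable borel" and fin: "\<And>t. clk g t < \<top>" and t: "0 \<le> t"
 shows "(\<integral>\<^sup>+s\<in>{0..t}. expm (clk g s) * g s \<partial>lborel) + expm (clk g t) = 1"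
proof -
 define T where "T = enn2real (clk g t)"
 have T: "clk g t = ennreal T" "0 \<le> T" using fin[of t] by (auto simp: T_def)
 have "(\<integral>\<^sup>+s\<in>{0..t}. expm (clk g s) * g s \<partial>lborel) = (\<integral>\<^sup>+c\<in>{0..T}. expm (ennreal c) \<partial>lborel)"
  using clk_substitution[OF g fin t, of expm] by (simp add: T_def)
 also have "\<dots> = (\<integral>\<^sup>+c. ennreal (exp (- c)) * indicator {0..T} c \<partial>lborel)"
  by (intro nn_integral_cong) (auto simp: expm_ennreal split: split_indicator)
 also have "\<dots> = ennreal (- exp (- T) - (- exp (- 0)))"
  using T(2) by (intro nn_integral_FTC_Icc) (auto intro!: derivative_eq_intros)
 finally show ?thesis
  using T by (simp add: expm_ennreal ennreal_plus[symmetric] del: ennreal_plus)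
qed

lemma clk_exp:
 assumes g[measurable]: "g \<in> borel_measurable borel" and fin: "\<And>t. clk g t < \<top>" and t: "0 \<le> t"
 shows "(\<integral>\<^sup>+s\<in>{0..t}. ennreal (exp (enn2real (clk g s))) * g s \<partial>lborel) + 1
  = ennreal (exp (enn2real (clk g t)))"
proof -
 define T where "T = enn2real (clk g t)"
 have T: "clk g t = ennreal T" "0 \<le> T" using fin[of t] by (auto simp: T_def)
 have "(\<integral>\<^sup>+s\<in>{0..t}. ennreal (exp (enn2real (clk g s))) * g s \<partial>lborel)
   = (\<integral>\<^sup>+c\<in>{0..T}. ennreal (exp (enn2real (ennreal c))) \<partial>lborel)"
  using clk_substitution[OF g fin t, of "\<lambda>c. ennreal (exp (enn2real c))"] by (simp add: T_def)
 also have "\<dots> = (\<integral>\<^sup>+c. ennreal (exp c) * indicator {0..T} c \<partial>lborel)"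
  by (intro nn_integral_cong) (auto split: split_indicator)
 also have "\<dots> = ennreal (exp T - exp 0)"
  using T(2) by (intro nn_integral_FTC_Icc) (auto intro!: derivative_eq_intros)
 finally show ?thesis
  using T by (simp add: T_def[symmetric] ennreal_plus[symmetric] del: ennreal_plus flip: ennreal_1)
qed

lemma clk_power:
 assumes g[measurable]: "g \<in> borel_measurable borel" and fin: "\<And>t. clk g t < \<top>" and t: "0 \<le> t"
 shows "(\<integral>\<^sup>+s\<in>{0..t}. (clk g s ^ n / fact n) * g s \<partial>lborel) = clk g t ^ Suc n / fact (Suc n)"
proof -
 define T where "T = enn2real (clk g t)"
 have T: "clk g t = ennreal T" "0 \<le> T" using fin[of t] by (auto simp: T_def)
 have *: "ennreal c ^ n / fact n = ennreal (c ^ n / fact n)" if "0 \<le> c" for c n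
 proof -
  have "(fact n :: ennreal) = ennreal (fact n)"
   by (metis ennreal_of_nat_eq_real_of_nat of_nat_fact)
  then show ?thesis using that by (simp add: ennreal_power divide_ennreal)
 qed
 have "(\<integral>\<^sup>+s\<in>{0..t}. (clk g s ^ n / fact n) * g s \<partial>lborel) = (\<integral>\<^sup>+c\<in>{0..T}. ennreal c ^ n / fact n \<partial>lborel)"
  using clk_substitution[OF g fin t, of "\<lambda>c. c ^ n / fact n"] by (simp add: T_def)
 also have "\<dots> = (\<integral>\<^sup>+c. ennreal (c ^ n / fact n) * indicator {0..T} c \<partial>lborel)"
  by (intro nn_integral_cong) (auto simp: * split: split_indicator)
 also have "\<dots> = ennreal (T ^ Suc n / fact (Suc n) - 0 ^ Suc n / fact (Suc n))"
  using T(2)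
  by (intro nn_integral_FTC_Icc)
    (auto intro!: derivative_eq_intros simp: divide_simps simp del: power_Suc)
 finally show ?thesis
  using T *[of T "Suc n"] by (simp del: power_Suc fact_Suc)
qed

section \<open>Products over the points of a unit-rate Poisson process\<close>

lemma sets_unit_exp [measurable_cong, simp]: "sets unit_exp = sets borel"
 by (simp add: unit_exp_def)

lemma space_unit_exp [simp]: "space unit_exp = UNIV"
 by (simp add: unit_exp_def)

lemma prob_space_unit_exp: "prob_space unit_exp"
 unfolding unit_exp_def by (rule prob_space_exponential_density) simp

lemma nn_integral_unit_exp:
 assumes [measurable]: "f \<in> borel_measurable borel"
 shows "(\<integral>\<^sup>+s. f s \<partial>unit_exp) = (\<integral>\<^sup>+s\<in>{0..}. f s * expm (ennreal s) \<partial>lborel)"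
 unfolding unit_exp_def
 by (subst nn_integral_density)
   (auto simp: exponential_density_def expm_ennreal mult_ac intro!: nn_integral_cong split: split_indicator)

abbreviation exp_seq :: "(nat => real) measure" where
 "exp_seq \<equiv> (\<Pi>\<^sub>M k\<in>UNIV. unit_exp)"

lemma sets_exp_seq [measurable_cong]: "sets exp_seq = sets (\<Pi>\<^sub>M k\<in>UNIV. borel)"
 by (rule sets_PiM_cong) auto

lemma prob_space_exp_seq: "prob_space exp_seq"
 by (rule prob_space_PiM) (rule prob_space_unit_exp)

lemma emeasure_space_exp_seq: "emeasure exp_seq (space exp_seq) = 1"
 by (rule prob_space.emeasure_space_1[OF prob_space_exp_seq])

interpretation exp_seq: sequence_space unit_exp
 by (unfold sequence_space_def product_prob_space_def product_prob_space_axioms_def product_sigma_finite_def)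
   (auto intro: prob_space_unit_exp prob_space_imp_sigma_finite)

text \<open>The partial sums of \<epsilon> are the points of a unit-rate Poisson process, so this is
  its product functional cut after \<open>K\<close> points. As \<open>K\<close> grows it tends to
  the exponential of minus the integral of \<open>p\<close>, with the explicit error of
  \<open>poisson_prod_le\<close>.\<close>

definition poisson_prod :: "nat => (real => ennreal) => ennreal" where
 "poisson_prod K p = (\<integral>\<^sup>+\<epsilon>. (\<Prod>k<K. 1 - p (\<Sum>i\<le>k. \<epsilon> i)) \<partial>exp_seq)"

text \<open>Conditioning on the first waiting time: the remaining waiting times form again an i.i.d.
  sequence, and all later points are shifted by \<open>s\<close>.\<close>

lemma poisson_prod_Suc:
 assumes [measurable]: "p \<in> borel_measurable borel"
 shows "poisson_prod (Suc K) p = (\<integral>\<^sup>+s. (1 - p s) * poisson_prod K (\<lambda>c. p (s + c)) \<partial>unit_exp)"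
proof -
 have "poisson_prod (Suc K) p =
   (\<integral>\<^sup>+x. (\<Prod>k<Suc K. 1 - p (\<Sum>i\<le>k. (case x of (s, \<epsilon>) => case_nat s \<epsilon>) i)) \<partial>(unit_exp \<Otimes>\<^sub>M exp_seq))"
  unfolding poisson_prod_def
  by (subst exp_seq.PiM_iter[symmetric], subst nn_integral_distr) (auto simp: case_prod_beta)
 also have "\<dots> = (\<integral>\<^sup>+x. (case x of (s, \<epsilon>) => (1 - p s) * (\<Prod>k<K. 1 - p (s + (\<Sum>i\<le>k. \<epsilon> i)))) \<partial>(unit_exp \<Otimes>\<^sub>M exp_seq))"
  by (intro nn_integral_cong) (auto simp: prod.lessThan_Suc_shift sum.atMost_Suc_shift simp del: prod.lessThan_Suc sum.atMost_Suc)
 also have "\<dots> = (\<integral>\<^sup>+s. \<integral>\<^sup>+\<epsilon>. (1 - p s) * (\<Prod>k<K. 1 - p (s + (\<Sum>i\<le>k. \<epsilon> i))) \<partial>exp_seq \<partial>unit_exp)"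
  by (subst sigma_finite_measure.nn_integral_fst[OF prob_space_imp_sigma_finite[OF prob_space_exp_seq], symmetric]) auto
 also have "\<dots> = (\<integral>\<^sup>+s. (1 - p s) * poisson_prod K (\<lambda>c. p (s + c)) \<partial>unit_exp)"
  unfolding poisson_prod_def by (intro nn_integral_cong nn_integral_cmult) auto
 finally show ?thesis .
qed

lemma poisson_prod_le_1: "poisson_prod K p \<le> 1"
proof -
 have "poisson_prod K p \<le> (\<integral>\<^sup>+\<epsilon>. 1 \<partial>exp_seq)"
  unfolding poisson_prod_def by (intro nn_integral_mono prod_le_1) (auto intro: diff_le_self_ennreal)
 then show ?thesis by (simp add: emeasure_space_exp_seq)
qed

lemma nn_integral_atLeast_SUP:
 assumes [measurable]: "f \<in> borel_measurable borel"
 shows "(\<integral>\<^sup>+s\<in>{0..}. f s \<partial>lborel) = (SUP n. \<integral>\<^sup>+s\<in>{0..real n}. f s \<partial>lborel)"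
proof -
 have "(\<integral>\<^sup>+s\<in>{0..}. f s \<partial>lborel) = (\<integral>\<^sup>+s. (SUP n. f s * indicator {0..real n} s) \<partial>lborel)"
 proof (intro nn_integral_cong antisym)
  fix s :: real
  obtain n where "s \<le> real n" using real_arch_simple by blast
  then have "f s * indicator {0..} s \<le> f s * indicator {0..real n} s"
   by (auto split: split_indicator)
  also have "\<dots> \<le> (SUP n. f s * indicator {0..real n} s)" by (rule SUP_upper) simp
  finally show "f s * indicator {0..} s \<le> (SUP n. f s * indicator {0..real n} s)" .
 qed (auto intro!: SUP_least split: split_indicator)
 also have "\<dots> = (SUP n. \<integral>\<^sup>+s\<in>{0..real n}. f s \<partial>lborel)"
  by (intro nn_integral_monotone_convergence_SUP)
    (auto simp: incseq_def le_fun_def intro!: mult_left_mono split: split_indicator)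
 finally show ?thesis .
qed

text \<open>The renewal equation at the first point of a Poisson process, with
 \<open>expm (\<integral> p)\<close> as the claimed Laplace functional.\<close>

lemma poisson_renewal:
 assumes p[measurable]: "p \<in> borel_measurable borel" and p1: "\<And>s. p s \<le> 1"
  and M: "0 \<le> M" and supp: "\<And>s. M < s ==> p s = 0"
 shows "(\<integral>\<^sup>+s. (1 - p s) * expm (\<integral>\<^sup>+c\<in>{0..}. p (s + c) \<partial>lborel) \<partial>unit_exp) = expm (\<integral>\<^sup>+c\<in>{0..}. p c \<partial>lborel)"
proof -
 let ?q = "\<lambda>s. 1 - p s"
 have one: "clk (\<lambda>_. 1) s = ennreal s" if "0 \<le> s" for s
  using that by (simp add: clk_def)
 have pq: "clk p s + clk ?q s = ennreal s" if "0 \<le> s" for s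
 proof -
  have "clk p s + clk ?q s = (\<integral>\<^sup>+r. p r * indicator {0..s} r + ?q r * indicator {0..s} r \<partial>lborel)"
   unfolding clk_def by (rule nn_integral_add[symmetric]) auto
  also have "\<dots> = clk (\<lambda>_. 1) s"
   unfolding clk_def using p1 by (intro nn_integral_cong) (auto split: split_indicator simp: ennreal_diff_self add_diff_inverse_ennreal diff_add_cancel_ennreal)
  finally show ?thesis using one[OF that] by simp
 qed
 have finp: "clk p s < \<top>" and finq: "clk ?q s < \<top>" for s
 proof -
  have "clk p (max 0 s) + clk ?q (max 0 s) < \<top>" using pq[of "max 0 s"] by simp
  then have "clk p (max 0 s) < \<top>" "clk ?q (max 0 s) < \<top>" by auto
  then show "clk p s < \<top>" "clk ?q s < \<top>"
   using clk_mono[of s "max 0 s"] by (meson le_less_trans max.cobounded2)+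
 qed
 have tail: "(\<integral>\<^sup>+c\<in>{0..}. p c \<partial>lborel) = clk p s + (\<integral>\<^sup>+c\<in>{0..}. p (s + c) \<partial>lborel)" if s: "0 \<le> s" for s
 proof -
  have "(\<integral>\<^sup>+c\<in>{0..}. p c \<partial>lborel) = (\<integral>\<^sup>+c. p c * indicator {0..s} c + p c * indicator {s<..} c \<partial>lborel)"
   using s by (intro nn_integral_cong) (auto split: split_indicator)
  also have "\<dots> = clk p s + (\<integral>\<^sup>+c. p c * indicator {s<..} c \<partial>lborel)"
   unfolding clk_def by (rule nn_integral_add) auto
  also have "(\<integral>\<^sup>+c. p c * indicator {s<..} c \<partial>lborel) = (\<integral>\<^sup>+c. p (s + c) * indicator {s<..} (s + c) \<partial>lborel)"
   using nn_integral_real_affine[of "\<lambda>r. p r * indicator {s<..} r" 1 s] by simp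
  also have "\<dots> = (\<integral>\<^sup>+c\<in>{0..}. p (s + c) \<partial>lborel)"
  proof (rule nn_integral_cong_AE)
   have "AE c in lborel. c \<noteq> (0::real)" by (rule AE_lborel_singleton)
   then show "AE c in lborel. p (s + c) * indicator {s<..} (s + c) = p (s + c) * indicator {0..} c"
    by eventually_elim (auto split: split_indicator)
  qed
  finally show ?thesis .
 qed
 have [measurable]: "clk ?q \<in> borel_measurable borel"
  by measurable
 have tot: "(\<integral>\<^sup>+c\<in>{0..}. p c \<partial>lborel) = clk p M"
 proof -
  have "AE c in lborel. c \<noteq> (0::real)" by (rule AE_lborel_singleton)
  then have "AE c in lborel. p (M + c) * indicator {0..} c = 0"
   by eventually_elim (use supp in \<open>auto split: split_indicator\<close>)
  then have "(\<integral>\<^sup>+c\<in>{0..}. p (M + c) \<partial>lborel) = (\<integral>\<^sup>+c. 0 \<partial>(lborel :: real measure))"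
   by (rule nn_integral_cong_AE)
  then show ?thesis using tail[OF M] by simp
 qed
 have "(\<integral>\<^sup>+s. (1 - p s) * expm (\<integral>\<^sup>+c\<in>{0..}. p (s + c) \<partial>lborel) \<partial>unit_exp) =
   (\<integral>\<^sup>+s\<in>{0..}. ?q s * expm (\<integral>\<^sup>+c\<in>{0..}. p (s + c) \<partial>lborel) * expm (ennreal s) \<partial>lborel)"
  by (rule nn_integral_unit_exp) measurable
 \<comment> \<open>By \<open>pq\<close> the factor exp(-s) splits over the clocks of
   \<open>p\<close> and of \<open>1 - p\<close>; the former recombines with the tail into the
   constant \<open>expm (clk p M)\<close>. What is left is the ringing density of the clock of
   \<open>1 - p\<close>.\<close>
 also have "\<dots> = (\<integral>\<^sup>+s\<in>{0..}. expm (clk p M) * (expm (clk ?q s) * ?q s) \<partial>lborel)"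
 proof (intro nn_integral_cong)
  fix s :: real
  show "?q s * expm (\<integral>\<^sup>+c\<in>{0..}. p (s + c) \<partial>lborel) * expm (ennreal s) * indicator {0..} s =
   expm (clk p M) * (expm (clk ?q s) * ?q s) * indicator {0..} s"
  proof (cases "0 \<le> s")
   case True
   have "expm (ennreal s) = expm (clk p s) * expm (clk ?q s)"
    using pq[OF True] by (simp flip: expm_add)
   moreover have "expm (clk p M) = expm (clk p s) * expm (\<integral>\<^sup>+c\<in>{0..}. p (s + c) \<partial>lborel)"
    using tail[OF True] by (simp add: tot flip: expm_add)
   ultimately show ?thesis by (simp add: mult_ac)
  qed simp
 qed
 also have "\<dots> = expm (clk p M) * (\<integral>\<^sup>+s\<in>{0..}. expm (clk ?q s) * ?q s \<partial>lborel)"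
  by (subst nn_integral_cmult[symmetric]) (auto simp: mult_ac)
 also have "(\<integral>\<^sup>+s\<in>{0..}. expm (clk ?q s) * ?q s \<partial>lborel) = 1"
 proof (rule antisym)
  have part: "(\<integral>\<^sup>+s\<in>{0..real n}. expm (clk ?q s) * ?q s \<partial>lborel) + expm (clk ?q (real n)) = 1" for n
   using finq by (intro clk_expm) auto
  have SUP: "(\<integral>\<^sup>+s\<in>{0..}. expm (clk ?q s) * ?q s \<partial>lborel) = (SUP n. \<integral>\<^sup>+s\<in>{0..real n}. expm (clk ?q s) * ?q s \<partial>lborel)"
   by (rule nn_integral_atLeast_SUP) auto
  have "(\<integral>\<^sup>+s\<in>{0..real n}. expm (clk ?q s) * ?q s \<partial>lborel) \<le> 1" for n
   using part[of n] by (metis le_iff_add)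
  then show "(\<integral>\<^sup>+s\<in>{0..}. expm (clk ?q s) * ?q s \<partial>lborel) \<le> 1"
   unfolding SUP by (intro SUP_least)
  have pM: "clk p s \<le> ennreal M" for s
  proof -
   have "clk p s \<le> (\<integral>\<^sup>+r. indicator {0..M} r \<partial>lborel)"
    unfolding clk_def using p1 supp by (intro nn_integral_mono) (auto split: split_indicator simp: not_le)
   then show ?thesis using M by simp
  qed
  \<comment> \<open>Since \<open>p\<close> is at most 1 and lives on \<open>{0..M}\<close>, the
    clock of \<open>1 - p\<close> reaches at least \<open>n - M\<close> at time \<open>n\<close>; it
    therefore rings almost surely and the boundary term disappears in the limit.\<close>
  have "1 \<le> (\<integral>\<^sup>+s\<in>{0..}. expm (clk ?q s) * ?q s \<partial>lborel) + expm (ennreal (real n - M))" for n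
  proof -
   have "ennreal (real n - M) \<le> clk ?q (real n)"
    using pq[of "real n"] pM[of "real n"] M finp[of "real n"] finq[of "real n"]
    by (cases "clk p (real n)"; cases "clk ?q (real n)")
      (auto simp: ennreal_plus[symmetric] simp del: ennreal_plus)
   then have 1: "expm (clk ?q (real n)) \<le> expm (ennreal (real n - M))" by (rule expm_antimono)
   have 2: "(\<integral>\<^sup>+s\<in>{0..real n}. expm (clk ?q s) * ?q s \<partial>lborel) \<le> (\<integral>\<^sup>+s\<in>{0..}. expm (clk ?q s) * ?q s \<partial>lborel)"
    unfolding SUP by (rule SUP_upper) simp
   show ?thesis by (rule order_trans[OF eq_refl[OF part[of n, symmetric]] add_mono[OF 2 1]])
  qed
  moreover have "(\<lambda>n. expm (ennreal (real n - M))) \<longlonglongrightarrow> expm \<top>"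
  proof (rule tendsto_expm)
   have "filterlim (\<lambda>n. real n - M) at_top sequentially"
    using filterlim_tendsto_add_at_top[OF tendsto_const[of "- M"] filterlim_real_sequentially] by simp
   then show "(\<lambda>n. ennreal (real n - M)) \<longlonglongrightarrow> \<top>"
    by (simp add: ennreal_tendsto_top_eq_at_top)
  qed
  then have "(\<lambda>n. (\<integral>\<^sup>+s\<in>{0..}. expm (clk ?q s) * ?q s \<partial>lborel) + expm (ennreal (real n - M)))
   \<longlonglongrightarrow> (\<integral>\<^sup>+s\<in>{0..}. expm (clk ?q s) * ?q s \<partial>lborel) + 0"
   by (intro tendsto_add) auto
  ultimately show "1 \<le> (\<integral>\<^sup>+s\<in>{0..}. expm (clk ?q s) * ?q s \<partial>lborel)"
   by (intro LIMSEQ_le_const) auto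
 qed
 finally show ?thesis unfolding tot by simp
qed

text \<open>The exponential is a fixed point of the recursion of \<open>poisson_prod\<close> and
  lies below its initial value 1; the recursion is monotone.\<close>

lemma poisson_prod_ge:
 assumes p: "p \<in> borel_measurable borel" "\<And>s. p s \<le> 1" "0 \<le> M" "\<And>s. M < s ==> p s = 0"
 shows "expm (\<integral>\<^sup>+c\<in>{0..}. p c \<partial>lborel) \<le> poisson_prod K p"
 using p
proof (induction K arbitrary: p M)
 case 0
 show ?case by (simp add: poisson_prod_def emeasure_space_exp_seq expm_le_1)
next
 case (Suc K)
 note [measurable] = Suc.prems(1)
 have "expm (\<integral>\<^sup>+c\<in>{0..}. p c \<partial>lborel) = (\<integral>\<^sup>+s. (1 - p s) * expm (\<integral>\<^sup>+c\<in>{0..}. p (s + c) \<partial>lborel) \<partial>unit_exp)"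
  using Suc.prems by (intro poisson_renewal[symmetric]) auto
 also have "\<dots> = (\<integral>\<^sup>+s\<in>{0..}. (1 - p s) * expm (\<integral>\<^sup>+c\<in>{0..}. p (s + c) \<partial>lborel) * expm (ennreal s) \<partial>lborel)"
  by (rule nn_integral_unit_exp) measurable
 also have "\<dots> \<le> (\<integral>\<^sup>+s\<in>{0..}. (1 - p s) * poisson_prod K (\<lambda>c. p (s + c)) * expm (ennreal s) \<partial>lborel)"
 proof (intro nn_integral_mono)
  fix s :: real
  have "0 \<le> s ==> expm (\<integral>\<^sup>+c\<in>{0..}. p (s + c) \<partial>lborel) \<le> poisson_prod K (\<lambda>c. p (s + c))"
   using Suc.prems by (intro Suc.IH[of _ M]) auto
  then show "(1 - p s) * expm (\<integral>\<^sup>+c\<in>{0..}. p (s + c) \<partial>lborel) * expm (ennreal s) * indicator {0..} s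
   \<le> (1 - p s) * poisson_prod K (\<lambda>c. p (s + c)) * expm (ennreal s) * indicator {0..} s"
   by (auto split: split_indicator intro!: mult_right_mono mult_left_mono)
 qed
 also have "\<dots> = (\<integral>\<^sup>+s. (1 - p s) * poisson_prod K (\<lambda>c. p (s + c)) \<partial>unit_exp)"
  unfolding poisson_prod_def by (rule nn_integral_unit_exp[symmetric]) measurable
 also have "\<dots> = poisson_prod (Suc K) p" by (rule poisson_prod_Suc[symmetric]) simp
 finally show ?case .
qed

text \<open>The same induction with an error term. An error of (M - s)^K / K! after the first point
  integrates over \<open>s\<close> to M^(K+1) / (K+1)!, so the bound reproduces itself.\<close>

lemma poisson_prod_le:
 assumes p: "p \<in> borel_measurable borel" "\<And>s. p s \<le> 1" "0 \<le> M" "\<And>s. M < s ==> p s = 0"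
 shows "poisson_prod K p \<le> expm (\<integral>\<^sup>+c\<in>{0..}. p c \<partial>lborel) + ennreal (M ^ K / fact K)"
 using p
proof (induction K arbitrary: p M)
 case 0
 show ?case by (simp add: poisson_prod_def emeasure_space_exp_seq)
next
 case (Suc K)
 note [measurable] = Suc.prems(1)
 let ?t = "\<lambda>s. expm (\<integral>\<^sup>+c\<in>{0..}. p (s + c) \<partial>lborel)"
 have "poisson_prod (Suc K) p = (\<integral>\<^sup>+s. (1 - p s) * poisson_prod K (\<lambda>c. p (s + c)) \<partial>unit_exp)"
  by (rule poisson_prod_Suc) simp
 also have "\<dots> = (\<integral>\<^sup>+s\<in>{0..}. (1 - p s) * poisson_prod K (\<lambda>c. p (s + c)) * expm (ennreal s) \<partial>lborel)"
  unfolding poisson_prod_def by (rule nn_integral_unit_exp) measurable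
 also have "\<dots> \<le> (\<integral>\<^sup>+s. (1 - p s) * ?t s * expm (ennreal s) * indicator {0..} s
    + ennreal ((M - s) ^ K / fact K) * indicator {0..M} s \<partial>lborel)"
 proof (intro nn_integral_mono)
  fix s :: real
  have "poisson_prod K (\<lambda>c. p (s + c)) \<le> ?t s + ennreal ((M - s) ^ K / fact K) * indicator {0..M} s" if "0 \<le> s"
  proof (cases "s \<le> M")
   case True
   have "poisson_prod K (\<lambda>c. p (s + c)) \<le> ?t s + ennreal ((M - s) ^ K / fact K)"
    using Suc.prems True by (intro Suc.IH) auto
   then show ?thesis using True that by simp
  next
   \<comment> \<open>After \<open>M\<close> the shifted intensity vanishes, hence
     \<open>?t s\<close> is 1 and the trivial bound on \<open>poisson_prod\<close> suffices.\<close>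
   case False
   then have "(\<integral>\<^sup>+c\<in>{0..}. p (s + c) \<partial>lborel) = (\<integral>\<^sup>+c. 0 \<partial>(lborel :: real measure))"
    using Suc.prems(4) by (intro nn_integral_cong) (auto split: split_indicator)
   then show ?thesis using False poisson_prod_le_1[of K] by simp
  qed
  then have "0 \<le> s ==> (1 - p s) * poisson_prod K (\<lambda>c. p (s + c)) * expm (ennreal s) \<le>
   (1 - p s) * (?t s + ennreal ((M - s) ^ K / fact K) * indicator {0..M} s) * expm (ennreal s)"
   by (intro mult_right_mono mult_left_mono) auto
  also have "\<dots> = (1 - p s) * ?t s * expm (ennreal s) + (1 - p s) * (ennreal ((M - s) ^ K / fact K) * indicator {0..M} s) * expm (ennreal s)"
   by (simp add: algebra_simps)
  also have "\<dots> \<le> (1 - p s) * ?t s * expm (ennreal s) + 1 * (ennreal ((M - s) ^ K / fact K) * indicator {0..M} s) * 1"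
   by (intro add_left_mono mult_mono diff_le_self_ennreal expm_le_1) auto
  finally show "(1 - p s) * poisson_prod K (\<lambda>c. p (s + c)) * expm (ennreal s) * indicator {0..} s
   \<le> (1 - p s) * ?t s * expm (ennreal s) * indicator {0..} s + ennreal ((M - s) ^ K / fact K) * indicator {0..M} s"
   by (auto split: split_indicator simp del: mult_1_left mult_1_right simp: mult_1_left[where 'a=ennreal] mult_1_right[where 'a=ennreal])
 qed
 also have "\<dots> = (\<integral>\<^sup>+s\<in>{0..}. (1 - p s) * ?t s * expm (ennreal s) \<partial>lborel) +
   (\<integral>\<^sup>+s. ennreal ((M - s) ^ K / fact K) * indicator {0..M} s \<partial>lborel)"
  by (rule nn_integral_add) auto
 also have "(\<integral>\<^sup>+s\<in>{0..}. (1 - p s) * ?t s * expm (ennreal s) \<partial>lborel) = (\<integral>\<^sup>+s. (1 - p s) * ?t s \<partial>unit_exp)"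
  by (rule nn_integral_unit_exp[symmetric]) measurable
 also have "\<dots> = expm (\<integral>\<^sup>+c\<in>{0..}. p c \<partial>lborel)"
  using Suc.prems by (intro poisson_renewal) auto
 also have "(\<integral>\<^sup>+s. ennreal ((M - s) ^ K / fact K) * indicator {0..M} s \<partial>lborel) =
   ennreal (- ((M - M) ^ Suc K / fact (Suc K)) - (- ((M - 0) ^ Suc K / fact (Suc K))))"
  using Suc.prems(3)
  by (intro nn_integral_FTC_Icc)
    (auto intro!: derivative_eq_intros simp: divide_simps simp del: power_Suc)
 finally show ?case by simp
qed

section \<open>Markov property for exponential functionals of the path\<close>

locale motion =
 fixes \<Omega> :: "'a measure" and F :: "real => 'a measure"
  and X :: "real => 'a => real" and Q :: "real => 'a measure"
 assumes motion: "markov_process \<Omega> F X Q"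
begin

text \<open>Clamping the time at 0 makes the process a jointly measurable function on the whole time
  axis, so that time integrals over the real line make sense without domain restrictions.\<close>

definition Y :: "real => 'a => real" where
 "Y s w = X (max 0 s) w"

lemma Y_eq: "0 \<le> s ==> Y s w = X s w"
 by (simp add: Y_def)

lemma Q_prob_algebra [measurable]: "Q \<in> borel \<rightarrow>\<^sub>M prob_algebra \<Omega>"
 using motion by (simp add: markov_process_def)

lemma Q_subprob_algebra [measurable]: "Q \<in> borel \<rightarrow>\<^sub>M subprob_algebra \<Omega>"
 by (rule measurable_prob_algebraD) measurable

lemma prob_space_Q: "prob_space (Q x)" and sets_Q [simp, measurable_cong]: "sets (Q x) = sets \<Omega>"
 using measurable_space[OF Q_prob_algebra, of x] by (auto simp: space_prob_algebra)

lemma space_Q [simp]: "space (Q x) = space \<Omega>"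
 by (rule sets_eq_imp_space_eq) simp

lemma subalgebra_F: "0 \<le> t ==> subalgebra \<Omega> (F t)"
 using motion by (auto simp: markov_process_def)

lemma F_mono: "0 \<le> s ==> s \<le> t ==> sets (F s) \<subseteq> sets (F t)"
 using motion by (auto simp: markov_process_def)

lemma space_F: "0 \<le> t ==> space (F t) = space \<Omega>"
 using subalgebra_F[of t] by (simp add: subalgebra_def)

lemma measurable_F_mono: "0 \<le> s ==> s \<le> t ==> f \<in> F s \<rightarrow>\<^sub>M N ==> f \<in> F t \<rightarrow>\<^sub>M N"
 using F_mono[of s t] by (auto simp: measurable_def space_F)

lemma measurable_F_Omega: "0 \<le> s ==> f \<in> F s \<rightarrow>\<^sub>M N ==> f \<in> \<Omega> \<rightarrow>\<^sub>M N"
 by (rule measurable_from_subalg[OF subalgebra_F])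

lemma X_progressive:
 assumes "0 \<le> t"
 shows "(\<lambda>(s, w). X (min t (max 0 s)) w) \<in> borel_measurable (borel \<Otimes>\<^sub>M F t)"
proof -
 have "(\<lambda>(s, w). (min t (max 0 s), w)) \<in> borel \<Otimes>\<^sub>M F t \<rightarrow>\<^sub>M restrict_space borel {0..t} \<Otimes>\<^sub>M F t"
  using assms by (intro measurable_split_conv[THEN iffD2] measurable_Pair measurable_restrict_space2) (auto simp: case_prod_beta)
 moreover have "(\<lambda>(s, w). X s w) \<in> borel_measurable (restrict_space borel {0..t} \<Otimes>\<^sub>M F t)"
  using motion assms by (auto simp: markov_process_def)
 ultimately show ?thesis
  by (rule measurable_compose[THEN measurable_cong[THEN iffD1, rotated]]) auto
qed

lemma Y_progressive:
 assumes "0 \<le> t"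
 shows "(\<lambda>(s, w). Y (min t s) w) \<in> borel_measurable (borel \<Otimes>\<^sub>M F t)"
proof -
 have "max 0 (min t s) = min t (max 0 s)" for s using assms by auto
 then show ?thesis using X_progressive[OF assms] by (simp add: Y_def)
qed

lemma Y_F: "0 \<le> t ==> Y t \<in> borel_measurable (F t)"
 using measurable_compose[OF measurable_Pair1'[of t borel "F t"] Y_progressive[of t]] by simp

text \<open>Progressive measurability covers bounded time intervals; stopping the time at
  \<open>n\<close> and letting \<open>n\<close> grow covers all of them, the approximations being
  eventually constant.\<close>

lemma Y_joint: "(\<lambda>x. Y (fst x) (snd x)) \<in> borel_measurable (borel \<Otimes>\<^sub>M \<Omega>)"
proof (rule borel_measurable_LIMSEQ_real)
 fix n :: nat
 have id: "(\<lambda>w. w) \<in> \<Omega> \<rightarrow>\<^sub>M F (real n)"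
  by (rule measurable_from_subalg[OF subalgebra_F measurable_ident_sets[OF refl]]) simp
 have "(\<lambda>x. (fst x, snd x)) \<in> borel \<Otimes>\<^sub>M \<Omega> \<rightarrow>\<^sub>M borel \<Otimes>\<^sub>M F (real n)"
  by (intro measurable_Pair measurable_compose[OF measurable_snd id]) auto
 from measurable_compose[OF this Y_progressive[of "real n"]]
 show "(\<lambda>x. Y (min (real n) (fst x)) (snd x)) \<in> borel_measurable (borel \<Otimes>\<^sub>M \<Omega>)" by simp
next
 fix x :: "real \<times> 'a"
 obtain N where "fst x \<le> real N" using real_arch_simple by blast
 then have "eventually (\<lambda>n. Y (min (real n) (fst x)) (snd x) = Y (fst x) (snd x)) sequentially"
  by (auto simp: eventually_sequentially min_def intro!: exI[of _ N])
    (metis antisym of_nat_le_iff order_trans)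
 then show "(\<lambda>n. Y (min (real n) (fst x)) (snd x)) \<longlonglongrightarrow> Y (fst x) (snd x)"
  by (rule tendsto_eventually)
qed

lemma measurable_Y [measurable (raw)]:
 "f \<in> borel_measurable N ==> h \<in> N \<rightarrow>\<^sub>M \<Omega> ==> (\<lambda>x. Y (f x) (h x)) \<in> borel_measurable N"
 using measurable_compose[OF measurable_Pair Y_joint, of f N h] by simp

lemma measurable_nn_integral_Q [measurable (raw)]:
 assumes "(\<lambda>(x, w). f x w) \<in> borel_measurable (N \<Otimes>\<^sub>M \<Omega>)" "h \<in> borel_measurable N"
 shows "(\<lambda>x. \<integral>\<^sup>+w. f x w \<partial>Q (h x)) \<in> borel_measurable N"
 by (rule nn_integral_measurable_subprob_algebra2[OF assms(1)]) (use assms in measurable)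

lemma Q_Fubini:
 assumes "(\<lambda>(s, w). f s w) \<in> borel_measurable (lborel \<Otimes>\<^sub>M \<Omega>)"
 shows "(\<integral>\<^sup>+w. \<integral>\<^sup>+s. f s w \<partial>lborel \<partial>Q x) = (\<integral>\<^sup>+s. \<integral>\<^sup>+w. f s w \<partial>Q x \<partial>(lborel :: real measure))"
proof -
 interpret Q: prob_space "Q x" by (rule prob_space_Q)
 interpret pair_sigma_finite "lborel :: real measure" "Q x" ..
 show ?thesis by (rule Fubini') (use assms in measurable)
qed

text \<open>Two nested monotone class arguments, the outer one in \<open>\<xi>\<close> and the inner
  one in \<open>h\<close>, starting from the defining property for a past event and a Borel
  set.\<close>

lemma markov_simple:
 assumes s: "0 \<le> s" and t: "0 \<le> t" and \<xi>: "\<xi> \<in> borel_measurable (F s)" and h: "h \<in> borel_measurable borel"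
 shows "(\<integral>\<^sup>+w. \<xi> w * h (Y (s + t) w) \<partial>Q x) = (\<integral>\<^sup>+w. \<xi> w * (\<integral>\<^sup>+w'. h (Y t w') \<partial>Q (Y s w)) \<partial>Q x)"
 using \<xi>
proof (induction rule: borel_measurable_induct)
 case (cong f g)
 then have "(\<integral>\<^sup>+w. f w * k w \<partial>Q x) = (\<integral>\<^sup>+w. g w * k w \<partial>Q x)" for k
  using s by (intro nn_integral_cong) (auto simp: space_F)
 with cong show ?case by simp
next
 case (set A)
 then have [measurable]: "A \<in> sets \<Omega>" using subalgebra_F[OF s] by (auto simp: subalgebra_def)
 show ?case using h
 proof (induction rule: borel_measurable_induct)
  case (cong f g)
  then show ?case by (simp cong: nn_integral_cong)
 next
  case (set B)
  note [measurable] = set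
  have sp: "{w \<in> space \<Omega>. X u w \<in> B} = {w \<in> space \<Omega>. Y u w \<in> B}" if "0 \<le> u" for u
   using that by (simp add: Y_eq)
  have "(\<integral>\<^sup>+w. indicator A w * indicator B (Y (s + t) w) \<partial>Q x) = emeasure (Q x) (A \<inter> {w \<in> space \<Omega>. Y (s + t) w \<in> B})"
  proof (subst nn_integral_indicator[symmetric])
   show "(\<integral>\<^sup>+w. indicator A w * indicator B (Y (s + t) w) \<partial>Q x) = (\<integral>\<^sup>+w. indicator (A \<inter> {w \<in> space \<Omega>. Y (s + t) w \<in> B}) w \<partial>Q x)"
    by (intro nn_integral_cong) (auto split: split_indicator)
  qed auto
  also have "\<dots> = (\<integral>\<^sup>+w\<in>A. emeasure (Q (X s w)) {w' \<in> space \<Omega>. X t w' \<in> B} \<partial>Q x)"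
   using motion s t \<open>A \<in> sets (F s)\<close> set by (simp add: markov_process_def sp[symmetric])
  also have "\<dots> = (\<integral>\<^sup>+w. indicator A w * (\<integral>\<^sup>+w'. indicator B (Y t w') \<partial>Q (Y s w)) \<partial>Q x)"
  proof (intro nn_integral_cong)
   fix w
   have "emeasure (Q (Y s w)) {w' \<in> space \<Omega>. Y t w' \<in> B} = (\<integral>\<^sup>+w'. indicator B (Y t w') \<partial>Q (Y s w))"
   proof (subst nn_integral_indicator[symmetric])
    show "(\<integral>\<^sup>+w'. indicator {w' \<in> space \<Omega>. Y t w' \<in> B} w' \<partial>Q (Y s w)) = (\<integral>\<^sup>+w'. indicator B (Y t w') \<partial>Q (Y s w))"
     by (intro nn_integral_cong) (auto split: split_indicator)
   qed auto
   then show "emeasure (Q (X s w)) {w' \<in> space \<Omega>. X t w' \<in> B} * indicator A w =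
     indicator A w * (\<integral>\<^sup>+w'. indicator B (Y t w') \<partial>Q (Y s w))"
    by (simp only: sp[OF t] Y_eq[OF s, symmetric] mult.commute)
  qed
  finally show ?case .
 next
  case (mult u c)
  note [measurable] = mult(2)
  have "(\<integral>\<^sup>+w. indicator A w * (c * u (Y (s + t) w)) \<partial>Q x) = c * (\<integral>\<^sup>+w. indicator A w * u (Y (s + t) w) \<partial>Q x)"
   by (subst nn_integral_cmult[symmetric]) (auto simp: mult_ac)
  also have "\<dots> = (\<integral>\<^sup>+w. indicator A w * (\<integral>\<^sup>+w'. c * u (Y t w') \<partial>Q (Y s w)) \<partial>Q x)"
   by (subst mult.IH, subst nn_integral_cmult[symmetric]) (auto simp: nn_integral_cmult mult_ac)
  finally show ?case .
 next
  case (add u v)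
  note [measurable] = add(1,3)
  show ?case
   using add by (simp add: nn_integral_add distrib_left)
 next
  case (seq U)
  note [measurable] = seq(1)
  have inc: "incseq U" by fact
  have U: "(SUP i. U i) = (\<lambda>y. SUP i. U i y)" by (simp add: fun_eq_iff image_comp)
  have "(\<integral>\<^sup>+w. indicator A w * (SUP i. U i (Y (s + t) w)) \<partial>Q x) = (SUP i. \<integral>\<^sup>+w. indicator A w * U i (Y (s + t) w) \<partial>Q x)"
   using inc by (subst nn_integral_monotone_convergence_SUP[symmetric])
     (auto simp: SUP_mult_left_ennreal incseq_def le_fun_def intro!: mult_left_mono)
  also have "\<dots> = (SUP i. \<integral>\<^sup>+w. indicator A w * (\<integral>\<^sup>+w'. U i (Y t w') \<partial>Q (Y s w)) \<partial>Q x)"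
   using seq by simp
  also have "\<dots> = (\<integral>\<^sup>+w. indicator A w * (\<integral>\<^sup>+w'. (SUP i. U i (Y t w')) \<partial>Q (Y s w)) \<partial>Q x)"
   using inc
   by (subst nn_integral_monotone_convergence_SUP[symmetric])
     (auto simp: SUP_mult_left_ennreal incseq_def le_fun_def nn_integral_monotone_convergence_SUP intro!: mult_left_mono nn_integral_mono)
  finally show ?case by (simp add: U)
 qed
next
 case (mult u c)
 have [measurable]: "u \<in> borel_measurable \<Omega>" using mult(2) s by (rule measurable_F_Omega[rotated])
 have [measurable]: "h \<in> borel_measurable borel" by fact
 show ?case using mult by (simp add: nn_integral_cmult mult.assoc)
next
 case (add u v)
 have [measurable]: "u \<in> borel_measurable \<Omega>" "v \<in> borel_measurable \<Omega>"
  using add s measurable_F_Omega by blast+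
 have [measurable]: "h \<in> borel_measurable borel" by fact
 show ?case using add by (simp add: nn_integral_add distrib_right)
next
 case (seq U)
 have [measurable]: "U i \<in> borel_measurable \<Omega>" for i
  using seq s measurable_F_Omega by blast
 have [measurable]: "h \<in> borel_measurable borel" by fact
 have inc: "incseq U" by fact
 have U: "(SUP i. U i) = (\<lambda>y. SUP i. U i y)" by (simp add: fun_eq_iff image_comp)
 have *: "(\<integral>\<^sup>+w. (SUP i. U i w) * k w \<partial>Q x) = (SUP i. \<integral>\<^sup>+w. U i w * k w \<partial>Q x)"
  if [measurable]: "k \<in> borel_measurable \<Omega>" for k
  using inc by (subst nn_integral_monotone_convergence_SUP[symmetric])
     (auto simp: SUP_mult_right_ennreal incseq_def le_fun_def intro!: mult_right_mono)
 show ?case using seq by (simp add: U *)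
qed

text \<open>The rate may depend on time, and its time argument counts from \<open>r\<close>. Hence
  the functional of the path after \<open>r\<close> and that of a fresh path started at
  \<open>Y r w\<close> use the same \<open>g\<close>.\<close>

definition pathclk :: "(real => real => ennreal) => real => real => 'a => ennreal" where
 "pathclk g r s w = clk (\<lambda>sg. g sg (Y (r + sg) w)) s"

lemma measurable_pathclk [measurable (raw)]:
 assumes [measurable]: "(\<lambda>(x, sg, y). g x sg y) \<in> borel_measurable (N \<Otimes>\<^sub>M borel \<Otimes>\<^sub>M borel)"
  "r \<in> borel_measurable N" "s \<in> borel_measurable N" "w \<in> N \<rightarrow>\<^sub>M \<Omega>"
 shows "(\<lambda>x. pathclk (g x) (r x) (s x) (w x)) \<in> borel_measurable N"
proof -
 have "(\<lambda>z. (fst z, snd z, Y (r (fst z) + snd z) (w (fst z)))) \<in> N \<Otimes>\<^sub>M borel \<rightarrow>\<^sub>M N \<Otimes>\<^sub>M borel \<Otimes>\<^sub>M borel"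
  by measurable
 from measurable_compose[OF this assms(1)]
 have [measurable]: "(\<lambda>(x, sg). g x sg (Y (r x + sg) (w x))) \<in> borel_measurable (N \<Otimes>\<^sub>M borel)"
  by (simp add: case_prod_beta)
 show ?thesis unfolding pathclk_def by measurable
qed

text \<open>Clamping the time at \<open>r + s\<close> does not change the integral, and the clamped
  process is measurable with respect to \<open>F (r + s)\<close> jointly with time.\<close>

lemma pathclk_F:
 assumes [measurable]: "(\<lambda>(sg, y). g sg y) \<in> borel_measurable borel2" and r: "0 \<le> r" and s: "0 \<le> s"
 shows "pathclk g r s \<in> borel_measurable (F (r + s))"
proof -
 have Yp[measurable (raw)]: "f \<in> borel_measurable N ==> h \<in> N \<rightarrow>\<^sub>M F (r + s) ==> (\<lambda>x. Y (min (r + s) (f x)) (h x)) \<in> borel_measurable N" for f h and N :: "(_ \<times> _) measure"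
  using measurable_compose[OF measurable_Pair Y_progressive, of f N h "r + s"] r s by simp
 have "pathclk g r s = (\<lambda>w. clk (\<lambda>sg. g sg (Y (min (r + s) (r + sg)) w)) s)"
  unfolding pathclk_def clk_def
  by (intro ext nn_integral_cong) (auto split: split_indicator simp: min_def)
 also have "\<dots> \<in> borel_measurable (F (r + s))"
  by measurable
 finally show ?thesis .
qed

lemma pathclk_bound:
 assumes "\<And>s y. g s y \<le> ennreal K"
 shows "pathclk g r s w < \<top>"
proof -
 have "pathclk g r s w \<le> (\<integral>\<^sup>+sg. ennreal K * indicator {0..s} sg \<partial>lborel)"
  unfolding pathclk_def clk_def using assms by (intro nn_integral_mono mult_right_mono) auto
 also have "\<dots> < \<top>" by (simp add: nn_integral_cmult ennreal_mult_less_top emeasure_lborel_Icc_eq)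
 finally show ?thesis .
qed

text \<open>By \<open>clk_power\<close> the power is an integral over the last time
  \<open>sg\<close> of the next lower power at \<open>sg\<close>. Given \<open>F (r + sg)\<close>
  only the end point \<open>Y (r + s)\<close> is still random, and the single-time Markov property
  replaces it by its kernel.\<close>

lemma markov_power_Suc:
 assumes g[measurable]: "(\<lambda>(sg, y). g sg y) \<in> borel_measurable borel2" and K: "\<And>s y. g s y \<le> ennreal K"
  and r: "0 \<le> r" and s: "0 \<le> s" and \<xi>: "\<xi> \<in> borel_measurable (F r)" and h[measurable]: "h \<in> borel_measurable borel"
 shows "(\<integral>\<^sup>+w. \<xi> w * (pathclk g r s w ^ Suc n / fact (Suc n) * h (Y (r + s) w)) \<partial>Q x) =
  (\<integral>\<^sup>+sg. (\<integral>\<^sup>+w. \<xi> w * (pathclk g r sg w ^ n / fact n *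
    (g sg (Y (r + sg) w) * (\<integral>\<^sup>+w'. h (Y (s - sg) w') \<partial>Q (Y (r + sg) w)))) \<partial>Q x) * indicator {0..s} sg \<partial>lborel)"
proof -
 have \<xi>\<Omega>[measurable]: "\<xi> \<in> borel_measurable \<Omega>" using r \<xi> by (rule measurable_F_Omega)
 have "(\<integral>\<^sup>+w. \<xi> w * (pathclk g r s w ^ Suc n / fact (Suc n) * h (Y (r + s) w)) \<partial>Q x) =
  (\<integral>\<^sup>+w. \<integral>\<^sup>+sg. \<xi> w * (pathclk g r sg w ^ n / fact n * g sg (Y (r + sg) w)) * h (Y (r + s) w) * indicator {0..s} sg \<partial>lborel \<partial>Q x)"
 proof (intro nn_integral_cong)
  fix w assume "w \<in> space (Q x)"
  then have [simp]: "w \<in> space \<Omega>" by simp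
  have fin: "clk (\<lambda>sg. g sg (Y (r + sg) w)) t < \<top>" for t
   using pathclk_bound[where r=r and s=t and w=w, OF K] by (simp add: pathclk_def)
  have "pathclk g r s w ^ Suc n / fact (Suc n) = (\<integral>\<^sup>+sg. (pathclk g r sg w ^ n / fact n * g sg (Y (r + sg) w)) * indicator {0..s} sg \<partial>lborel)"
   unfolding pathclk_def by (rule clk_power[symmetric]) (use fin s in auto)
  then have "\<xi> w * (pathclk g r s w ^ Suc n / fact (Suc n) * h (Y (r + s) w)) =
   (\<xi> w * h (Y (r + s) w)) * (\<integral>\<^sup>+sg. (pathclk g r sg w ^ n / fact n * g sg (Y (r + sg) w)) * indicator {0..s} sg \<partial>lborel)"
   by (simp only: mult_ac)
  also have "\<dots> = (\<integral>\<^sup>+sg. \<xi> w * (pathclk g r sg w ^ n / fact n * g sg (Y (r + sg) w)) * h (Y (r + s) w) * indicator {0..s} sg \<partial>lborel)"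
   by (subst nn_integral_cmult[symmetric]) (auto simp: mult_ac)
  finally show "\<xi> w * (pathclk g r s w ^ Suc n / fact (Suc n) * h (Y (r + s) w)) = \<dots>" .
 qed
 also have "\<dots> = (\<integral>\<^sup>+sg. \<integral>\<^sup>+w. \<xi> w * (pathclk g r sg w ^ n / fact n * g sg (Y (r + sg) w)) * h (Y (r + s) w) * indicator {0..s} sg \<partial>Q x \<partial>lborel)"
  by (rule Q_Fubini) measurable
 also have "\<dots> = (\<integral>\<^sup>+sg. (\<integral>\<^sup>+w. \<xi> w * (pathclk g r sg w ^ n / fact n *
    (g sg (Y (r + sg) w) * (\<integral>\<^sup>+w'. h (Y (s - sg) w') \<partial>Q (Y (r + sg) w)))) \<partial>Q x) * indicator {0..s} sg \<partial>lborel)"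
 proof (intro nn_integral_cong)
  fix sg :: real
  show "(\<integral>\<^sup>+w. \<xi> w * (pathclk g r sg w ^ n / fact n * g sg (Y (r + sg) w)) * h (Y (r + s) w) * indicator {0..s} sg \<partial>Q x) =
   (\<integral>\<^sup>+w. \<xi> w * (pathclk g r sg w ^ n / fact n *
    (g sg (Y (r + sg) w) * (\<integral>\<^sup>+w'. h (Y (s - sg) w') \<partial>Q (Y (r + sg) w)))) \<partial>Q x) * indicator {0..s} sg"
  proof (cases "sg \<in> {0..s}")
   case True
   have [measurable]: "\<xi> \<in> borel_measurable (F (r + sg))" "Y (r + sg) \<in> borel_measurable (F (r + sg))"
    "pathclk g r sg \<in> borel_measurable (F (r + sg))"
    using r True by (auto intro: Y_F pathclk_F measurable_F_mono[OF _ _ \<xi>])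
   have "(\<integral>\<^sup>+w. \<xi> w * (pathclk g r sg w ^ n / fact n * g sg (Y (r + sg) w)) * h (Y ((r + sg) + (s - sg)) w) \<partial>Q x) =
    (\<integral>\<^sup>+w. \<xi> w * (pathclk g r sg w ^ n / fact n * g sg (Y (r + sg) w)) * (\<integral>\<^sup>+w'. h (Y (s - sg) w') \<partial>Q (Y (r + sg) w)) \<partial>Q x)"
    by (rule markov_simple) (use r True in auto)
   then show ?thesis using True by (simp add: mult_ac)
  qed simp
 qed
 finally show ?thesis .
qed

text \<open>Both sides satisfy the recursion of \<open>markov_power_Suc\<close>, so induction on the
  power extends the Markov property from one time to a functional of the whole path segment.\<close>

lemma markov_power:
 assumes g[measurable]: "(\<lambda>(sg, y). g sg y) \<in> borel_measurable borel2" and K: "\<And>s y. g s y \<le> ennreal K"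
  and r: "0 \<le> r" and s: "0 \<le> s" and \<xi>: "\<xi> \<in> borel_measurable (F r)" and h: "h \<in> borel_measurable borel"
 shows "(\<integral>\<^sup>+w. \<xi> w * (pathclk g r s w ^ n / fact n * h (Y (r + s) w)) \<partial>Q x) =
  (\<integral>\<^sup>+w. \<xi> w * (\<integral>\<^sup>+w'. pathclk g 0 s w' ^ n / fact n * h (Y s w') \<partial>Q (Y r w)) \<partial>Q x)"
 using s h
proof (induction n arbitrary: s h)
 case 0
 then show ?case using markov_simple[OF r _ \<xi>, of s h x] by simp
next
 case (Suc n)
 note [measurable] = Suc.prems(2)
 have \<xi>\<Omega>[measurable]: "\<xi> \<in> borel_measurable \<Omega>" using r \<xi> by (rule measurable_F_Omega)
 \<comment> \<open>The end function that remains after one power has been peeled off. It depends on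
   the peeled time \<open>sg\<close>, which is why the induction runs over arbitrary
   \<open>s\<close> and \<open>h\<close>.\<close>
 define h' where "h' sg y = g sg y * (\<integral>\<^sup>+w'. h (Y (s - sg) w') \<partial>Q y)" for sg y
 have [measurable]: "(\<lambda>(sg, y). h' sg y) \<in> borel_measurable borel2"
  unfolding h'_def by measurable
 have "(\<integral>\<^sup>+w. \<xi> w * (pathclk g r s w ^ Suc n / fact (Suc n) * h (Y (r + s) w)) \<partial>Q x) =
  (\<integral>\<^sup>+sg. (\<integral>\<^sup>+w. \<xi> w * (pathclk g r sg w ^ n / fact n * h' sg (Y (r + sg) w)) \<partial>Q x) * indicator {0..s} sg \<partial>lborel)"
  unfolding h'_def by (rule markov_power_Suc) (use K r Suc.prems \<xi> in auto)
 also have "\<dots> = (\<integral>\<^sup>+sg. (\<integral>\<^sup>+w. \<xi> w * (\<integral>\<^sup>+w'. pathclk g 0 sg w' ^ n / fact n * h' sg (Y sg w') \<partial>Q (Y r w)) \<partial>Q x) * indicator {0..s} sg \<partial>lborel)"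
  by (intro nn_integral_cong) (auto simp: Suc.IH split: split_indicator)
 also have "\<dots> = (\<integral>\<^sup>+sg. (\<integral>\<^sup>+w. \<xi> w * (\<integral>\<^sup>+w'. pathclk g 0 sg w' ^ n / fact n * h' sg (Y sg w') \<partial>Q (Y r w)) * indicator {0..s} sg \<partial>Q x) \<partial>lborel)"
  by (intro nn_integral_cong nn_integral_multc[symmetric]) measurable
 also have "\<dots> = (\<integral>\<^sup>+w. \<integral>\<^sup>+sg. \<xi> w * (\<integral>\<^sup>+w'. pathclk g 0 sg w' ^ n / fact n * h' sg (Y sg w') \<partial>Q (Y r w)) * indicator {0..s} sg \<partial>lborel \<partial>Q x)"
  by (rule Q_Fubini[symmetric]) measurable
 \<comment> \<open>The recursion is read backwards under the law \<open>Q (Y r w)\<close>, that is,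
   for starting time 0 and weight 1.\<close>
 also have "\<dots> = (\<integral>\<^sup>+w. \<xi> w * (\<integral>\<^sup>+w'. pathclk g 0 s w' ^ Suc n / fact (Suc n) * h (Y s w') \<partial>Q (Y r w)) \<partial>Q x)"
 proof (intro nn_integral_cong)
  fix w assume "w \<in> space (Q x)"
  then have [simp]: "w \<in> space \<Omega>" by simp
  have "(\<integral>\<^sup>+w'. 1 * (pathclk g 0 s w' ^ Suc n / fact (Suc n) * h (Y (0 + s) w')) \<partial>Q (Y r w)) =
   (\<integral>\<^sup>+sg. (\<integral>\<^sup>+w'. 1 * (pathclk g 0 sg w' ^ n / fact n * h' sg (Y (0 + sg) w')) \<partial>Q (Y r w)) * indicator {0..s} sg \<partial>lborel)"
   unfolding h'_def by (rule markov_power_Suc) (use K Suc.prems in auto)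
  then have *: "(\<integral>\<^sup>+w'. pathclk g 0 s w' ^ Suc n / fact (Suc n) * h (Y s w') \<partial>Q (Y r w)) =
   (\<integral>\<^sup>+sg. (\<integral>\<^sup>+w'. pathclk g 0 sg w' ^ n / fact n * h' sg (Y sg w') \<partial>Q (Y r w)) * indicator {0..s} sg \<partial>lborel)"
   by simp
  show "(\<integral>\<^sup>+sg. \<xi> w * (\<integral>\<^sup>+w'. pathclk g 0 sg w' ^ n / fact n * h' sg (Y sg w') \<partial>Q (Y r w)) * indicator {0..s} sg \<partial>lborel) =
    \<xi> w * (\<integral>\<^sup>+w'. pathclk g 0 s w' ^ Suc n / fact (Suc n) * h (Y s w') \<partial>Q (Y r w))"
   unfolding * by (subst nn_integral_cmult[symmetric]) (auto simp: mult.assoc)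
 qed
 finally show ?case .
qed

lemma exp_series_ennreal:
 assumes "c < \<top>"
 shows "(\<Sum>n. c ^ n / fact n) = ennreal (exp (enn2real c))"
proof -
 obtain r where r: "c = ennreal r" "0 \<le> r" using assms by (cases c) auto
 have f: "(fact n :: ennreal) = ennreal (fact n)" for n
  by (metis ennreal_of_nat_eq_real_of_nat of_nat_fact)
 have "(\<lambda>n. r ^ n / fact n) sums exp r"
  using exp_converges[of r] by (simp add: field_simps)
 then have "(\<Sum>n. ennreal (r ^ n / fact n)) = ennreal (exp r)"
  using r(2) by (intro suminf_ennreal_eq) auto
 then show ?thesis using r by (simp add: f ennreal_power divide_ennreal)
qed

lemma markov_exp:
 assumes g[measurable]: "(\<lambda>(sg, y). g sg y) \<in> borel_measurable borel2" and K: "\<And>s y. g s y \<le> ennreal K"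
  and r: "0 \<le> r" and s: "0 \<le> s" and \<xi>: "\<xi> \<in> borel_measurable (F r)" and h[measurable]: "h \<in> borel_measurable borel"
 shows "(\<integral>\<^sup>+w. \<xi> w * (ennreal (exp (enn2real (pathclk g r s w))) * h (Y (r + s) w)) \<partial>Q x) =
  (\<integral>\<^sup>+w. \<xi> w * (\<integral>\<^sup>+w'. ennreal (exp (enn2real (pathclk g 0 s w'))) * h (Y s w') \<partial>Q (Y r w)) \<partial>Q x)"
proof -
 have \<xi>\<Omega>[measurable]: "\<xi> \<in> borel_measurable \<Omega>" using r \<xi> by (rule measurable_F_Omega)
 have ser: "ennreal (exp (enn2real (pathclk g r s w))) = (\<Sum>n. pathclk g r s w ^ n / fact n)" for r s w
  by (rule exp_series_ennreal[OF pathclk_bound[OF K], symmetric])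
 have "(\<integral>\<^sup>+w. \<xi> w * (ennreal (exp (enn2real (pathclk g r s w))) * h (Y (r + s) w)) \<partial>Q x) =
   (\<integral>\<^sup>+w. (\<Sum>n. \<xi> w * (pathclk g r s w ^ n / fact n * h (Y (r + s) w))) \<partial>Q x)"
  by (simp add: ser)
 also have "\<dots> = (\<Sum>n. \<integral>\<^sup>+w. \<xi> w * (pathclk g r s w ^ n / fact n * h (Y (r + s) w)) \<partial>Q x)"
  by (rule nn_integral_suminf) measurable
 also have "\<dots> = (\<Sum>n. \<integral>\<^sup>+w. \<xi> w * (\<integral>\<^sup>+w'. pathclk g 0 s w' ^ n / fact n * h (Y s w') \<partial>Q (Y r w)) \<partial>Q x)"
  by (simp add: markov_power[OF g K r s \<xi> h])
 also have "\<dots> = (\<integral>\<^sup>+w. (\<Sum>n. \<xi> w * (\<integral>\<^sup>+w'. pathclk g 0 s w' ^ n / fact n * h (Y s w') \<partial>Q (Y r w))) \<partial>Q x)"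
  by (rule nn_integral_suminf[symmetric]) measurable
 also have "\<dots> = (\<integral>\<^sup>+w. \<xi> w * (\<integral>\<^sup>+w'. (\<Sum>n. pathclk g 0 s w' ^ n / fact n * h (Y s w')) \<partial>Q (Y r w)) \<partial>Q x)"
 proof (intro nn_integral_cong)
  fix w
  have "(\<integral>\<^sup>+w'. (\<Sum>n. pathclk g 0 s w' ^ n / fact n * h (Y s w')) \<partial>Q (Y r w)) =
   (\<Sum>n. \<integral>\<^sup>+w'. pathclk g 0 s w' ^ n / fact n * h (Y s w') \<partial>Q (Y r w))"
   by (rule nn_integral_suminf) measurable
  then show "(\<Sum>n. \<xi> w * (\<integral>\<^sup>+w'. pathclk g 0 s w' ^ n / fact n * h (Y s w') \<partial>Q (Y r w))) =
   \<xi> w * (\<integral>\<^sup>+w'. (\<Sum>n. pathclk g 0 s w' ^ n / fact n * h (Y s w')) \<partial>Q (Y r w))"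
   by simp
 qed
 finally show ?thesis by (simp add: ser)
qed

text \<open>Writing exp(- integral of g) as exp(-K s) times exp(integral of K - g) leads back to the
  exponential series of \<open>markov_exp\<close>, whose terms are nonnegative and may be summed
  under the integral.\<close>

lemma markov_expm_bounded:
 assumes g[measurable]: "(\<lambda>(sg, y). g sg y) \<in> borel_measurable borel2" and K: "\<And>s y. g s y \<le> ennreal K" "0 \<le> K"
  and r: "0 \<le> r" and s: "0 \<le> s" and \<xi>: "\<xi> \<in> borel_measurable (F r)" and h[measurable]: "h \<in> borel_measurable borel"
 shows "(\<integral>\<^sup>+w. \<xi> w * (expm (pathclk g r s w) * h (Y (r + s) w)) \<partial>Q x) =
  (\<integral>\<^sup>+w. \<xi> w * (\<integral>\<^sup>+w'. expm (pathclk g 0 s w') * h (Y s w') \<partial>Q (Y r w)) \<partial>Q x)"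
proof -
 have \<xi>\<Omega>[measurable]: "\<xi> \<in> borel_measurable \<Omega>" using r \<xi> by (rule measurable_F_Omega)
 let ?g = "\<lambda>sg y. ennreal K - g sg y"
 have gK: "?g sg y \<le> ennreal K" for sg y by (rule diff_le_self_ennreal)
 have E: "expm (pathclk g r s w) = expm (ennreal (K * s)) * ennreal (exp (enn2real (pathclk ?g r s w)))"
  if [simp]: "w \<in> space \<Omega>" for r w
 proof -
  have "pathclk g r s w + pathclk ?g r s w =
   (\<integral>\<^sup>+sg. g sg (Y (r + sg) w) * indicator {0..s} sg + ?g sg (Y (r + sg) w) * indicator {0..s} sg \<partial>lborel)"
   unfolding pathclk_def clk_def by (rule nn_integral_add[symmetric]) measurable
  also have "\<dots> = (\<integral>\<^sup>+sg. ennreal K * indicator {0..s} sg \<partial>lborel)"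
   using K(1) by (intro nn_integral_cong) (auto split: split_indicator simp: add_diff_inverse_ennreal)
  also have "\<dots> = ennreal (K * s)"
   using s K by (simp add: nn_integral_cmult ennreal_mult)
  finally have sum: "pathclk g r s w + pathclk ?g r s w = ennreal (K * s)" .
  define a b where "a = enn2real (pathclk g r s w)" and "b = enn2real (pathclk ?g r s w)"
  then have ab: "pathclk g r s w = ennreal a" "0 \<le> a" "pathclk ?g r s w = ennreal b" "0 \<le> b"
   using pathclk_bound[where r=r and s=s and w=w, OF K(1)] pathclk_bound[where g="?g" and r=r and s=s and w=w, OF gK]
   by simp_all
  with sum s K have "K * s = a + b" by (simp flip: ennreal_plus)
  moreover have "expm (ennreal (a + b)) * ennreal (exp b) = ennreal (exp (- a))"
   using ab by (subst expm_ennreal) (auto simp: ennreal_mult[symmetric] exp_add[symmetric])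
  ultimately show ?thesis using ab by (simp add: expm_ennreal)
 qed
 have "(\<integral>\<^sup>+w. \<xi> w * (expm (pathclk g r s w) * h (Y (r + s) w)) \<partial>Q x) =
  (\<integral>\<^sup>+w. expm (ennreal (K * s)) * (\<xi> w * (ennreal (exp (enn2real (pathclk ?g r s w))) * h (Y (r + s) w))) \<partial>Q x)"
  by (intro nn_integral_cong) (simp add: E mult_ac)
 also have "\<dots> = expm (ennreal (K * s)) * (\<integral>\<^sup>+w. \<xi> w * (ennreal (exp (enn2real (pathclk ?g r s w))) * h (Y (r + s) w)) \<partial>Q x)"
  by (rule nn_integral_cmult) measurable
 also have "\<dots> = expm (ennreal (K * s)) * (\<integral>\<^sup>+w. \<xi> w * (\<integral>\<^sup>+w'. ennreal (exp (enn2real (pathclk ?g 0 s w'))) * h (Y s w') \<partial>Q (Y r w)) \<partial>Q x)"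
  by (intro arg_cong2[where f="(*)"] refl markov_exp[OF _ gK r s \<xi> h]) measurable
 also have "\<dots> = (\<integral>\<^sup>+w. \<xi> w * (expm (ennreal (K * s)) * (\<integral>\<^sup>+w'. ennreal (exp (enn2real (pathclk ?g 0 s w'))) * h (Y s w') \<partial>Q (Y r w))) \<partial>Q x)"
  by (subst nn_integral_cmult[symmetric]) (auto simp: mult_ac)
 also have "\<dots> = (\<integral>\<^sup>+w. \<xi> w * (\<integral>\<^sup>+w'. expm (pathclk g 0 s w') * h (Y s w') \<partial>Q (Y r w)) \<partial>Q x)"
  by (intro nn_integral_cong arg_cong2[where f="(*)"] refl, subst nn_integral_cmult[symmetric])
    (auto simp: E mult_ac intro!: nn_integral_cong)
 finally show ?thesis .
qed

lemma pathclk_truncate: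
 assumes g[measurable]: "(\<lambda>(sg, y). g sg y) \<in> borel_measurable borel2" and [simp]: "w \<in> space \<Omega>"
 shows "(\<lambda>n. pathclk (\<lambda>sg y. min (g sg y) (ennreal (real n))) r s w) \<longlonglongrightarrow> pathclk g r s w"
 unfolding pathclk_def clk_def
proof (rule nn_integral_LIMSEQ)
 show "incseq (\<lambda>n sg. min (g sg (Y (r + sg) w)) (ennreal (real n)) * indicator {0..s} sg)"
  by (auto simp: incseq_def le_fun_def intro!: mult_right_mono min.mono ennreal_leI)
 show "(\<lambda>n. min (g sg (Y (r + sg) w)) (ennreal (real n)) * indicator {0..s} sg) \<longlonglongrightarrow> g sg (Y (r + sg) w) * indicator {0..s} sg" for sg
 proof -
  have "(\<lambda>n. ennreal (real n)) \<longlonglongrightarrow> \<top>"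
   using ennreal_tendsto_top_eq_at_top[of "\<lambda>n. real n" sequentially] filterlim_real_sequentially by simp
  then have "(\<lambda>n. min (g sg (Y (r + sg) w)) (ennreal (real n))) \<longlonglongrightarrow> min (g sg (Y (r + sg) w)) \<top>"
   by (intro tendsto_min tendsto_const)
  then show ?thesis by (auto split: split_indicator)
 qed
qed measurable

text \<open>Truncation of \<open>g\<close> at level \<open>n\<close> and dominated convergence, for
  which the bounds on \<open>\<xi>\<close> and \<open>h\<close> provide the constant
  \<open>C * D\<close>. The potential \<open>g\<close> itself may be unbounded, as the death rate
  is.\<close>

lemma markov_expm:
 assumes g[measurable]: "(\<lambda>(sg, y). g sg y) \<in> borel_measurable borel2"
  and r: "0 \<le> r" and s: "0 \<le> s" and \<xi>: "\<xi> \<in> borel_measurable (F r)" and h[measurable]: "h \<in> borel_measurable borel"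
  and b\<xi>: "\<And>w. \<xi> w \<le> C" "C < \<top>" and bh: "\<And>y. h y \<le> D" "D < \<top>"
 shows "(\<integral>\<^sup>+w. \<xi> w * (expm (pathclk g r s w) * h (Y (r + s) w)) \<partial>Q x) =
  (\<integral>\<^sup>+w. \<xi> w * (\<integral>\<^sup>+w'. expm (pathclk g 0 s w') * h (Y s w') \<partial>Q (Y r w)) \<partial>Q x)"
proof (rule LIMSEQ_unique)
 have \<xi>\<Omega>[measurable]: "\<xi> \<in> borel_measurable \<Omega>" using r \<xi> by (rule measurable_F_Omega)
 let ?g = "\<lambda>n sg y. min (g sg y) (ennreal (real n))"
 let ?L = "\<lambda>n. \<integral>\<^sup>+w. \<xi> w * (expm (pathclk (?g n) r s w) * h (Y (r + s) w)) \<partial>Q x"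
 have lim: "(\<lambda>n. expm (pathclk (?g n) r s w)) \<longlonglongrightarrow> expm (pathclk g r s w)" if "w \<in> space \<Omega>" for r w
  by (intro tendsto_expm pathclk_truncate g that)
 have bd: "expm a * h y \<le> D" for a y
  using mult_mono[OF expm_le_1[of a] bh(1)[of y]] by simp
 show "?L \<longlonglongrightarrow> (\<integral>\<^sup>+w. \<xi> w * (expm (pathclk g r s w) * h (Y (r + s) w)) \<partial>Q x)"
 proof (rule nn_integral_dominated_convergence[where w="\<lambda>_. C * D"])
  show "(\<integral>\<^sup>+w. C * D \<partial>Q x) < \<infinity>"
   using b\<xi> bh by (simp add: prob_space.emeasure_space_1[OF prob_space_Q, unfolded space_Q] ennreal_mult_less_top)
  show "AE w in Q x. (\<lambda>n. \<xi> w * (expm (pathclk (?g n) r s w) * h (Y (r + s) w))) \<longlonglongrightarrow>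
   \<xi> w * (expm (pathclk g r s w) * h (Y (r + s) w))"
  proof (rule AE_I2)
   fix w assume "w \<in> space (Q x)"
   moreover have "\<xi> w < \<top>" "h (Y (r + s) w) < \<top>" using b\<xi> bh by (auto intro: le_less_trans)
   ultimately have "(\<lambda>n. \<xi> w * (h (Y (r + s) w) * expm (pathclk (?g n) r s w))) \<longlonglongrightarrow>
    \<xi> w * (h (Y (r + s) w) * expm (pathclk g r s w))"
    by (intro ennreal_tendsto_cmult lim) auto
   then show "(\<lambda>n. \<xi> w * (expm (pathclk (?g n) r s w) * h (Y (r + s) w))) \<longlonglongrightarrow>
    \<xi> w * (expm (pathclk g r s w) * h (Y (r + s) w))"
    by (simp add: mult.commute)
  qed
 qed (use b\<xi> bd in \<open>auto intro!: mult_mono\<close>)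
 have "?L = (\<lambda>n. \<integral>\<^sup>+w. \<xi> w * (\<integral>\<^sup>+w'. expm (pathclk (?g n) 0 s w') * h (Y s w') \<partial>Q (Y r w)) \<partial>Q x)"
 proof (rule ext)
  show "?L n = (\<integral>\<^sup>+w. \<xi> w * (\<integral>\<^sup>+w'. expm (pathclk (?g n) 0 s w') * h (Y s w') \<partial>Q (Y r w)) \<partial>Q x)" for n
   by (rule markov_expm_bounded[where K="real n"]) (use r s \<xi> in auto)
 qed
 also have "\<dots> \<longlonglongrightarrow> (\<integral>\<^sup>+w. \<xi> w * (\<integral>\<^sup>+w'. expm (pathclk g 0 s w') * h (Y s w') \<partial>Q (Y r w)) \<partial>Q x)"
 proof (rule nn_integral_dominated_convergence[where w="\<lambda>_. C * D"])
  show "(\<integral>\<^sup>+w. C * D \<partial>Q x) < \<infinity>"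
   using b\<xi> bh by (simp add: prob_space.emeasure_space_1[OF prob_space_Q, unfolded space_Q] ennreal_mult_less_top)
  have D: "(\<integral>\<^sup>+w'. expm (pathclk g' 0 s w') * h (Y s w') \<partial>Q y) \<le> D" for g' y
  proof -
   have "(\<integral>\<^sup>+w'. expm (pathclk g' 0 s w') * h (Y s w') \<partial>Q y) \<le> (\<integral>\<^sup>+w'. D \<partial>Q y)"
    by (intro nn_integral_mono bd)
   then show ?thesis by (simp add: prob_space.emeasure_space_1[OF prob_space_Q, unfolded space_Q])
  qed
  then show "AE w in Q x. \<xi> w * (\<integral>\<^sup>+w'. expm (pathclk (?g n) 0 s w') * h (Y s w') \<partial>Q (Y r w)) \<le> C * D" for n
   using b\<xi> by (auto intro!: mult_mono)
  show "AE w in Q x. (\<lambda>n. \<xi> w * (\<integral>\<^sup>+w'. expm (pathclk (?g n) 0 s w') * h (Y s w') \<partial>Q (Y r w))) \<longlonglongrightarrow>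
   \<xi> w * (\<integral>\<^sup>+w'. expm (pathclk g 0 s w') * h (Y s w') \<partial>Q (Y r w))"
  proof (intro AE_I2 ennreal_tendsto_cmult)
   fix w
   show "\<xi> w < \<top>" using b\<xi> by (auto intro: le_less_trans)
   show "(\<lambda>n. \<integral>\<^sup>+w'. expm (pathclk (?g n) 0 s w') * h (Y s w') \<partial>Q (Y r w)) \<longlonglongrightarrow>
     (\<integral>\<^sup>+w'. expm (pathclk g 0 s w') * h (Y s w') \<partial>Q (Y r w))"
   proof (rule nn_integral_dominated_convergence[where w="\<lambda>_. D"])
    show "(\<integral>\<^sup>+w'. D \<partial>Q (Y r w)) < \<infinity>"
     using bh by (simp add: prob_space.emeasure_space_1[OF prob_space_Q, unfolded space_Q])
    show "AE w' in Q (Y r w). (\<lambda>n. expm (pathclk (?g n) 0 s w') * h (Y s w')) \<longlonglongrightarrow> expm (pathclk g 0 s w') * h (Y s w')"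
    proof (rule AE_I2)
     fix w' assume "w' \<in> space (Q (Y r w))"
     moreover have "h (Y s w') < \<top>" using bh by (auto intro: le_less_trans)
     ultimately have "(\<lambda>n. h (Y s w') * expm (pathclk (?g n) 0 s w')) \<longlonglongrightarrow> h (Y s w') * expm (pathclk g 0 s w')"
      by (intro ennreal_tendsto_cmult lim) auto
     then show "(\<lambda>n. expm (pathclk (?g n) 0 s w') * h (Y s w')) \<longlonglongrightarrow> expm (pathclk g 0 s w') * h (Y s w')"
      by (simp add: mult.commute)
    qed
   qed (use bd in auto)
  qed
 qed measurable
 finally show "?L \<longlonglongrightarrow> (\<integral>\<^sup>+w. \<xi> w * (\<integral>\<^sup>+w'. expm (pathclk g 0 s w') * h (Y s w') \<partial>Q (Y r w)) \<partial>Q x)" .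
qed

end

text \<open>Extends a conditional law from rectangles to all nonnegative functions of the
 pair (past, new value).\<close>

lemma nn_integral_kernel_extend:
 assumes P: "prob_space P" and sub: "subalgebra P F"
  and U[measurable]: "U \<in> P \<rightarrow>\<^sub>M N" and \<kappa>: "\<kappa> \<in> F \<rightarrow>\<^sub>M subprob_algebra N"
  and R[measurable]: "R \<in> borel_measurable P" "R' \<in> borel_measurable P"
  and R1: "\<And>om. R om \<le> 1"
  and rect: "\<And>G D. G \<in> sets F ==> D \<in> sets N ==>
   (\<integral>\<^sup>+om. R om * (indicator G om * indicator D (U om)) \<partial>P) = (\<integral>\<^sup>+om. R' om * (indicator G om * emeasure (\<kappa> om) D) \<partial>P)"
  and h: "(\<lambda>(om, l). h om l) \<in> borel_measurable (F \<Otimes>\<^sub>M N)"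
 shows "(\<integral>\<^sup>+om. R om * h om (U om) \<partial>P) = (\<integral>\<^sup>+om. R' om * (\<integral>\<^sup>+l. h om l \<partial>\<kappa> om) \<partial>P)"
proof -
 interpret P: prob_space P by fact
 have ne: "space P \<noteq> {}" by (rule P.not_empty)
 have spF: "space F = space P" using sub by (simp add: subalgebra_def)
 have FP: "A \<in> sets F ==> A \<in> sets P" for A using sub by (auto simp: subalgebra_def)
 have id[measurable]: "(\<lambda>om. om) \<in> P \<rightarrow>\<^sub>M F"
  by (rule measurable_from_subalg[OF sub measurable_ident_sets[OF refl]])
 have \<kappa>P[measurable]: "\<kappa> \<in> P \<rightarrow>\<^sub>M subprob_algebra N" by (rule measurable_from_subalg[OF sub \<kappa>])
 have sets\<kappa>: "sets (\<kappa> om) = sets N" if "om \<in> space P" for om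
  using sets_kernel[OF \<kappa>P that] .
 let ?K = "\<lambda>om. distr (\<kappa> om) (F \<Otimes>\<^sub>M N) (Pair om)"
 have "(\<lambda>z. (fst z, snd z)) \<in> P \<Otimes>\<^sub>M N \<rightarrow>\<^sub>M F \<Otimes>\<^sub>M N" by measurable
 then have "?K \<in> P \<rightarrow>\<^sub>M subprob_algebra (F \<Otimes>\<^sub>M N)"
  by (intro measurable_distr2[OF _ \<kappa>P]) (simp add: case_prod_beta)
 then have K[measurable]: "?K \<in> density P R' \<rightarrow>\<^sub>M subprob_algebra (F \<Otimes>\<^sub>M N)"
  unfolding measurable_cong_sets[OF sets_density refl] .
 \<comment> \<open>Two measures on pairs (past, new value): \<open>?M\<close> is the joint law
   weighted by \<open>R\<close>, while \<open>?N\<close> draws the new value from the kernel under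
   the weight \<open>R'\<close>. The hypothesis on rectangles says that they agree on a generator
   stable under intersection.\<close>
 let ?M = "distr (density P R) (F \<Otimes>\<^sub>M N) (\<lambda>om. (om, U om))"
 let ?N = "density P R' \<bind> ?K"
 have setsN: "sets ?N = sets (F \<Otimes>\<^sub>M N)"
  by (rule sets_bind_measurable[OF K]) (simp add: ne)
 have M: "(\<integral>\<^sup>+z. f z \<partial>?M) = (\<integral>\<^sup>+om. R om * f (om, U om) \<partial>P)" if [measurable]: "f \<in> borel_measurable (F \<Otimes>\<^sub>M N)" for f
  by (subst nn_integral_distr, simp, simp, subst nn_integral_density) auto
 have N: "(\<integral>\<^sup>+z. f z \<partial>?N) = (\<integral>\<^sup>+om. R' om * (\<integral>\<^sup>+l. f (om, l) \<partial>\<kappa> om) \<partial>P)" if f[measurable]: "f \<in> borel_measurable (F \<Otimes>\<^sub>M N)" for f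
 proof -
  have "(\<integral>\<^sup>+z. f z \<partial>?N) = (\<integral>\<^sup>+om. \<integral>\<^sup>+z. f z \<partial>?K om \<partial>density P R')"
   by (rule nn_integral_bind[OF f K])
  also have "\<dots> = (\<integral>\<^sup>+om. R' om * (\<integral>\<^sup>+z. f z \<partial>?K om) \<partial>P)"
   by (rule nn_integral_density) (use measurable_compose[OF K nn_integral_measurable_subprob_algebra[OF f]] in auto)
  also have "\<dots> = (\<integral>\<^sup>+om. R' om * (\<integral>\<^sup>+l. f (om, l) \<partial>\<kappa> om) \<partial>P)"
  proof (intro nn_integral_cong arg_cong2[where f="(*)"] refl)
   fix om assume om: "om \<in> space P"
   have "Pair om \<in> \<kappa> om \<rightarrow>\<^sub>M F \<Otimes>\<^sub>M N"
    using om sets\<kappa>[OF om] spF by (subst measurable_cong_sets[OF sets\<kappa>[OF om] refl]) simp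
   then show "(\<integral>\<^sup>+z. f z \<partial>?K om) = (\<integral>\<^sup>+l. f (om, l) \<partial>\<kappa> om)"
    by (rule nn_integral_distr) simp
  qed
  finally show ?thesis .
 qed
 have "?M = ?N"
 proof (rule measure_eqI_generator_eq[OF Int_stable_pair_measure_generator[of F N], where A="\<lambda>_. space F \<times> space N"])
  show "{a \<times> b |a b. a \<in> sets F \<and> b \<in> sets N} \<subseteq> Pow (space F \<times> space N)"
   using sets.space_closed[of F] sets.space_closed[of N] by auto
  show "sets ?M = sigma_sets (space F \<times> space N) {a \<times> b |a b. a \<in> sets F \<and> b \<in> sets N}"
   by (simp add: sets_pair_measure)
  show "sets ?N = sigma_sets (space F \<times> space N) {a \<times> b |a b. a \<in> sets F \<and> b \<in> sets N}"
   using setsN by (simp add: sets_pair_measure)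
  have *: "emeasure ?M (G \<times> D) = emeasure ?N (G \<times> D)" if [measurable]: "G \<in> sets F" "D \<in> sets N" for G D
  proof -
   have ind: "(indicator (G \<times> D) (om, l) :: ennreal) = indicator G om * indicator D l" for om l
    by (auto split: split_indicator)
   have "emeasure ?M (G \<times> D) = (\<integral>\<^sup>+z. indicator (G \<times> D) z \<partial>?M)" by (rule nn_integral_indicator[symmetric]) auto
   also have "\<dots> = (\<integral>\<^sup>+om. R om * (indicator G om * indicator D (U om)) \<partial>P)"
    by (subst M) (auto simp: ind)
   also have "\<dots> = (\<integral>\<^sup>+om. R' om * (indicator G om * emeasure (\<kappa> om) D) \<partial>P)" by (rule rect) fact+
   also have "\<dots> = (\<integral>\<^sup>+om. R' om * (\<integral>\<^sup>+l. indicator (G \<times> D) (om, l) \<partial>\<kappa> om) \<partial>P)"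
    by (intro nn_integral_cong) (simp add: ind nn_integral_cmult sets\<kappa> that)
   also have "\<dots> = (\<integral>\<^sup>+z. indicator (G \<times> D) z \<partial>?N)" by (rule N[symmetric]) simp
   also have "\<dots> = emeasure ?N (G \<times> D)" by (rule nn_integral_indicator) (simp add: setsN)
   finally show ?thesis .
  qed
  then show "\<And>X. X \<in> {a \<times> b |a b. a \<in> sets F \<and> b \<in> sets N} ==> emeasure ?M X = emeasure ?N X" by auto
  show "range (\<lambda>_. space F \<times> space N) \<subseteq> {a \<times> b |a b. a \<in> sets F \<and> b \<in> sets N}" by auto
  \<comment> \<open>The bound \<open>R \<le> 1\<close> makes the total mass finite, as uniqueness on
    a generator demands.\<close>
  have "emeasure ?M (space F \<times> space N) \<le> (\<integral>\<^sup>+om. 1 \<partial>P)"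
  proof -
   have "emeasure ?M (space F \<times> space N) = (\<integral>\<^sup>+z. indicator (space F \<times> space N) z \<partial>?M)"
    by (rule nn_integral_indicator[symmetric]) auto
   also have "\<dots> = (\<integral>\<^sup>+om. R om * indicator (space F \<times> space N) (om, U om) \<partial>P)" by (rule M) auto
   also have "\<dots> \<le> (\<integral>\<^sup>+om. 1 \<partial>P)"
    using R1 by (intro nn_integral_mono) (auto split: split_indicator)
   finally show ?thesis .
  qed
  then show "emeasure ?M (space F \<times> space N) \<noteq> \<infinity>" for i :: nat
   by (auto simp: P.emeasure_space_1 top_unique)
 qed auto
 from arg_cong[OF this, of "\<lambda>M. \<integral>\<^sup>+z. (case z of (om, l) => h om l) \<partial>M"] show ?thesis
  by (simp only: M[OF h] N[OF h] prod.case)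
qed

section \<open>The branching tree and the independence of generations\<close>

locale branching = motion \<Omega> F X Q
 for \<Omega> :: "'a measure" and F and X :: "real => 'a => real" and Q +
 fixes b d :: "real => real" and Pr :: "real => 'w measure" and L :: "nat list => 'w => 'a life"
 assumes HV: "HV b d"
  and V_integrable: "\<And>x. AE w in Q x. \<forall>t\<ge>0. set_integrable lborel {0..t} (\<lambda>s. b (X s w) - d (X s w))"
  and branching: "branching_markov_process \<Omega> X Q b Pr L"
begin

lemma b_nonneg: "0 \<le> b y" and d_nonneg: "0 \<le> d y"
 using HV by (auto simp: HV_def)

lemma b_measurable [measurable]: "b \<in> borel_measurable borel" and d_measurable [measurable]: "d \<in> borel_measurable borel"
 using HV by (auto simp: HV_def intro: borel_measurable_continuous_onI)

definition bmax :: real where "bmax = (SOME c. 0 < c \<and> (\<forall>y. b y \<le> c))"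

lemma bmax: "0 < bmax" "b y \<le> bmax"
 using someI_ex[of "\<lambda>c. 0 < c \<and> (\<forall>y. b y \<le> c)"] HV by (auto simp: HV_def bmax_def)

definition rate :: "(real => real) => 'a => real => ennreal" where
 "rate r w s = ennreal (r (Y s w))"

lemma measurable_rate [measurable (raw)]:
 assumes [measurable]: "r \<in> borel_measurable borel" "w \<in> N \<rightarrow>\<^sub>M \<Omega>" "s \<in> borel_measurable N"
 shows "(\<lambda>x. rate r (w x) (s x)) \<in> borel_measurable N"
 unfolding rate_def by measurable

lemma ring_age_eq: "ring_age X r w e = first_age (rate r w) e"
proof -
 have "(\<integral>\<^sup>+s\<in>{0..a}. ennreal (r (X s w)) \<partial>lborel) = clk (rate r w) a" for a
  unfolding clk_def rate_def by (intro nn_integral_cong) (auto simp: Y_eq split: split_indicator)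
 then show ?thesis by (simp add: ring_age_def first_age_def)
qed

lemma death_age_eq: "death_age X d l = first_age (rate d (fst l)) (fst (snd l))"
 and birth_age_eq: "birth_age X b k l = first_age (rate b (fst l)) (\<Sum>i\<le>k. snd (snd l) i)"
 by (auto simp: death_age_def birth_age_def ring_age_eq split: prod.split)

lemma birth_age_nonneg: "0 \<le> birth_age X b k l"
 by (simp add: birth_age_eq first_age_nonneg)

lemma measurable_death_age [measurable (raw)]:
 assumes [measurable]: "l \<in> N \<rightarrow>\<^sub>M life_space \<Omega>"
 shows "(\<lambda>x. death_age X d (l x)) \<in> borel_measurable N"
proof -
 have [measurable]: "l \<in> N \<rightarrow>\<^sub>M \<Omega> \<Otimes>\<^sub>M (borel \<Otimes>\<^sub>M (\<Pi>\<^sub>M k\<in>UNIV. borel))"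
  using assms by (simp add: life_space_def)
 show ?thesis unfolding death_age_eq by measurable
qed

lemma measurable_birth_age [measurable (raw)]:
 assumes [measurable]: "l \<in> N \<rightarrow>\<^sub>M life_space \<Omega>"
 shows "(\<lambda>x. birth_age X b k (l x)) \<in> borel_measurable N"
proof -
 have [measurable]: "l \<in> N \<rightarrow>\<^sub>M \<Omega> \<Otimes>\<^sub>M (borel \<Otimes>\<^sub>M (\<Pi>\<^sub>M k\<in>UNIV. borel))"
  using assms by (simp add: life_space_def)
 show ?thesis unfolding birth_age_eq by measurable
qed

lemma measurable_life_path [measurable (raw)]:
 assumes [measurable]: "l \<in> N \<rightarrow>\<^sub>M life_space \<Omega>"
 shows "(\<lambda>x. fst (l x)) \<in> N \<rightarrow>\<^sub>M \<Omega>"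
proof -
 have [measurable]: "l \<in> N \<rightarrow>\<^sub>M \<Omega> \<Otimes>\<^sub>M (borel \<Otimes>\<^sub>M (\<Pi>\<^sub>M k\<in>UNIV. borel))"
  using assms by (simp add: life_space_def)
 show ?thesis by measurable
qed

lemma life_law_kernel [measurable]: "life_law Q \<in> borel \<rightarrow>\<^sub>M subprob_algebra (life_space \<Omega>)"
proof -
 have "(\<lambda>y. Q y \<Otimes>\<^sub>M (unit_exp \<Otimes>\<^sub>M exp_seq)) \<in> borel \<rightarrow>\<^sub>M subprob_algebra (\<Omega> \<Otimes>\<^sub>M (unit_exp \<Otimes>\<^sub>M exp_seq))"
  by (intro measurable_pair_measure Q_subprob_algebra measurable_const)
    (auto simp: space_subprob_algebra intro!: prob_space_imp_subprob_space prob_space_unit_exp prob_space_exp_seq)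
 moreover have "sets (\<Omega> \<Otimes>\<^sub>M (unit_exp \<Otimes>\<^sub>M exp_seq)) = sets (life_space \<Omega>)"
  unfolding life_space_def by (intro sets_pair_measure_cong sets_exp_seq) auto
 ultimately show ?thesis
  unfolding life_law_def by (simp cong: subprob_algebra_cong)
qed

lemma sets_life_law [simp]: "sets (life_law Q y) = sets (life_space \<Omega>)"
 by (rule sets_kernel[OF life_law_kernel]) simp

lemma prob_space_life_law: "prob_space (life_law Q y)"
 unfolding life_law_def by (intro prob_space_pair prob_space_Q prob_space_unit_exp prob_space_exp_seq)

lemma nn_integral_life_law:
 assumes "f \<in> borel_measurable (life_space \<Omega>)"
 shows "(\<integral>\<^sup>+l. f l \<partial>life_law Q y) = (\<integral>\<^sup>+w. \<integral>\<^sup>+\<eta>. \<integral>\<^sup>+\<epsilon>. f (w, \<eta>, \<epsilon>) \<partial>exp_seq \<partial>unit_exp \<partial>Q y)"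
proof -
 interpret EE: prob_space "unit_exp \<Otimes>\<^sub>M exp_seq"
  by (intro prob_space_pair prob_space_unit_exp prob_space_exp_seq)
 have f[measurable]: "f \<in> borel_measurable (Q y \<Otimes>\<^sub>M (unit_exp \<Otimes>\<^sub>M exp_seq))"
  using assms unfolding measurable_cong_sets[OF sets_life_law[unfolded life_law_def] refl] .
 have "(\<integral>\<^sup>+l. f l \<partial>life_law Q y) = (\<integral>\<^sup>+w. \<integral>\<^sup>+z. f (w, z) \<partial>(unit_exp \<Otimes>\<^sub>M exp_seq) \<partial>Q y)"
  unfolding life_law_def by (rule EE.nn_integral_fst[symmetric, OF f])
 also have "\<dots> = (\<integral>\<^sup>+w. \<integral>\<^sup>+\<eta>. \<integral>\<^sup>+\<epsilon>. f (w, \<eta>, \<epsilon>) \<partial>exp_seq \<partial>unit_exp \<partial>Q y)"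
  by (intro nn_integral_cong sigma_finite_measure.nn_integral_fst[OF prob_space_imp_sigma_finite[OF prob_space_exp_seq], symmetric]) measurable
 finally show ?thesis .
qed

text \<open>The factor produced by one life: \<open>f\<close> for the individual itself and
  \<open>g\<close> for the whole subtree of each child. Cutting after \<open>K\<close> children
  keeps the product finite; the cut is removed in \<open>ext\<close>.\<close>

definition lifeprod :: "nat => (real => ennreal) => (real => real => ennreal) => real => 'a life => ennreal" where
 "lifeprod K f g t l =
   (if ereal t < death_age X d l then f (Y t (fst l)) else 1) *
   (\<Prod>k<K. if birth_age X b k l < death_age X d l \<and> birth_age X b k l \<le> ereal t
    then g (t - real_of_ereal (birth_age X b k l)) (Y (real_of_ereal (birth_age X b k l)) (fst l)) else 1)"

text \<open>The one-generation operator: its iterates, started from 1, are the product functionals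
  of trees of bounded depth.\<close>

definition phi :: "nat => (real => ennreal) => (real => real => ennreal) => real => real => ennreal" where
 "phi K f g t y = (\<integral>\<^sup>+l. lifeprod K f g t l \<partial>life_law Q y)"

lemma measurable_lifeprod [measurable (raw)]:
 assumes [measurable]: "f \<in> borel_measurable borel" "(\<lambda>(t, y). g t y) \<in> borel_measurable borel2"
  "t \<in> borel_measurable N" "l \<in> N \<rightarrow>\<^sub>M life_space \<Omega>"
 shows "(\<lambda>x. lifeprod K f g (t x) (l x)) \<in> borel_measurable N"
 unfolding lifeprod_def by measurable

lemma measurable_phi [measurable]:
 assumes [measurable]: "f \<in> borel_measurable borel" "(\<lambda>(t, y). g t y) \<in> borel_measurable borel2"
 shows "(\<lambda>(t, y). phi K f g t y) \<in> borel_measurable borel2"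
proof -
 have "(\<lambda>z. \<integral>\<^sup>+l. lifeprod K f g (fst z) l \<partial>life_law Q (snd z)) \<in> borel_measurable borel2"
  by (rule nn_integral_measurable_subprob_algebra2[where N="life_space \<Omega>"]) measurable
 then show ?thesis by (simp add: phi_def case_prod_beta)
qed

lemma lifeprod_le_1:
 assumes "\<And>y. f y \<le> 1" "\<And>t y. g t y \<le> 1"
 shows "lifeprod K f g t l \<le> 1"
proof -
 have "lifeprod K f g t l \<le> 1 * 1"
  unfolding lifeprod_def using assms by (intro mult_mono prod_le_1) auto
 then show ?thesis by simp
qed

lemma phi_le_1:
 assumes "\<And>y. f y \<le> 1" "\<And>t y. g t y \<le> 1"
 shows "phi K f g t y \<le> 1"
proof -
 have "phi K f g t y \<le> (\<integral>\<^sup>+l. 1 \<partial>life_law Q y)"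
  unfolding phi_def by (intro nn_integral_mono lifeprod_le_1 assms)
 then show ?thesis by (simp add: prob_space.emeasure_space_1[OF prob_space_life_law])
qed

lemma prob_space_Pr: "prob_space (Pr x)"
 and L_measurable [measurable]: "L u \<in> Pr x \<rightarrow>\<^sub>M life_space \<Omega>"
 using branching by (auto simp: branching_markov_process_def)

abbreviation tree :: "'w => 'a tree" where "tree om \<equiv> (\<lambda>u. L u om)"

abbreviation past :: "real => nat => 'w measure" where
 "past x n \<equiv> past_generations \<Omega> (space (Pr x)) L n"

lemma L_past: "length v < n ==> L v \<in> past x n \<rightarrow>\<^sub>M life_space \<Omega>"
proof -
 assume v: "length v < n"
 have "(\<lambda>om. \<lambda>v\<in>{v. length v < n}. L v om) \<in> space (Pr x) \<rightarrow> space (\<Pi>\<^sub>M v\<in>{v. length v < n}. life_space \<Omega>)"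
  using measurable_space[OF L_measurable] by (auto simp: space_PiM)
 from measurable_vimage_algebra1[OF this]
 have "(\<lambda>om. \<lambda>v\<in>{v. length v < n}. L v om) \<in> past x n \<rightarrow>\<^sub>M (\<Pi>\<^sub>M v\<in>{v. length v < n}. life_space \<Omega>)"
  by (simp add: past_generations_def)
 from measurable_compose[OF this measurable_component_singleton[of v]] v show ?thesis by simp
qed

lemma subalgebra_past: "subalgebra (Pr x) (past x n)"
proof -
 have "sets (past x n) \<subseteq> sets (Pr x)"
  unfolding past_generations_def by (rule sets_image_in_sets) (auto intro!: measurable_restrict)
 moreover have "space (past x n) = space (Pr x)" by (simp add: past_generations_def)
 ultimately show ?thesis by (simp add: subalgebra_def)
qed

text \<open>The birth data of a label are functions of the lives of its proper ancestors, whose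
  labels are shorter. Thus \<open>M\<close> can be taken as the past of a generation as well as the
  full space.\<close>

lemma tree_measurable:
 assumes "\<And>v. length v < length u ==> L v \<in> M \<rightarrow>\<^sub>M life_space \<Omega>"
 shows "Measurable.pred M (\<lambda>om. born X b d (tree om) u)"
  "(\<lambda>om. birth_time X b (tree om) u) \<in> borel_measurable M"
  "(\<lambda>om. birth_trait X b x (tree om) u) \<in> borel_measurable M"
proof -
 have "Measurable.pred M (\<lambda>om. born X b d (tree om) u) \<and> (\<lambda>om. birth_time X b (tree om) u) \<in> borel_measurable M
  \<and> (\<lambda>om. birth_trait X b x (tree om) u) \<in> borel_measurable M"
  using assms
 proof (induction u)
  case (Cons k u)
  have [measurable]: "L u \<in> M \<rightarrow>\<^sub>M life_space \<Omega>" using Cons.prems by simp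
  have [measurable]: "Measurable.pred M (\<lambda>om. born X b d (tree om) u)" "(\<lambda>om. birth_time X b (tree om) u) \<in> borel_measurable M"
   using Cons by auto
  have "(\<lambda>om. Y (real_of_ereal (birth_age X b k (L u om))) (fst (L u om))) \<in> borel_measurable M"
   by measurable
  then show ?case by (auto simp: Y_eq real_of_ereal_pos birth_age_nonneg)
 qed simp
 then show "Measurable.pred M (\<lambda>om. born X b d (tree om) u)"
  "(\<lambda>om. birth_time X b (tree om) u) \<in> borel_measurable M"
  "(\<lambda>om. birth_trait X b x (tree om) u) \<in> borel_measurable M"
  by auto
qed

text \<open>Independence is postulated for sets; here it is raised to functions that may also depend
  on the past, one label at a time. \<open>J'\<close> carries the labels still tested by sets and
  \<open>J\<close> those already tested by functions.\<close>

lemma generation_independent: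
 assumes J: "finite J" "J' \<inter> J = {}" "finite J'" "\<And>u. u \<in> J \<union> J' ==> length u = n"
  and D: "\<And>u. D u \<in> sets (life_space \<Omega>)"
  and h: "\<And>u. u \<in> J ==> (\<lambda>(om, l). h u om l) \<in> borel_measurable (past x n \<Otimes>\<^sub>M life_space \<Omega>)"
  and h1: "\<And>u om l. h u om l \<le> 1"
  and G: "G \<in> sets (past x n)"
 shows "(\<integral>\<^sup>+om. indicator G om * (\<Prod>u\<in>J'. indicator (D u) (L u om)) * (\<Prod>u\<in>J. h u om (L u om)) \<partial>Pr x) =
  (\<integral>\<^sup>+om. indicator G om * (\<Prod>u\<in>J'. emeasure (life_law Q (birth_trait X b x (tree om) u)) (D u)) *
    (\<Prod>u\<in>J. \<integral>\<^sup>+l. h u om l \<partial>life_law Q (birth_trait X b x (tree om) u)) \<partial>Pr x)"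
 using J D h G
proof (induction J arbitrary: J' D G rule: finite_induct)
 case empty
 have GP: "G \<in> sets (Pr x)" using empty subalgebra_past[of x n] by (auto simp: subalgebra_def)
 have "emeasure (Pr x) (G \<inter> {om \<in> space (Pr x). \<forall>u\<in>J'. L u om \<in> D u}) =
  (\<integral>\<^sup>+om\<in>G. (\<Prod>u\<in>J'. emeasure (life_law Q (birth_trait X b x (tree om) u)) (D u)) \<partial>Pr x)"
 proof -
  have "\<forall>u\<in>J'. length u = n \<and> D u \<in> sets (life_space \<Omega>)" using empty by auto
  with branching \<open>finite J'\<close> \<open>G \<in> sets (past x n)\<close> show ?thesis
   unfolding branching_markov_process_def by blast
 qed
 moreover have "emeasure (Pr x) (G \<inter> {om \<in> space (Pr x). \<forall>u\<in>J'. L u om \<in> D u}) =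
  (\<integral>\<^sup>+om. indicator G om * (\<Prod>u\<in>J'. indicator (D u) (L u om)) \<partial>Pr x)"
 proof (subst nn_integral_indicator[symmetric])
  have [measurable]: "{om \<in> space (Pr x). L u om \<in> D u} \<in> sets (Pr x)" for u
   using measurable_sets[OF L_measurable empty.prems(4)] by (simp add: vimage_def Int_def conj_commute)
  show "G \<inter> {om \<in> space (Pr x). \<forall>u\<in>J'. L u om \<in> D u} \<in> sets (Pr x)"
   using GP \<open>finite J'\<close> by (intro sets.Int sets.sets_Collect_finite_All) auto
  show "(\<integral>\<^sup>+om. indicator (G \<inter> {om \<in> space (Pr x). \<forall>u\<in>J'. L u om \<in> D u}) om \<partial>Pr x) =
   (\<integral>\<^sup>+om. indicator G om * (\<Prod>u\<in>J'. indicator (D u) (L u om)) \<partial>Pr x)"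
  proof (intro nn_integral_cong)
   fix om assume "om \<in> space (Pr x)"
   then show "indicator (G \<inter> {om \<in> space (Pr x). \<forall>u\<in>J'. L u om \<in> D u}) om =
    (indicator G om * (\<Prod>u\<in>J'. indicator (D u) (L u om)) :: ennreal)"
    using \<open>finite J'\<close> by (cases "\<forall>u\<in>J'. L u om \<in> D u") (auto split: split_indicator intro!: prod_zero)
  qed
 qed
 ultimately show ?case by (simp add: mult.commute)
next
 case (insert u0 J)
 have lu0: "length u0 = n" using insert.prems by simp
 have [measurable]: "G' \<in> sets (Pr x)" if "G' \<in> sets (past x n)" for G'
  using that subalgebra_past[of x n] by (auto simp: subalgebra_def)
 have tm[measurable]: "(\<lambda>om. birth_trait X b x (tree om) u) \<in> borel_measurable (past x n)" if "length u = n" for u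
  using that by (intro tree_measurable L_past) auto
 have tP: "(\<lambda>om. birth_trait X b x (tree om) u) \<in> borel_measurable (Pr x)" for u
  by (intro tree_measurable L_measurable)
 have idP: "(\<lambda>om. om) \<in> Pr x \<rightarrow>\<^sub>M past x n"
  by (rule measurable_from_subalg[OF subalgebra_past measurable_ident_sets[OF refl]])
 let ?\<kappa> = "\<lambda>u om. life_law Q (birth_trait X b x (tree om) u)"
 let ?R = "\<lambda>G J' D om. indicator G om * (\<Prod>u\<in>J'. indicator (D u) (L u om)) * (\<Prod>u\<in>J. h u om (L u om)) :: ennreal"
 let ?R' = "\<lambda>G J' D om. indicator G om * (\<Prod>u\<in>J'. emeasure (?\<kappa> u om) (D u)) * (\<Prod>u\<in>J. \<integral>\<^sup>+l. h u om l \<partial>?\<kappa> u om) :: ennreal"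
 have hm: "(\<lambda>om. h u om (L u om)) \<in> borel_measurable (Pr x)" if "u \<in> J" for u
  using measurable_compose[OF measurable_Pair[OF idP L_measurable] insert.prems(5), of u] that by simp
 have hm': "(\<lambda>om. \<integral>\<^sup>+l. h u om l \<partial>?\<kappa> u om) \<in> borel_measurable (Pr x)" if "u \<in> J" for u
 proof -
  have "(\<lambda>(om, l). h u om l) \<in> borel_measurable (past x n \<Otimes>\<^sub>M life_space \<Omega>)" using insert.prems(5) that by simp
  then have "(\<lambda>om. \<integral>\<^sup>+l. h u om l \<partial>?\<kappa> u om) \<in> borel_measurable (past x n)"
   by (rule nn_integral_measurable_subprob_algebra2)
     (rule measurable_compose[OF tm life_law_kernel], use insert.prems(3) that in auto)
  then show ?thesis by (rule measurable_from_subalg[OF subalgebra_past])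
 qed
 have "(\<integral>\<^sup>+om. ?R G J' D om * h u0 om (L u0 om) \<partial>Pr x) = (\<integral>\<^sup>+om. ?R' G J' D om * (\<integral>\<^sup>+l. h u0 om l \<partial>?\<kappa> u0 om) \<partial>Pr x)"
 proof (rule nn_integral_kernel_extend[OF prob_space_Pr subalgebra_past L_measurable])
  show "?\<kappa> u0 \<in> past x n \<rightarrow>\<^sub>M subprob_algebra (life_space \<Omega>)"
   by (rule measurable_compose[OF tm life_law_kernel]) (rule lu0)
  show "(\<lambda>(om, l). h u0 om l) \<in> borel_measurable (past x n \<Otimes>\<^sub>M life_space \<Omega>)" using insert.prems by simp
  show "?R G J' D \<in> borel_measurable (Pr x)"
  proof (intro borel_measurable_times_ennreal borel_measurable_prod_ennreal borel_measurable_indicator)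
   show "(\<lambda>om. indicator (D u) (L u om) :: ennreal) \<in> borel_measurable (Pr x)" for u
    by (rule measurable_compose[OF L_measurable borel_measurable_indicator[OF insert.prems(4)]])
  qed (use hm insert.prems in auto)
  show "?R' G J' D \<in> borel_measurable (Pr x)"
  proof (intro borel_measurable_times_ennreal borel_measurable_prod_ennreal borel_measurable_indicator)
   show "(\<lambda>om. emeasure (?\<kappa> u om) (D u)) \<in> borel_measurable (Pr x)" for u
    by (rule measurable_emeasure_kernel[OF measurable_compose[OF tP life_law_kernel] insert.prems(4)])
  qed (use hm' insert.prems in auto)
  show "?R G J' D om \<le> 1" for om
  proof -
   have "?R G J' D om \<le> 1 * 1 * 1"
    using h1 by (intro mult_mono prod_le_1) (auto split: split_indicator)
   then show ?thesis by simp
  qed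
  \<comment> \<open>The rectangle condition of the kernel extension is the induction hypothesis with
    \<open>u0\<close> moved to the set-tested labels, \<open>D'\<close> as its test set and
    \<open>G'\<close> absorbed into the past event.\<close>
  fix G' D' assume G': "G' \<in> sets (past x n)" and D': "D' \<in> sets (life_space \<Omega>)"
  have nu0: "u0 \<notin> J'" using insert.prems by auto
  have upd: "(\<Prod>u\<in>J'. F u ((D(u0 := D')) u)) = (\<Prod>u\<in>J'. F u (D u))" for F :: "_ => _ => ennreal"
   using nu0 by (intro prod.cong) auto
  have "(\<integral>\<^sup>+om. ?R (G \<inter> G') (insert u0 J') (D(u0 := D')) om \<partial>Pr x) =
   (\<integral>\<^sup>+om. ?R' (G \<inter> G') (insert u0 J') (D(u0 := D')) om \<partial>Pr x)"
   using insert.prems insert.hyps G' D' by (intro insert.IH) auto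
  moreover have "?R (G \<inter> G') (insert u0 J') (D(u0 := D')) om = ?R G J' D om * (indicator G' om * indicator D' (L u0 om))" for om
   using nu0 \<open>finite J'\<close> upd[of "\<lambda>u D. indicator D (L u om)"]
   by (simp add: indicator_inter_arith mult_ac del: fun_upd_apply) (simp add: mult_ac)
  moreover have "?R' (G \<inter> G') (insert u0 J') (D(u0 := D')) om = ?R' G J' D om * (indicator G' om * emeasure (?\<kappa> u0 om) D')" for om
   using nu0 \<open>finite J'\<close> upd[of "\<lambda>u D. emeasure (?\<kappa> u om) D"]
   by (simp add: indicator_inter_arith mult_ac del: fun_upd_apply) (simp add: mult_ac)
  ultimately show "(\<integral>\<^sup>+om. ?R G J' D om * (indicator G' om * indicator D' (L u0 om)) \<partial>Pr x) =
   (\<integral>\<^sup>+om. ?R' G J' D om * (indicator G' om * emeasure (?\<kappa> u0 om) D') \<partial>Pr x)"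
   by simp
 qed
 then show ?case using insert.hyps by (simp add: mult_ac)
qed

end

text \<open>The kernel extension with a one-point space in place of the new value, so that only the
  past variable remains.\<close>

lemma nn_integral_past_weight:
 assumes P: "prob_space P" and sub: "subalgebra P F"
  and R: "R \<in> borel_measurable P" "R' \<in> borel_measurable P" "\<And>om. R om \<le> (1::ennreal)"
  and eq: "\<And>G. G \<in> sets F ==> (\<integral>\<^sup>+om. indicator G om * R om \<partial>P) = (\<integral>\<^sup>+om. indicator G om * R' om \<partial>P)"
  and \<xi>: "\<xi> \<in> borel_measurable F"
 shows "(\<integral>\<^sup>+om. \<xi> om * R om \<partial>P) = (\<integral>\<^sup>+om. \<xi> om * R' om \<partial>P)"
proof -
 let ?N = "count_space (UNIV :: unit set)"
 have "(\<integral>\<^sup>+om. R om * \<xi> om \<partial>P) = (\<integral>\<^sup>+om. R' om * (\<integral>\<^sup>+l. \<xi> om \<partial>return ?N ()) \<partial>P)"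
 proof (rule nn_integral_kernel_extend[OF P sub, of "\<lambda>_. ()" ?N "\<lambda>_. return ?N ()"])
  fix G and D :: "unit set" assume "G \<in> sets F"
  then show "(\<integral>\<^sup>+om. R om * (indicator G om * indicator D ()) \<partial>P) = (\<integral>\<^sup>+om. R' om * (indicator G om * emeasure (return ?N ()) D) \<partial>P)"
   using eq[of G] by (cases "() \<in> D") (auto simp: mult.commute)
 qed (use R \<xi> in auto)
 then show ?thesis
  by (simp add: nn_integral_const emeasure_return mult.commute)
qed

lemma tendsto_prod_ennreal:
 fixes g :: "nat => 'i => ennreal"
 assumes "finite I" "\<And>i. i \<in> I ==> (\<lambda>n. g n i) \<longlonglongrightarrow> G i" "\<And>i. i \<in> I ==> G i < \<top>"
 shows "(\<lambda>n. \<Prod>i\<in>I. g n i) \<longlonglongrightarrow> (\<Prod>i\<in>I. G i)"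
 using assms
proof (induction I rule: finite_induct)
 case (insert i I)
 have "(\<Prod>i\<in>I. G i) < \<top>" using insert by (auto simp: less_top[symmetric] ennreal_prod_eq_top)
 then have "(\<lambda>n. g n i * (\<Prod>i\<in>I. g n i)) \<longlonglongrightarrow> G i * (\<Prod>i\<in>I. G i)"
  using insert by (intro tendsto_mult_ennreal) (auto simp: less_top)
 then show ?case using insert by simp
qed simp

lemma prod_mono_ennreal:
 fixes f g :: "'i => ennreal"
 shows "(\<And>i. i \<in> A ==> f i \<le> g i) ==> prod f A \<le> prod g A"
 by (induction A rule: infinite_finite_induct) (auto intro!: mult_mono)

section \<open>Recursion over the generations of the truncated tree\<close>

context branching
begin

definition present :: "real => nat list => 'w => bool" where
 "present t u om \<longleftrightarrow> born X b d (tree om) u \<and> birth_time X b (tree om) u \<le> ereal t"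

definition age :: "real => nat list => 'w => real" where
 "age t u om = t - real_of_ereal (birth_time X b (tree om) u)"

text \<open>The neutral value 1 for labels not alive turns a product over any finite set of labels
  into the product over the living ones. \<open>subtree\<close> below uses the same convention for
  labels not yet born.\<close>

definition leaf :: "(real => ennreal) => real => nat list => 'w => ennreal" where
 "leaf f t u om = (if u \<in> alive X b d (tree om) t then f (trait_at X b (tree om) t u) else 1)"

definition subtree :: "(real => real => ennreal) => real => real => nat list => 'w => ennreal" where
 "subtree g x t u om = (if present t u om then g (age t u om) (birth_trait X b x (tree om) u) else 1)"

lemma birth_time_nonneg: "0 \<le> birth_time X b T u"
 by (induction u) (auto simp: birth_age_nonneg)

lemma present_finite:
 assumes "present t u om"
 obtains \<tau> where "birth_time X b (tree om) u = ereal \<tau>" "0 \<le> \<tau>" "\<tau> \<le> t" "age t u om = t - \<tau>"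
 using assms birth_time_nonneg[of "tree om" u]
 by (cases "birth_time X b (tree om) u") (auto simp: present_def age_def)

text \<open>With time counted from the birth of \<open>u\<close>, the individual and the subtrees of
  its children are determined by its life alone. If \<open>u\<close> has not been born by time
  \<open>t\<close>, neither have its children, and every factor is 1.\<close>

lemma leaf_subtree:
 "leaf f t u om * (\<Prod>k<K. subtree g x t (k # u) om) =
  (if present t u om then lifeprod K f g (age t u om) (L u om) else 1)"
proof (cases "present t u om")
 case True
 then obtain \<tau> where \<tau>: "birth_time X b (tree om) u = ereal \<tau>" "0 \<le> \<tau>" "\<tau> \<le> t" "age t u om = t - \<tau>"
  by (rule present_finite)
 have born: "born X b d (tree om) u" using True by (simp add: present_def)
 have al: "u \<in> alive X b d (tree om) t \<longleftrightarrow> ereal (t - \<tau>) < death_age X d (L u om)"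
  using born \<tau> by (cases "death_age X d (L u om)") (auto simp: alive_def)
 have tr: "trait_at X b (tree om) t u = Y (t - \<tau>) (fst (L u om))"
  using \<tau> by (simp add: trait_at_def Y_eq)
 have sub: "subtree g x t (k # u) om =
  (if birth_age X b k (L u om) < death_age X d (L u om) \<and> birth_age X b k (L u om) \<le> ereal (t - \<tau>)
   then g (t - \<tau> - real_of_ereal (birth_age X b k (L u om))) (Y (real_of_ereal (birth_age X b k (L u om))) (fst (L u om))) else 1)" for k
  using born \<tau> birth_age_nonneg[of k "L u om"]
  by (cases "birth_age X b k (L u om)")
    (auto simp: subtree_def present_def age_def Y_eq algebra_simps)
 show ?thesis
  using True \<tau> by (simp add: leaf_def al tr sub lifeprod_def)
next
 case False
 have "\<not> present t (k # u) om" for k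
 proof
  assume "present t (k # u) om"
  then have "born X b d (tree om) u" "birth_time X b (tree om) u + birth_age X b k (L u om) \<le> ereal t"
   by (auto simp: present_def)
  moreover have "birth_time X b (tree om) u + 0 \<le> birth_time X b (tree om) u + birth_age X b k (L u om)"
   by (intro add_left_mono birth_age_nonneg)
  ultimately show False using False by (auto simp: present_def)
 qed
 moreover have "u \<notin> alive X b d (tree om) t" using False by (auto simp: alive_def present_def)
 ultimately show ?thesis using False by (simp add: leaf_def subtree_def)
qed

lemma
 assumes "\<And>v. length v < length u ==> L v \<in> M \<rightarrow>\<^sub>M life_space \<Omega>"
 shows measurable_present: "Measurable.pred M (present t u)"
  and measurable_age: "age t u \<in> borel_measurable M"
proof -
 note [measurable] = tree_measurable(1,2)[OF assms]
 show "Measurable.pred M (present t u)" unfolding present_def by measurable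
 show "age t u \<in> borel_measurable M" unfolding age_def by measurable
qed

lemma measurable_subtree:
 assumes L: "\<And>v. length v < length u ==> L v \<in> M \<rightarrow>\<^sub>M life_space \<Omega>"
  and g[measurable]: "(\<lambda>(t, y). g t y) \<in> borel_measurable borel2"
 shows "subtree g x t u \<in> borel_measurable M"
proof -
 note [measurable] = tree_measurable(3)[OF L] measurable_present[OF L] measurable_age[OF L]
 show ?thesis unfolding subtree_def by measurable
qed

lemma measurable_leaf:
 assumes L: "\<And>v. length v \<le> length u ==> L v \<in> M \<rightarrow>\<^sub>M life_space \<Omega>"
  and [measurable]: "f \<in> borel_measurable borel"
 shows "leaf f t u \<in> borel_measurable M"
proof -
 note [measurable] = measurable_present[where u=u, OF L] measurable_age[where u=u, OF L]
 have [measurable]: "L u \<in> M \<rightarrow>\<^sub>M life_space \<Omega>" by (rule L) simp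
 have "leaf f t u = (\<lambda>om. if present t u om then lifeprod 0 f (\<lambda>_ _. 1) (age t u om) (L u om) else 1)"
  using leaf_subtree[where f=f and t=t and u=u and K=0] by (auto simp: fun_eq_iff)
 also have "\<dots> \<in> borel_measurable M" by measurable
 finally show ?thesis .
qed

lemma leaf_le_1: "(\<And>y. f y \<le> 1) ==> leaf f t u om \<le> 1"
 by (simp add: leaf_def)

text \<open>Given the past, the lives of generation \<open>n\<close> are integrated out
  independently; each one contributes the average \<open>phi\<close> started at its trait of birth
  and run for its age.\<close>

lemma generation_step:
 assumes J: "finite J" "\<And>u. u \<in> J ==> length u = n" and \<xi>: "\<xi> \<in> borel_measurable (past x n)"
  and [measurable]: "f \<in> borel_measurable borel" "(\<lambda>(t, y). g t y) \<in> borel_measurable borel2"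
  and f1: "\<And>y. f y \<le> 1" and g1: "\<And>t y. g t y \<le> 1"
 shows "(\<integral>\<^sup>+om. \<xi> om * (\<Prod>u\<in>J. if present t u om then lifeprod K f g (age t u om) (L u om) else 1) \<partial>Pr x) =
  (\<integral>\<^sup>+om. \<xi> om * (\<Prod>u\<in>J. subtree (phi K f g) x t u om) \<partial>Pr x)"
proof -
 let ?h = "\<lambda>u om l. if present t u om then lifeprod K f g (age t u om) l else 1"
 have sub: "(\<integral>\<^sup>+l. ?h u om l \<partial>life_law Q (birth_trait X b x (tree om) u)) = subtree (phi K f g) x t u om" for u om
  by (simp add: subtree_def phi_def prob_space.emeasure_space_1[OF prob_space_life_law])
 show ?thesis
 proof (rule nn_integral_past_weight[OF prob_space_Pr subalgebra_past])
  show "(\<lambda>om. \<Prod>u\<in>J. ?h u om (L u om)) \<in> borel_measurable (Pr x)"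
  proof (intro borel_measurable_prod_ennreal)
   fix u
   note [measurable] = measurable_present[where u=u, OF L_measurable] measurable_age[where u=u, OF L_measurable]
   show "(\<lambda>om. ?h u om (L u om)) \<in> borel_measurable (Pr x)" by measurable
  qed
  show "(\<lambda>om. \<Prod>u\<in>J. subtree (phi K f g) x t u om) \<in> borel_measurable (Pr x)"
   by (intro borel_measurable_prod_ennreal measurable_subtree L_measurable) measurable
  show "(\<Prod>u\<in>J. ?h u om (L u om)) \<le> 1" for om
   using lifeprod_le_1[OF f1 g1] by (intro prod_le_1) auto
  fix G assume G: "G \<in> sets (past x n)"
  have "(\<integral>\<^sup>+om. indicator G om * (\<Prod>u\<in>{}. indicator (space (life_space \<Omega>)) (L u om)) * (\<Prod>u\<in>J. ?h u om (L u om)) \<partial>Pr x) =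
   (\<integral>\<^sup>+om. indicator G om * (\<Prod>u\<in>{}. emeasure (life_law Q (birth_trait X b x (tree om) u)) (space (life_space \<Omega>))) *
    (\<Prod>u\<in>J. \<integral>\<^sup>+l. ?h u om l \<partial>life_law Q (birth_trait X b x (tree om) u)) \<partial>Pr x)"
  proof (rule generation_independent[where n=n])
   fix u assume "u \<in> J"
   then have u: "length u = n" using J by simp
   have [measurable]: "Measurable.pred (past x n) (present t u)" "age t u \<in> borel_measurable (past x n)"
    using u by (auto intro!: measurable_present measurable_age L_past)
   show "(\<lambda>(om, l). ?h u om l) \<in> borel_measurable (past x n \<Otimes>\<^sub>M life_space \<Omega>)"
    by measurable
  qed (use J G lifeprod_le_1[OF f1 g1] in auto)
  then show "(\<integral>\<^sup>+om. indicator G om * (\<Prod>u\<in>J. ?h u om (L u om)) \<partial>Pr x) =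
   (\<integral>\<^sup>+om. indicator G om * (\<Prod>u\<in>J. subtree (phi K f g) x t u om) \<partial>Pr x)"
   by (simp add: sub)
 qed (rule \<xi>)
qed

definition labels :: "nat => nat => nat list set" where
 "labels K n = {u. length u = n \<and> set u \<subseteq> {..<K}}"

definition labels_below :: "nat => nat => nat list set" where
 "labels_below K n = {u. length u < n \<and> set u \<subseteq> {..<K}}"

lemma finite_labels: "finite (labels K n)"
 unfolding labels_def using finite_lists_length_eq[of "{..<K}" n] by (simp add: conj_commute)

lemma labels_below_Suc: "labels_below K (Suc n) = labels_below K n \<union> labels K n"
 by (auto simp: labels_below_def labels_def)

lemma finite_labels_below: "finite (labels_below K n)"
 by (induction n) (auto simp: labels_below_Suc finite_labels, simp add: labels_below_def)

lemma labels_Suc: "labels K (Suc n) = (\<lambda>(u, k). k # u) ` (labels K n \<times> {..<K})"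
proof (intro set_eqI iffI)
 fix v assume "v \<in> labels K (Suc n)"
 then obtain k u where "v = k # u" "u \<in> labels K n" "k < K"
  by (cases v) (auto simp: labels_def)
 then show "v \<in> (\<lambda>(u, k). k # u) ` (labels K n \<times> {..<K})" by force
qed (auto simp: labels_def)

text \<open>The deepest generation is peeled off: \<open>leaf_subtree\<close> gathers each of its
  members with the subtrees below, and \<open>generation_step\<close> averages over its lives, which
  replaces \<open>g\<close> by \<open>phi K f g\<close> one level higher.\<close>

lemma generation_recursion:
 assumes [measurable]: "f \<in> borel_measurable borel" and f1: "\<And>y. f y \<le> 1"
  and g: "(\<lambda>(t, y). g t y) \<in> borel_measurable borel2" "\<And>t y. g t y \<le> 1"
  and t: "0 \<le> t"
 shows "(\<integral>\<^sup>+om. (\<Prod>u\<in>labels_below K n. leaf f t u om) * (\<Prod>u\<in>labels K n. subtree g x t u om) \<partial>Pr x) =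
  (phi K f ^^ n) g t x"
 using g
proof (induction n arbitrary: g)
 case 0
 have "labels_below K 0 = {}" "labels K 0 = {[]}" by (auto simp: labels_below_def labels_def)
 then show ?case
  using t by (simp add: subtree_def present_def age_def prob_space.emeasure_space_1[OF prob_space_Pr])
next
 case (Suc n)
 note [measurable] = Suc.prems(1)
 have disj: "labels_below K n \<inter> labels K n = {}" by (auto simp: labels_below_def labels_def)
 have inj: "inj_on (\<lambda>(u, k). k # u) (labels K n \<times> {..<K})" by (auto simp: inj_on_def)
 have "(\<Prod>u\<in>labels_below K (Suc n). leaf f t u om) * (\<Prod>u\<in>labels K (Suc n). subtree g x t u om) =
  (\<Prod>u\<in>labels_below K n. leaf f t u om) * (\<Prod>u\<in>labels K n. if present t u om then lifeprod K f g (age t u om) (L u om) else 1)" for om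
 proof -
  have "(\<Prod>u\<in>labels K (Suc n). subtree g x t u om) = (\<Prod>u\<in>labels K n. \<Prod>k<K. subtree g x t (k # u) om)"
   unfolding labels_Suc prod.reindex[OF inj] prod.cartesian_product by (intro prod.cong) auto
  moreover have "(\<Prod>u\<in>labels_below K (Suc n). leaf f t u om) = (\<Prod>u\<in>labels_below K n. leaf f t u om) * (\<Prod>u\<in>labels K n. leaf f t u om)"
   by (simp add: labels_below_Suc prod.union_disjoint finite_labels finite_labels_below disj)
  ultimately show ?thesis
   by (simp add: mult.assoc prod.distrib[symmetric] leaf_subtree)
 qed
 then have "(\<integral>\<^sup>+om. (\<Prod>u\<in>labels_below K (Suc n). leaf f t u om) * (\<Prod>u\<in>labels K (Suc n). subtree g x t u om) \<partial>Pr x) =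
  (\<integral>\<^sup>+om. (\<Prod>u\<in>labels_below K n. leaf f t u om) * (\<Prod>u\<in>labels K n. if present t u om then lifeprod K f g (age t u om) (L u om) else 1) \<partial>Pr x)"
  by simp
 also have "\<dots> = (\<integral>\<^sup>+om. (\<Prod>u\<in>labels_below K n. leaf f t u om) * (\<Prod>u\<in>labels K n. subtree (phi K f g) x t u om) \<partial>Pr x)"
 proof (rule generation_step[where n=n])
  show "(\<lambda>om. \<Prod>u\<in>labels_below K n. leaf f t u om) \<in> borel_measurable (past x n)"
   by (intro borel_measurable_prod_ennreal measurable_leaf L_past) (auto simp: labels_below_def)
 qed (use Suc.prems f1 finite_labels in \<open>auto simp: labels_def\<close>)
 also have "\<dots> = (phi K f ^^ n) (phi K f g) t x"
  using Suc.prems f1 by (intro Suc.IH measurable_phi phi_le_1) auto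
 also have "\<dots> = (phi K f ^^ Suc n) g t x" by (simp only: funpow_Suc_right comp_def)
 finally show ?case .
qed

definition gen :: "(real => ennreal) => nat => nat => real => real => ennreal" where
 "gen f K n = (phi K f ^^ n) (\<lambda>_ _. 1)"

lemma gen_Suc: "gen f K (Suc n) = phi K f (gen f K n)"
 by (simp add: gen_def)

lemma gen_eq:
 assumes [measurable]: "f \<in> borel_measurable borel" and f1: "\<And>y. f y \<le> 1" and t: "0 \<le> t"
 shows "(\<integral>\<^sup>+om. (\<Prod>u\<in>labels_below K n. leaf f t u om) \<partial>Pr x) = gen f K n t x"
 using generation_recursion[where f=f and g="\<lambda>_ _. 1" and t=t and K=K and n=n and x=x] assms by (simp add: gen_def subtree_def)

lemma measurable_gen [measurable]:
 assumes [measurable]: "f \<in> borel_measurable borel"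
 shows "(\<lambda>(t, y). gen f K n t y) \<in> borel_measurable borel2"
 by (induction n) (simp add: gen_def, unfold gen_Suc, rule measurable_phi, auto)

lemma gen_le_1:
 assumes "\<And>y. f y \<le> 1"
 shows "gen f K n t y \<le> 1"
proof (induction n arbitrary: t y)
 case (Suc n)
 then show ?case unfolding gen_Suc using assms by (intro phi_le_1)
qed (simp add: gen_def)

lemma lifeprod_mono:
 assumes "\<And>t y. g t y \<le> g' t y" "\<And>t y. g t y \<le> 1" "K' \<le> K"
 shows "lifeprod K f g t l \<le> lifeprod K' f g' t l"
proof -
 let ?p = "\<lambda>g k. if birth_age X b k l < death_age X d l \<and> birth_age X b k l \<le> ereal t
    then g (t - real_of_ereal (birth_age X b k l)) (Y (real_of_ereal (birth_age X b k l)) (fst l)) else 1 :: ennreal"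
 have "(\<Prod>k<K. ?p g k) = (\<Prod>k<K'. ?p g k) * (\<Prod>k\<in>{K'..<K}. ?p g k)"
  using \<open>K' \<le> K\<close> by (subst prod.union_disjoint[symmetric]) (auto intro!: prod.cong)
 also have "\<dots> \<le> (\<Prod>k<K'. ?p g' k) * 1"
 proof (rule mult_mono)
  show "(\<Prod>k<K'. ?p g k) \<le> (\<Prod>k<K'. ?p g' k)" by (rule prod_mono_ennreal) (use assms in auto)
  show "(\<Prod>k\<in>{K'..<K}. ?p g k) \<le> 1" by (rule prod_le_1) (use assms in auto)
 qed auto
 finally show ?thesis unfolding lifeprod_def by (intro mult_left_mono) auto
qed

lemma phi_mono:
 assumes "\<And>t y. g t y \<le> g' t y" "\<And>t y. g t y \<le> 1" "K' \<le> K"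
 shows "phi K f g t y \<le> phi K' f g' t y"
 unfolding phi_def using assms by (intro nn_integral_mono lifeprod_mono)

lemma gen_antimono_n:
 assumes f1: "\<And>y. f y \<le> 1" shows "n \<le> m ==> gen f K m t y \<le> gen f K n t y"
proof -
 have "gen f K (Suc n) t y \<le> gen f K n t y" for n t y
 proof (induction n arbitrary: t y)
  case 0 then show ?case using gen_le_1[of f K "Suc 0" t y, OF f1] by (simp add: gen_def)
 next
  case (Suc n)
  show ?case unfolding gen_Suc[of f K "Suc n"] gen_Suc[of f K n]
   by (intro phi_mono Suc[unfolded gen_Suc] phi_le_1 gen_le_1 f1 order_refl)
 qed
 then show "n \<le> m ==> gen f K m t y \<le> gen f K n t y"
  using lift_Suc_antimono_le[of "\<lambda>n. gen f K n t y"] by auto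
qed

lemma gen_antimono_K:
 assumes f1: "\<And>y. f y \<le> 1" shows "K' \<le> K ==> gen f K n t y \<le> gen f K' n t y"
proof (induction n arbitrary: t y)
 case (Suc n)
 then show ?case using gen_le_1[OF f1] unfolding gen_Suc by (intro phi_mono) auto
qed (simp add: gen_def)

definition genK :: "(real => ennreal) => nat => real => real => ennreal" where
 "genK f K t y = (INF n. gen f K n t y)"

text \<open>The depth goes to infinity first, so that for each \<open>K\<close> a fixed point
  equation is available (\<open>genK_fixed\<close>), in which the limit in \<open>K\<close> can then
  be taken. The identification with an expectation over the full tree is
  \<open>ext_tree\<close>.\<close>

definition ext :: "(real => ennreal) => real => real => ennreal" where
 "ext f t y = (INF K. genK f K t y)"

lemma measurable_genK [measurable]:
 assumes [measurable]: "f \<in> borel_measurable borel"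
 shows "(\<lambda>(t, y). genK f K t y) \<in> borel_measurable borel2"
 unfolding genK_def by measurable

lemma measurable_ext [measurable]:
 assumes [measurable]: "f \<in> borel_measurable borel"
 shows "(\<lambda>(t, y). ext f t y) \<in> borel_measurable borel2"
 unfolding ext_def by measurable

lemma genK_le_1: "(\<And>y. f y \<le> 1) ==> genK f K t y \<le> 1"
 unfolding genK_def by (rule INF_lower2[of 0]) (auto intro: gen_le_1)

lemma ext_le_1: "(\<And>y. f y \<le> 1) ==> ext f t y \<le> 1"
 unfolding ext_def by (rule INF_lower2[of 0]) (auto intro: genK_le_1)

lemma genK_antimono: "(\<And>y. f y \<le> 1) ==> K' \<le> K ==> genK f K t y \<le> genK f K' t y"
 unfolding genK_def by (intro INF_mono) (auto intro: gen_antimono_K)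

lemma tendsto_genK:
 assumes "\<And>y. f y \<le> 1" shows "(\<lambda>n. gen f K n t y) \<longlonglongrightarrow> genK f K t y"
 unfolding genK_def using assms by (intro LIMSEQ_INF) (auto simp: decseq_def intro: gen_antimono_n)

lemma tendsto_ext:
 assumes "\<And>y. f y \<le> 1" shows "(\<lambda>K. genK f K t y) \<longlonglongrightarrow> ext f t y"
 unfolding ext_def using assms by (intro LIMSEQ_INF) (auto simp: decseq_def intro: genK_antimono)

lemma genK_fixed:
 assumes [measurable]: "f \<in> borel_measurable borel" and f1: "\<And>y. f y \<le> 1"
 shows "genK f K t y = phi K f (genK f K) t y"
proof (rule LIMSEQ_unique)
 show "(\<lambda>n. gen f K (Suc n) t y) \<longlonglongrightarrow> genK f K t y"
  using tendsto_genK[OF f1] by (rule LIMSEQ_Suc)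
 show "(\<lambda>n. gen f K (Suc n) t y) \<longlonglongrightarrow> phi K f (genK f K) t y"
  unfolding gen_Suc phi_def
 proof (rule nn_integral_dominated_convergence[where w="\<lambda>_. 1"])
  show "AE l in life_law Q y. lifeprod K f (gen f K n) t l \<le> 1" for n
   using f1 by (intro AE_I2 lifeprod_le_1 gen_le_1)
  show "(\<integral>\<^sup>+l. 1 \<partial>life_law Q y) < \<infinity>"
   by (simp add: prob_space.emeasure_space_1[OF prob_space_life_law])
  show "AE l in life_law Q y. (\<lambda>n. lifeprod K f (gen f K n) t l) \<longlonglongrightarrow> lifeprod K f (genK f K) t l"
  proof (rule AE_I2)
   fix l
   have c: "(if ereal t < death_age X d l then f (Y t (fst l)) else 1) < \<top>"
    by (auto intro: le_less_trans[OF f1])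
   show "(\<lambda>n. lifeprod K f (gen f K n) t l) \<longlonglongrightarrow> lifeprod K f (genK f K) t l"
    unfolding lifeprod_def
   proof (intro ennreal_tendsto_cmult c tendsto_prod_ennreal)
    fix k
    show "(if birth_age X b k l < death_age X d l \<and> birth_age X b k l \<le> ereal t
     then genK f K (t - real_of_ereal (birth_age X b k l)) (Y (real_of_ereal (birth_age X b k l)) (fst l)) else 1) < \<top>"
     by (auto intro: le_less_trans[OF genK_le_1[OF f1]])
   qed (auto intro: tendsto_genK f1)
  qed
 qed (measurable, auto simp: sets_life_law cong: measurable_cong_sets)
qed

end

section \<open>Product functionals along the path of the ancestor\<close>

lemma unit_exp_tail: "0 \<le> a ==> (\<integral>\<^sup>+\<eta>. (if a < \<eta> then 1 else 0) \<partial>unit_exp) = expm (ennreal a)"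
proof -
 assume a: "0 \<le> a"
 have "(\<integral>\<^sup>+\<eta>. (if a < \<eta> then 1 else 0) \<partial>unit_exp) = (\<integral>\<^sup>+\<eta>\<in>{0..}. (if a < \<eta> then 1 else 0) * expm (ennreal \<eta>) \<partial>lborel)"
  by (rule nn_integral_unit_exp) measurable
 also have "\<dots> = (\<integral>\<^sup>+\<eta>. ennreal (exp (- \<eta>)) * indicator {a..} \<eta> \<partial>lborel)"
 proof (rule nn_integral_cong_AE)
  have "AE \<eta> in lborel. \<eta> \<noteq> a" by (rule AE_lborel_singleton)
  then show "AE \<eta> in lborel. (if a < \<eta> then 1 else 0) * expm (ennreal \<eta>) * indicator {0..} \<eta> = ennreal (exp (- \<eta>)) * indicator {a..} \<eta>"
   by eventually_elim (use a in \<open>auto simp: expm_ennreal split: split_indicator\<close>)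
 qed
 also have "\<dots> = ennreal (0 - (- exp (- a)))"
 proof (rule nn_integral_FTC_atLeast)
  show "((\<lambda>x::real. - exp (- x)) \<longlongrightarrow> 0) at_top"
   using tendsto_minus[OF filterlim_compose[OF exp_at_bot filterlim_uminus_at_bot_at_top]] by simp
 qed (auto intro!: derivative_eq_intros)
 finally show ?thesis using a by (simp add: expm_ennreal)
qed

context branching
begin

lemma clk_rate_b:
 assumes "0 \<le> t"
 shows "clk (rate b w) t \<le> ennreal (bmax * t)"
proof -
 have "clk (rate b w) t \<le> (\<integral>\<^sup>+s. ennreal bmax * indicator {0..t} s \<partial>lborel)"
  unfolding clk_def rate_def using bmax by (intro nn_integral_mono) (auto split: split_indicator intro: ennreal_leI)
 also have "\<dots> = ennreal (bmax * t)"
  using assms bmax by (simp add: nn_integral_cmult ennreal_mult)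
 finally show ?thesis .
qed

lemma clk_rate_b_fin: "clk (rate b w) t < \<top>"
proof -
 have "clk (rate b w) t \<le> clk (rate b w) (max 0 t)" by (rule clk_mono) simp
 also have "\<dots> \<le> ennreal (bmax * max 0 t)" by (rule clk_rate_b) simp
 also have "\<dots> < \<top>" by simp
 finally show ?thesis .
qed

text \<open>Only the difference \<open>b - d\<close> is assumed integrable along paths, but
  \<open>d\<close> is at most its absolute value plus \<open>bmax\<close>.\<close>

lemma AE_clk_rate_d: "AE w in Q y. \<forall>t. clk (rate d w) t < \<top>"
 using V_integrable[of y]
proof (eventually_elim, intro allI)
 fix w and t :: real assume int: "\<forall>t\<ge>0. set_integrable lborel {0..t} (\<lambda>s. b (X s w) - d (X s w))"
 let ?t = "max 0 t"
 have "set_integrable lborel {0..?t} (\<lambda>s. b (X s w) - d (X s w))" using int by simp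
 then have fin: "(\<integral>\<^sup>+s. ennreal (norm (indicator {0..?t} s *\<^sub>R (b (X s w) - d (X s w)))) \<partial>lborel) < \<infinity>"
  and m: "(\<lambda>s. indicator {0..?t} s *\<^sub>R (b (X s w) - d (X s w))) \<in> borel_measurable lborel"
  unfolding set_integrable_def integrable_iff_bounded by auto
 have "clk (rate d w) ?t \<le> (\<integral>\<^sup>+s. ennreal (norm (indicator {0..?t} s *\<^sub>R (b (X s w) - d (X s w)))) + ennreal bmax * indicator {0..?t} s \<partial>lborel)"
  unfolding clk_def rate_def
 proof (intro nn_integral_mono)
  fix s :: real
  have "d (X s w) \<le> \<bar>b (X s w) - d (X s w)\<bar> + bmax" using bmax(2)[of "X s w"] by linarith
  then have "ennreal (d (X s w)) \<le> ennreal \<bar>b (X s w) - d (X s w)\<bar> + ennreal bmax"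
   using bmax by (simp flip: ennreal_plus add: ennreal_leI)
  then show "ennreal (d (Y s w)) * indicator {0..?t} s \<le>
   ennreal (norm (indicator {0..?t} s *\<^sub>R (b (X s w) - d (X s w)))) + ennreal bmax * indicator {0..?t} s"
   by (auto split: split_indicator simp: Y_eq)
 qed
 also have "\<dots> = (\<integral>\<^sup>+s. ennreal (norm (indicator {0..?t} s *\<^sub>R (b (X s w) - d (X s w)))) \<partial>lborel) + (\<integral>\<^sup>+s. ennreal bmax * indicator {0..?t} s \<partial>lborel)"
  using m by (intro nn_integral_add) auto
 also have "\<dots> < \<top>" using fin by (simp add: nn_integral_cmult ennreal_mult_less_top)
 finally show "clk (rate d w) t < \<top>"
  using clk_mono[of t ?t "rate d w"] by (auto intro: le_less_trans)
qed

text \<open>Parametrised by the internal time \<open>e\<close>, in which births form a unit-rate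
  Poisson process: a birth at internal time \<open>e\<close> contributes the factor
  \<open>1 - thin\<close>. Births after death or after the horizon \<open>t\<close> contribute
  1.\<close>

definition thin :: "(real => real => ennreal) => real => 'a => real => real => ennreal" where
 "thin h t w \<eta> e =
   (let a = first_age (rate b w) e in
   if a < first_age (rate d w) \<eta> \<and> a \<le> ereal t then 1 - h (t - real_of_ereal a) (Y (real_of_ereal a) w) else 0)"

lemma measurable_thin [measurable (raw)]:
 assumes [measurable]: "(\<lambda>(t, y). h t y) \<in> borel_measurable borel2" "w \<in> N \<rightarrow>\<^sub>M \<Omega>" "\<eta> \<in> borel_measurable N" "e \<in> borel_measurable N"
 shows "(\<lambda>x. thin h t (w x) (\<eta> x) (e x)) \<in> borel_measurable N"
 unfolding thin_def Let_def by measurable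

lemma thin_le_1: "thin h t w \<eta> e \<le> 1"
 by (simp add: thin_def Let_def diff_le_self_ennreal)

lemma lifeprod_thin:
 assumes "\<And>t y. h t y \<le> 1"
 shows "lifeprod K f h t (w, \<eta>, \<epsilon>) = (if ereal t < first_age (rate d w) \<eta> then f (Y t w) else 1) *
  (\<Prod>k<K. 1 - thin h t w \<eta> (\<Sum>i\<le>k. \<epsilon> i))"
proof -
 have "1 - (1 - h s z) = h s z" for s z
  using assms[of s z] by (cases "h s z") (auto simp: ennreal_minus top_unique simp flip: ennreal_1)
 then show ?thesis
  unfolding lifeprod_def death_age_eq birth_age_eq
  by (intro arg_cong2[where f="(*)"] prod.cong) (auto simp: thin_def Let_def)
qed

lemma phi_poisson:
 assumes [measurable]: "f \<in> borel_measurable borel" and h[measurable]: "(\<lambda>(t, y). h t y) \<in> borel_measurable borel2" and h1: "\<And>t y. h t y \<le> 1"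
 shows "phi K f h t y = (\<integral>\<^sup>+w. \<integral>\<^sup>+\<eta>. (if ereal t < first_age (rate d w) \<eta> then f (Y t w) else 1) * poisson_prod K (thin h t w \<eta>) \<partial>unit_exp \<partial>Q y)"
proof -
 have "phi K f h t y = (\<integral>\<^sup>+w. \<integral>\<^sup>+\<eta>. \<integral>\<^sup>+\<epsilon>. lifeprod K f h t (w, \<eta>, \<epsilon>) \<partial>exp_seq \<partial>unit_exp \<partial>Q y)"
  unfolding phi_def by (rule nn_integral_life_law) measurable
 also have "\<dots> = (\<integral>\<^sup>+w. \<integral>\<^sup>+\<eta>. (if ereal t < first_age (rate d w) \<eta> then f (Y t w) else 1) * poisson_prod K (thin h t w \<eta>) \<partial>unit_exp \<partial>Q y)"
  unfolding lifeprod_thin[OF h1] poisson_prod_def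
  by (intro nn_integral_cong nn_integral_cmult) measurable
 finally show ?thesis .
qed

text \<open>A bounded birth rate consumes finite charge up to \<open>t\<close>; this gives the
  support bound \<open>M\<close> demanded by the two estimates of
  \<open>poisson_prod\<close>.\<close>

lemma thin_support:
 assumes w[simp]: "w \<in> space \<Omega>" and t: "0 \<le> t" and e: "enn2real (clk (rate b w) t) < e"
 shows "thin h t w \<eta> e = 0"
proof -
 have "\<not> ennreal e \<le> clk (rate b w) t"
  using e clk_rate_b_fin[of w t] by (metis enn2real_nonneg ennreal_enn2real ennreal_le_iff not_le)
 moreover have "first_age (rate b w) e \<le> ereal t \<longleftrightarrow> ennreal e \<le> clk (rate b w) t"
  by (rule first_age_le_iff) (use t clk_rate_b_fin in auto)
 ultimately show ?thesis by (simp add: thin_def)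
qed

lemma thin_substitution:
 assumes w[simp]: "w \<in> space \<Omega>" and t: "0 \<le> t" and h[measurable]: "(\<lambda>(t, y). h t y) \<in> borel_measurable borel2"
 shows "(\<integral>\<^sup>+e\<in>{0..}. thin h t w \<eta> e \<partial>lborel) =
  clk (\<lambda>s. (if ereal s < first_age (rate d w) \<eta> then 1 - h (t - s) (Y s w) else 0) * rate b w s) t"
proof -
 let ?\<phi> = "\<lambda>s. if ereal s < first_age (rate d w) \<eta> then 1 - h (t - s) (Y s w) else 0"
 have "(\<integral>\<^sup>+e\<in>{0..}. thin h t w \<eta> e \<partial>lborel) =
  (\<integral>\<^sup>+e\<in>{0..}. (if first_age (rate b w) e \<le> ereal t then ?\<phi> (real_of_ereal (first_age (rate b w) e)) else 0) \<partial>lborel)"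
 proof (intro nn_integral_cong arg_cong2[where f="(*)"] refl)
  fix e
  show "thin h t w \<eta> e = (if first_age (rate b w) e \<le> ereal t then ?\<phi> (real_of_ereal (first_age (rate b w) e)) else 0)"
   using first_age_nonneg[of "rate b w" e] by (cases "first_age (rate b w) e") (auto simp: thin_def)
 qed
 also have "\<dots> = (\<integral>\<^sup>+s\<in>{0..t}. ?\<phi> s * rate b w s \<partial>lborel)"
  by (rule first_age_substitution) (use t clk_rate_b_fin in auto)
 finally show ?thesis by (simp only: clk_def)
qed

text \<open>The number of children tends to infinity in the fixed point equation. Given the path and
  the death clock, the product over the births lies between its exponential limit and that limit
  plus M^K / K!, while \<open>genK\<close> decreases to \<open>ext\<close>; dominated convergence
  does the rest.\<close>

lemma ext_path:
 assumes f[measurable]: "f \<in> borel_measurable borel" and f1: "\<And>y. f y \<le> 1" and t: "0 \<le> t"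
 shows "ext f t y = (\<integral>\<^sup>+w. \<integral>\<^sup>+\<eta>. (if ereal t < first_age (rate d w) \<eta> then f (Y t w) else 1) *
   expm (\<integral>\<^sup>+e\<in>{0..}. thin (ext f) t w \<eta> e \<partial>lborel) \<partial>unit_exp \<partial>Q y)"
proof (rule LIMSEQ_unique)
 show "(\<lambda>K. genK f K t y) \<longlonglongrightarrow> ext f t y" using f1 by (rule tendsto_ext)
 let ?c = "\<lambda>w \<eta>. if ereal t < first_age (rate d w) \<eta> then f (Y t w) else 1"
 have c1: "?c w \<eta> \<le> 1" for w \<eta> using f1 by simp
 have g1: "genK f K s z \<le> 1" for K s z using f1 by (rule genK_le_1)
 have pm: "(\<lambda>\<eta>. poisson_prod K (thin (genK f K) t w \<eta>)) \<in> borel_measurable borel" if [simp]: "w \<in> space \<Omega>" for w K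
  unfolding poisson_prod_def by measurable
 have lim: "(\<lambda>K. poisson_prod K (thin (genK f K) t w \<eta>)) \<longlonglongrightarrow> expm (\<integral>\<^sup>+e\<in>{0..}. thin (ext f) t w \<eta> e \<partial>lborel)"
  if w[simp]: "w \<in> space \<Omega>" for w \<eta>
 proof (rule tendsto_sandwich)
  define M where "M = enn2real (clk (rate b w) t)"
  let ?I = "\<lambda>K. \<integral>\<^sup>+e\<in>{0..}. thin (genK f K) t w \<eta> e \<partial>lborel"
  have "?I \<longlonglongrightarrow> (\<integral>\<^sup>+e\<in>{0..}. thin (ext f) t w \<eta> e \<partial>lborel)"
  proof (rule nn_integral_LIMSEQ)
   show "incseq (\<lambda>K e. thin (genK f K) t w \<eta> e * indicator {0..} e)"
    using genK_antimono[OF f1]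
    by (auto simp: incseq_def le_fun_def thin_def Let_def intro!: mult_right_mono ennreal_mono_minus)
   fix e
   have "(\<lambda>K. 1 - genK f K s z) \<longlonglongrightarrow> 1 - ext f s z" for s z
    using tendsto_ext[where f=f, OF f1] ext_le_1[where f=f, OF f1, of s z]
    by (intro tendsto_diff_ennreal) (auto simp: top_unique)
   then have "(\<lambda>K. thin (genK f K) t w \<eta> e) \<longlonglongrightarrow> thin (ext f) t w \<eta> e"
    by (auto simp: thin_def Let_def)
   then show "(\<lambda>K. thin (genK f K) t w \<eta> e * indicator {0..} e) \<longlonglongrightarrow> thin (ext f) t w \<eta> e * indicator {0..} e"
    by (auto split: split_indicator)
  qed measurable
  then have E: "(\<lambda>K. expm (?I K)) \<longlonglongrightarrow> expm (\<integral>\<^sup>+e\<in>{0..}. thin (ext f) t w \<eta> e \<partial>lborel)"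
   by (rule tendsto_expm)
  then show "(\<lambda>K. expm (?I K)) \<longlonglongrightarrow> expm (\<integral>\<^sup>+e\<in>{0..}. thin (ext f) t w \<eta> e \<partial>lborel)" .
  have "(\<lambda>K. M ^ K / fact K) \<longlonglongrightarrow> 0"
   using summable_LIMSEQ_zero[OF summable_exp[of M]] by (simp add: field_simps)
  then have "(\<lambda>K. ennreal (M ^ K / fact K)) \<longlonglongrightarrow> ennreal 0" by (rule tendsto_ennrealI)
  from tendsto_add[OF E this]
  show "(\<lambda>K. expm (?I K) + ennreal (M ^ K / fact K)) \<longlonglongrightarrow> expm (\<integral>\<^sup>+e\<in>{0..}. thin (ext f) t w \<eta> e \<partial>lborel)" by simp
  have supp: "\<And>e. M < e ==> thin (genK f K) t w \<eta> e = 0" for K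
   unfolding M_def using t by (intro thin_support) auto
  show "eventually (\<lambda>K. expm (?I K) \<le> poisson_prod K (thin (genK f K) t w \<eta>)) sequentially"
   by (intro always_eventually allI poisson_prod_ge[where M=M] supp thin_le_1) (auto simp: M_def)
  show "eventually (\<lambda>K. poisson_prod K (thin (genK f K) t w \<eta>) \<le> expm (?I K) + ennreal (M ^ K / fact K)) sequentially"
   by (intro always_eventually allI poisson_prod_le supp thin_le_1) (auto simp: M_def)
 qed
 have bound: "?c w \<eta> * poisson_prod K p \<le> 1" for w \<eta> K p
  using mult_mono[OF c1[of w \<eta>] poisson_prod_le_1[of K p]] by simp
 have inner: "(\<lambda>K. \<integral>\<^sup>+\<eta>. ?c w \<eta> * poisson_prod K (thin (genK f K) t w \<eta>) \<partial>unit_exp) \<longlonglongrightarrow>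
   (\<integral>\<^sup>+\<eta>. ?c w \<eta> * expm (\<integral>\<^sup>+e\<in>{0..}. thin (ext f) t w \<eta> e \<partial>lborel) \<partial>unit_exp)" if w[simp]: "w \<in> space \<Omega>" for w
 proof (rule nn_integral_dominated_convergence[where w="\<lambda>_. 1"])
  show "AE \<eta> in unit_exp. (\<lambda>K. ?c w \<eta> * poisson_prod K (thin (genK f K) t w \<eta>)) \<longlonglongrightarrow> ?c w \<eta> * expm (\<integral>\<^sup>+e\<in>{0..}. thin (ext f) t w \<eta> e \<partial>lborel)"
   by (intro AE_I2 ennreal_tendsto_cmult lim le_less_trans[OF c1]) auto
  show "(\<lambda>\<eta>. ?c w \<eta> * poisson_prod K (thin (genK f K) t w \<eta>)) \<in> borel_measurable unit_exp" for K
   using pm[OF w, of K] by measurable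
  show "(\<integral>\<^sup>+\<eta>. 1 \<partial>unit_exp) < \<infinity>"
   using prob_space.emeasure_space_1[OF prob_space_unit_exp] by simp
 qed (use bound in auto)
 have inner1: "(\<integral>\<^sup>+\<eta>. ?c w \<eta> * poisson_prod K (thin (genK f K) t w \<eta>) \<partial>unit_exp) \<le> 1" for w K
 proof -
  have "(\<integral>\<^sup>+\<eta>. ?c w \<eta> * poisson_prod K (thin (genK f K) t w \<eta>) \<partial>unit_exp) \<le> (\<integral>\<^sup>+\<eta>. 1 \<partial>unit_exp)"
   by (intro nn_integral_mono bound)
  then show ?thesis using prob_space.emeasure_space_1[OF prob_space_unit_exp] by simp
 qed
 have E: "genK f K t y = (\<integral>\<^sup>+w. \<integral>\<^sup>+\<eta>. ?c w \<eta> * poisson_prod K (thin (genK f K) t w \<eta>) \<partial>unit_exp \<partial>Q y)" for K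
  by (rule trans[OF genK_fixed[OF f f1] phi_poisson[OF f measurable_genK[OF f] g1]])
 show "(\<lambda>K. genK f K t y) \<longlonglongrightarrow> (\<integral>\<^sup>+w. \<integral>\<^sup>+\<eta>. ?c w \<eta> * expm (\<integral>\<^sup>+e\<in>{0..}. thin (ext f) t w \<eta> e \<partial>lborel) \<partial>unit_exp \<partial>Q y)"
  unfolding E
 proof (rule nn_integral_dominated_convergence[where w="\<lambda>_. 1"])
  show "(\<lambda>w. \<integral>\<^sup>+\<eta>. ?c w \<eta> * poisson_prod K (thin (genK f K) t w \<eta>) \<partial>unit_exp) \<in> borel_measurable (Q y)" for K
   unfolding poisson_prod_def by measurable
  show "(\<integral>\<^sup>+w. 1 \<partial>Q y) < \<infinity>"
   using prob_space.emeasure_space_1[OF prob_space_Q, of y] by simp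
 qed (use inner inner1 in auto)
qed

text \<open>The function m of the overview. If every living individual is marked independently with
  probability \<open>1 - f\<close>, it is the probability of seeing a mark at time \<open>t\<close>;
  for \<open>f = 0\<close> this is survival.\<close>

definition mort :: "(real => ennreal) => real => real => ennreal" where
 "mort f t y = 1 - ext f t y"

lemma measurable_mort [measurable]:
 assumes [measurable]: "f \<in> borel_measurable borel"
 shows "(\<lambda>(t, y). mort f t y) \<in> borel_measurable borel2"
 unfolding mort_def by measurable

lemma mort_le_1: "mort f t y \<le> 1"
 by (simp add: mort_def diff_le_self_ennreal)

text \<open>At age \<open>s\<close> a birth whose subtree will show a mark by the horizon
  \<open>t\<close> occurs with intensity \<open>kap\<close>; adding the death rate gives the total
  killing rate \<open>pot\<close>.\<close>

abbreviation kap :: "(real => ennreal) => real => real => real => ennreal" where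
 "kap f t s z \<equiv> ennreal (b z) * mort f (t - s) z"

abbreviation pot :: "(real => ennreal) => real => real => real => ennreal" where
 "pot f t s z \<equiv> ennreal (d z) + kap f t s z"

lemma kap_le: "kap f t s z \<le> ennreal bmax"
 using mult_mono[of "ennreal (b z)" "ennreal bmax" "mort f (t - s) z" 1] bmax mort_le_1
 by (auto simp: ennreal_leI)

lemma survival_tail:
 assumes w: "w \<in> space \<Omega>" and fin: "\<forall>t. clk (rate d w) t < \<top>" and s: "0 \<le> s"
 shows "(\<integral>\<^sup>+\<eta>. (if ereal s < first_age (rate d w) \<eta> then 1 else 0) \<partial>unit_exp) = expm (clk (rate d w) s)"
proof -
 define a where "a = enn2real (clk (rate d w) s)"
 have a: "clk (rate d w) s = ennreal a" "0 \<le> a" using fin by (auto simp: a_def)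
 have "ereal s < first_age (rate d w) \<eta> \<longleftrightarrow> a < \<eta>" for \<eta>
 proof -
  have "first_age (rate d w) \<eta> \<le> ereal s \<longleftrightarrow> ennreal \<eta> \<le> clk (rate d w) s"
   by (rule first_age_le_iff) (use w s fin in auto)
  also have "\<dots> \<longleftrightarrow> \<eta> \<le> a" using a by (simp add: ennreal_le_iff)
  finally show ?thesis by auto
 qed
 then show ?thesis using unit_exp_tail[OF a(2)] a by simp
qed

text \<open>Stopping at the first marked birth or at death: either a marked birth comes first, or
  the path reaches \<open>t\<close> and is itself marked. The identity is obtained by complement,
  because the two parts together with the integrand of \<open>ext_path\<close> add up to 1 along
  each path.\<close>

lemma mort_path:
 assumes f[measurable]: "f \<in> borel_measurable borel" and f1: "\<And>y. f y \<le> 1" and t: "0 \<le> t"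
 shows "mort f t y = (\<integral>\<^sup>+w. (\<integral>\<^sup>+s\<in>{0..t}. expm (pathclk (pot f t) 0 s w) * kap f t s (Y s w) \<partial>lborel) +
   expm (pathclk (pot f t) 0 t w) * (1 - f (Y t w)) \<partial>Q y)"
proof -
 let ?D = "\<lambda>w. first_age (rate d w)"
 let ?k = "\<lambda>w s. kap f t s (Y s w)"
 have kfin: "clk (?k w) s < \<top>" for w s
  using pathclk_bound[where g="kap f t" and K=bmax and r=0 and s=s and w=w, OF kap_le] by (simp add: pathclk_def)
 have add: "expm (pathclk (pot f t) 0 s w) = expm (clk (rate d w) s) * expm (clk (?k w) s)" if [simp]: "w \<in> space \<Omega>" for s w
 proof -
  have "pathclk (pot f t) 0 s w = clk (rate d w) s + clk (?k w) s"
   unfolding pathclk_def clk_def rate_def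
   by (subst nn_integral_add[symmetric]) (auto simp: distrib_right)
  then show ?thesis by (simp add: expm_add)
 qed
 let ?A = "\<lambda>w \<eta>. (if ereal t < ?D w \<eta> then f (Y t w) else 1) * expm (\<integral>\<^sup>+e\<in>{0..}. thin (ext f) t w \<eta> e \<partial>lborel)"
 let ?B = "\<lambda>w \<eta>. (\<integral>\<^sup>+s\<in>{0..t}. (if ereal s < ?D w \<eta> then 1 else 0) * (expm (clk (?k w) s) * ?k w s) \<partial>lborel) +
   (if ereal t < ?D w \<eta> then 1 else 0) * (expm (clk (?k w) t) * (1 - f (Y t w)))"
 \<comment> \<open>For fixed path and death clock this is \<open>clk_expm\<close> for the marked
   births occurring before death, whose intensity is \<open>k'\<close>.\<close>
 have one: "?A w \<eta> + ?B w \<eta> = 1" if w[simp]: "w \<in> space \<Omega>" for w \<eta>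
 proof -
  define k' where "k' s = (if ereal s < ?D w \<eta> then 1 - ext f (t - s) (Y s w) else 0) * rate b w s" for s
  have [measurable]: "k' \<in> borel_measurable borel" unfolding k'_def by measurable
  have k': "k' s = (if ereal s < ?D w \<eta> then 1 else 0) * ?k w s" for s
   by (simp add: k'_def mort_def rate_def mult.commute)
  have fin': "clk k' s < \<top>" for s
  proof -
   have "clk k' s \<le> clk (?k w) s" unfolding clk_def k' by (intro nn_integral_mono) (auto split: split_indicator)
   then show ?thesis using kfin by (rule le_less_trans)
  qed
  have clk': "clk k' s = clk (?k w) s" if "ereal s < ?D w \<eta>" for s
   unfolding clk_def k'
  proof (intro nn_integral_cong)
   fix r
   have "r \<le> s ==> ereal r < ?D w \<eta>" using that by (rule le_less_trans[rotated]) simp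
   then show "(if ereal r < ?D w \<eta> then 1 else 0) * ?k w r * indicator {0..s} r = ?k w r * indicator {0..s} r"
    by (auto split: split_indicator)
  qed
  have th: "(\<integral>\<^sup>+e\<in>{0..}. thin (ext f) t w \<eta> e \<partial>lborel) = clk k' t"
   unfolding k'_def by (rule thin_substitution) (use t in auto)
  have B1: "(\<integral>\<^sup>+s\<in>{0..t}. (if ereal s < ?D w \<eta> then 1 else 0) * (expm (clk (?k w) s) * ?k w s) \<partial>lborel) = (\<integral>\<^sup>+s\<in>{0..t}. expm (clk k' s) * k' s \<partial>lborel)"
   by (intro nn_integral_cong) (auto simp: k' clk' split: split_indicator)
  have "(if ereal t < ?D w \<eta> then f (Y t w) else 1) * expm (clk k' t) + (if ereal t < ?D w \<eta> then 1 else 0) * (expm (clk (?k w) t) * (1 - f (Y t w))) = expm (clk k' t)"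
  proof (cases "ereal t < ?D w \<eta>")
   case True
   have "f (Y t w) * expm (clk k' t) + expm (clk k' t) * (1 - f (Y t w)) = expm (clk k' t) * (f (Y t w) + (1 - f (Y t w)))"
    by (simp add: distrib_left mult.commute)
   also have "f (Y t w) + (1 - f (Y t w)) = 1" using f1 by (simp add: add_diff_inverse_ennreal)
   finally show ?thesis using True clk'[OF True] by simp
  qed simp
  then have "?A w \<eta> + ?B w \<eta> = (\<integral>\<^sup>+s\<in>{0..t}. expm (clk k' s) * k' s \<partial>lborel) + expm (clk k' t)"
   unfolding th B1 by (simp add: add_ac)
  also have "\<dots> = 1" by (rule clk_expm) (use fin' t in auto)
  finally show ?thesis .
 qed
 \<comment> \<open>Averaging over the death clock replaces the event of being alive at age
   \<open>s\<close> by the exponential of minus the integrated death rate, which merges with the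
   thinning weight into \<open>pot\<close>.\<close>
 have Bint: "(\<integral>\<^sup>+\<eta>. ?B w \<eta> \<partial>unit_exp) = (\<integral>\<^sup>+s\<in>{0..t}. expm (pathclk (pot f t) 0 s w) * ?k w s \<partial>lborel) +
   expm (pathclk (pot f t) 0 t w) * (1 - f (Y t w))"
  if w[simp]: "w \<in> space \<Omega>" and fin: "\<forall>t. clk (rate d w) t < \<top>" for w
 proof -
  interpret U: pair_sigma_finite "lborel :: real measure" unit_exp
   by (intro pair_sigma_finite.intro prob_space_imp_sigma_finite prob_space_unit_exp sigma_finite_lborel)
  have "(\<integral>\<^sup>+\<eta>. ?B w \<eta> \<partial>unit_exp) = (\<integral>\<^sup>+\<eta>. \<integral>\<^sup>+s. (if ereal s < ?D w \<eta> then 1 else 0) * (expm (clk (?k w) s) * ?k w s) * indicator {0..t} s \<partial>lborel \<partial>unit_exp)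
    + (\<integral>\<^sup>+\<eta>. (if ereal t < ?D w \<eta> then 1 else 0) * (expm (clk (?k w) t) * (1 - f (Y t w))) \<partial>unit_exp)"
   by (rule nn_integral_add) measurable
  also have "(\<integral>\<^sup>+\<eta>. (if ereal t < ?D w \<eta> then 1 else 0) * (expm (clk (?k w) t) * (1 - f (Y t w))) \<partial>unit_exp) =
    expm (clk (rate d w) t) * (expm (clk (?k w) t) * (1 - f (Y t w)))"
   by (subst nn_integral_multc) (measurable, simp add: survival_tail[OF w fin t])
  also have "(\<integral>\<^sup>+\<eta>. \<integral>\<^sup>+s. (if ereal s < ?D w \<eta> then 1 else 0) * (expm (clk (?k w) s) * ?k w s) * indicator {0..t} s \<partial>lborel \<partial>unit_exp) =
    (\<integral>\<^sup>+s. \<integral>\<^sup>+\<eta>. (if ereal s < ?D w \<eta> then 1 else 0) * (expm (clk (?k w) s) * ?k w s) * indicator {0..t} s \<partial>unit_exp \<partial>lborel)"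
   by (rule U.Fubini') measurable
  also have "\<dots> = (\<integral>\<^sup>+s\<in>{0..t}. expm (clk (rate d w) s) * (expm (clk (?k w) s) * ?k w s) \<partial>lborel)"
  proof (intro nn_integral_cong)
   fix s :: real
   show "(\<integral>\<^sup>+\<eta>. (if ereal s < ?D w \<eta> then 1 else 0) * (expm (clk (?k w) s) * ?k w s) * indicator {0..t} s \<partial>unit_exp) =
    expm (clk (rate d w) s) * (expm (clk (?k w) s) * ?k w s) * indicator {0..t} s"
   proof (cases "s \<in> {0..t}")
    case True
    then have "(\<integral>\<^sup>+\<eta>. (if ereal s < ?D w \<eta> then 1 else 0) * (expm (clk (?k w) s) * ?k w s) \<partial>unit_exp) =
     expm (clk (rate d w) s) * (expm (clk (?k w) s) * ?k w s)"
     by (subst nn_integral_multc) (measurable, simp add: survival_tail[OF w fin])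
    then show ?thesis using True by simp
   qed simp
  qed
  finally show ?thesis by (simp add: add mult.assoc)
 qed
 have "1 = (\<integral>\<^sup>+w. \<integral>\<^sup>+\<eta>. 1 \<partial>unit_exp \<partial>Q y)"
  using prob_space.emeasure_space_1[OF prob_space_Q, of y] prob_space.emeasure_space_1[OF prob_space_unit_exp]
  by simp
 also have "\<dots> = (\<integral>\<^sup>+w. \<integral>\<^sup>+\<eta>. ?A w \<eta> + ?B w \<eta> \<partial>unit_exp \<partial>Q y)"
  by (intro nn_integral_cong one[symmetric]) simp
 also have "\<dots> = (\<integral>\<^sup>+w. (\<integral>\<^sup>+\<eta>. ?A w \<eta> \<partial>unit_exp) + (\<integral>\<^sup>+\<eta>. ?B w \<eta> \<partial>unit_exp) \<partial>Q y)"
  by (intro nn_integral_cong nn_integral_add) measurable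
 also have "\<dots> = (\<integral>\<^sup>+w. \<integral>\<^sup>+\<eta>. ?A w \<eta> \<partial>unit_exp \<partial>Q y) + (\<integral>\<^sup>+w. \<integral>\<^sup>+\<eta>. ?B w \<eta> \<partial>unit_exp \<partial>Q y)"
  by (intro nn_integral_add) measurable
 also have "(\<integral>\<^sup>+w. \<integral>\<^sup>+\<eta>. ?A w \<eta> \<partial>unit_exp \<partial>Q y) = ext f t y"
  by (rule ext_path[OF f f1 t, symmetric])
 also have "(\<integral>\<^sup>+w. \<integral>\<^sup>+\<eta>. ?B w \<eta> \<partial>unit_exp \<partial>Q y) = (\<integral>\<^sup>+w. (\<integral>\<^sup>+s\<in>{0..t}. expm (pathclk (pot f t) 0 s w) * ?k w s \<partial>lborel) +
   expm (pathclk (pot f t) 0 t w) * (1 - f (Y t w)) \<partial>Q y)"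
  by (rule nn_integral_cong_AE) (use AE_clk_rate_d[of y] AE_space[of "Q y"] in \<open>eventually_elim, auto simp: Bint\<close>)
 finally have sum: "1 = ext f t y + (\<integral>\<^sup>+w. (\<integral>\<^sup>+s\<in>{0..t}. expm (pathclk (pot f t) 0 s w) * ?k w s \<partial>lborel) +
   expm (pathclk (pot f t) 0 t w) * (1 - f (Y t w)) \<partial>Q y)" (is "_ = _ + ?R") .
 have "ext f t y \<noteq> \<top>" using ext_le_1[where f=f, OF f1, of t y] by (auto simp: top_unique)
 then have "(ext f t y + ?R) - ext f t y = ?R" by (rule ennreal_add_diff_cancel_left)
 then have "1 - ext f t y = ?R" by (simp only: sum[symmetric])
 then show ?thesis by (simp only: mort_def[of f t y])
qed

end

section \<open>The Duhamel equation for the Feynman-Kac semigroup\<close>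

context branching
begin

text \<open>The Feynman-Kac factor exp(integral of b - d), split into two factors so that it stays
  meaningful on paths where the death clock is infinite.\<close>

definition weight :: "real => 'a => ennreal" where
 "weight t w = expm (clk (rate d w) t) * ennreal (exp (enn2real (clk (rate b w) t)))"

lemma measurable_weight [measurable (raw)]:
 assumes [measurable]: "t \<in> borel_measurable N" "w \<in> N \<rightarrow>\<^sub>M \<Omega>"
 shows "(\<lambda>x. weight (t x) (w x)) \<in> borel_measurable N"
 unfolding weight_def by measurable

lemma weight_le:
 assumes "0 \<le> t" shows "weight t w \<le> ennreal (exp (bmax * t))"
proof -
 have "enn2real (clk (rate b w) t) \<le> bmax * t"
  using clk_rate_b[OF assms, of w] bmax assms by (intro enn2real_leI) auto
 then have "weight t w \<le> 1 * ennreal (exp (bmax * t))"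
  unfolding weight_def by (intro mult_mono expm_le_1) (auto intro: ennreal_leI)
 then show ?thesis by simp
qed

lemma weight_F:
 assumes "0 \<le> t" shows "weight t \<in> borel_measurable (F t)"
proof -
 have "clk (rate r w) t = pathclk (\<lambda>_ z. ennreal (r z)) 0 t w" for r w
  by (simp add: pathclk_def rate_def[abs_def])
 moreover have "pathclk (\<lambda>_ z. ennreal (r z)) 0 t \<in> borel_measurable (F t)" if [measurable]: "r \<in> borel_measurable borel" for r
  using pathclk_F[of "\<lambda>_ z. ennreal (r z)" 0 t] assms by simp
 ultimately show ?thesis unfolding weight_def[abs_def] by simp
qed

text \<open>The Feynman-Kac semigroup on nonnegative extended functions, where Fubini and monotone
  limits require no integrability. The real-valued version is the integral against
  \<open>kappa\<close>.\<close>

definition PP :: "real => (real => ennreal) => real => ennreal" where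
 "PP t h y = (\<integral>\<^sup>+w. weight t w * h (Y t w) \<partial>Q y)"

lemma measurable_PP [measurable (raw)]:
 assumes [measurable]: "(\<lambda>(x, z). h x z) \<in> borel_measurable (N \<Otimes>\<^sub>M borel)" "t \<in> borel_measurable N" "y \<in> borel_measurable N"
 shows "(\<lambda>x. PP (t x) (h x) (y x)) \<in> borel_measurable N"
 unfolding PP_def by measurable

lemma PP_bound:
 assumes "0 \<le> t" "\<And>z. h z \<le> D"
 shows "PP t h y \<le> ennreal (exp (bmax * t)) * D"
proof -
 have "PP t h y \<le> (\<integral>\<^sup>+w. ennreal (exp (bmax * t)) * D \<partial>Q y)"
  unfolding PP_def using assms by (intro nn_integral_mono mult_mono weight_le) auto
 also have "\<dots> = ennreal (exp (bmax * t)) * D"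
  using prob_space.emeasure_space_1[OF prob_space_Q, of y] by simp
 finally show ?thesis .
qed

lemma PP_add:
 assumes [measurable]: "h \<in> borel_measurable borel" "h' \<in> borel_measurable borel"
 shows "PP t (\<lambda>z. h z + h' z) y = PP t h y + PP t h' y"
 unfolding PP_def distrib_left by (rule nn_integral_add) measurable

text \<open>\<open>mort_path\<close> is inserted at the position \<open>Y r w\<close>, and the
  Markov property exchanges the fresh path for the continuation of the given one. Afterwards
  everything lives on a single path and can be compared with \<open>mort_path\<close> at time
  0.\<close>

lemma mort_markov:
 assumes f[measurable]: "f \<in> borel_measurable borel" and f1: "\<And>y. f y \<le> 1" and r: "0 \<le> r" "r \<le> t"
  and \<xi>: "\<xi> \<in> borel_measurable (F r)" and b\<xi>: "\<And>w. \<xi> w \<le> C" "C < \<top>"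
 shows "(\<integral>\<^sup>+w. \<xi> w * mort f (t - r) (Y r w) \<partial>Q y) =
  (\<integral>\<^sup>+w. \<xi> w * ((\<integral>\<^sup>+s\<in>{0..t-r}. expm (pathclk (pot f (t - r)) r s w) * kap f (t - r) s (Y (r + s) w) \<partial>lborel) +
   expm (pathclk (pot f (t - r)) r (t - r) w) * (1 - f (Y t w))) \<partial>Q y)"
proof -
 have [measurable]: "\<xi> \<in> borel_measurable \<Omega>" using r(1) \<xi> by (rule measurable_F_Omega)
 let ?G = "pot f (t - r)" and ?k = "kap f (t - r)"
 have G[measurable]: "(\<lambda>(sg, z). ?G sg z) \<in> borel_measurable borel2" by measurable
 have mk: "(\<integral>\<^sup>+w. \<xi> w * (expm (pathclk ?G r s w) * h (Y (r + s) w)) \<partial>Q y) =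
  (\<integral>\<^sup>+w. \<xi> w * (\<integral>\<^sup>+w'. expm (pathclk ?G 0 s w') * h (Y s w') \<partial>Q (Y r w)) \<partial>Q y)"
  if "0 \<le> s" "h \<in> borel_measurable borel" "\<And>z. h z \<le> D" "D < \<top>" for s h D
  using that by (intro markov_expm[where C=C and D=D] r \<xi> b\<xi>) auto
 have "(\<integral>\<^sup>+w. \<xi> w * mort f (t - r) (Y r w) \<partial>Q y) = (\<integral>\<^sup>+w. \<xi> w * (\<integral>\<^sup>+w'. \<integral>\<^sup>+s. expm (pathclk ?G 0 s w') * ?k s (Y s w') * indicator {0..t-r} s \<partial>lborel \<partial>Q (Y r w)) +
  \<xi> w * (\<integral>\<^sup>+w'. expm (pathclk ?G 0 (t - r) w') * (1 - f (Y (t - r) w')) \<partial>Q (Y r w)) \<partial>Q y)"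
 proof (intro nn_integral_cong)
  fix w
  have "mort f (t - r) (Y r w) = (\<integral>\<^sup>+w'. (\<integral>\<^sup>+s\<in>{0..t-r}. expm (pathclk ?G 0 s w') * ?k s (Y s w') \<partial>lborel) +
   expm (pathclk ?G 0 (t - r) w') * (1 - f (Y (t - r) w')) \<partial>Q (Y r w))"
   by (rule mort_path) (use r f1 in auto)
  also have "\<dots> = (\<integral>\<^sup>+w'. (\<integral>\<^sup>+s\<in>{0..t-r}. expm (pathclk ?G 0 s w') * ?k s (Y s w') \<partial>lborel) \<partial>Q (Y r w)) +
   (\<integral>\<^sup>+w'. expm (pathclk ?G 0 (t - r) w') * (1 - f (Y (t - r) w')) \<partial>Q (Y r w))"
   by (rule nn_integral_add) measurable
  finally show "\<xi> w * mort f (t - r) (Y r w) = \<xi> w * (\<integral>\<^sup>+w'. \<integral>\<^sup>+s. expm (pathclk ?G 0 s w') * ?k s (Y s w') * indicator {0..t-r} s \<partial>lborel \<partial>Q (Y r w)) +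
   \<xi> w * (\<integral>\<^sup>+w'. expm (pathclk ?G 0 (t - r) w') * (1 - f (Y (t - r) w')) \<partial>Q (Y r w))"
   by (simp add: distrib_left)
 qed
 also have "\<dots> = (\<integral>\<^sup>+w. \<xi> w * (\<integral>\<^sup>+w'. \<integral>\<^sup>+s. expm (pathclk ?G 0 s w') * ?k s (Y s w') * indicator {0..t-r} s \<partial>lborel \<partial>Q (Y r w)) \<partial>Q y) +
  (\<integral>\<^sup>+w. \<xi> w * (\<integral>\<^sup>+w'. expm (pathclk ?G 0 (t - r) w') * (1 - f (Y (t - r) w')) \<partial>Q (Y r w)) \<partial>Q y)"
  by (rule nn_integral_add) measurable
 also have "(\<integral>\<^sup>+w. \<xi> w * (\<integral>\<^sup>+w'. expm (pathclk ?G 0 (t - r) w') * (1 - f (Y (t - r) w')) \<partial>Q (Y r w)) \<partial>Q y) =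
  (\<integral>\<^sup>+w. \<xi> w * (expm (pathclk ?G r (t - r) w) * (1 - f (Y t w))) \<partial>Q y)"
  using mk[of "t - r" "\<lambda>z. 1 - f z" 1] r by (simp add: diff_le_self_ennreal)
 also have "(\<integral>\<^sup>+w. \<xi> w * (\<integral>\<^sup>+w'. \<integral>\<^sup>+s. expm (pathclk ?G 0 s w') * ?k s (Y s w') * indicator {0..t-r} s \<partial>lborel \<partial>Q (Y r w)) \<partial>Q y) =
  (\<integral>\<^sup>+w. \<integral>\<^sup>+s. \<xi> w * (\<integral>\<^sup>+w'. expm (pathclk ?G 0 s w') * ?k s (Y s w') * indicator {0..t-r} s \<partial>Q (Y r w)) \<partial>lborel \<partial>Q y)"
 proof (intro nn_integral_cong)
  fix w
  have "(\<integral>\<^sup>+w'. \<integral>\<^sup>+s. expm (pathclk ?G 0 s w') * ?k s (Y s w') * indicator {0..t-r} s \<partial>lborel \<partial>Q (Y r w)) =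
   (\<integral>\<^sup>+s. \<integral>\<^sup>+w'. expm (pathclk ?G 0 s w') * ?k s (Y s w') * indicator {0..t-r} s \<partial>Q (Y r w) \<partial>lborel)"
   by (rule Q_Fubini) measurable
  then show "\<xi> w * (\<integral>\<^sup>+w'. \<integral>\<^sup>+s. expm (pathclk ?G 0 s w') * ?k s (Y s w') * indicator {0..t-r} s \<partial>lborel \<partial>Q (Y r w)) =
   (\<integral>\<^sup>+s. \<xi> w * (\<integral>\<^sup>+w'. expm (pathclk ?G 0 s w') * ?k s (Y s w') * indicator {0..t-r} s \<partial>Q (Y r w)) \<partial>lborel)"
   by (subst nn_integral_cmult) auto
 qed
 also have "\<dots> = (\<integral>\<^sup>+s. \<integral>\<^sup>+w. \<xi> w * (\<integral>\<^sup>+w'. expm (pathclk ?G 0 s w') * ?k s (Y s w') * indicator {0..t-r} s \<partial>Q (Y r w)) \<partial>Q y \<partial>lborel)"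
  by (rule Q_Fubini) measurable
 also have "\<dots> = (\<integral>\<^sup>+s. \<integral>\<^sup>+w. \<xi> w * (expm (pathclk ?G r s w) * ?k s (Y (r + s) w) * indicator {0..t-r} s) \<partial>Q y \<partial>lborel)"
 proof (rule nn_integral_cong)
  fix s :: real
  show "(\<integral>\<^sup>+w. \<xi> w * (\<integral>\<^sup>+w'. expm (pathclk ?G 0 s w') * ?k s (Y s w') * indicator {0..t-r} s \<partial>Q (Y r w)) \<partial>Q y) =
   (\<integral>\<^sup>+w. \<xi> w * (expm (pathclk ?G r s w) * ?k s (Y (r + s) w) * indicator {0..t-r} s) \<partial>Q y)"
   using mk[of s "?k s" "ennreal bmax"] kap_le by (cases "s \<in> {0..t-r}") auto
 qed
 also have "\<dots> = (\<integral>\<^sup>+w. \<integral>\<^sup>+s. \<xi> w * (expm (pathclk ?G r s w) * ?k s (Y (r + s) w) * indicator {0..t-r} s) \<partial>lborel \<partial>Q y)"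
  by (rule Q_Fubini[symmetric]) measurable
 also have "\<dots> = (\<integral>\<^sup>+w. \<xi> w * (\<integral>\<^sup>+s\<in>{0..t-r}. expm (pathclk ?G r s w) * ?k s (Y (r + s) w) \<partial>lborel) \<partial>Q y)"
  by (intro nn_integral_cong nn_integral_cmult) measurable
 also have "\<dots> + (\<integral>\<^sup>+w. \<xi> w * (expm (pathclk ?G r (t - r) w) * (1 - f (Y t w))) \<partial>Q y) =
   (\<integral>\<^sup>+w. \<xi> w * (\<integral>\<^sup>+s\<in>{0..t-r}. expm (pathclk ?G r s w) * ?k s (Y (r + s) w) \<partial>lborel) + \<xi> w * (expm (pathclk ?G r (t - r) w) * (1 - f (Y t w))) \<partial>Q y)"
  by (rule nn_integral_add[symmetric]) measurable
 finally show ?thesis by (simp only: distrib_left)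
qed

lemma expm_mult_exp: "c < \<top> ==> expm c * ennreal (exp (enn2real c)) = 1"
 by (cases c) (auto simp: expm_ennreal ennreal_mult[symmetric] exp_add[symmetric])

lemma exp_enn2real_add: "a < \<top> ==> c < \<top> ==> ennreal (exp (enn2real (a + c))) = ennreal (exp (enn2real a)) * ennreal (exp (enn2real c))"
 by (cases a; cases c) (auto simp: ennreal_mult[symmetric] exp_add[symmetric] ennreal_plus[symmetric] simp del: ennreal_plus)

lemma lborel_triangle_swap:
 assumes [measurable]: "p \<in> borel_measurable borel" "q \<in> borel_measurable borel"
 shows "(\<integral>\<^sup>+r. p r * (\<integral>\<^sup>+s. q s * indicator {r..t} s \<partial>lborel) * indicator {0..t} r \<partial>lborel) =
  (\<integral>\<^sup>+s. q s * (\<integral>\<^sup>+r. p r * indicator {0..s} r \<partial>lborel) * indicator {0..t} s \<partial>(lborel :: real measure))"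
proof -
 have "(\<integral>\<^sup>+r. p r * (\<integral>\<^sup>+s. q s * indicator {r..t} s \<partial>lborel) * indicator {0..t} r \<partial>lborel) =
  (\<integral>\<^sup>+r. \<integral>\<^sup>+s. p r * q s * (if 0 \<le> r \<and> r \<le> s \<and> s \<le> t then 1 else 0) \<partial>lborel \<partial>lborel)"
 proof (intro nn_integral_cong)
  fix r :: real
  have "(\<integral>\<^sup>+s. p r * q s * (if 0 \<le> r \<and> r \<le> s \<and> s \<le> t then 1 else 0) \<partial>lborel) = (\<integral>\<^sup>+s. (p r * indicator {0..t} r) * (q s * indicator {r..t} s) \<partial>lborel)"
   by (intro nn_integral_cong) (auto split: split_indicator)
  also have "\<dots> = (p r * indicator {0..t} r) * (\<integral>\<^sup>+s. q s * indicator {r..t} s \<partial>lborel)"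
   by (rule nn_integral_cmult) measurable
  finally show "p r * (\<integral>\<^sup>+s. q s * indicator {r..t} s \<partial>lborel) * indicator {0..t} r =
   (\<integral>\<^sup>+s. p r * q s * (if 0 \<le> r \<and> r \<le> s \<and> s \<le> t then 1 else 0) \<partial>lborel)" by (simp add: mult_ac)
 qed
 also have "\<dots> = (\<integral>\<^sup>+s. \<integral>\<^sup>+r. p r * q s * (if 0 \<le> r \<and> r \<le> s \<and> s \<le> t then 1 else 0) \<partial>lborel \<partial>lborel)"
  by (rule lborel_pair.Fubini') measurable
 also have "\<dots> = (\<integral>\<^sup>+s. q s * (\<integral>\<^sup>+r. p r * indicator {0..s} r \<partial>lborel) * indicator {0..t} s \<partial>(lborel :: real measure))"
 proof (intro nn_integral_cong)
  fix s :: real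
  have "(\<integral>\<^sup>+r. p r * q s * (if 0 \<le> r \<and> r \<le> s \<and> s \<le> t then 1 else 0) \<partial>lborel) = (\<integral>\<^sup>+r. (q s * indicator {0..t} s) * (p r * indicator {0..s} r) \<partial>lborel)"
   by (intro nn_integral_cong) (auto simp: mult.commute split: split_indicator)
  also have "\<dots> = (q s * indicator {0..t} s) * (\<integral>\<^sup>+r. p r * indicator {0..s} r \<partial>lborel)"
   by (rule nn_integral_cmult) measurable
  finally show "(\<integral>\<^sup>+r. p r * q s * (if 0 \<le> r \<and> r \<le> s \<and> s \<le> t then 1 else 0) \<partial>lborel) =
   q s * (\<integral>\<^sup>+r. p r * indicator {0..s} r \<partial>lborel) * indicator {0..t} s" by (simp add: mult_ac)
 qed
 finally show ?thesis .
qed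

text \<open>Passing from the potential \<open>d + b u\<close> to the potential \<open>d - b\<close>: along a path the
 difference of the weights is the integral of \<open>b (1 + u)\<close> against the mixed weights.\<close>

lemma mort_duhamel:
 assumes f[measurable]: "f \<in> borel_measurable borel" and f1: "\<And>y. f y \<le> 1" and t: "0 \<le> t"
 shows "mort f t y + (\<integral>\<^sup>+s\<in>{0..t}. PP s (\<lambda>z. ennreal (b z) * mort f (t - s) z ^ 2) y \<partial>lborel) = PP t (\<lambda>z. 1 - f z) y"
proof -
 let ?k = "\<lambda>s z. kap f t s z"
 let ?c = "\<lambda>s z. ennreal (b z) + kap f t s z"
 let ?\<Lambda> = "\<lambda>s w. pathclk (pot f t) 0 s w"
 let ?E = "\<lambda>s w. ennreal (exp (enn2real (pathclk ?c 0 s w)))"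
 have clk_add: "pathclk (\<lambda>s z. ennreal (r z) + ?k s z) 0 s w = clk (rate r w) s + pathclk ?k 0 s w"
  if [simp, measurable]: "w \<in> space \<Omega>" "r \<in> borel_measurable borel" for s w r
  unfolding pathclk_def clk_def rate_def
  by (subst nn_integral_add[symmetric]) (auto simp: distrib_right)
 note ck = clk_add[OF _ b_measurable] and dk = clk_add[OF _ d_measurable]
 have kfin: "pathclk ?k 0 s w < \<top>" for s w by (rule pathclk_bound[OF kap_le])
 have cfin: "pathclk ?c 0 s w < \<top>" if "w \<in> space \<Omega>" for s w
  using ck[OF that] kfin clk_rate_b_fin by simp
 \<comment> \<open>The identity b - d = (b + b m) - (d + b m) under the exponential:
   \<open>?E\<close> belongs to the added part \<open>?c\<close>, and \<open>?\<Lambda>\<close> is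
   the killing potential of \<open>mort_path\<close>.\<close>
 have WE: "weight s w = ?E s w * expm (?\<Lambda> s w)" if "w \<in> space \<Omega>" for s w
  unfolding ck[OF that] dk[OF that] weight_def expm_add exp_enn2real_add[OF clk_rate_b_fin kfin]
  using expm_mult_exp[OF kfin, of s w] by (simp add: mult_ac)
 let ?tail = "\<lambda>r w. (\<integral>\<^sup>+s. expm (?\<Lambda> s w) * ?k s (Y s w) * indicator {r..t} s \<partial>lborel)"
 let ?term = "\<lambda>w. expm (?\<Lambda> t w) * (1 - f (Y t w))"
 have step: "PP r (\<lambda>z. ?c r z * mort f (t - r) z) y = (\<integral>\<^sup>+w. ?E r w * ?c r (Y r w) * (?tail r w + ?term w) \<partial>Q y)"
  if r: "0 \<le> r" "r \<le> t" for r
 proof -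
  let ?\<xi> = "\<lambda>w. weight r w * ?c r (Y r w)"
  have [measurable]: "weight r \<in> borel_measurable (F r)" "Y r \<in> borel_measurable (F r)"
   using r by (auto intro: weight_F Y_F)
  have bd: "?\<xi> w \<le> ennreal (exp (bmax * r)) * (ennreal bmax + ennreal bmax)" for w
   using r bmax by (intro mult_mono add_mono kap_le weight_le) (auto intro: ennreal_leI)
  have "PP r (\<lambda>z. ?c r z * mort f (t - r) z) y = (\<integral>\<^sup>+w. ?\<xi> w * mort f (t - r) (Y r w) \<partial>Q y)"
   by (simp add: PP_def mult.assoc)
  also have "\<dots> = (\<integral>\<^sup>+w. ?\<xi> w * ((\<integral>\<^sup>+s\<in>{0..t-r}. expm (pathclk (pot f (t - r)) r s w) * kap f (t - r) s (Y (r + s) w) \<partial>lborel) +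
   expm (pathclk (pot f (t - r)) r (t - r) w) * (1 - f (Y t w))) \<partial>Q y)"
   by (rule mort_markov[OF f f1 r _ bd]) (measurable, simp add: ennreal_mult_less_top)
  also have "\<dots> = (\<integral>\<^sup>+w. ?E r w * ?c r (Y r w) * (?tail r w + ?term w) \<partial>Q y)"
  proof (intro nn_integral_cong)
   fix w assume "w \<in> space (Q y)"
   then have w[simp]: "w \<in> space \<Omega>" by simp
   have tr: "t - r - s = t - (r + s)" for s by simp
   have shift: "?\<Lambda> (r + s) w = ?\<Lambda> r w + pathclk (pot f (t - r)) r s w" if "0 \<le> s" for s
   proof -
    have "?\<Lambda> (r + s) w = ?\<Lambda> r w + clk (\<lambda>sg. pot f t (0 + (r + sg)) (Y (0 + (r + sg)) w)) s"
     unfolding pathclk_def using r that by (subst clk_shift) auto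
    then show ?thesis by (simp only: pathclk_def tr add_0)
   qed
   have A: "weight r w * expm (pathclk (pot f (t - r)) r s w) = ?E r w * expm (?\<Lambda> (r + s) w)" if "0 \<le> s" for s
    unfolding WE[OF w] shift[OF that] expm_add by (simp only: mult_ac)
   have "?tail r w = (\<integral>\<^sup>+s. expm (?\<Lambda> (r + s) w) * ?k (r + s) (Y (r + s) w) * indicator {r..t} (r + s) \<partial>lborel)"
    using nn_integral_real_affine[of "\<lambda>s. expm (?\<Lambda> s w) * ?k s (Y s w) * indicator {r..t} s" 1 r] by simp
   then have "?E r w * ?tail r w = (\<integral>\<^sup>+s. ?E r w * (expm (?\<Lambda> (r + s) w) * ?k (r + s) (Y (r + s) w) * indicator {r..t} (r + s)) \<partial>lborel)"
    by (simp only:, intro nn_integral_cmult[symmetric]) measurable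
   also have "\<dots> = (\<integral>\<^sup>+s. weight r w * (expm (pathclk (pot f (t - r)) r s w) * kap f (t - r) s (Y (r + s) w) * indicator {0..t-r} s) \<partial>lborel)"
   proof (intro nn_integral_cong)
    fix s
    show "?E r w * (expm (?\<Lambda> (r + s) w) * ?k (r + s) (Y (r + s) w) * indicator {r..t} (r + s)) =
     weight r w * (expm (pathclk (pot f (t - r)) r s w) * kap f (t - r) s (Y (r + s) w) * indicator {0..t-r} s)"
    proof (cases "s \<in> {0..t-r}")
     case True
     then have "indicator {r..t} (r + s) = (1::ennreal)" "indicator {0..t-r} s = (1::ennreal)" by auto
     moreover have "weight r w * (expm (pathclk (pot f (t - r)) r s w) * kap f (t - r) s (Y (r + s) w)) =
      ?E r w * (expm (?\<Lambda> (r + s) w) * ?k (r + s) (Y (r + s) w))"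
      using A[of s] True by (simp only: tr mult.assoc[symmetric]) simp
     ultimately show ?thesis by simp
    next
     case False
     then have "indicator {r..t} (r + s) = (0::ennreal)" "indicator {0..t-r} s = (0::ennreal)" by (auto split: split_indicator)
     then show ?thesis by simp
    qed
   qed
   also have "\<dots> = weight r w * (\<integral>\<^sup>+s\<in>{0..t-r}. expm (pathclk (pot f (t - r)) r s w) * kap f (t - r) s (Y (r + s) w) \<partial>lborel)"
    by (rule nn_integral_cmult) measurable
   finally have B: "weight r w * (\<integral>\<^sup>+s\<in>{0..t-r}. expm (pathclk (pot f (t - r)) r s w) * kap f (t - r) s (Y (r + s) w) \<partial>lborel) = ?E r w * ?tail r w" ..
   have C: "weight r w * expm (pathclk (pot f (t - r)) r (t - r) w) = ?E r w * expm (?\<Lambda> t w)"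
    using A[of "t - r"] r by simp
   have dist: "W * c * (I + J * K) = c * (W * I + (W * J) * K)" for W c I J K :: ennreal
    by (simp add: distrib_left mult_ac)
   then show "?\<xi> w * ((\<integral>\<^sup>+s\<in>{0..t-r}. expm (pathclk (pot f (t - r)) r s w) * kap f (t - r) s (Y (r + s) w) \<partial>lborel) +
    expm (pathclk (pot f (t - r)) r (t - r) w) * (1 - f (Y t w))) = ?E r w * ?c r (Y r w) * (?tail r w + ?term w)"
    by (simp only: dist B C)
  qed
  finally show ?thesis .
 qed
 have "(\<integral>\<^sup>+r\<in>{0..t}. PP r (\<lambda>z. ?c r z * mort f (t - r) z) y \<partial>lborel) =
  (\<integral>\<^sup>+r. (\<integral>\<^sup>+w. ?E r w * ?c r (Y r w) * (?tail r w + ?term w) * indicator {0..t} r \<partial>Q y) \<partial>lborel)"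
  by (intro nn_integral_cong) (auto simp: step split: split_indicator)
 also have "\<dots> = (\<integral>\<^sup>+w. \<integral>\<^sup>+r. ?E r w * ?c r (Y r w) * (?tail r w + ?term w) * indicator {0..t} r \<partial>lborel \<partial>Q y)"
  by (rule Q_Fubini[symmetric]) (measurable, simp add: indicator_def, measurable)
 finally have L1: "(\<integral>\<^sup>+r\<in>{0..t}. PP r (\<lambda>z. ?c r z * mort f (t - r) z) y \<partial>lborel) =
  (\<integral>\<^sup>+w. \<integral>\<^sup>+r. ?E r w * ?c r (Y r w) * (?tail r w + ?term w) * indicator {0..t} r \<partial>lborel \<partial>Q y)" .
 have "(\<integral>\<^sup>+r\<in>{0..t}. PP r (\<lambda>z. ?c r z * mort f (t - r) z) y \<partial>lborel) + mort f t y = (\<integral>\<^sup>+w. (\<integral>\<^sup>+r. ?E r w * ?c r (Y r w) * (?tail r w + ?term w) * indicator {0..t} r \<partial>lborel) +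
  ((\<integral>\<^sup>+s. expm (?\<Lambda> s w) * ?k s (Y s w) * indicator {0..t} s \<partial>lborel) + ?term w) \<partial>Q y)"
  unfolding mort_path[OF f f1 t] L1
  by (rule nn_integral_add[symmetric]) (measurable, simp add: indicator_def, measurable)
 \<comment> \<open>Along a path, the integral of \<open>?c\<close> times \<open>?E\<close> up to
   \<open>s\<close> equals \<open>?E s w - 1\<close>. The missing 1 is provided by the summand
   \<open>mort f t y\<close>, and the killing weight becomes the full Feynman-Kac weight.\<close>
 also have "\<dots> = (\<integral>\<^sup>+w. (\<integral>\<^sup>+s. weight s w * ?k s (Y s w) * indicator {0..t} s \<partial>lborel) + weight t w * (1 - f (Y t w)) \<partial>Q y)"
 proof (intro nn_integral_cong)
  fix w assume "w \<in> space (Q y)"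
  then have w[simp]: "w \<in> space \<Omega>" by simp
  let ?p = "\<lambda>r. ?E r w * ?c r (Y r w)" and ?q = "\<lambda>s. expm (?\<Lambda> s w) * ?k s (Y s w)"
  have Eint: "(\<integral>\<^sup>+r. ?p r * indicator {0..s} r \<partial>lborel) + 1 = ?E s w" if "0 \<le> s" for s
   using clk_exp[of "\<lambda>r. ?c r (Y (0 + r) w)" s] cfin[OF w] that by (simp add: pathclk_def)
  have "(\<integral>\<^sup>+r. ?p r * (?tail r w + ?term w) * indicator {0..t} r \<partial>lborel) =
   (\<integral>\<^sup>+r. ?p r * ?tail r w * indicator {0..t} r + ?p r * indicator {0..t} r * ?term w \<partial>lborel)"
   by (intro nn_integral_cong) (simp only: distrib_left distrib_right mult_ac)
  also have "\<dots> = (\<integral>\<^sup>+r. ?p r * ?tail r w * indicator {0..t} r \<partial>lborel) + (\<integral>\<^sup>+r. ?p r * indicator {0..t} r * ?term w \<partial>lborel)"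
   by (rule nn_integral_add) (measurable, simp add: indicator_def, measurable)
  also have "(\<integral>\<^sup>+r. ?p r * ?tail r w * indicator {0..t} r \<partial>lborel) = (\<integral>\<^sup>+s. ?q s * (\<integral>\<^sup>+r. ?p r * indicator {0..s} r \<partial>lborel) * indicator {0..t} s \<partial>lborel)"
   by (rule lborel_triangle_swap) measurable
  also have "(\<integral>\<^sup>+r. ?p r * indicator {0..t} r * ?term w \<partial>lborel) = (\<integral>\<^sup>+r. ?p r * indicator {0..t} r \<partial>lborel) * ?term w"
   by (rule nn_integral_multc) measurable
  finally have "(\<integral>\<^sup>+r. ?p r * (?tail r w + ?term w) * indicator {0..t} r \<partial>lborel) + ((\<integral>\<^sup>+s. ?q s * indicator {0..t} s \<partial>lborel) + ?term w) =
   ((\<integral>\<^sup>+s. ?q s * (\<integral>\<^sup>+r. ?p r * indicator {0..s} r \<partial>lborel) * indicator {0..t} s \<partial>lborel) + (\<integral>\<^sup>+s. ?q s * indicator {0..t} s \<partial>lborel)) +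
   ((\<integral>\<^sup>+r. ?p r * indicator {0..t} r \<partial>lborel) + 1) * ?term w"
   by (simp add: distrib_right add_ac)
  also have "(\<integral>\<^sup>+s. ?q s * (\<integral>\<^sup>+r. ?p r * indicator {0..s} r \<partial>lborel) * indicator {0..t} s \<partial>lborel) + (\<integral>\<^sup>+s. ?q s * indicator {0..t} s \<partial>lborel) =
   (\<integral>\<^sup>+s. ?q s * (\<integral>\<^sup>+r. ?p r * indicator {0..s} r \<partial>lborel) * indicator {0..t} s + ?q s * indicator {0..t} s \<partial>lborel)"
   by (rule nn_integral_add[symmetric]) (measurable, simp add: indicator_def, measurable)
  also have "\<dots> = (\<integral>\<^sup>+s. weight s w * ?k s (Y s w) * indicator {0..t} s \<partial>lborel)"
  proof (intro nn_integral_cong)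
   fix s :: real
   show "?q s * (\<integral>\<^sup>+r. ?p r * indicator {0..s} r \<partial>lborel) * indicator {0..t} s + ?q s * indicator {0..t} s =
    weight s w * ?k s (Y s w) * indicator {0..t} s"
   proof (cases "s \<in> {0..t}")
    case True
    then have "?q s * ?E s w = ?q s * (\<integral>\<^sup>+r. ?p r * indicator {0..s} r \<partial>lborel) + ?q s"
     by (subst Eint[symmetric]) (simp_all add: distrib_left)
    then have "?q s * (\<integral>\<^sup>+r. ?p r * indicator {0..s} r \<partial>lborel) + ?q s = weight s w * ?k s (Y s w)"
     by (simp only: WE[OF w] mult_ac)
    then show ?thesis using True by simp
   qed simp
  qed
  also have "((\<integral>\<^sup>+r. ?p r * indicator {0..t} r \<partial>lborel) + 1) * ?term w = weight t w * (1 - f (Y t w))"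
   using Eint[OF t] by (simp add: WE mult_ac)
  finally show "(\<integral>\<^sup>+r. ?p r * (?tail r w + ?term w) * indicator {0..t} r \<partial>lborel) + ((\<integral>\<^sup>+s. ?q s * indicator {0..t} s \<partial>lborel) + ?term w) =
   (\<integral>\<^sup>+s. weight s w * ?k s (Y s w) * indicator {0..t} s \<partial>lborel) + weight t w * (1 - f (Y t w))" .
 qed
 also have "\<dots> = (\<integral>\<^sup>+w. \<integral>\<^sup>+s. weight s w * ?k s (Y s w) * indicator {0..t} s \<partial>lborel \<partial>Q y) + PP t (\<lambda>z. 1 - f z) y"
  unfolding PP_def by (rule nn_integral_add) measurable
 also have "(\<integral>\<^sup>+w. \<integral>\<^sup>+s. weight s w * ?k s (Y s w) * indicator {0..t} s \<partial>lborel \<partial>Q y) =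
  (\<integral>\<^sup>+s. \<integral>\<^sup>+w. weight s w * ?k s (Y s w) * indicator {0..t} s \<partial>Q y \<partial>lborel)"
  by (rule Q_Fubini) measurable
 also have "\<dots> = (\<integral>\<^sup>+s\<in>{0..t}. PP s (?k s) y \<partial>lborel)"
  unfolding PP_def by (intro nn_integral_cong nn_integral_multc) measurable
 finally have main: "(\<integral>\<^sup>+r\<in>{0..t}. PP r (\<lambda>z. ?c r z * mort f (t - r) z) y \<partial>lborel) + mort f t y =
  (\<integral>\<^sup>+s\<in>{0..t}. PP s (?k s) y \<partial>lborel) + PP t (\<lambda>z. 1 - f z) y" .
 \<comment> \<open>Since \<open>?c\<close> is \<open>b\<close> plus \<open>b\<close> times m, the
   left side of \<open>main\<close> also contains the semigroup integral of \<open>b\<close> times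
   m. It is finite and cancels, which leaves only the quadratic term.\<close>
 have "(\<integral>\<^sup>+r\<in>{0..t}. PP r (\<lambda>z. ?c r z * mort f (t - r) z) y \<partial>lborel) =
  (\<integral>\<^sup>+r. PP r (?k r) y * indicator {0..t} r + PP r (\<lambda>z. ennreal (b z) * mort f (t - r) z ^ 2) y * indicator {0..t} r \<partial>lborel)"
  by (intro nn_integral_cong, subst distrib_right[symmetric], subst PP_add[symmetric])
    (auto simp: distrib_right power2_eq_square mult.assoc)
 also have "\<dots> = (\<integral>\<^sup>+s\<in>{0..t}. PP s (?k s) y \<partial>lborel) + (\<integral>\<^sup>+s\<in>{0..t}. PP s (\<lambda>z. ennreal (b z) * mort f (t - s) z ^ 2) y \<partial>lborel)"
  by (rule nn_integral_add) measurable
 finally have "(\<integral>\<^sup>+s\<in>{0..t}. PP s (?k s) y \<partial>lborel) + (mort f t y + (\<integral>\<^sup>+s\<in>{0..t}. PP s (\<lambda>z. ennreal (b z) * mort f (t - s) z ^ 2) y \<partial>lborel)) =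
  (\<integral>\<^sup>+s\<in>{0..t}. PP s (?k s) y \<partial>lborel) + PP t (\<lambda>z. 1 - f z) y"
  using main by (simp add: add_ac)
 moreover have "(\<integral>\<^sup>+s\<in>{0..t}. PP s (?k s) y \<partial>lborel) \<noteq> \<top>"
 proof -
  have "(\<integral>\<^sup>+s\<in>{0..t}. PP s (?k s) y \<partial>lborel) \<le> (\<integral>\<^sup>+s. ennreal (exp (bmax * t)) * ennreal bmax * indicator {0..t} s \<partial>lborel)"
  proof (intro nn_integral_mono)
   fix s :: real
   have "PP s (?k s) y \<le> ennreal (exp (bmax * t)) * ennreal bmax" if "0 \<le> s" "s \<le> t"
   proof -
    have "PP s (?k s) y \<le> ennreal (exp (bmax * s)) * ennreal bmax" using that kap_le by (intro PP_bound) auto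
    also have "\<dots> \<le> ennreal (exp (bmax * t)) * ennreal bmax"
     using that bmax by (intro mult_right_mono ennreal_leI) auto
    finally show ?thesis .
   qed
   then show "PP s (?k s) y * indicator {0..t} s \<le> ennreal (exp (bmax * t)) * ennreal bmax * indicator {0..t} s"
    by (auto split: split_indicator)
  qed
  also have "\<dots> < \<top>" by (simp add: nn_integral_cmult ennreal_mult_less_top emeasure_lborel_Icc_eq)
  finally show ?thesis by simp
 qed
 ultimately show ?thesis by simp
qed

text \<open>Up to the deterministic factor exp(bmax t), the weight is the exponential of minus the
  nonnegative potential \<open>d + (bmax - b)\<close>, so \<open>markov_expm\<close>
  applies.\<close>

lemma PP_semigroup:
 assumes h[measurable]: "h \<in> borel_measurable borel" and hD: "\<And>z. h z \<le> D" "D < \<top>" and s: "0 \<le> s" and t: "0 \<le> t"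
 shows "PP (s + t) h y = PP s (PP t h) y"
proof -
 have g: "ennreal (d z + (bmax - b z)) + ennreal (b z) = ennreal (d z) + ennreal bmax" for z
  using bmax(2)[of z] bmax(1) d_nonneg[of z] b_nonneg[of z] by (simp flip: ennreal_plus)
 have loc: "expm (clk (\<lambda>sg. rate d w (r + sg)) t) * ennreal (exp (enn2real (clk (\<lambda>sg. rate b w (r + sg)) t))) =
  ennreal (exp (bmax * t)) * expm (pathclk (\<lambda>sg z. ennreal (d z + (bmax - b z))) r t w)" if [simp]: "w \<in> space \<Omega>" for r w
 proof -
  let ?B = "clk (\<lambda>sg. rate b w (r + sg)) t" and ?D = "clk (\<lambda>sg. rate d w (r + sg)) t"
  have "pathclk (\<lambda>sg z. ennreal (d z + (bmax - b z))) r t w + ?B =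
   (\<integral>\<^sup>+sg. ennreal (d (Y (r + sg) w) + (bmax - b (Y (r + sg) w))) * indicator {0..t} sg + ennreal (b (Y (r + sg) w)) * indicator {0..t} sg \<partial>lborel)"
   unfolding pathclk_def clk_def rate_def by (rule nn_integral_add[symmetric]) measurable
  also have "\<dots> = (\<integral>\<^sup>+sg. ennreal (d (Y (r + sg) w)) * indicator {0..t} sg + ennreal bmax * indicator {0..t} sg \<partial>lborel)"
   by (simp only: distrib_right[symmetric] g)
  also have "\<dots> = ?D + (\<integral>\<^sup>+sg. ennreal bmax * indicator {0..t} sg \<partial>lborel)"
   unfolding clk_def rate_def by (rule nn_integral_add) measurable
  also have "(\<integral>\<^sup>+sg. ennreal bmax * indicator {0..t} sg \<partial>lborel) = ennreal (bmax * t)"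
   using t bmax by (simp add: nn_integral_cmult ennreal_mult)
  finally have sum: "pathclk (\<lambda>sg z. ennreal (d z + (bmax - b z))) r t w + ?B = ?D + ennreal (bmax * t)" .
  have "?B \<le> (\<integral>\<^sup>+sg. ennreal bmax * indicator {0..t} sg \<partial>lborel)"
   unfolding clk_def rate_def using bmax by (intro nn_integral_mono mult_right_mono ennreal_leI) auto
  also have "\<dots> < \<top>" by (simp add: nn_integral_cmult ennreal_mult_less_top emeasure_lborel_Icc_eq)
  finally have Bfin: "?B < \<top>" .
  \<comment> \<open>Terms cannot be moved across the equation \<open>sum\<close>, because the death
    clock may be infinite. Finite clocks are cancelled instead by multiplying with the inverses of
    their exponentials.\<close>
  have alg: "\<delta> * e = T * a" if "a * \<beta> = \<delta> * m" "\<beta> * e = 1" "m * T = 1" for a \<beta> \<delta> m e T :: ennreal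
  proof -
   have "\<delta> * e = (\<delta> * m) * (e * T)" using that(3) by (metis mult.assoc mult.commute mult.right_neutral)
   also have "\<dots> = a * T * (\<beta> * e)" by (simp add: that(1)[symmetric] mult_ac)
   finally show ?thesis by (simp add: that mult.commute)
  qed
  show ?thesis
  proof (rule alg)
   show "expm (pathclk (\<lambda>sg z. ennreal (d z + (bmax - b z))) r t w) * expm ?B = expm ?D * expm (ennreal (bmax * t))"
    by (simp only: sum flip: expm_add)
   show "expm (ennreal (bmax * t)) * ennreal (exp (bmax * t)) = 1"
    using expm_mult_exp[of "ennreal (bmax * t)"] t bmax by simp
  qed (rule expm_mult_exp[OF Bfin])
 qed
 have split: "weight (s + t) w = weight s w * (ennreal (exp (bmax * t)) * expm (pathclk (\<lambda>sg z. ennreal (d z + (bmax - b z))) s t w))"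
  if w[simp]: "w \<in> space \<Omega>" for w
 proof -
  have c: "clk (rate r w) (s + t) = clk (rate r w) s + clk (\<lambda>sg. rate r w (s + sg)) t" if [measurable]: "r \<in> borel_measurable borel" for r
   using s t by (intro clk_shift) auto
  have "clk (\<lambda>sg. rate b w (s + sg)) t < \<top>"
   using clk_rate_b_fin[of w "s + t"] c[OF b_measurable] by auto
  then show ?thesis
   unfolding weight_def c[OF d_measurable] c[OF b_measurable] expm_add loc[OF w, symmetric]
   by (simp add: exp_enn2real_add clk_rate_b_fin mult_ac)
 qed
 have W0: "weight t w = ennreal (exp (bmax * t)) * expm (pathclk (\<lambda>sg z. ennreal (d z + (bmax - b z))) 0 t w)" if "w \<in> space \<Omega>" for w
  using loc[OF that, of 0] by (simp add: weight_def)
 let ?G = "\<lambda>(sg::real) z. ennreal (d z + (bmax - b z))"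
 have wF: "weight s \<in> borel_measurable (F s)" using s by (rule weight_F)
 have "PP (s + t) h y = (\<integral>\<^sup>+w. ennreal (exp (bmax * t)) * (weight s w * (expm (pathclk ?G s t w) * h (Y (s + t) w))) \<partial>Q y)"
  unfolding PP_def by (intro nn_integral_cong) (simp add: split mult_ac)
 also have "\<dots> = ennreal (exp (bmax * t)) * (\<integral>\<^sup>+w. weight s w * (expm (pathclk ?G s t w) * h (Y (s + t) w)) \<partial>Q y)"
  by (rule nn_integral_cmult) measurable
 also have "(\<integral>\<^sup>+w. weight s w * (expm (pathclk ?G s t w) * h (Y (s + t) w)) \<partial>Q y) =
  (\<integral>\<^sup>+w. weight s w * (\<integral>\<^sup>+w'. expm (pathclk ?G 0 t w') * h (Y t w') \<partial>Q (Y s w)) \<partial>Q y)"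
  by (rule markov_expm[OF _ s t wF h weight_le[OF s] _ hD]) auto
 also have "ennreal (exp (bmax * t)) * \<dots> = (\<integral>\<^sup>+w. ennreal (exp (bmax * t)) * (weight s w * (\<integral>\<^sup>+w'. expm (pathclk ?G 0 t w') * h (Y t w') \<partial>Q (Y s w))) \<partial>Q y)"
  by (rule nn_integral_cmult[symmetric]) measurable
 also have "\<dots> = PP s (PP t h) y"
  unfolding PP_def
 proof (intro nn_integral_cong)
  fix w
  have "(\<integral>\<^sup>+w'. weight t w' * h (Y t w') \<partial>Q (Y s w)) = (\<integral>\<^sup>+w'. ennreal (exp (bmax * t)) * (expm (pathclk ?G 0 t w') * h (Y t w')) \<partial>Q (Y s w))"
   by (intro nn_integral_cong) (simp add: W0 mult_ac)
  also have "\<dots> = ennreal (exp (bmax * t)) * (\<integral>\<^sup>+w'. expm (pathclk ?G 0 t w') * h (Y t w') \<partial>Q (Y s w))"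
   by (rule nn_integral_cmult) measurable
  finally show "ennreal (exp (bmax * t)) * (weight s w * (\<integral>\<^sup>+w'. expm (pathclk ?G 0 t w') * h (Y t w') \<partial>Q (Y s w))) =
   weight s w * (\<integral>\<^sup>+w'. weight t w' * h (Y t w') \<partial>Q (Y s w))" by (simp add: mult_ac)
 qed
 finally show ?thesis .
qed

end

section \<open>Non-explosion and Laplace transforms of the population\<close>

context branching
begin

lemma labels_below_mono: "K \<le> K' ==> n \<le> n' ==> labels_below K n \<subseteq> labels_below K' n'"
 by (auto simp: labels_below_def)

lemma labels_below_finite_subset:
 assumes "finite A"
 obtains n where "A \<subseteq> labels_below n n"
proof -
 have "\<exists>n. A \<subseteq> labels_below n n"
  using assms
 proof (induction A rule: finite_induct)
  case (insert u A)
  then obtain n where "A \<subseteq> labels_below n n" by auto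
  obtain m where m: "\<forall>k\<in>set u. k < m" using finite_nat_set_iff_bounded[of "set u"] by auto
  let ?N = "max n (max m (Suc (length u)))"
  have "A \<subseteq> labels_below ?N ?N" using \<open>A \<subseteq> labels_below n n\<close> labels_below_mono[of n ?N n ?N] by auto
  moreover have "u \<in> labels_below ?N ?N"
   using m by (auto simp: labels_below_def less_max_iff_disj)
  ultimately show ?case by auto
 qed auto
 then show ?thesis using that by auto
qed

text \<open>An infimum of decreasing finite products, and therefore defined before the living
  population is known to be finite.\<close>

definition tree_prod :: "(real => ennreal) => real => 'w => ennreal" where
 "tree_prod f t om = (INF n. \<Prod>u\<in>labels_below n n. leaf f t u om)"

lemma leaf_prod_antimono:
 assumes "\<And>y. f y \<le> 1" "n \<le> m"
 shows "(\<Prod>u\<in>labels_below m m. leaf f t u om) \<le> (\<Prod>u\<in>labels_below n n. leaf f t u om)"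
proof -
 have "(\<Prod>u\<in>labels_below m m. leaf f t u om) =
  (\<Prod>u\<in>labels_below n n. leaf f t u om) * (\<Prod>u\<in>labels_below m m - labels_below n n. leaf f t u om)"
  using labels_below_mono[OF assms(2) assms(2)] finite_labels_below
  by (metis mult.commute prod.subset_diff)
 also have "\<dots> \<le> (\<Prod>u\<in>labels_below n n. leaf f t u om) * 1"
  using assms by (intro mult_left_mono prod_le_1) (auto simp: leaf_le_1)
 finally show ?thesis by simp
qed

lemma measurable_leaf_Pr [measurable]:
 "f \<in> borel_measurable borel ==> leaf f t u \<in> borel_measurable (Pr x)"
 by (rule measurable_leaf[OF L_measurable])

text \<open>The truncated functionals decrease in both cut-offs, so the iterated infimum may be
  taken along the diagonal; then monotone convergence applies to the decreasing products.\<close>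

lemma ext_tree:
 assumes [measurable]: "f \<in> borel_measurable borel" and f1: "\<And>y. f y \<le> 1" and t: "0 \<le> t"
 shows "ext f t x = (\<integral>\<^sup>+om. tree_prod f t om \<partial>Pr x)"
proof -
 have "ext f t x = (INF n. gen f n n t x)"
 proof (rule antisym)
  show "ext f t x \<le> (INF n. gen f n n t x)"
   unfolding ext_def genK_def by (intro INF_greatest) (auto intro!: INF_lower2)
  show "(INF n. gen f n n t x) \<le> ext f t x"
   unfolding ext_def genK_def
  proof (intro INF_greatest)
   fix K n
   have "gen f (max K n) (max K n) t x \<le> gen f K (max K n) t x" by (rule gen_antimono_K[OF f1]) simp
   also have "\<dots> \<le> gen f K n t x" by (rule gen_antimono_n[OF f1]) simp
   finally show "(INF n. gen f n n t x) \<le> gen f K n t x" by (rule INF_lower2[OF UNIV_I])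
  qed
 qed
 also have "\<dots> = (INF n. \<integral>\<^sup>+om. (\<Prod>u\<in>labels_below n n. leaf f t u om) \<partial>Pr x)"
  using gen_eq[where f=f and t=t, OF _ f1 t] by simp
 also have "\<dots> = (\<integral>\<^sup>+om. tree_prod f t om \<partial>Pr x)"
  unfolding tree_prod_def
 proof (rule nn_integral_monotone_convergence_INF_decseq[symmetric])
  show "decseq (\<lambda>n om. \<Prod>u\<in>labels_below n n. leaf f t u om)"
   by (intro monotoneI le_funI leaf_prod_antimono f1)
  have "(\<integral>\<^sup>+om. (\<Prod>u\<in>labels_below 0 0. leaf f t u om) \<partial>Pr x) \<le> (\<integral>\<^sup>+om. 1 \<partial>Pr x)"
   using f1 by (intro nn_integral_mono prod_le_1) (auto simp: leaf_le_1)
  then show "(\<integral>\<^sup>+om. (\<Prod>u\<in>labels_below 0 0. leaf f t u om) \<partial>Pr x) < \<infinity>"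
   using prob_space.emeasure_space_1[OF prob_space_Pr, of x] by (auto intro: le_less_trans)
 qed measurable
 finally show ?thesis .
qed

abbreviation aliv :: "real => 'w => nat list set" where
 "aliv t om \<equiv> alive X b d (tree om) t"

lemma leaf_prod_alive:
 "finite A ==> (\<Prod>u\<in>A. leaf f t u om) = (\<Prod>u\<in>A \<inter> aliv t om. f (trait_at X b (tree om) t u))"
 by (rule prod.mono_neutral_cong_right) (auto simp: leaf_def)

lemma tree_prod_finite:
 assumes f1: "\<And>y. f y \<le> 1" and fin: "finite (aliv t om)"
 shows "tree_prod f t om = (\<Prod>u\<in>aliv t om. f (trait_at X b (tree om) t u))"
proof -
 obtain N where N: "aliv t om \<subseteq> labels_below N N" using labels_below_finite_subset[OF fin] .
 have eq: "(\<Prod>u\<in>labels_below n n. leaf f t u om) = (\<Prod>u\<in>aliv t om. f (trait_at X b (tree om) t u))" if "N \<le> n" for n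
 proof -
  have "labels_below n n \<inter> aliv t om = aliv t om" using N labels_below_mono[OF that that] by auto
  then show ?thesis by (simp add: leaf_prod_alive finite_labels_below)
 qed
 show ?thesis
 proof (rule antisym)
  show "tree_prod f t om \<le> (\<Prod>u\<in>aliv t om. f (trait_at X b (tree om) t u))"
   unfolding tree_prod_def by (rule INF_lower2[of N]) (auto simp: eq)
  show "(\<Prod>u\<in>aliv t om. f (trait_at X b (tree om) t u)) \<le> tree_prod f t om"
   unfolding tree_prod_def
  proof (rule INF_greatest)
   fix n
   show "(\<Prod>u\<in>aliv t om. f (trait_at X b (tree om) t u)) \<le> (\<Prod>u\<in>labels_below n n. leaf f t u om)"
    using leaf_prod_antimono[where f=f, OF f1, of n "max n N" t om] eq[of "max n N"] by simp
  qed
 qed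
qed

text \<open>A constant below 1 detects explosion: infinitely many factors \<rho> force the product
  below every power of \<rho>.\<close>

lemma tree_prod_infinite:
 assumes \<rho>: "0 \<le> \<rho>" "\<rho> < 1" and inf: "infinite (aliv t om)"
 shows "tree_prod (\<lambda>_. ennreal \<rho>) t om = 0"
proof -
 have "tree_prod (\<lambda>_. ennreal \<rho>) t om \<le> ennreal (\<rho> ^ N)" for N
 proof -
  obtain B where B: "finite B" "card B = N" "B \<subseteq> aliv t om" using infinite_arbitrarily_large[OF inf] by blast
  obtain n where n: "B \<subseteq> labels_below n n" using labels_below_finite_subset[OF B(1)] .
  have "tree_prod (\<lambda>_. ennreal \<rho>) t om \<le> (\<Prod>u\<in>labels_below n n. leaf (\<lambda>_. ennreal \<rho>) t u om)"
   unfolding tree_prod_def by (rule INF_lower) simp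
  also have "\<dots> = ennreal (\<rho> ^ card (labels_below n n \<inter> aliv t om))"
   using \<rho> by (simp add: leaf_prod_alive finite_labels_below ennreal_power)
  also have "\<dots> \<le> ennreal (\<rho> ^ N)"
   using \<rho> B n by (intro ennreal_leI power_decreasing) (auto intro!: card_mono simp: finite_labels_below)
  finally show ?thesis .
 qed
 moreover have "(\<lambda>N. ennreal (\<rho> ^ N)) \<longlonglongrightarrow> ennreal 0"
  using \<rho> by (intro tendsto_ennrealI LIMSEQ_realpow_zero)
 ultimately have "tree_prod (\<lambda>_. ennreal \<rho>) t om \<le> ennreal 0" by (intro LIMSEQ_le_const) auto
 then show ?thesis by simp
qed

lemma measurable_aliv [measurable]: "Measurable.pred (Pr x) (\<lambda>om. u \<in> aliv t om)"
proof -
 have "(\<lambda>om. u \<in> aliv t om) = (\<lambda>om. leaf (\<lambda>_. 0) t u om = 0)" by (auto simp: leaf_def)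
 then show ?thesis by simp
qed

lemma measurable_finite_aliv [measurable]: "Measurable.pred (Pr x) (\<lambda>om. finite (aliv t om))"
proof -
 have "(\<lambda>om. finite (aliv t om)) = (\<lambda>om. \<exists>n. \<forall>u. u \<in> aliv t om \<longrightarrow> u \<in> labels_below n n)"
  by (auto simp: fun_eq_iff subset_iff[symmetric] intro: finite_subset[OF _ finite_labels_below] elim: labels_below_finite_subset)
    (metis labels_below_finite_subset)
 then show ?thesis by simp
qed

lemma mort_le_PP:
 assumes "f \<in> borel_measurable borel" "\<And>y. f y \<le> 1" "0 \<le> t"
 shows "mort f t y \<le> PP t (\<lambda>z. 1 - f z) y"
 by (subst mort_duhamel[OF assms, symmetric]) simp

text \<open>Test with a constant \<rho> below 1. The product vanishes on explosion, so the
  probability of explosion is at most \<open>mort\<close>, which by the Duhamel equation is at most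
  P_t (1 - \<rho>), hence at most exp(bmax t) (1 - \<rho>). Then \<rho> tends to 1.\<close>

lemma AE_finite_aliv:
 assumes t: "0 \<le> t"
 shows "AE om in Pr x. finite (aliv t om)"
proof -
 interpret P: prob_space "Pr x" by (rule prob_space_Pr)
 have bound: "P.prob {om \<in> space (Pr x). \<not> finite (aliv t om)} \<le> exp (bmax * t) * (1 - \<rho>)" if \<rho>: "0 \<le> \<rho>" "\<rho> < 1" for \<rho>
 proof -
  let ?f = "\<lambda>_::real. ennreal \<rho>"
  have f1: "?f y \<le> 1" for y using \<rho> by simp
  have "ext ?f t x \<le> (\<integral>\<^sup>+om. indicator {om \<in> space (Pr x). finite (aliv t om)} om \<partial>Pr x)"
   unfolding ext_tree[where f="?f", OF borel_measurable_const f1 t]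
  proof (intro nn_integral_mono)
   fix om assume "om \<in> space (Pr x)"
   moreover have "tree_prod ?f t om \<le> 1"
    unfolding tree_prod_def by (rule INF_lower2[of 0]) (auto intro!: prod_le_1 leaf_le_1 f1)
   ultimately show "tree_prod ?f t om \<le> indicator {om \<in> space (Pr x). finite (aliv t om)} om"
    using tree_prod_infinite[where t=t and om=om, OF \<rho>] by (auto split: split_indicator)
  qed
  also have "\<dots> = emeasure (Pr x) {om \<in> space (Pr x). finite (aliv t om)}" by simp
  finally have 1: "ext ?f t x \<le> ennreal (P.prob {om \<in> space (Pr x). finite (aliv t om)})"
   by (simp add: P.emeasure_eq_measure)
  have "mort ?f t x \<le> PP t (\<lambda>z. 1 - ?f z) x"
   by (rule mort_le_PP) (use f1 t in auto)
  also have "\<dots> \<le> ennreal (exp (bmax * t)) * ennreal (1 - \<rho>)"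
   using \<rho> by (intro PP_bound t) (simp add: ennreal_minus flip: ennreal_1)
  finally have 2: "mort ?f t x \<le> ennreal (exp (bmax * t) * (1 - \<rho>))" using \<rho> by (simp add: ennreal_mult)
  have "1 \<le> ext ?f t x + mort ?f t x"
   unfolding mort_def using ext_le_1[where f="?f", OF f1, of t x] by (simp add: add_diff_inverse_ennreal)
  also have "\<dots> \<le> ennreal (P.prob {om \<in> space (Pr x). finite (aliv t om)} + exp (bmax * t) * (1 - \<rho>))"
   using 1 2 \<rho> by (simp add: add_mono)
  finally have "1 \<le> P.prob {om \<in> space (Pr x). finite (aliv t om)} + exp (bmax * t) * (1 - \<rho>)"
   using \<rho> by (subst (asm) ennreal_1[symmetric], subst (asm) ennreal_le_iff) (auto intro!: add_nonneg_nonneg)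
  moreover have "P.prob {om \<in> space (Pr x). \<not> finite (aliv t om)} = 1 - P.prob {om \<in> space (Pr x). finite (aliv t om)}"
   by (rule P.prob_neg) measurable
  ultimately show ?thesis by simp
 qed
 have "P.prob {om \<in> space (Pr x). \<not> finite (aliv t om)} \<le> 0"
 proof (rule field_le_epsilon)
  fix e :: real assume e: "0 < e"
  \<comment> \<open>The minimum with 1/2 keeps \<rho> nonnegative when \<open>e\<close> is
    large.\<close>
  define \<rho> where "\<rho> = 1 - min (1/2) (e / exp (bmax * t))"
  have "0 \<le> \<rho>" "\<rho> < 1" "1 - \<rho> \<le> e / exp (bmax * t)" using e by (auto simp: \<rho>_def min_def)
  then have "exp (bmax * t) * (1 - \<rho>) \<le> e" by (simp add: field_simps)
  then show "P.prob {om \<in> space (Pr x). \<not> finite (aliv t om)} \<le> 0 + e"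
   using bound[OF \<open>0 \<le> \<rho>\<close> \<open>\<rho> < 1\<close>] by simp
 qed
 then have "P.prob {om \<in> space (Pr x). \<not> finite (aliv t om)} = 0" by (simp add: measure_le_0_iff)
 then show ?thesis by (simp add: AE_iff_measurable[OF _ refl] P.emeasure_eq_measure)
qed

lemma mort_tree:
 assumes [measurable]: "f \<in> borel_measurable borel" and f1: "\<And>y. f y \<le> 1" and t: "0 \<le> t"
 shows "mort f t x = (\<integral>\<^sup>+om. 1 - tree_prod f t om \<partial>Pr x)"
proof -
 have le: "tree_prod f t om \<le> 1" for om
  unfolding tree_prod_def by (rule INF_lower2[of 0]) (auto intro!: prod_le_1 simp: leaf_le_1 f1)
 have "(\<integral>\<^sup>+om. tree_prod f t om \<partial>Pr x) \<noteq> \<infinity>"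
  using ext_tree[where f=f, OF _ f1 t, of x] ext_le_1[where f=f, OF f1, of t x] by (auto simp: top_unique)
 then have "(\<integral>\<^sup>+om. 1 - tree_prod f t om \<partial>Pr x) = (\<integral>\<^sup>+om. 1 \<partial>Pr x) - (\<integral>\<^sup>+om. tree_prod f t om \<partial>Pr x)"
  by (intro nn_integral_diff AE_I2 le) (auto simp: tree_prod_def)
 then show ?thesis
  using ext_tree[where f=f, OF _ f1 t, of x] prob_space.emeasure_space_1[OF prob_space_Pr, of x] by (simp add: mort_def)
qed

lemma pop_size_pos_iff: "0 < pop_size X b d (tree om) t \<longleftrightarrow> finite (aliv t om) \<and> aliv t om \<noteq> {}"
 by (auto simp: pop_size_def pairing_def card_gt_0_iff)

text \<open>With \<open>f = 0\<close> the product is 1 for an empty population and 0 for a nonempty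
  finite one. Infinite populations, for which \<open>pop_size\<close> takes its default value 0,
  have probability zero.\<close>

lemma survival_mort:
 assumes t: "0 \<le> t"
 shows "ennreal (measure (Pr x) {om \<in> space (Pr x). 0 < pop_size X b d (tree om) t}) = mort (\<lambda>_. 0) t x"
proof -
 interpret P: prob_space "Pr x" by (rule prob_space_Pr)
 have m: "Measurable.pred (Pr x) (\<lambda>om. 0 < pop_size X b d (tree om) t)"
 proof -
  have "(\<lambda>om. 0 < pop_size X b d (tree om) t) = (\<lambda>om. finite (aliv t om) \<and> (\<exists>u. u \<in> aliv t om))"
   by (auto simp: pop_size_pos_iff)
  then show ?thesis by simp
 qed
 have "mort (\<lambda>_. 0) t x = (\<integral>\<^sup>+om. 1 - tree_prod (\<lambda>_. 0) t om \<partial>Pr x)"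
  using t by (intro mort_tree) auto
 also have "\<dots> = (\<integral>\<^sup>+om. indicator {om \<in> space (Pr x). 0 < pop_size X b d (tree om) t} om \<partial>Pr x)"
 proof (rule nn_integral_cong_AE)
  show "AE om in Pr x. 1 - tree_prod (\<lambda>_. 0) t om = indicator {om \<in> space (Pr x). 0 < pop_size X b d (tree om) t} om"
   using AE_finite_aliv[OF t, of x] AE_space
  proof eventually_elim
   case (elim om)
   then have "tree_prod (\<lambda>_. 0) t om = (if aliv t om = {} then 1 else 0)"
    by (subst tree_prod_finite) (auto intro!: prod_zero)
   then show ?case using elim by (auto simp: pop_size_pos_iff split: split_indicator)
  qed
 qed
 also have "\<dots> = emeasure (Pr x) {om \<in> space (Pr x). 0 < pop_size X b d (tree om) t}"
  using m by (intro nn_integral_indicator) simp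
 finally show ?thesis by (simp add: P.emeasure_eq_measure)
qed

lemma trait_alive: "u \<in> aliv t om ==> trait_at X b (tree om) t u = Y (age t u om) (fst (L u om))"
proof -
 assume u: "u \<in> aliv t om"
 then have "present t u om" by (auto simp: alive_def present_def)
 then show ?thesis by (elim present_finite) (simp add: trait_at_def Y_eq)
qed

text \<open>Sums over truncated label sets are eventually constant when the population is finite;
  otherwise the test on finiteness reproduces the default value 0 of \<open>pairing\<close>.\<close>

lemma measurable_pairing [measurable]:
 assumes [measurable]: "g \<in> borel_measurable borel"
 shows "(\<lambda>om. pairing X b d (tree om) t g) \<in> borel_measurable (Pr x)"
proof (rule borel_measurable_LIMSEQ_real)
 let ?s = "\<lambda>n om. if finite (aliv t om) then \<Sum>u\<in>labels_below n n. if u \<in> aliv t om then g (Y (age t u om) (fst (L u om))) else 0 else 0"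
 note [measurable] = measurable_age[OF L_measurable]
 show "?s n \<in> borel_measurable (Pr x)" for n by measurable
 fix om
 show "(\<lambda>n. ?s n om) \<longlonglongrightarrow> pairing X b d (tree om) t g"
 proof (cases "finite (aliv t om)")
  case True
  obtain N where N: "aliv t om \<subseteq> labels_below N N" using labels_below_finite_subset[OF True] .
  have "?s n om = pairing X b d (tree om) t g" if "N \<le> n" for n
  proof -
   have "aliv t om \<subseteq> labels_below n n" using N labels_below_mono[OF that that] by auto
   then have "pairing X b d (tree om) t g = (\<Sum>u\<in>labels_below n n. if u \<in> aliv t om then g (Y (age t u om) (fst (L u om))) else 0)"
    unfolding pairing_def by (intro sum.mono_neutral_cong_left) (auto simp: finite_labels_below trait_alive)
   then show ?thesis using True by simp
  qed
  then show ?thesis unfolding eventually_sequentially by (intro tendsto_eventually eventually_sequentiallyI)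
 qed (simp add: pairing_def)
qed

lemma laplace_mort:
 assumes [measurable]: "g \<in> borel_measurable borel" and g: "\<And>y. 0 \<le> g y" and \<theta>: "0 \<le> \<theta>" and t: "0 \<le> t"
 shows "mort (\<lambda>y. ennreal (exp (- \<theta> * g y))) t x = (\<integral>\<^sup>+om. ennreal (1 - exp (- \<theta> * pairing X b d (tree om) t g)) \<partial>Pr x)"
proof -
 let ?f = "\<lambda>y. ennreal (exp (- \<theta> * g y))"
 have f1: "?f y \<le> 1" for y using \<theta> g by simp
 have "mort ?f t x = (\<integral>\<^sup>+om. 1 - tree_prod ?f t om \<partial>Pr x)"
  by (rule mort_tree) (use f1 t in auto)
 also have "\<dots> = (\<integral>\<^sup>+om. ennreal (1 - exp (- \<theta> * pairing X b d (tree om) t g)) \<partial>Pr x)"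
 proof (rule nn_integral_cong_AE)
  show "AE om in Pr x. 1 - tree_prod ?f t om = ennreal (1 - exp (- \<theta> * pairing X b d (tree om) t g))"
   using AE_finite_aliv[OF t, of x]
  proof eventually_elim
   case (elim om)
   have "tree_prod ?f t om = (\<Prod>u\<in>aliv t om. ?f (trait_at X b (tree om) t u))"
    by (rule tree_prod_finite) (use f1 elim in auto)
   also have "\<dots> = ennreal (\<Prod>u\<in>aliv t om. exp (- \<theta> * g (trait_at X b (tree om) t u)))"
    by (rule prod_ennreal) simp
   also have "(\<Prod>u\<in>aliv t om. exp (- \<theta> * g (trait_at X b (tree om) t u))) = exp (- \<theta> * pairing X b d (tree om) t g)"
    using elim by (simp add: pairing_def exp_sum[symmetric] sum_distrib_left sum_negf)
   finally show ?case by (simp add: ennreal_minus flip: ennreal_1)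
  qed
 qed
 finally show ?thesis .
qed

lemma pairing_nonneg: "(\<And>y. 0 \<le> g y) ==> 0 \<le> pairing X b d T t g"
 by (simp add: pairing_def sum_nonneg)

end

section \<open>Finite differences and the recursion of the moments\<close>

lemma alternating_binomial: "(\<Sum>j\<le>n. (-1) ^ j * real (n choose j) * p ^ j) = (1 - p) ^ n"
proof -
 have "(1 - p) ^ n = ((- p) + 1) ^ n" by simp
 also have "\<dots> = (\<Sum>j\<le>n. real (n choose j) * (- p) ^ j * 1 ^ (n - j))" by (rule binomial_ring)
 also have "\<dots> = (\<Sum>j\<le>n. (-1) ^ j * real (n choose j) * p ^ j)"
  by (intro sum.cong) (auto simp: power_minus[of p] mult_ac)
 finally show ?thesis ..
qed

lemma sum_atMost_ends:
 fixes f :: "nat => real"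
 assumes "1 \<le> n"
 shows "(\<Sum>k\<le>n. f k) = f 0 + (\<Sum>k\<in>{1..<n}. f k) + f n"
proof -
 have "{..n} = insert 0 (insert n {1..<n})" using assms by auto
 then show ?thesis using assms by simp
qed

text \<open>The left side comes from the quadratic term of the Duhamel equation for the functionals
 \<open>1 - q^j\<close>, after taking the finite difference that turns \<open>1 - q^j\<close> into \<open>(1 - q)^n\<close>.\<close>

lemma (in prob_space) alternating_square_sum:
 assumes q[measurable]: "q \<in> borel_measurable M" and q01: "\<And>om. 0 \<le> q om" "\<And>om. q om \<le> (1::real)" and n: "1 \<le> n"
 shows "(\<Sum>j\<le>n. (-1) ^ j * real (n choose j) * (expectation (\<lambda>om. 1 - q om ^ j))\<^sup>2) =
  (\<Sum>k\<in>{1..<n}. real (n choose k) * expectation (\<lambda>om. (1 - q om) ^ k * q om ^ (n - k)) * expectation (\<lambda>om. (1 - q om) ^ (n - k)))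
  - expectation (\<lambda>om. (1 - q om) ^ n) * expectation (\<lambda>om. 1 - q om ^ n)"
proof -
 have int: "integrable M (\<lambda>om. (1 - q om) ^ k * q om ^ l)" for k l
  by (rule integrable_const_bound[where B=1])
    (auto simp: q01 abs_mult power_abs intro!: AE_I2 mult_le_one power_le_one)
 have int1[simp]: "integrable M (\<lambda>om. q om ^ l)" and int2[simp]: "integrable M (\<lambda>om. (1 - q om) ^ k)" for k l
  using int[of 0 l] int[of k 0] by auto
 have int3[simp]: "integrable M (\<lambda>om. 1 - q om ^ l)" for l by auto
 let ?D = "\<lambda>k. expectation (\<lambda>om. (1 - q om) ^ k)"
 \<comment> \<open>One factor of the square is frozen at a value p and the other one averaged, as
   for two independent copies of q; integrating over p comes last.\<close>
 have fixed: "(\<Sum>j\<le>n. (-1) ^ j * real (n choose j) * ((1 - p ^ j) * expectation (\<lambda>om. 1 - q om ^ j))) =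
  (\<Sum>k\<in>{1..<n}. real (n choose k) * ((1 - p) ^ k * p ^ (n - k)) * ?D (n - k)) - ?D n * (1 - p ^ n)" for p
 proof -
  have "(\<Sum>j\<le>n. (-1) ^ j * real (n choose j) * ((1 - p ^ j) * expectation (\<lambda>om. 1 - q om ^ j))) =
   expectation (\<lambda>om. \<Sum>j\<le>n. (-1) ^ j * real (n choose j) * ((1 - p ^ j) * (1 - q om ^ j)))"
   by simp
  also have "\<dots> = expectation (\<lambda>om. (\<Sum>k\<le>n. real (n choose k) * ((1 - p) ^ k * p ^ (n - k)) * (1 - q om) ^ (n - k)) - (1 - p) ^ n - (1 - q om) ^ n)"
  proof (intro Bochner_Integration.integral_cong refl)
   fix om
   have "(\<Sum>j\<le>n. (-1) ^ j * real (n choose j) * ((1 - p ^ j) * (1 - q om ^ j))) =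
    (\<Sum>j\<le>n. (-1) ^ j * real (n choose j) * 1 ^ j) - (\<Sum>j\<le>n. (-1) ^ j * real (n choose j) * p ^ j)
    - (\<Sum>j\<le>n. (-1) ^ j * real (n choose j) * q om ^ j) + (\<Sum>j\<le>n. (-1) ^ j * real (n choose j) * (p * q om) ^ j)"
    unfolding sum_subtractf[symmetric] sum.distrib[symmetric]
    by (intro sum.cong) (auto simp: algebra_simps power_mult_distrib)
   also have "\<dots> = (1 - p * q om) ^ n - (1 - p) ^ n - (1 - q om) ^ n"
    unfolding alternating_binomial using n by simp
   \<comment> \<open>Splitting 1 - p q as (1 - p) + p (1 - q) makes the binomial expansion a sum of
     products of a function of p and a function of q.\<close>
   also have "(1 - p * q om) ^ n = ((1 - p) + p * (1 - q om)) ^ n" by (simp add: algebra_simps)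
   also have "\<dots> = (\<Sum>k\<le>n. real (n choose k) * (1 - p) ^ k * (p * (1 - q om)) ^ (n - k))" by (rule binomial_ring)
   also have "\<dots> = (\<Sum>k\<le>n. real (n choose k) * ((1 - p) ^ k * p ^ (n - k)) * (1 - q om) ^ (n - k))"
    by (intro sum.cong) (auto simp: power_mult_distrib)
   finally show "(\<Sum>j\<le>n. (-1) ^ j * real (n choose j) * ((1 - p ^ j) * (1 - q om ^ j))) =
    (\<Sum>k\<le>n. real (n choose k) * ((1 - p) ^ k * p ^ (n - k)) * (1 - q om) ^ (n - k)) - (1 - p) ^ n - (1 - q om) ^ n" .
  qed
  also have "\<dots> = (\<Sum>k\<le>n. real (n choose k) * ((1 - p) ^ k * p ^ (n - k)) * ?D (n - k)) - (1 - p) ^ n - ?D n"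
   by (simp add: prob_space)
  also have "\<dots> = (\<Sum>k\<in>{1..<n}. real (n choose k) * ((1 - p) ^ k * p ^ (n - k)) * ?D (n - k)) - ?D n * (1 - p ^ n)"
   by (subst sum_atMost_ends[OF n]) (simp add: algebra_simps prob_space)
  finally show ?thesis .
 qed
 have "(\<Sum>j\<le>n. (-1) ^ j * real (n choose j) * (expectation (\<lambda>om. 1 - q om ^ j))\<^sup>2) =
  expectation (\<lambda>om. \<Sum>j\<le>n. (-1) ^ j * real (n choose j) * ((1 - q om ^ j) * expectation (\<lambda>om. 1 - q om ^ j)))"
  by (simp add: power2_eq_square)
 also have "\<dots> = expectation (\<lambda>om. (\<Sum>k\<in>{1..<n}. real (n choose k) * ((1 - q om) ^ k * q om ^ (n - k)) * ?D (n - k)) - ?D n * (1 - q om ^ n))"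
  by (simp only: fixed)
 also have "\<dots> = (\<Sum>k\<in>{1..<n}. real (n choose k) * expectation (\<lambda>om. (1 - q om) ^ k * q om ^ (n - k)) * ?D (n - k))
  - ?D n * expectation (\<lambda>om. 1 - q om ^ n)"
  using int by (subst Bochner_Integration.integral_diff) auto
 finally show ?thesis .
qed

context branching
begin

text \<open>The kernel of the semigroup as a measure: its integrals are P_t h (y). Together with the
  space-time measure \<open>nu\<close> of the next definition, which carries ds P_s (y, dz) on
  \<open>{0..t}\<close>, it turns the Duhamel equation into one between integrals against finite
  measures, where subtraction is legitimate.\<close>

definition kappa :: "real => real => real measure" where
 "kappa t y = distr (density (Q y) (weight t)) borel (Y t)"

definition nu :: "real => real => (real \<times> real) measure" where
 "nu t y = distr (density (lborel \<Otimes>\<^sub>M Q y) (\<lambda>(s, w). weight s w * indicator {0..t} s)) borel2 (\<lambda>(s, w). (s, Y s w))"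

lemma sets_kappa [simp, measurable_cong]: "sets (kappa t y) = sets borel"
 and space_kappa [simp]: "space (kappa t y) = UNIV"
 by (simp_all add: kappa_def)

lemma sets_nu [simp, measurable_cong]: "sets (nu t y) = sets borel2"
 and space_nu [simp]: "space (nu t y) = UNIV"
 by (simp_all add: nu_def space_pair_measure)

lemma nn_integral_kappa:
 assumes [measurable]: "h \<in> borel_measurable borel"
 shows "(\<integral>\<^sup>+z. h z \<partial>kappa t y) = PP t h y"
 unfolding kappa_def PP_def by (subst nn_integral_distr, measurable, subst nn_integral_density) auto

lemma nn_integral_nu:
 assumes [measurable]: "h \<in> borel_measurable borel2"
 shows "(\<integral>\<^sup>+z. h z \<partial>nu t y) = (\<integral>\<^sup>+s\<in>{0..t}. PP s (\<lambda>z. h (s, z)) y \<partial>lborel)"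
proof -
 interpret Q: prob_space "Q y" by (rule prob_space_Q)
 have "(\<integral>\<^sup>+z. h z \<partial>nu t y) = (\<integral>\<^sup>+x. (case x of (s, w) => weight s w * indicator {0..t} s * h (s, Y s w)) \<partial>(lborel \<Otimes>\<^sub>M Q y))"
  unfolding nu_def
  by (subst nn_integral_distr, measurable, subst nn_integral_density) (auto simp: case_prod_beta')
 also have "\<dots> = (\<integral>\<^sup>+s. \<integral>\<^sup>+w. weight s w * indicator {0..t} s * h (s, Y s w) \<partial>Q y \<partial>lborel)"
  by (subst Q.nn_integral_fst[symmetric]) auto
 also have "\<dots> = (\<integral>\<^sup>+s\<in>{0..t}. PP s (\<lambda>z. h (s, z)) y \<partial>lborel)"
  unfolding PP_def
  by (intro nn_integral_cong, subst nn_integral_multc[symmetric]) (auto simp: mult_ac)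
 finally show ?thesis .
qed

lemma emeasure_kappa: "0 \<le> t ==> emeasure (kappa t y) UNIV \<le> ennreal (exp (bmax * t))"
 using nn_integral_kappa[of "\<lambda>_. 1" t y] PP_bound[of t "\<lambda>_. 1" 1 y] by simp

lemma finite_measure_kappa: "0 \<le> t ==> finite_measure (kappa t y)"
 using emeasure_kappa[of t y] by (intro finite_measureI) (auto simp: top_unique)

lemma emeasure_nu:
 assumes "0 \<le> t" shows "emeasure (nu t y) UNIV \<le> ennreal (t * exp (bmax * t))"
proof -
 have "emeasure (nu t y) UNIV = (\<integral>\<^sup>+s\<in>{0..t}. PP s (\<lambda>z. 1) y \<partial>lborel)"
  using nn_integral_nu[of "\<lambda>_. 1" t y] by simp
 also have "\<dots> \<le> (\<integral>\<^sup>+s. ennreal (exp (bmax * t)) * indicator {0..t} s \<partial>lborel)"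
 proof (intro nn_integral_mono)
  fix s :: real
  have "PP s (\<lambda>z. 1) y \<le> ennreal (exp (bmax * t))" if "0 \<le> s" "s \<le> t"
  proof -
   have "PP s (\<lambda>z. 1) y \<le> ennreal (exp (bmax * s)) * 1" using that by (intro PP_bound) auto
   also have "\<dots> \<le> ennreal (exp (bmax * t))" using that bmax by (auto intro!: ennreal_leI)
   finally show ?thesis .
  qed
  then show "PP s (\<lambda>z. 1) y * indicator {0..t} s \<le> ennreal (exp (bmax * t)) * indicator {0..t} s"
   by (auto split: split_indicator)
 qed
 also have "\<dots> = ennreal (t * exp (bmax * t))" using assms by (simp add: nn_integral_cmult_indicator ennreal_mult) (simp add: mult.commute)
 finally show ?thesis .
qed

lemma finite_measure_nu: "0 \<le> t ==> finite_measure (nu t y)"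
 using emeasure_nu[of t y] by (intro finite_measureI) (auto simp: top_unique)

lemma measure_nu: "0 \<le> t ==> measure (nu t y) UNIV \<le> t * exp (bmax * t)"
 using emeasure_nu[of t y] by (simp add: measure_def enn2real_leI)

lemma measure_kappa: "0 \<le> t ==> measure (kappa t y) UNIV \<le> exp (bmax * t)"
 using emeasure_kappa[of t y] by (simp add: measure_def enn2real_leI)

lemma AE_nu: "AE x in nu t y. 0 \<le> fst x \<and> fst x \<le> t"
 unfolding nu_def
 by (subst AE_distr_iff) (auto simp: AE_density case_prod_beta intro!: AE_I2 split: split_indicator)

definition lapl :: "real => (real => real) => real => real => real" where
 "lapl \<theta> g t x = enn2real (mort (\<lambda>y. ennreal (exp (- \<theta> * g y))) t x)"

lemma measurable_lapl [measurable]: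
 assumes [measurable]: "g \<in> borel_measurable borel"
 shows "(\<lambda>(t, x). lapl \<theta> g t x) \<in> borel_measurable borel2"
 unfolding lapl_def by measurable

lemma lapl_bounds: "0 \<le> lapl \<theta> g t x" "lapl \<theta> g t x \<le> 1"
 by (auto simp: lapl_def intro!: enn2real_leI mort_le_1)

lemma ennreal_lapl: "ennreal (lapl \<theta> g t x) = mort (\<lambda>y. ennreal (exp (- \<theta> * g y))) t x"
 unfolding lapl_def by (rule ennreal_enn2real) (rule le_less_trans[OF mort_le_1], simp)

definition pr :: "(real => real) => real => 'w => real" where
 "pr g t om = pairing X b d (tree om) t g"

lemma measurable_pr [measurable]: "g \<in> borel_measurable borel ==> pr g t \<in> borel_measurable (Pr x)"
 unfolding pr_def[abs_def] by measurable

lemma pr_nonneg: "(\<And>y. 0 \<le> g y) ==> 0 \<le> pr g t om"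
 unfolding pr_def by (rule pairing_nonneg)

lemma lapl_expectation:
 assumes [measurable]: "g \<in> borel_measurable borel" and g: "\<And>y. 0 \<le> g y" and \<theta>: "0 \<le> \<theta>" and t: "0 \<le> t"
 shows "lapl \<theta> g t x = (LINT om|Pr x. 1 - exp (- \<theta> * pr g t om))"
 unfolding lapl_def laplace_mort[OF assms] pr_def[symmetric]
 by (rule integral_eq_nn_integral[symmetric]) (use pr_nonneg[of g t] g \<theta> in auto)

lemma lapl_duhamel:
 assumes [measurable]: "g \<in> borel_measurable borel" and g: "\<And>y. 0 \<le> g y" and \<theta>: "0 \<le> \<theta>" and t: "0 \<le> t"
 shows "lapl \<theta> g t y = (LINT z|kappa t y. 1 - exp (- \<theta> * g z)) - (LINT x|nu t y. b (snd x) * (lapl \<theta> g (t - fst x) (snd x))\<^sup>2)"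
proof -
 interpret K: finite_measure "kappa t y" by (rule finite_measure_kappa[OF t])
 interpret N: finite_measure "nu t y" by (rule finite_measure_nu[OF t])
 let ?f = "\<lambda>y. ennreal (exp (- \<theta> * g y))"
 have h: "0 \<le> 1 - exp (- \<theta> * g z)" "1 - exp (- \<theta> * g z) \<le> 1" for z using g \<theta> by auto
 have "mort ?f t y + (\<integral>\<^sup>+s\<in>{0..t}. PP s (\<lambda>z. ennreal (b z) * mort ?f (t - s) z ^ 2) y \<partial>lborel) = PP t (\<lambda>z. 1 - ?f z) y"
  by (rule mort_duhamel) (use g \<theta> t in auto)
 moreover have "PP t (\<lambda>z. 1 - ?f z) y = ennreal (LINT z|kappa t y. 1 - exp (- \<theta> * g z))"
 proof -
  have "PP t (\<lambda>z. 1 - ?f z) y = (\<integral>\<^sup>+z. ennreal (1 - exp (- \<theta> * g z)) \<partial>kappa t y)"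
   by (subst nn_integral_kappa) (auto simp: ennreal_minus simp flip: ennreal_1)
  also have "\<dots> = ennreal (LINT z|kappa t y. 1 - exp (- \<theta> * g z))"
   by (rule nn_integral_eq_integral) (use h in \<open>auto intro!: K.integrable_const_bound[where B=1] simp: abs_le_iff\<close>)
  finally show ?thesis .
 qed
 moreover have "(\<integral>\<^sup>+s\<in>{0..t}. PP s (\<lambda>z. ennreal (b z) * mort ?f (t - s) z ^ 2) y \<partial>lborel) =
  ennreal (LINT x|nu t y. b (snd x) * (lapl \<theta> g (t - fst x) (snd x))\<^sup>2)"
 proof -
  have "(\<integral>\<^sup>+s\<in>{0..t}. PP s (\<lambda>z. ennreal (b z) * mort ?f (t - s) z ^ 2) y \<partial>lborel) =
   (\<integral>\<^sup>+x. ennreal (b (snd x) * (lapl \<theta> g (t - fst x) (snd x))\<^sup>2) \<partial>nu t y)"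
  proof (subst nn_integral_nu)
   have "ennreal (b z * (lapl \<theta> g s z)\<^sup>2) = ennreal (b z) * mort ?f s z ^ 2" for s z
    unfolding ennreal_lapl[symmetric] by (simp add: ennreal_mult b_nonneg lapl_bounds ennreal_power)
   then show "(\<integral>\<^sup>+s\<in>{0..t}. PP s (\<lambda>z. ennreal (b z) * mort ?f (t - s) z ^ 2) y \<partial>lborel) =
    (\<integral>\<^sup>+s\<in>{0..t}. PP s (\<lambda>z. ennreal (b (snd (s, z)) * (lapl \<theta> g (t - fst (s, z)) (snd (s, z)))\<^sup>2)) y \<partial>lborel)"
    by simp
  qed measurable
  also have "\<dots> = ennreal (LINT x|nu t y. b (snd x) * (lapl \<theta> g (t - fst x) (snd x))\<^sup>2)"
  proof (rule nn_integral_eq_integral)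
   have "\<bar>b z * (lapl \<theta> g s z)\<^sup>2\<bar> \<le> bmax * 1" for s z
    using lapl_bounds[of \<theta> g s z] bmax(2)[of z] b_nonneg[of z] unfolding abs_mult
    by (intro mult_mono) (auto simp: power_le_one bmax less_imp_le[OF bmax(1)])
   then show "integrable (nu t y) (\<lambda>x. b (snd x) * (lapl \<theta> g (t - fst x) (snd x))\<^sup>2)"
    by (intro N.integrable_const_bound[where B="bmax * 1"]) auto
  qed (auto simp: b_nonneg)
  finally show ?thesis .
 qed
 ultimately have "ennreal (lapl \<theta> g t y) + ennreal (LINT x|nu t y. b (snd x) * (lapl \<theta> g (t - fst x) (snd x))\<^sup>2) =
  ennreal (LINT z|kappa t y. 1 - exp (- \<theta> * g z))"
  by (simp add: ennreal_lapl)
 moreover have ?thesis if "ennreal (lapl \<theta> g t y) + ennreal (LINT x|nu t y. b (snd x) * (lapl \<theta> g (t - fst x) (snd x))\<^sup>2) =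
  ennreal (LINT z|kappa t y. 1 - exp (- \<theta> * g z))"
 proof -
  have alg: "r + s = u" if "ennreal r + ennreal s = ennreal u" "0 \<le> r" "0 \<le> s" "0 \<le> u" for r s u
   using that by (simp add: ennreal_plus[symmetric] del: ennreal_plus)
  from that have "lapl \<theta> g t y + (LINT x|nu t y. b (snd x) * (lapl \<theta> g (t - fst x) (snd x))\<^sup>2) = (LINT z|kappa t y. 1 - exp (- \<theta> * g z))"
   by (rule alg) (auto simp: lapl_bounds b_nonneg h intro!: lint_nonneg mult_nonneg_nonneg g \<theta>)
  then show ?thesis by simp
 qed
 ultimately show ?thesis by blast
qed

text \<open>An n-th finite difference in \<theta>, equal to the expectation of (1 - exp(- \<theta>
  <Z,g>))^n by \<open>diffpow_eq\<close>. Defining it through \<open>lapl\<close> makes it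
  measurable in the trait and lets the Duhamel equation be applied term by term.\<close>

definition diffpow :: "nat => real => (real => real) => real => real => real" where
 "diffpow n \<theta> g t x = - (\<Sum>j\<le>n. (-1) ^ j * real (n choose j) * lapl (real j * \<theta>) g t x)"

text \<open>The same finite difference applied to the squares, that is, to the quadratic term of the
  Duhamel equation.\<close>

definition inter :: "nat => real => (real => real) => real => real => real" where
 "inter n \<theta> g t x = (\<Sum>j\<le>n. (-1) ^ j * real (n choose j) * (lapl (real j * \<theta>) g t x)\<^sup>2)"

lemma measurable_diffpow [measurable]:
 assumes [measurable]: "g \<in> borel_measurable borel"
 shows "(\<lambda>(t, x). diffpow n \<theta> g t x) \<in> borel_measurable borel2"
 unfolding diffpow_def by measurable

lemma measurable_inter [measurable]:
 assumes [measurable]: "g \<in> borel_measurable borel"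
 shows "(\<lambda>(t, x). inter n \<theta> g t x) \<in> borel_measurable borel2"
 unfolding inter_def by measurable

context
 fixes g :: "real => real" and \<theta> :: real
 assumes g[measurable]: "g \<in> borel_measurable borel" and g0: "\<And>y. 0 \<le> g y" and \<theta>: "0 \<le> \<theta>"
begin

lemma exp_mult_power: "exp (- (real j * \<theta>) * w) = exp (- \<theta> * w) ^ j"
 by (simp add: exp_of_nat_mult[symmetric] mult_ac)

lemma
 assumes t: "0 \<le> t"
 shows exp_pr_bounds: "0 \<le> exp (- \<theta> * pr g t om)" "exp (- \<theta> * pr g t om) \<le> 1"
  and integrable_exp_pr: "integrable (Pr x) (\<lambda>om. (1 - exp (- \<theta> * pr g t om)) ^ k * exp (- \<theta> * pr g t om) ^ l)"
proof -
 interpret P: prob_space "Pr x" by (rule prob_space_Pr)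
 have *: "exp (- \<theta> * pr g t om) \<le> 1" for om using pr_nonneg[of g t om] g0 \<theta> by simp
 show "0 \<le> exp (- \<theta> * pr g t om)" "exp (- \<theta> * pr g t om) \<le> 1" using * by auto
 show "integrable (Pr x) (\<lambda>om. (1 - exp (- \<theta> * pr g t om)) ^ k * exp (- \<theta> * pr g t om) ^ l)"
  using * by (intro P.integrable_const_bound[where B=1]) (auto simp: abs_mult power_abs intro!: AE_I2 mult_le_one power_le_one)
qed

lemma diffpow_eq:
 assumes t: "0 \<le> t" and n: "1 \<le> n"
 shows "diffpow n \<theta> g t x = (LINT om|Pr x. (1 - exp (- \<theta> * pr g t om)) ^ n)"
proof -
 interpret P: prob_space "Pr x" by (rule prob_space_Pr)
 let ?q = "\<lambda>om. exp (- \<theta> * pr g t om)"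
 have [simp]: "integrable (Pr x) (\<lambda>om. exp (- (\<theta> * pr g t om)) ^ l)" for l using integrable_exp_pr[OF t, of x 0 l] by simp
 have "diffpow n \<theta> g t x = - (\<Sum>j\<le>n. (-1) ^ j * real (n choose j) * (LINT om|Pr x. 1 - ?q om ^ j))"
  unfolding diffpow_def
  by (intro arg_cong[where f=uminus] sum.cong refl arg_cong2[where f="(*)"] , subst lapl_expectation)
    (use g0 \<theta> t in \<open>auto simp only: exp_mult_power g intro!: mult_nonneg_nonneg of_nat_0_le_iff\<close>)
 also have "\<dots> = (LINT om|Pr x. - (\<Sum>j\<le>n. (-1) ^ j * real (n choose j) * (1 - ?q om ^ j)))"
  by simp
 also have "\<dots> = (LINT om|Pr x. (1 - ?q om) ^ n)"
 proof (intro Bochner_Integration.integral_cong refl)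
  fix om
  have "- (\<Sum>j\<le>n. (-1) ^ j * real (n choose j) * (1 - ?q om ^ j)) =
   (\<Sum>j\<le>n. (-1) ^ j * real (n choose j) * ?q om ^ j) - (\<Sum>j\<le>n. (-1) ^ j * real (n choose j) * 1 ^ j)"
   by (simp add: right_diff_distrib sum_subtractf)
  then show "- (\<Sum>j\<le>n. (-1) ^ j * real (n choose j) * (1 - ?q om ^ j)) = (1 - ?q om) ^ n"
   unfolding alternating_binomial using n by simp
 qed
 finally show ?thesis .
qed

lemma inter_eq:
 assumes t: "0 \<le> t" and n: "1 \<le> n"
 shows "inter n \<theta> g t x =
  (\<Sum>k\<in>{1..<n}. real (n choose k) * (LINT om|Pr x. (1 - exp (- \<theta> * pr g t om)) ^ k * exp (- \<theta> * pr g t om) ^ (n - k)) *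
    (LINT om|Pr x. (1 - exp (- \<theta> * pr g t om)) ^ (n - k)))
  - (LINT om|Pr x. (1 - exp (- \<theta> * pr g t om)) ^ n) * (LINT om|Pr x. 1 - exp (- \<theta> * pr g t om) ^ n)"
proof -
 interpret P: prob_space "Pr x" by (rule prob_space_Pr)
 have "inter n \<theta> g t x = (\<Sum>j\<le>n. (-1) ^ j * real (n choose j) * (LINT om|Pr x. 1 - exp (- \<theta> * pr g t om) ^ j)\<^sup>2)"
  unfolding inter_def
  by (intro sum.cong refl arg_cong2[where f="(*)"] arg_cong[where f="\<lambda>z. z\<^sup>2"], subst lapl_expectation)
    (use g0 \<theta> t in \<open>auto simp only: exp_mult_power g intro!: mult_nonneg_nonneg of_nat_0_le_iff\<close>)
 moreover have "(\<lambda>om. exp (- \<theta> * pr g t om)) \<in> borel_measurable (Pr x)" by measurable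
 ultimately show ?thesis
  using P.alternating_square_sum[OF _ exp_pr_bounds[OF t] n] by simp
qed

text \<open>The Duhamel equations for the parameters j \<theta> are combined with the coefficients
  of the n-th difference. The sign in front of the difference makes the quadratic term enter with a
  plus sign.\<close>

lemma diffpow_duhamel:
 assumes t: "0 \<le> t" and n: "1 \<le> n"
 shows "diffpow n \<theta> g t y = (LINT z|kappa t y. (1 - exp (- \<theta> * g z)) ^ n) + (LINT x|nu t y. b (snd x) * inter n \<theta> g (t - fst x) (snd x))"
proof -
 interpret K: finite_measure "kappa t y" by (rule finite_measure_kappa[OF t])
 interpret N: finite_measure "nu t y" by (rule finite_measure_nu[OF t])
 let ?c = "\<lambda>j. (-1) ^ j * real (n choose j)"
 have e: "0 \<le> exp (- \<theta> * g z)" "exp (- \<theta> * g z) \<le> 1" for z using g0 \<theta> by auto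
 have i1[simp]: "integrable (kappa t y) (\<lambda>z. exp (- (\<theta> * g z)) ^ j)" for j
  using e by (intro K.integrable_const_bound[where B=1]) (auto intro!: AE_I2 power_le_one simp: power_abs)
 have bd: "\<bar>b z * (lapl \<theta>' g s z)\<^sup>2\<bar> \<le> bmax * 1" for s z \<theta>'
  using lapl_bounds[of \<theta>' g s z] bmax(2)[of z] b_nonneg[of z] unfolding abs_mult
  by (intro mult_mono) (auto simp: power_le_one bmax less_imp_le[OF bmax(1)])
 have i2[simp]: "integrable (nu t y) (\<lambda>x. b (snd x) * (lapl \<theta>' g (t - fst x) (snd x))\<^sup>2)" for \<theta>'
  using bd by (intro N.integrable_const_bound[where B="bmax * 1"]) auto
 have "diffpow n \<theta> g t y = - (\<Sum>j\<le>n. ?c j * ((LINT z|kappa t y. 1 - exp (- \<theta> * g z) ^ j) - (LINT x|nu t y. b (snd x) * (lapl (real j * \<theta>) g (t - fst x) (snd x))\<^sup>2)))"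
  unfolding diffpow_def
  by (intro arg_cong[where f=uminus] sum.cong refl arg_cong2[where f="(*)"], subst lapl_duhamel)
    (use g0 \<theta> t in \<open>auto simp only: exp_mult_power g intro!: mult_nonneg_nonneg of_nat_0_le_iff\<close>)
 also have "\<dots> = (LINT z|kappa t y. - (\<Sum>j\<le>n. ?c j * (1 - exp (- \<theta> * g z) ^ j))) + (LINT x|nu t y. (\<Sum>j\<le>n. ?c j * (b (snd x) * (lapl (real j * \<theta>) g (t - fst x) (snd x))\<^sup>2)))"
  by (simp add: right_diff_distrib sum_subtractf) (simp add: sum_distrib_left mult_ac)
 also have "(\<lambda>z. - (\<Sum>j\<le>n. ?c j * (1 - exp (- \<theta> * g z) ^ j))) = (\<lambda>z. (1 - exp (- \<theta> * g z)) ^ n)"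
 proof
  fix z
  have "- (\<Sum>j\<le>n. ?c j * (1 - exp (- \<theta> * g z) ^ j)) =
   (\<Sum>j\<le>n. ?c j * exp (- \<theta> * g z) ^ j) - (\<Sum>j\<le>n. ?c j * 1 ^ j)"
   by (simp add: right_diff_distrib sum_subtractf)
  then show "- (\<Sum>j\<le>n. ?c j * (1 - exp (- \<theta> * g z) ^ j)) = (1 - exp (- \<theta> * g z)) ^ n"
   unfolding alternating_binomial using n by simp
 qed
 also have "(\<lambda>x. (\<Sum>j\<le>n. ?c j * (b (snd x) * (lapl (real j * \<theta>) g (t - fst x) (snd x))\<^sup>2))) = (\<lambda>x. b (snd x) * inter n \<theta> g (t - fst x) (snd x))"
  by (simp add: inter_def sum_distrib_left mult_ac)
 finally show ?thesis .
qed

end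

end

lemma one_minus_exp_le: "0 \<le> (w::real) ==> 0 \<le> \<theta> ==> 1 - exp (- \<theta> * w) \<le> \<theta> * w"
 using exp_ge_add_one_self[of "- \<theta> * w"] by simp

lemma tendsto_one_minus_exp: "(\<lambda>k. real (Suc k) * (1 - exp (- inverse (real (Suc k)) * w))) \<longlonglongrightarrow> w"
proof -
 have "((\<lambda>x. 1 - exp (- x * w)) has_real_derivative w) (at 0)"
  by (auto intro!: derivative_eq_intros)
 then have "((\<lambda>h. (1 - exp (- h * w)) / h) \<longlongrightarrow> w) (at 0)"
  by (simp add: DERIV_def)
 moreover have "filterlim (\<lambda>k. inverse (real (Suc k))) (at 0) sequentially"
  using LIMSEQ_inverse_real_of_nat by (simp add: filterlim_at)
 ultimately have "(\<lambda>k. (1 - exp (- inverse (real (Suc k)) * w)) / inverse (real (Suc k))) \<longlonglongrightarrow> w"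
  by (rule filterlim_compose)
 then show ?thesis by (simp add: field_simps)
qed

context branching
begin

abbreviation th :: "nat => real" where "th k \<equiv> inverse (real (Suc k))"

text \<open>The value 0 at negative times lets the moment be treated as a measurable function on the
  whole plane.\<close>

definition moment :: "nat => (real => real) => real => real => real" where
 "moment n g t x = (if 0 \<le> t then \<integral>om. pr g t om ^ n \<partial>Pr x else 0)"

text \<open>Uniform in the trait and over bounded times. Integrability is part of the claim, since
  the integral of a non-integrable function would be 0 and the bound void.\<close>

definition moment_bdd :: "nat => (real => real) => bool" where
 "moment_bdd n g \<longleftrightarrow> (\<forall>T\<ge>0. \<exists>C\<ge>0. \<forall>t x. 0 \<le> t \<longrightarrow> t \<le> T \<longrightarrow> integrable (Pr x) (\<lambda>om. pr g t om ^ n) \<and> (LINT om|Pr x. pr g t om ^ n) \<le> C)"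

context
 fixes g :: "real => real" and G :: real
 assumes g[measurable]: "g \<in> borel_measurable borel" and g0: "\<And>y. 0 \<le> g y" and gG: "\<And>y. g y \<le> G"
begin

lemma pr0: "0 \<le> pr g t om"
 using g0 by (rule pr_nonneg)

lemma G0: "0 \<le> G"
 using g0[of 0] gG[of 0] by simp

lemma s_bounds: "0 \<le> 1 - exp (- th k * pr g t om)" "1 - exp (- th k * pr g t om) \<le> th k * pr g t om"
 "1 - exp (- th k * pr g t om) \<le> 1"
 using pr0[of t om] one_minus_exp_le[of "pr g t om" "th k"] by auto

text \<open>The negative last term of \<open>inter_eq\<close> is dropped and 1 - exp(- \<theta> v)
  is bounded by \<theta> v, which extracts the factor \<open>th k ^ n\<close>. Only moments of order
  below \<open>n\<close> occur.\<close>

lemma inter_le: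
 assumes t: "0 \<le> t" and n: "1 \<le> n" and int: "\<And>k. 1 \<le> k ==> k < n ==> integrable (Pr x) (\<lambda>om. pr g t om ^ k)"
 shows "inter n (th k) g t x \<le> th k ^ n * (\<Sum>j\<in>{1..<n}. real (n choose j) * (LINT om|Pr x. pr g t om ^ j) * (LINT om|Pr x. pr g t om ^ (n - j)))"
proof -
 interpret P: prob_space "Pr x" by (rule prob_space_Pr)
 let ?q = "\<lambda>om. exp (- th k * pr g t om)"
 have th0: "0 \<le> th k" by simp
 have e: "0 \<le> ?q om" "?q om \<le> 1" for om by (rule exp_pr_bounds[OF g g0 th0 t])+
 have A: "(LINT om|Pr x. (1 - ?q om) ^ j * ?q om ^ l) \<le> th k ^ j * (LINT om|Pr x. pr g t om ^ j)" if j: "1 \<le> j" "j < n" for j l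
 proof -
  have "(LINT om|Pr x. (1 - ?q om) ^ j * ?q om ^ l) \<le> (LINT om|Pr x. th k ^ j * pr g t om ^ j)"
  proof (rule integral_mono)
   show "integrable (Pr x) (\<lambda>om. (1 - ?q om) ^ j * ?q om ^ l)" by (rule integrable_exp_pr[OF g g0 th0 t])
   show "integrable (Pr x) (\<lambda>om. th k ^ j * pr g t om ^ j)" using int[OF j] by simp
   fix om
   have "(1 - ?q om) ^ j * ?q om ^ l \<le> (th k * pr g t om) ^ j * 1"
    using e[of om] s_bounds[of k t om] pr0[of t om] by (intro mult_mono power_mono power_le_one) auto
   then show "(1 - ?q om) ^ j * ?q om ^ l \<le> th k ^ j * pr g t om ^ j" by (simp add: power_mult_distrib)
  qed
  then show ?thesis by simp
 qed
 have nn: "0 \<le> (LINT om|Pr x. (1 - ?q om) ^ j * ?q om ^ l)" for j l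
  using e by (intro lint_nonneg) auto
 have nn': "0 \<le> (LINT om|Pr x. (1 - ?q om) ^ j)" for j using nn[of j 0] by simp
 have "inter n (th k) g t x \<le> (\<Sum>j\<in>{1..<n}. real (n choose j) * (LINT om|Pr x. (1 - ?q om) ^ j * ?q om ^ (n - j)) * (LINT om|Pr x. (1 - ?q om) ^ (n - j)))"
 proof -
  have "0 \<le> (LINT om|Pr x. (1 - ?q om) ^ n) * (LINT om|Pr x. 1 - ?q om ^ n)"
   using e by (intro mult_nonneg_nonneg nn' lint_nonneg) (auto simp: power_le_one)
  then show ?thesis unfolding inter_eq[OF g g0 th0 t n] by linarith
 qed
 also have "\<dots> \<le> (\<Sum>j\<in>{1..<n}. real (n choose j) * (th k ^ j * (LINT om|Pr x. pr g t om ^ j)) * (th k ^ (n - j) * (LINT om|Pr x. pr g t om ^ (n - j))))"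
 proof (intro sum_mono mult_mono mult_left_mono A)
  fix j assume j: "j \<in> {1..<n}"
  show "(LINT om|Pr x. (1 - ?q om) ^ (n - j)) \<le> th k ^ (n - j) * (LINT om|Pr x. pr g t om ^ (n - j))"
   using A[of "n - j" 0] j by auto
  show "0 \<le> real (n choose j) * (th k ^ j * (LINT om|Pr x. pr g t om ^ j))"
   using pr0 by (intro mult_nonneg_nonneg lint_nonneg) auto
 qed (use nn nn' in auto)
 also have "\<dots> = th k ^ n * (\<Sum>j\<in>{1..<n}. real (n choose j) * (LINT om|Pr x. pr g t om ^ j) * (LINT om|Pr x. pr g t om ^ (n - j)))"
  unfolding sum_distrib_left
 proof (intro sum.cong refl)
  fix j assume "j \<in> {1..<n}"
  then have "th k ^ n = th k ^ j * th k ^ (n - j)" by (simp add: power_add[symmetric] del: power_inverse)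
  then show "real (n choose j) * (th k ^ j * (LINT om|Pr x. pr g t om ^ j)) * (th k ^ (n - j) * (LINT om|Pr x. pr g t om ^ (n - j))) =
   th k ^ n * (real (n choose j) * (LINT om|Pr x. pr g t om ^ j) * (LINT om|Pr x. pr g t om ^ (n - j)))"
   by (simp only: mult_ac)
 qed
 finally show ?thesis .
qed

lemma integral_kappa_power_le:
 assumes t: "0 \<le> t"
 shows "(LINT z|kappa t y. (1 - exp (- th k * g z)) ^ n) \<le> th k ^ n * (G ^ n * exp (bmax * t))"
proof -
 interpret K: finite_measure "kappa t y" by (rule finite_measure_kappa[OF t])
 have le: "(1 - exp (- th k * g z)) ^ n \<le> th k ^ n * G ^ n" and ge: "0 \<le> (1 - exp (- th k * g z)) ^ n" for z
 proof -
  have "1 - exp (- th k * g z) \<le> th k * g z" by (rule one_minus_exp_le) (use g0 in auto)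
  also have "\<dots> \<le> th k * G" using gG by (intro mult_left_mono) auto
  finally show "(1 - exp (- th k * g z)) ^ n \<le> th k ^ n * G ^ n"
   using g0[of z] unfolding power_mult_distrib[symmetric] by (intro power_mono) auto
  show "0 \<le> (1 - exp (- th k * g z)) ^ n" using g0[of z] by simp
 qed
 have "(LINT z|kappa t y. (1 - exp (- th k * g z)) ^ n) \<le> (LINT z|kappa t y. th k ^ n * G ^ n)"
  using le ge G0 by (intro integral_mono K.integrable_const_bound[where B="th k ^ n * G ^ n"]) auto
 also have "\<dots> = th k ^ n * G ^ n * measure (kappa t y) UNIV" by simp
 also have "\<dots> \<le> th k ^ n * G ^ n * exp (bmax * t)"
  using G0 by (intro mult_left_mono measure_kappa t) auto
 finally show ?thesis by (simp add: mult_ac)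
qed

lemma inter_bound: "\<exists>C. \<forall>t x. \<bar>inter n \<theta> g t x\<bar> \<le> C"
proof (intro exI allI)
 fix t x
 have "\<bar>inter n \<theta> g t x\<bar> \<le> (\<Sum>j\<le>n. \<bar>(-1) ^ j * real (n choose j) * (lapl (real j * \<theta>) g t x)\<^sup>2\<bar>)"
  unfolding inter_def by (rule sum_abs)
 also have "\<dots> \<le> (\<Sum>j\<le>n. real (n choose j))"
  by (intro sum_mono) (auto simp: abs_mult power_abs lapl_bounds intro!: mult_left_le power_le_one)
 finally show "\<bar>inter n \<theta> g t x\<bar> \<le> (\<Sum>j\<le>n. real (n choose j))" .
qed

text \<open>The bound is of the exact order \<open>th k ^ n\<close> with a constant independent of
  \<open>k\<close>, so it survives division by that power and a passage to the limit.\<close>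

lemma diffpow_le:
 assumes t: "0 \<le> t" "t \<le> T" and n: "1 \<le> n"
  and C: "\<And>s x k. 0 \<le> s ==> s \<le> T ==> 1 \<le> k ==> k < n ==> integrable (Pr x) (\<lambda>om. pr g s om ^ k) \<and> (LINT om|Pr x. pr g s om ^ k) \<le> C k"
  and C0: "\<And>k. 0 \<le> C k"
 shows "diffpow n (th k) g t y \<le> th k ^ n * (G ^ n * exp (bmax * T) + bmax * (\<Sum>j\<in>{1..<n}. real (n choose j) * C j * C (n - j)) * (T * exp (bmax * T)))"
proof -
 interpret N: finite_measure "nu t y" by (rule finite_measure_nu[OF t(1)])
 let ?S = "\<Sum>j\<in>{1..<n}. real (n choose j) * C j * C (n - j)"
 have S0: "0 \<le> ?S" using C0 by (intro sum_nonneg) auto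
 have il: "inter n (th k) g s x \<le> th k ^ n * ?S" if s: "0 \<le> s" "s \<le> T" for s x
 proof -
  have "inter n (th k) g s x \<le> th k ^ n * (\<Sum>j\<in>{1..<n}. real (n choose j) * (LINT om|Pr x. pr g s om ^ j) * (LINT om|Pr x. pr g s om ^ (n - j)))"
   using C s by (intro inter_le n) auto
  also have "\<dots> \<le> th k ^ n * ?S"
   using C s C0 pr0 by (intro mult_left_mono sum_mono mult_mono) (auto intro!: lint_nonneg mult_nonneg_nonneg)
  finally show ?thesis .
 qed
 obtain D where D: "\<And>t x. \<bar>inter n (th k) g t x\<bar> \<le> D" using inter_bound by blast
 have intN: "integrable (nu t y) (\<lambda>x. b (snd x) * inter n (th k) g (t - fst x) (snd x))"
 proof (rule N.integrable_const_bound[where B="bmax * D"])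
  have "\<bar>b z * inter n (th k) g s z\<bar> \<le> bmax * D" for s z
   unfolding abs_mult using D[of s z] bmax(2)[of z] bmax(1) b_nonneg[of z] by (intro mult_mono) auto
  then show "AE x in nu t y. norm (b (snd x) * inter n (th k) g (t - fst x) (snd x)) \<le> bmax * D" by simp
 qed measurable
 have "(LINT x|nu t y. b (snd x) * inter n (th k) g (t - fst x) (snd x)) \<le> (LINT x|nu t y. bmax * (th k ^ n * ?S))"
 proof (rule integral_mono_AE[OF intN])
  show "AE x in nu t y. b (snd x) * inter n (th k) g (t - fst x) (snd x) \<le> bmax * (th k ^ n * ?S)"
   using AE_nu[of t y]
  proof eventually_elim
   case (elim x)
   have "b (snd x) * inter n (th k) g (t - fst x) (snd x) \<le> b (snd x) * (th k ^ n * ?S)"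
    using il[of "t - fst x" "snd x"] elim t by (intro mult_left_mono b_nonneg) auto
   also have "\<dots> \<le> bmax * (th k ^ n * ?S)" using bmax S0 by (intro mult_right_mono) auto
   finally show ?case .
  qed
 qed simp
 also have "\<dots> = th k ^ n * (bmax * ?S) * measure (nu t y) UNIV" by simp
 also have "\<dots> \<le> th k ^ n * (bmax * ?S) * (t * exp (bmax * t))"
  using S0 bmax by (intro mult_left_mono measure_nu t mult_nonneg_nonneg) auto
 also have "\<dots> \<le> th k ^ n * (bmax * ?S) * (T * exp (bmax * T))"
  using S0 bmax t by (intro mult_left_mono mult_mono mult_nonneg_nonneg) auto
 finally have 1: "(LINT x|nu t y. b (snd x) * inter n (th k) g (t - fst x) (snd x)) \<le> th k ^ n * (bmax * ?S) * (T * exp (bmax * T))" .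
 have "(LINT z|kappa t y. (1 - exp (- th k * g z)) ^ n) \<le> th k ^ n * (G ^ n * exp (bmax * t))"
  by (rule integral_kappa_power_le[OF t(1)])
 also have "\<dots> \<le> th k ^ n * (G ^ n * exp (bmax * T))"
  using G0 bmax t by (intro mult_left_mono) auto
 finally have 2: "(LINT z|kappa t y. (1 - exp (- th k * g z)) ^ n) \<le> th k ^ n * (G ^ n * exp (bmax * T))" .
 have "diffpow n (th k) g t y \<le> th k ^ n * (G ^ n * exp (bmax * T)) + th k ^ n * (bmax * ?S) * (T * exp (bmax * T))"
  using 1 2 by (subst diffpow_duhamel[OF g g0 _ t(1) n]) auto
 then show ?thesis by (simp add: algebra_simps)
qed

text \<open>Strong induction on the order: \<open>diffpow_le\<close> bounds the rescaled differences
  by means of the lower moments, and Fatou's lemma transfers the bound to the moment itself, thereby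
  proving its existence.\<close>

lemma moment_bddI: "1 \<le> n ==> moment_bdd n g"
proof (induction n rule: less_induct)
 case (less n)
 show ?case unfolding moment_bdd_def
 proof (intro allI impI)
  fix T :: real assume T: "0 \<le> T"
  have "\<exists>C. 0 \<le> C \<and> (1 \<le> k \<and> k < n \<longrightarrow> (\<forall>t x. 0 \<le> t \<longrightarrow> t \<le> T \<longrightarrow> integrable (Pr x) (\<lambda>om. pr g t om ^ k) \<and> (LINT om|Pr x. pr g t om ^ k) \<le> C))" for k
  proof (cases "1 \<le> k \<and> k < n")
   case True
   then show ?thesis using less.IH[of k] T unfolding moment_bdd_def by blast
  next
   case False
   then show ?thesis using order_refl[of "0::real"] by blast
  qed
  then have "\<exists>C. \<forall>k. 0 \<le> C k \<and> (1 \<le> k \<and> k < n \<longrightarrow> (\<forall>t x. 0 \<le> t \<longrightarrow> t \<le> T \<longrightarrow> integrable (Pr x) (\<lambda>om. pr g t om ^ k) \<and> (LINT om|Pr x. pr g t om ^ k) \<le> C k))"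
   by (intro choice allI)
  then obtain C where C0: "\<And>k. 0 \<le> C k" and C: "\<And>k t x. 1 \<le> k ==> k < n ==> 0 \<le> t ==> t \<le> T ==> integrable (Pr x) (\<lambda>om. pr g t om ^ k) \<and> (LINT om|Pr x. pr g t om ^ k) \<le> C k"
   by blast
  define B where "B = G ^ n * exp (bmax * T) + bmax * (\<Sum>j\<in>{1..<n}. real (n choose j) * C j * C (n - j)) * (T * exp (bmax * T))"
  have B0: "0 \<le> B"
   unfolding B_def using G0 bmax T C0 by (intro add_nonneg_nonneg mult_nonneg_nonneg sum_nonneg) auto
  show "\<exists>C\<ge>0. \<forall>t x. 0 \<le> t \<longrightarrow> t \<le> T \<longrightarrow> integrable (Pr x) (\<lambda>om. pr g t om ^ n) \<and> (LINT om|Pr x. pr g t om ^ n) \<le> C"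
  proof (rule exI[of _ B], intro conjI B0 allI impI)
   fix t x assume t: "0 \<le> t" "t \<le> T"
   have th0: "0 \<le> th k" for k by simp
   let ?u = "\<lambda>k om. (real (Suc k) * (1 - exp (- th k * pr g t om))) ^ n"
   have u: "(\<integral>\<^sup>+om. ennreal (?u k om) \<partial>Pr x) \<le> ennreal B" for k
   proof -
    have int: "integrable (Pr x) (\<lambda>om. (1 - exp (- th k * pr g t om)) ^ n)"
     using integrable_exp_pr[where \<theta>="th k" and x=x and k=n and l=0, OF g g0 th0 t(1)] by simp
    have "(\<integral>\<^sup>+om. ennreal (?u k om) \<partial>Pr x) = ennreal (LINT om|Pr x. real (Suc k) ^ n * (1 - exp (- th k * pr g t om)) ^ n)"
     unfolding power_mult_distrib using int pr0 by (intro nn_integral_eq_integral) auto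
    also have "\<dots> = ennreal (real (Suc k) ^ n * diffpow n (th k) g t x)"
     by (simp only: diffpow_eq[OF g g0 th0 t(1) less.prems] integral_mult_right_zero)
    also have "\<dots> \<le> ennreal (real (Suc k) ^ n * (th k ^ n * B))"
     unfolding B_def using C C0 t less.prems by (intro ennreal_leI mult_left_mono diffpow_le) auto
    also have "real (Suc k) ^ n * (th k ^ n * B) = B"
     by (simp add: power_mult_distrib[symmetric] mult.assoc[symmetric] del: power_inverse of_nat_Suc)
    finally show ?thesis .
   qed
   \<comment> \<open>Fatou's lemma along \<open>th k\<close>: the rescaled differences converge
     pointwise to the n-th power.\<close>
   have "(\<integral>\<^sup>+om. ennreal (pr g t om ^ n) \<partial>Pr x) = (\<integral>\<^sup>+om. liminf (\<lambda>k. ennreal (?u k om)) \<partial>Pr x)"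
   proof (intro nn_integral_cong)
    fix om
    have "(\<lambda>k. ennreal (?u k om)) \<longlonglongrightarrow> ennreal (pr g t om ^ n)"
     by (intro tendsto_ennrealI tendsto_power tendsto_one_minus_exp)
    from lim_imp_Liminf[OF _ this] show "ennreal (pr g t om ^ n) = liminf (\<lambda>k. ennreal (?u k om))" by simp
   qed
   also have "\<dots> \<le> liminf (\<lambda>k. \<integral>\<^sup>+om. ennreal (?u k om) \<partial>Pr x)" by (rule nn_integral_liminf) measurable
   also have "\<dots> \<le> ennreal B"
   proof -
    have "liminf (\<lambda>k. \<integral>\<^sup>+om. ennreal (?u k om) \<partial>Pr x) \<le> liminf (\<lambda>k::nat. ennreal B)"
     using u by (intro Liminf_mono always_eventually) auto
    then show ?thesis by (simp add: Liminf_const)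
   qed
   finally have *: "(\<integral>\<^sup>+om. ennreal (pr g t om ^ n) \<partial>Pr x) \<le> ennreal B" .
   show "integrable (Pr x) (\<lambda>om. pr g t om ^ n)"
    using * pr0 by (intro integrableI_nonneg) (auto intro: le_less_trans)
   then have "ennreal (LINT om|Pr x. pr g t om ^ n) \<le> ennreal B"
    using * pr0 by (subst nn_integral_eq_integral[symmetric]) auto
   then show "(LINT om|Pr x. pr g t om ^ n) \<le> B" using B0 by (simp add: ennreal_le_iff)
  qed
 qed
qed

lemma integrable_pr: "0 \<le> t ==> integrable (Pr x) (\<lambda>om. pr g t om ^ n)"
proof (cases "n = 0")
 case True
 interpret P: prob_space "Pr x" by (rule prob_space_Pr)
 show ?thesis using True by simp
next
 case False
 assume "0 \<le> t"
 moreover have "moment_bdd n g" using False by (intro moment_bddI) simp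
 ultimately show ?thesis unfolding moment_bdd_def by blast
qed

lemma moment_eq: "0 \<le> t ==> moment n g t x = (LINT om|Pr x. pr g t om ^ n)"
 by (simp add: moment_def)

lemma moment_nonneg: "0 \<le> moment n g t x"
 using pr0 by (auto simp: moment_def)

lemma moment_le_ex:
 assumes "1 \<le> n" "0 \<le> T"
 shows "\<exists>C. 0 \<le> C \<and> (\<forall>t x. t \<le> T \<longrightarrow> moment n g t x \<le> C)"
proof -
 have "\<exists>C\<ge>0. \<forall>t x. 0 \<le> t \<longrightarrow> t \<le> T \<longrightarrow> integrable (Pr x) (\<lambda>om. pr g t om ^ n) \<and> (LINT om|Pr x. pr g t om ^ n) \<le> C"
  using moment_bddI[OF assms(1), unfolded moment_bdd_def] assms(2) by (elim allE impE)
 then obtain C where C0: "0 \<le> C" and C: "\<forall>t x. 0 \<le> t \<longrightarrow> t \<le> T \<longrightarrow> integrable (Pr x) (\<lambda>om. pr g t om ^ n) \<and> (LINT om|Pr x. pr g t om ^ n) \<le> C"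
  by (elim exE conjE)
 show ?thesis
 proof (rule exI[of _ C], intro conjI C0 allI impI)
  fix t x assume "t \<le> T"
  then show "moment n g t x \<le> C" using C[rule_format, of t x] C0 by (cases "0 \<le> t") (simp_all add: moment_def)
 qed
qed

text \<open>Now that the n-th moment is known to be finite, it dominates the rescaled differences.
  The extra factor exp(- \<theta> <Z,g>)^l tends to 1; it stems from the mixed terms in
  \<open>inter_eq\<close>.\<close>

lemma
 assumes t: "0 \<le> t"
 shows tendsto_moment: "(\<lambda>k. real (Suc k) ^ n * (LINT om|Pr x. (1 - exp (- th k * pr g t om)) ^ n * exp (- th k * pr g t om) ^ l)) \<longlonglongrightarrow> moment n g t x"
  and moment_prelimit_le: "real (Suc k) ^ n * (LINT om|Pr x. (1 - exp (- th k * pr g t om)) ^ n * exp (- th k * pr g t om) ^ l) \<le> moment n g t x"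
proof -
 let ?u = "\<lambda>k om. (real (Suc k) * (1 - exp (- th k * pr g t om))) ^ n * exp (- th k * pr g t om) ^ l"
 have eq: "real (Suc k) ^ n * (LINT om|Pr x. (1 - exp (- th k * pr g t om)) ^ n * exp (- th k * pr g t om) ^ l) = (LINT om|Pr x. ?u k om)" for k
  by (simp only: power_mult_distrib mult.assoc integral_mult_right_zero)
 have bd: "0 \<le> ?u k om \<and> ?u k om \<le> pr g t om ^ n" for k om
 proof -
  have e: "0 \<le> exp (- th k * pr g t om)" "exp (- th k * pr g t om) \<le> 1" using pr0[of t om] by auto
  have "real (Suc k) * (1 - exp (- th k * pr g t om)) \<le> real (Suc k) * (th k * pr g t om)"
   using s_bounds by (intro mult_left_mono) auto
  also have "\<dots> = pr g t om" by (simp add: mult.assoc[symmetric] del: of_nat_Suc)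
  finally have "(real (Suc k) * (1 - exp (- th k * pr g t om))) ^ n * exp (- th k * pr g t om) ^ l \<le> pr g t om ^ n * 1"
   using e s_bounds[of k t om] pr0[of t om] by (intro mult_mono power_mono power_le_one) (auto simp del: of_nat_Suc)
  moreover have "0 \<le> ?u k om" using e by (intro mult_nonneg_nonneg zero_le_power) auto
  ultimately show ?thesis by simp
 qed
 have m[measurable]: "?u k \<in> borel_measurable (Pr x)" for k by measurable
 have "(\<lambda>k. \<integral>om. ?u k om \<partial>Pr x) \<longlonglongrightarrow> (LINT om|Pr x. pr g t om ^ n)"
 proof (rule integral_dominated_convergence[where w="\<lambda>om. pr g t om ^ n"])
  show "AE om in Pr x. (\<lambda>k. ?u k om) \<longlonglongrightarrow> pr g t om ^ n"
  proof (rule AE_I2)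
   fix om
   have "(\<lambda>k. exp (- th k * pr g t om)) \<longlonglongrightarrow> exp (- 0 * pr g t om)"
    by (intro tendsto_exp tendsto_mult tendsto_minus LIMSEQ_inverse_real_of_nat tendsto_const)
   then have "(\<lambda>k. ?u k om) \<longlonglongrightarrow> pr g t om ^ n * exp (- 0 * pr g t om) ^ l"
    by (intro tendsto_mult tendsto_power tendsto_one_minus_exp)
   then show "(\<lambda>k. ?u k om) \<longlonglongrightarrow> pr g t om ^ n" by simp
  qed
  show "AE om in Pr x. norm (?u k om) \<le> pr g t om ^ n" for k
   by (intro AE_I2) (use bd in \<open>simp only: real_norm_def abs_of_nonneg\<close>)
 qed (use integrable_pr[OF t] in auto)
 then show "(\<lambda>k. real (Suc k) ^ n * (LINT om|Pr x. (1 - exp (- th k * pr g t om)) ^ n * exp (- th k * pr g t om) ^ l)) \<longlonglongrightarrow> moment n g t x"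
  unfolding eq moment_eq[OF t] .
 show "real (Suc k) ^ n * (LINT om|Pr x. (1 - exp (- th k * pr g t om)) ^ n * exp (- th k * pr g t om) ^ l) \<le> moment n g t x"
  unfolding eq moment_eq[OF t]
 proof (rule integral_mono_AE)
  show "integrable (Pr x) (?u k)"
   by (rule Bochner_Integration.integrable_bound[OF integrable_pr[OF t]])
     (use bd pr0 in \<open>auto simp only: m real_norm_def abs_of_nonneg zero_le_power intro!: AE_I2\<close>)
 qed (use bd integrable_pr[OF t] in auto)
qed

text \<open>Measurability in the trait cannot be read off from \<open>Pr x\<close>, about which
  nothing is assumed as a function of \<open>x\<close>. It is inherited from the recursive
  construction of \<open>lapl\<close>, through \<open>diffpow\<close>.\<close>

lemma measurable_moment [measurable]:
 assumes n: "1 \<le> n"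
 shows "(\<lambda>(t, x). moment n g t x) \<in> borel_measurable borel2"
proof (rule borel_measurable_LIMSEQ_real)
 show "(\<lambda>(t, x). if 0 \<le> t then real (Suc k) ^ n * diffpow n (th k) g t x else 0) \<in> borel_measurable borel2" for k
  by measurable
 fix z :: "real \<times> real"
 show "(\<lambda>k. case z of (t, x) => if 0 \<le> t then real (Suc k) ^ n * diffpow n (th k) g t x else 0) \<longlonglongrightarrow> (case z of (t, x) => moment n g t x)"
 proof (cases "0 \<le> fst z")
  case True
  have "real (Suc k) ^ n * diffpow n (th k) g (fst z) (snd z) =
   real (Suc k) ^ n * (LINT om|Pr (snd z). (1 - exp (- th k * pr g (fst z) om)) ^ n * exp (- th k * pr g (fst z) om) ^ 0)" for k
   by (subst diffpow_eq[OF g g0 _ True n]) auto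
  then show ?thesis using True tendsto_moment[where n=n and l=0 and x="snd z", OF True] by (simp only: case_prod_beta if_True)
 qed (simp add: case_prod_beta moment_def)
qed

text \<open>The finite-difference Duhamel equation divided by \<open>th k ^ n\<close> as
  \<open>k\<close> tends to infinity. In the binomial sum the two factors of each summand share the
  power of \<open>th k\<close> exactly; the remaining term of \<open>inter_eq\<close> has one factor
  too many and vanishes.\<close>

lemma moment_recursion:
 assumes t: "0 \<le> t" and n: "1 \<le> n"
 shows "moment n g t y = (LINT z|kappa t y. g z ^ n) +
  (LINT x|nu t y. b (snd x) * (\<Sum>j\<in>{1..<n}. real (n choose j) * moment j g (t - fst x) (snd x) * moment (n - j) g (t - fst x) (snd x)))"
proof (rule LIMSEQ_unique)
 interpret K: finite_measure "kappa t y" by (rule finite_measure_kappa[OF t])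
 interpret N: finite_measure "nu t y" by (rule finite_measure_nu[OF t])
 have th0: "0 \<le> th k" for k by simp
 have dp: "real (Suc k) ^ n * diffpow n (th k) g t y = real (Suc k) ^ n * (LINT om|Pr y. (1 - exp (- th k * pr g t om)) ^ n * exp (- th k * pr g t om) ^ 0)" for k
  by (subst diffpow_eq[OF g g0 th0 t n]) simp
 show "(\<lambda>k. real (Suc k) ^ n * diffpow n (th k) g t y) \<longlonglongrightarrow> moment n g t y"
  unfolding dp by (rule tendsto_moment[OF t])
 have mjm[measurable]: "(\<lambda>(t, x). moment j g t x) \<in> borel_measurable borel2" if "j \<in> {1..<n}" for j
  using that by (intro measurable_moment) auto
 have mjm'[measurable]: "(\<lambda>(t, x). moment (n - j) g t x) \<in> borel_measurable borel2" if "j \<in> {1..<n}" for j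
  using that by (intro measurable_moment) auto
 let ?I = "\<lambda>k s x. real (Suc k) ^ n * inter n (th k) g s x"
 let ?M = "\<lambda>s x. \<Sum>j\<in>{1..<n}. real (n choose j) * moment j g s x * moment (n - j) g s x"
 have Ieq: "?I k s x = (\<Sum>j\<in>{1..<n}. real (n choose j) * (real (Suc k) ^ j * (LINT om|Pr x. (1 - exp (- th k * pr g s om)) ^ j * exp (- th k * pr g s om) ^ (n - j))) *
    (real (Suc k) ^ (n - j) * (LINT om|Pr x. (1 - exp (- th k * pr g s om)) ^ (n - j) * exp (- th k * pr g s om) ^ 0)))
  - (real (Suc k) ^ n * (LINT om|Pr x. (1 - exp (- th k * pr g s om)) ^ n * exp (- th k * pr g s om) ^ 0)) * (LINT om|Pr x. 1 - exp (- th k * pr g s om) ^ n)"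
  if s: "0 \<le> s" for k s x
 proof -
  have "real (Suc k) ^ n = real (Suc k) ^ j * real (Suc k) ^ (n - j)" if "j \<in> {1..<n}" for j
   using that by (simp add: power_add[symmetric])
  then show ?thesis
   unfolding inter_eq[OF g g0 th0 s n] right_diff_distrib sum_distrib_left power_0 mult_1_right
   by (intro arg_cong2[where f="(-)"] sum.cong refl) (simp_all only: mult_ac)
 qed
 \<comment> \<open>The surplus factor in the last term of \<open>inter_eq\<close>, which removes
   that term from the limit.\<close>
 have lim_u: "(\<lambda>k. \<integral>om. 1 - exp (- th k * pr g s om) ^ n \<partial>Pr x) \<longlonglongrightarrow> 0" if s: "0 \<le> s" for s x
 proof -
  interpret P: prob_space "Pr x" by (rule prob_space_Pr)
  have "(\<lambda>k. \<integral>om. 1 - exp (- th k * pr g s om) ^ n \<partial>Pr x) \<longlonglongrightarrow> (LINT om|Pr x. 0)"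
  proof (rule integral_dominated_convergence[where w="\<lambda>_. 1"])
   show "AE om in Pr x. (\<lambda>k. 1 - exp (- th k * pr g s om) ^ n) \<longlonglongrightarrow> 0"
   proof (rule AE_I2)
    fix om
    have "(\<lambda>k. 1 - exp (- th k * pr g s om) ^ n) \<longlonglongrightarrow> 1 - exp (- 0 * pr g s om) ^ n"
     by (intro tendsto_diff tendsto_power tendsto_exp tendsto_mult tendsto_minus LIMSEQ_inverse_real_of_nat tendsto_const)
    then show "(\<lambda>k. 1 - exp (- th k * pr g s om) ^ n) \<longlonglongrightarrow> 0" by simp
   qed
   show "AE om in Pr x. norm (1 - exp (- th k * pr g s om) ^ n) \<le> 1" for k
    using exp_pr_bounds[OF g g0 th0 s] by (intro AE_I2) (auto simp: power_le_one abs_of_nonneg)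
  qed auto
  then show ?thesis by simp
 qed
 have lim_I: "(\<lambda>k. ?I k s x) \<longlonglongrightarrow> ?M s x" if s: "0 \<le> s" for s x
 proof -
  have "(\<lambda>k. ?I k s x) \<longlonglongrightarrow> ?M s x - moment n g s x * 0"
   unfolding Ieq[OF s] by (intro tendsto_diff tendsto_sum tendsto_mult tendsto_const tendsto_moment s lim_u)
  then show ?thesis by simp
 qed
 obtain Cn where Cn: "0 \<le> Cn" "\<And>s x. s \<le> t ==> moment n g s x \<le> Cn" using moment_le_ex[OF n t] by blast
 have "\<exists>C. 0 \<le> C \<and> (1 \<le> j \<longrightarrow> (\<forall>s x. s \<le> t \<longrightarrow> moment j g s x \<le> C))" for j
 proof (cases "1 \<le> j")
  case True
  show ?thesis using moment_le_ex[OF True t] by blast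
 next
  case False
  then show ?thesis by (intro exI[of _ 0]) auto
 qed
 then have "\<exists>C. \<forall>j. 0 \<le> C j \<and> (1 \<le> j \<longrightarrow> (\<forall>s x. s \<le> t \<longrightarrow> moment j g s x \<le> C j))"
  by (intro choice allI)
 then obtain C where C: "\<And>j. 0 \<le> C j" "\<And>j s x. 1 \<le> j ==> s \<le> t ==> moment j g s x \<le> C j" by blast
 define B where "B = (\<Sum>j\<in>{1..<n}. real (n choose j) * C j * C (n - j)) + Cn"
 have nnE: "0 \<le> real (Suc k) ^ m * (LINT om|Pr x. (1 - exp (- th k * pr g s om)) ^ m * exp (- th k * pr g s om) ^ l)" for m k l s x
  using s_bounds by (intro mult_nonneg_nonneg lint_nonneg) auto
 have bd_I: "\<bar>?I k s x\<bar> \<le> B" if s: "0 \<le> s" "s \<le> t" for k s x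
 proof -
  interpret P: prob_space "Pr x" by (rule prob_space_Pr)
  let ?S = "\<Sum>j\<in>{1..<n}. real (n choose j) * (real (Suc k) ^ j * (LINT om|Pr x. (1 - exp (- th k * pr g s om)) ^ j * exp (- th k * pr g s om) ^ (n - j))) *
    (real (Suc k) ^ (n - j) * (LINT om|Pr x. (1 - exp (- th k * pr g s om)) ^ (n - j) * exp (- th k * pr g s om) ^ 0))"
  let ?m = "real (Suc k) ^ n * (LINT om|Pr x. (1 - exp (- th k * pr g s om)) ^ n * exp (- th k * pr g s om) ^ 0)"
  let ?v = "\<integral>om. 1 - exp (- th k * pr g s om) ^ n \<partial>Pr x"
  have S: "0 \<le> ?S" "?S \<le> (\<Sum>j\<in>{1..<n}. real (n choose j) * C j * C (n - j))"
  proof -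
   show "0 \<le> ?S" by (intro sum_nonneg mult_nonneg_nonneg nnE) auto
   show "?S \<le> (\<Sum>j\<in>{1..<n}. real (n choose j) * C j * C (n - j))"
    by (intro sum_mono mult_mono mult_left_mono nnE mult_nonneg_nonneg C order_trans[OF moment_prelimit_le[OF s(1)] C(2)]) (use s in auto)
  qed
  have m: "0 \<le> ?m" "?m \<le> Cn" by (rule nnE, rule order_trans[OF moment_prelimit_le[OF s(1)] Cn(2)[OF s(2)]])
  have v: "0 \<le> ?v" "?v \<le> 1"
  proof -
   have e: "0 \<le> exp (- th k * pr g s om) ^ n" "exp (- th k * pr g s om) ^ n \<le> 1" for om
    using exp_pr_bounds[OF g g0 th0 s(1)] by (auto intro!: power_le_one)
   show "0 \<le> ?v" using e by (intro lint_nonneg) auto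
   have "?v \<le> (LINT om|Pr x. 1)"
    using e by (intro integral_mono P.integrable_const_bound[where B=1]) (auto simp: abs_of_nonneg)
   then show "?v \<le> 1" by (simp add: P.prob_space)
  qed
  have "0 \<le> ?m * ?v" by (rule mult_nonneg_nonneg[OF m(1) v(1)])
  moreover have "?m * ?v \<le> Cn * 1" by (rule mult_mono[OF m(2) v(2) Cn(1) v(1)])
  ultimately show ?thesis unfolding Ieq[OF s(1)] B_def abs_le_iff using S Cn(1) by linarith
 qed
 have "(\<lambda>k. \<integral>z. (real (Suc k) * (1 - exp (- th k * g z))) ^ n \<partial>kappa t y) \<longlonglongrightarrow> (LINT z|kappa t y. g z ^ n)"
 proof (rule integral_dominated_convergence[where w="\<lambda>_. G ^ n"])
  show "AE z in kappa t y. (\<lambda>k. (real (Suc k) * (1 - exp (- th k * g z))) ^ n) \<longlonglongrightarrow> g z ^ n"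
   by (intro AE_I2 tendsto_power tendsto_one_minus_exp)
  show "AE z in kappa t y. norm ((real (Suc k) * (1 - exp (- th k * g z))) ^ n) \<le> G ^ n" for k
  proof (rule AE_I2)
   fix z
   have "1 - exp (- th k * g z) \<le> th k * g z" by (rule one_minus_exp_le) (use g0 in auto)
   then have "real (Suc k) * (1 - exp (- th k * g z)) \<le> real (Suc k) * (th k * g z)" by (intro mult_left_mono) auto
   also have "\<dots> = g z" by (simp add: mult.assoc[symmetric] del: of_nat_Suc)
   also have "\<dots> \<le> G" by (rule gG)
   finally have le: "real (Suc k) * (1 - exp (- th k * g z)) \<le> G" .
   moreover have "0 \<le> real (Suc k) * (1 - exp (- th k * g z))" using g0[of z] by (intro mult_nonneg_nonneg) auto
   ultimately show "norm ((real (Suc k) * (1 - exp (- th k * g z))) ^ n) \<le> G ^ n"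
    by (simp only: real_norm_def power_abs abs_of_nonneg power_mono)
  qed
 qed auto
 moreover have "(\<lambda>k. \<integral>x. b (snd x) * ?I k (t - fst x) (snd x) \<partial>nu t y) \<longlonglongrightarrow> (LINT x|nu t y. b (snd x) * ?M (t - fst x) (snd x))"
 proof (rule integral_dominated_convergence[where w="\<lambda>_. bmax * B"])
  show "AE x in nu t y. (\<lambda>k. b (snd x) * ?I k (t - fst x) (snd x)) \<longlonglongrightarrow> b (snd x) * ?M (t - fst x) (snd x)"
   using AE_nu[of t y] by eventually_elim (intro tendsto_mult tendsto_const lim_I, simp)
  show "AE x in nu t y. norm (b (snd x) * ?I k (t - fst x) (snd x)) \<le> bmax * B" for k
   using AE_nu[of t y]
  proof eventually_elim
   case (elim x)
   then have "\<bar>?I k (t - fst x) (snd x)\<bar> \<le> B" by (intro bd_I) auto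
   then show ?case
    unfolding real_norm_def abs_mult[of "b (snd x)"] using b_nonneg[of "snd x"] bmax(2)[of "snd x"] bmax(1) by (intro mult_mono) auto
  qed
  show "(\<lambda>x. b (snd x) * ?M (t - fst x) (snd x)) \<in> borel_measurable (nu t y)"
  proof (intro borel_measurable_times borel_measurable_sum)
   fix j assume j: "j \<in> {1..<n}"
   note [measurable] = mjm[OF j] mjm'[OF j]
   show "(\<lambda>x. moment j g (t - fst x) (snd x)) \<in> borel_measurable (nu t y)" by measurable
   show "(\<lambda>x. moment (n - j) g (t - fst x) (snd x)) \<in> borel_measurable (nu t y)" by measurable
  qed measurable
 qed auto
 ultimately have "(\<lambda>k. (LINT z|kappa t y. (real (Suc k) * (1 - exp (- th k * g z))) ^ n) + (LINT x|nu t y. b (snd x) * ?I k (t - fst x) (snd x))) \<longlonglongrightarrow>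
  (LINT z|kappa t y. g z ^ n) + (LINT x|nu t y. b (snd x) * ?M (t - fst x) (snd x))"
  by (rule tendsto_add)
 moreover have "real (Suc k) ^ n * diffpow n (th k) g t y =
  (LINT z|kappa t y. (real (Suc k) * (1 - exp (- th k * g z))) ^ n) + (LINT x|nu t y. b (snd x) * ?I k (t - fst x) (snd x))" for k
  unfolding diffpow_duhamel[OF g g0 th0 t n] distrib_left power_mult_distrib mult.left_commute[of "b _" "real (Suc k) ^ n"] integral_mult_right_zero ..
 ultimately show "(\<lambda>k. real (Suc k) ^ n * diffpow n (th k) g t y) \<longlonglongrightarrow> (LINT z|kappa t y. g z ^ n) +
  (LINT x|nu t y. b (snd x) * ?M (t - fst x) (snd x))" by simp
qed

end

end

section \<open>The spectral gap for Borel functions\<close>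

text \<open>A single function has to serve both measures. Inner compact and outer open
  approximations are taken for each of them; Urysohn's lemma separates the union of the compact sets
  from the complement of the intersection of the open sets.\<close>

lemma continuous_between:
 fixes M :: "real measure"
 assumes M: "sets M = sets borel" "finite_measure M" and M': "sets M' = sets borel" "finite_measure M'"
  and A: "A \<in> sets borel" and e: "0 < e"
 obtains h where "continuous_on UNIV h" "\<And>x. 0 \<le> h x" "\<And>x. h x \<le> (1::real)"
  "\<bar>(LINT x|M. h x) - measure M A\<bar> \<le> e" "\<bar>(LINT x|M'. h x) - measure M' A\<bar> \<le> e"
proof -
 have reg: "\<exists>K U. K \<subseteq> A \<and> compact K \<and> A \<subseteq> U \<and> open U \<and> measure N A - e < measure N K \<and> measure N U < measure N A + e"
  if N: "sets N = sets borel" "finite_measure N" for N :: "real measure"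
 proof -
  interpret N: finite_measure N by fact
  have "ennreal (measure N A - e) < emeasure N A \<or> measure N A - e < 0"
   using e by (auto simp: N.emeasure_eq_measure ennreal_less_iff not_less)
  have "\<exists>K. K \<subseteq> A \<and> compact K \<and> measure N A - e < measure N K"
  proof (cases "measure N A - e < 0")
   case True
   then show ?thesis by (intro exI[of _ "{}"]) auto
  next
   case False
   then have "ennreal (measure N A - e) < emeasure N A" using e by (simp add: N.emeasure_eq_measure ennreal_less_iff)
   also have "emeasure N A = (SUP K \<in> {K. K \<subseteq> A \<and> compact K}. emeasure N K)"
    using N A by (intro inner_regular) (auto simp: N.emeasure_eq_measure)
   finally obtain K where "K \<subseteq> A" "compact K" "ennreal (measure N A - e) < emeasure N K" by (auto simp: less_SUP_iff)
   then show ?thesis using False by (auto simp: N.emeasure_eq_measure ennreal_less_iff)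
  qed
  moreover have "\<exists>U. A \<subseteq> U \<and> open U \<and> measure N U < measure N A + e"
  proof -
   have "(INF U \<in> {U. A \<subseteq> U \<and> open U}. emeasure N U) = emeasure N A"
    using N A by (intro outer_regular[symmetric]) (auto simp: N.emeasure_eq_measure)
   also have "\<dots> < ennreal (measure N A + e)" using e by (simp add: N.emeasure_eq_measure ennreal_less_iff)
   finally obtain U where "A \<subseteq> U" "open U" "emeasure N U < ennreal (measure N A + e)" by (auto simp: INF_less_iff)
   then show ?thesis by (auto simp: N.emeasure_eq_measure ennreal_less_iff)
  qed
  ultimately show ?thesis by blast
 qed
 obtain K1 U1 where 1: "K1 \<subseteq> A" "compact K1" "A \<subseteq> U1" "open U1" "measure M A - e < measure M K1" "measure M U1 < measure M A + e"
  using reg[OF M] by blast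
 obtain K2 U2 where 2: "K2 \<subseteq> A" "compact K2" "A \<subseteq> U2" "open U2" "measure M' A - e < measure M' K2" "measure M' U2 < measure M' A + e"
  using reg[OF M'] by blast
 have "closed (- (U1 \<inter> U2))" "closed (K1 \<union> K2)" "- (U1 \<inter> U2) \<inter> (K1 \<union> K2) = {}"
  using 1 2 by (auto intro: compact_imp_closed)
 then obtain h :: "real => real" where h: "continuous_on UNIV h" "\<And>x. h x \<in> closed_segment 0 1"
  "\<And>x. x \<in> - (U1 \<inter> U2) ==> h x = 0" "\<And>x. x \<in> K1 \<union> K2 ==> h x = 1"
  by (rule Urysohn[of _ _ "0::real" "1::real"]) blast
 have h01: "0 \<le> h x" "h x \<le> 1" for x using h(2)[of x] by (auto simp: closed_segment_eq_real_ivl)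
 have near: "\<bar>(LINT x|N. h x) - measure N A\<bar> \<le> e"
  if N: "sets N = sets borel" "finite_measure N" and K: "compact K" "K \<subseteq> K1 \<union> K2" "measure N A - e < measure N K"
   and U: "open U" "U1 \<inter> U2 \<subseteq> U" "measure N U < measure N A + e" for N K U
 proof -
  interpret N: finite_measure N by fact
  have [measurable]: "h \<in> borel_measurable N"
   using h(1) N(1) by (simp add: borel_measurable_continuous_onI cong: measurable_cong_sets)
  have ih: "integrable N h" using h01 by (intro N.integrable_const_bound[where B=1]) auto
  have sK: "K \<in> sets N" "U \<in> sets N" using K U N by (auto intro: borel_compact)
  have "measure N K = (LINT x|N. indicator K x)" using sK by simp
  also have "\<dots> \<le> (LINT x|N. h x)"
   using sK ih h01 h(4) K(2) by (intro integral_mono) (auto split: split_indicator intro!: integrable_real_indicator N.emeasure_finite simp: less_top[symmetric])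
  finally have "measure N A - e \<le> (LINT x|N. h x)" using K by simp
  moreover have hU: "h x \<le> indicator U x" for x using h(3)[of x] U(2) h01[of x] by (auto split: split_indicator)
  have "(LINT x|N. h x) \<le> (LINT x|N. indicator U x)"
   using sK ih hU by (intro integral_mono) (auto split: split_indicator intro!: integrable_real_indicator simp: less_top[symmetric])
  then have "(LINT x|N. h x) \<le> measure N A + e" using U sK by simp
  ultimately show ?thesis by auto
 qed
 show ?thesis
  by (rule that[OF h(1) h01 near[OF M 1(2) _ 1(5) 1(4) _ 1(6)] near[OF M' 2(2) _ 2(5) 2(4) _ 2(6)]]) auto
qed

text \<open>A bound on the difference of two measures over sets passes to integrals of functions with
 values in the unit interval, because those are averages of indicator functions of level sets.\<close>

lemma integral_diff_le_of_sets:
 fixes g :: "real => real"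
 assumes M: "sets M = sets borel" "finite_measure M" and M': "sets M' = sets borel" "finite_measure M'"
  and bd: "\<And>A. A \<in> sets borel ==> \<bar>measure M A - \<theta> * measure M' A\<bar> \<le> \<delta>"
  and g: "g \<in> borel_measurable borel" "\<And>x. 0 \<le> g x" "\<And>x. g x \<le> (1::real)" and \<theta>: "0 \<le> \<theta>"
 shows "\<bar>(LINT x|M. g x) - \<theta> * (LINT x|M'. g x)\<bar> \<le> \<delta>"
proof -
 define lev where "lev n x = (\<Sum>k\<in>{1..n}. indicator {x. real k / real n \<le> g x} x / real n)" for n x
 have lv: "lev n x \<le> g x \<and> g x \<le> lev n x + 1 / real n" if n: "0 < n" for n x
 proof -
  define m where "m = nat \<lfloor>real n * g x\<rfloor>"
  have m: "real m \<le> real n * g x" "real n * g x < real m + 1"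
   using g(2)[of x] by (auto simp: m_def)
  have "real n * g x \<le> real n * 1" using g(3)[of x] by (intro mult_left_mono) auto
  then have "m \<le> n" using m(1) by linarith
  have "lev n x = (\<Sum>k\<in>{1..n}. if k \<le> m then 1 / real n else 0)"
   unfolding lev_def
  proof (intro sum.cong refl)
   fix k assume "k \<in> {1..n}"
   have "real k / real n \<le> g x \<longleftrightarrow> real k \<le> real n * g x" using n by (simp add: field_simps)
   also have "\<dots> \<longleftrightarrow> k \<le> m" using m by linarith
   finally show "indicator {x. real k / real n \<le> g x} x / real n = (if k \<le> m then 1 / real n else 0)"
    by (auto split: split_indicator)
  qed
  also have "\<dots> = (\<Sum>k\<in>{1..m}. 1 / real n)"
   using \<open>m \<le> n\<close> by (intro sum.mono_neutral_cong_right) auto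
  finally have "lev n x = real m / real n" by simp
  moreover have "real m / real n \<le> g x" using m n by (simp add: pos_divide_le_eq mult.commute)
  moreover have "g x \<le> (real m + 1) / real n" using m n by (simp add: pos_le_divide_eq mult.commute)
  ultimately show ?thesis by (simp add: add_divide_distrib)
 qed
 have lint: "(LINT x|N. lev n x) = (\<Sum>k\<in>{1..n}. measure N {x. real k / real n \<le> g x} / real n)"
  and close: "0 < n ==> (LINT x|N. lev n x) \<le> (LINT x|N. g x) \<and> (LINT x|N. g x) \<le> (LINT x|N. lev n x) + measure N UNIV / real n"
  if N: "sets N = sets borel" "finite_measure N" for N n
 proof -
  interpret N: finite_measure N by fact
  have spN: "space N = UNIV" using sets_eq_imp_space_eq[OF N(1)] by simp
  have gm[measurable]: "g \<in> borel_measurable N" using g N by (simp cong: measurable_cong_sets)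
  have s[measurable]: "{x. r \<le> g x} \<in> sets N" for r using measurable_sets[OF gm, of "{r..}"] by (simp add: vimage_def spN)
  have ii[simp]: "integrable N (indicator {x. r \<le> g x} :: real => real)" for r
   by (intro integrable_real_indicator s) (simp add: less_top[symmetric])
  show "(LINT x|N. lev n x) = (\<Sum>k\<in>{1..n}. measure N {x. real k / real n \<le> g x} / real n)"
   unfolding lev_def by (subst Bochner_Integration.integral_sum) auto
  have il: "integrable N (lev n)" unfolding lev_def by auto
  have ig: "integrable N g" using g by (intro N.integrable_const_bound[where B=1]) auto
  assume n: "0 < n"
  have "(LINT x|N. lev n x) \<le> (LINT x|N. g x)" using lv[OF n] by (intro integral_mono il ig) auto
  moreover have "(LINT x|N. g x) \<le> (LINT x|N. lev n x + 1 / real n)" using lv[OF n] il by (intro integral_mono ig) auto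
  moreover have "(LINT x|N. lev n x + 1 / real n) = (LINT x|N. lev n x) + measure N UNIV / real n" using il by (simp add: spN)
  ultimately show "(LINT x|N. lev n x) \<le> (LINT x|N. g x) \<and> (LINT x|N. g x) \<le> (LINT x|N. lev n x) + measure N UNIV / real n" by simp
 qed
 have ld: "\<bar>(LINT x|M. lev n x) - \<theta> * (LINT x|M'. lev n x)\<bar> \<le> \<delta>" if n: "0 < n" for n
 proof -
  have s: "{x. r \<le> g x} \<in> sets borel" for r using measurable_sets[OF g(1), of "{r..}"] by (simp add: vimage_def)
  have "\<bar>(LINT x|M. lev n x) - \<theta> * (LINT x|M'. lev n x)\<bar> = \<bar>\<Sum>k\<in>{1..n}. (measure M {x. real k / real n \<le> g x} - \<theta> * measure M' {x. real k / real n \<le> g x}) / real n\<bar>"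
   unfolding lint[OF M] lint[OF M'] sum_distrib_left sum_subtractf[symmetric] by (simp add: diff_divide_distrib)
  also have "\<dots> \<le> (\<Sum>k\<in>{1..n}. \<bar>(measure M {x. real k / real n \<le> g x} - \<theta> * measure M' {x. real k / real n \<le> g x}) / real n\<bar>)"
   by (rule sum_abs)
  also have "\<dots> \<le> (\<Sum>k\<in>{1..n}. \<delta> / real n)"
   using bd[OF s] by (intro sum_mono) (auto simp: abs_divide intro!: divide_right_mono)
  finally show ?thesis using n by simp
 qed
 have "\<bar>(LINT x|M. g x) - \<theta> * (LINT x|M'. g x)\<bar> \<le> \<delta> + (measure M UNIV + \<theta> * measure M' UNIV) * inverse (real (Suc n))" for n
 proof -
  have "\<theta> * (LINT x|M'. lev (Suc n) x) \<le> \<theta> * (LINT x|M'. g x)" "\<theta> * (LINT x|M'. g x) \<le> \<theta> * ((LINT x|M'. lev (Suc n) x) + measure M' UNIV / real (Suc n))"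
   using close[OF M', of "Suc n"] \<theta> by (auto intro: mult_left_mono)
  moreover have "\<theta> * ((LINT x|M'. lev (Suc n) x) + measure M' UNIV / real (Suc n)) = \<theta> * (LINT x|M'. lev (Suc n) x) + \<theta> * measure M' UNIV * inverse (real (Suc n))"
   by (simp add: distrib_left divide_inverse)
  moreover have "measure M UNIV / real (Suc n) = measure M UNIV * inverse (real (Suc n))" by (simp add: divide_inverse)
  moreover have "0 \<le> \<theta> * measure M' UNIV * inverse (real (Suc n))" "0 \<le> measure M UNIV * inverse (real (Suc n))" using \<theta> by auto
  ultimately show ?thesis using close[OF M, of "Suc n"] ld[of "Suc n"] by (simp only: distrib_right) linarith
 qed
 moreover have "(\<lambda>n. \<delta> + (measure M UNIV + \<theta> * measure M' UNIV) * inverse (real (Suc n))) \<longlonglongrightarrow> \<delta> + (measure M UNIV + \<theta> * measure M' UNIV) * 0"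
  by (intro tendsto_intros LIMSEQ_inverse_real_of_nat)
 ultimately show ?thesis by (intro LIMSEQ_le_const[where X="\<lambda>n. \<delta> + (measure M UNIV + \<theta> * measure M' UNIV) * inverse (real (Suc n))"]) auto
qed

text \<open>The hypotheses at \<open>lam0 = 0\<close> in terms of the kernels \<open>kappa\<close>:
  \<open>c\<close> stands for the gap \<open>lam1 - lam0\<close>, and \<open>Tm\<close> for an upper
  bound of the eigenfunction, which exists because it tends to 0 at infinity.\<close>

locale critical = branching \<Omega> F X Q b d Pr L
 for \<Omega> :: "'a measure" and F and X :: "real => 'a => real" and Q and b d and Pr :: "real => 'w measure" and L +
 fixes \<Theta> :: "real => real" and \<mu> :: "real measure" and H c Tm :: real
 assumes sets_mu [measurable_cong, simp]: "sets \<mu> = sets borel" and finite_mu: "finite_measure \<mu>"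
  and open_mu: "\<And>U. open U ==> U \<noteq> {} ==> 0 < emeasure \<mu> U"
  and Theta_cont: "continuous_on UNIV \<Theta>" and Theta_pos: "\<And>x. 0 < \<Theta> x" and Theta_le: "\<And>x. \<Theta> x \<le> Tm"
  and mu_Theta: "(LINT y|\<mu>. \<Theta> y) = 1"
  and c_pos: "0 < c" and H_pos: "0 < H"
  and Theta_inv: "\<And>t x. 0 \<le> t ==> (LINT z|kappa t x. \<Theta> z) = \<Theta> x"
  and gap: "\<And>g t x K. continuous_on UNIV g ==> (\<And>y. \<bar>g y\<bar> \<le> K) ==> 0 \<le> t ==>
   \<bar>(LINT z|kappa t x. g z) - \<Theta> x * (LINT y|\<mu>. g y)\<bar> \<le> H * K * exp (- c * t)"
begin

sublocale mu: finite_measure \<mu> by (rule finite_mu)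

lemma space_mu [simp]: "space \<mu> = UNIV"
 using sets_eq_imp_space_eq[OF sets_mu] by simp

lemma Theta_measurable [measurable]: "\<Theta> \<in> borel_measurable borel"
 using Theta_cont by (rule borel_measurable_continuous_onI)

lemma Tm_pos: "0 < Tm"
 using Theta_pos[of 0] Theta_le[of 0] by simp

abbreviation "mass \<equiv> measure \<mu> UNIV"

text \<open>The gap is given for continuous functions, whereas the functions to be fed into it are
  built from survival probabilities of which only measurability is known. A continuous function that
  approximates the set for both measures carries the bound over with the same
  \<open>H\<close>.\<close>

lemma gap_set:
 assumes "A \<in> sets borel" "0 \<le> t"
 shows "\<bar>measure (kappa t x) A - \<Theta> x * measure \<mu> A\<bar> \<le> H * exp (- c * t)"
proof (rule field_le_epsilon)
 fix e :: real assume e: "0 < e"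
 \<comment> \<open>The approximation error enters once for \<open>kappa\<close> and once, multiplied
   by \<open>\<Theta> x\<close>, for \<open>\<mu>\<close>.\<close>
 define e' where "e' = e / (1 + \<Theta> x)"
 have e': "0 < e'" "e' * (1 + \<Theta> x) = e" using e Theta_pos[of x] by (auto simp: e'_def)
 obtain h where h: "continuous_on UNIV h" "\<And>x. 0 \<le> h x" "\<And>x. h x \<le> (1::real)"
  "\<bar>(LINT x|kappa t x. h x) - measure (kappa t x) A\<bar> \<le> e'" "\<bar>(LINT x|\<mu>. h x) - measure \<mu> A\<bar> \<le> e'"
  by (rule continuous_between[OF sets_kappa[of t x] finite_measure_kappa[OF assms(2), of x] sets_mu finite_mu assms(1) e'(1)]) blast
 have "\<bar>(LINT z|kappa t x. h z) - \<Theta> x * (LINT y|\<mu>. h y)\<bar> \<le> H * 1 * exp (- c * t)"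
  using h by (intro gap assms) auto
 moreover have "\<bar>\<Theta> x * (LINT y|\<mu>. h y) - \<Theta> x * measure \<mu> A\<bar> \<le> \<Theta> x * e'"
  unfolding right_diff_distrib[symmetric] abs_mult using h(5) Theta_pos[of x] by (auto intro: mult_left_mono)
 moreover have "e' + \<Theta> x * e' = e" using e'(2) by (simp add: algebra_simps)
 ultimately show "\<bar>measure (kappa t x) A - \<Theta> x * measure \<mu> A\<bar> \<le> H * exp (- c * t) + e"
  using h(4) by simp
qed

lemma gap_pos:
 assumes g[measurable]: "g \<in> borel_measurable borel" and g0: "\<And>y. 0 \<le> g y" and gK: "\<And>y. g y \<le> K" and t: "0 \<le> t"
 shows "\<bar>(LINT z|kappa t x. g z) - \<Theta> x * (LINT y|\<mu>. g y)\<bar> \<le> H * K * exp (- c * t)"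
proof (cases "K = 0")
 case True
 then have "g = (\<lambda>_. 0)" using g0 gK by (auto intro!: ext antisym)
 then show ?thesis using True by simp
next
 case False
 then have K: "0 < K" using g0[of 0] gK[of 0] by simp
 have "\<bar>(LINT z|kappa t x. g z / K) - \<Theta> x * (LINT y|\<mu>. g y / K)\<bar> \<le> H * exp (- c * t)"
  by (rule integral_diff_le_of_sets[OF sets_kappa finite_measure_kappa[OF t] sets_mu finite_mu gap_set[OF _ t]])
    (use K g0 gK less_imp_le[OF Theta_pos] in auto)
 then have "\<bar>((LINT z|kappa t x. g z) - \<Theta> x * (LINT y|\<mu>. g y)) / K\<bar> \<le> H * exp (- c * t)"
  by (simp add: diff_divide_distrib)
 then show ?thesis using K by (simp add: abs_divide field_simps)
qed

lemma integrable_kappa: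
 "g \<in> borel_measurable borel ==> (\<And>y. \<bar>g y\<bar> \<le> K) ==> 0 \<le> t ==> integrable (kappa t x) (g :: real => real)"
 by (intro finite_measure.integrable_const_bound[OF finite_measure_kappa, where B=K]) auto

lemma integrable_mu:
 "g \<in> borel_measurable borel ==> (\<And>y. \<bar>g y\<bar> \<le> K) ==> integrable \<mu> (g :: real => real)"
 by (intro mu.integrable_const_bound[where B=K]) auto

text \<open>The function is shifted to \<open>g + K\<close>, which lies between 0 and
  \<open>2 * K\<close>, and the constant is subtracted again: the factor 3 is 2 + 1.\<close>

lemma gap_signed:
 assumes g[measurable]: "g \<in> borel_measurable borel" and gK: "\<And>y. \<bar>g y\<bar> \<le> K" and t: "0 \<le> t"
 shows "\<bar>(LINT z|kappa t x. g z) - \<Theta> x * (LINT y|\<mu>. g y)\<bar> \<le> 3 * H * K * exp (- c * t)"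
proof -
 have K: "0 \<le> g y + K" "g y + K \<le> 2 * K" for y using gK[of y] by auto
 have K0: "0 \<le> K" using gK[of 0] by simp
 have ik: "integrable (kappa t x) g" "integrable \<mu> g" using integrable_kappa[OF g gK t] integrable_mu[OF g gK] by auto
 interpret K: finite_measure "kappa t x" by (rule finite_measure_kappa[OF t])
 have "\<bar>(LINT z|kappa t x. g z + K) - \<Theta> x * (LINT y|\<mu>. g y + K)\<bar> \<le> H * (2 * K) * exp (- c * t)"
  using K by (intro gap_pos t) auto
 moreover have "\<bar>(LINT z|kappa t x. K) - \<Theta> x * (LINT y|\<mu>. K)\<bar> \<le> H * K * exp (- c * t)"
  using K0 by (intro gap_pos t) auto
 moreover have "(LINT z|kappa t x. g z + K) = (LINT z|kappa t x. g z) + (LINT z|kappa t x. K)" "(LINT y|\<mu>. g y + K) = (LINT y|\<mu>. g y) + (LINT y|\<mu>. K)"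
  using ik by (auto simp: Bochner_Integration.integral_add)
 ultimately show ?thesis by (simp only: distrib_left)
qed

text \<open>A bound on P_t 1 uniform in \<open>t\<close> and in the trait, supplied by the gap; the
  bound exp(bmax t) used so far grows with time.\<close>

definition Ck :: real where "Ck = Tm * mass + H"

lemma Ck_pos: "0 < Ck"
 using Tm_pos H_pos by (simp add: Ck_def add_nonneg_pos)

lemma kappa_mass: "0 \<le> t ==> measure (kappa t x) UNIV \<le> Ck"
proof -
 assume t: "0 \<le> t"
 have "measure (kappa t x) UNIV \<le> \<Theta> x * mass + H * exp (- c * t)" using gap_set[of UNIV t x] t by auto
 also have "\<dots> \<le> Tm * mass + H * 1"
  using Theta_le[of x] H_pos c_pos t by (intro add_mono mult_right_mono mult_left_mono) auto
 finally show ?thesis by (simp add: Ck_def)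
qed

lemma integral_kappa_le:
 assumes "g \<in> borel_measurable borel" "\<And>y. 0 \<le> g y" "\<And>y. g y \<le> K" "0 \<le> t"
 shows "(LINT z|kappa t x. g z) \<le> Ck * K"
proof -
 have K: "0 \<le> K" by (rule order_trans[OF assms(2)[of 0] assms(3)[of 0]])
 interpret K: finite_measure "kappa t x" by (rule finite_measure_kappa[OF assms(4)])
 have "(LINT z|kappa t x. g z) \<le> (LINT z|kappa t x. K)"
  using assms K by (intro integral_mono integrable_kappa[where K=K]) auto
 also have "\<dots> \<le> Ck * K" using kappa_mass[OF assms(4)] K by (simp add: mult_right_mono)
 finally show ?thesis .
qed

lemma ennreal_integral_kappa:
 assumes [measurable]: "g \<in> borel_measurable borel" and g: "\<And>y. 0 \<le> g y" "\<And>y. g y \<le> K" and t: "0 \<le> t"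
 shows "ennreal (LINT z|kappa t x. g z) = PP t (\<lambda>z. ennreal (g z)) x"
 using integrable_kappa[of g K t x] g t by (subst nn_integral_eq_integral[symmetric]) (auto simp: nn_integral_kappa)

lemma measurable_integral_kappa:
 fixes \<phi> :: "real => real => real"
 assumes [measurable]: "(\<lambda>(s, z). \<phi> s z) \<in> borel_measurable borel2" and \<phi>: "\<And>s z. 0 \<le> \<phi> s z" "\<And>s z. \<phi> s z \<le> K"
  and [measurable]: "s \<in> borel_measurable N" "x \<in> borel_measurable N"
 shows "(\<lambda>v. if 0 \<le> s v then \<integral>z. \<phi> (s v) z \<partial>kappa (s v) (x v) else 0) \<in> borel_measurable N"
proof -
 have eq: "(if 0 \<le> r then \<integral>z. \<phi> r z \<partial>kappa r y else 0) = (if 0 \<le> r then enn2real (PP r (\<lambda>z. ennreal (\<phi> r z)) y) else 0)" for r y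
 proof (cases "0 \<le> r")
  case True
  have [measurable]: "\<phi> r \<in> borel_measurable borel" by measurable
  show ?thesis using \<phi> True
   by (simp add: ennreal_integral_kappa[OF _ \<phi> True, symmetric] lint_nonneg)
 qed simp
 show ?thesis unfolding eq by measurable
qed

text \<open>The gap is integrated over the time window. Since exp(-c s) has integral at most 1/c,
  replacing the kernel by its projection costs an error that does not grow with
  \<open>t\<close>.\<close>

lemma nu_estimate:
 assumes \<phi>m[measurable]: "(\<lambda>(s, z). \<phi> s z) \<in> borel_measurable borel2" and t: "0 \<le> t"
  and \<phi>0: "\<And>s z. 0 \<le> s ==> s \<le> t ==> 0 \<le> \<phi> s z" and \<phi>K: "\<And>s z. 0 \<le> s ==> s \<le> t ==> \<phi> s z \<le> K"
 shows "\<bar>(LINT p|nu t x. \<phi> (fst p) (snd p)) - \<Theta> x * (LINT s:{0..t}|lborel. \<integral>z. \<phi> s z \<partial>\<mu>)\<bar> \<le> H * K / c"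
  and "(LINT p|nu t x. \<phi> (fst p) (snd p)) \<le> t * Ck * K"
proof -
 \<comment> \<open>Extension by 0 outside the window, so that the bounds on \<phi> hold at all
   times, as the measurability and gap lemmas expect.\<close>
 define \<psi> where "\<psi> s z = (if 0 \<le> s \<and> s \<le> t then \<phi> s z else 0)" for s z
 have K: "0 \<le> K" using \<phi>0[of 0 0] \<phi>K[of 0 0] t by simp
 have \<psi>m[measurable]: "(\<lambda>(s, z). \<psi> s z) \<in> borel_measurable borel2" unfolding \<psi>_def by measurable
 have \<psi>: "0 \<le> \<psi> s z" "\<psi> s z \<le> K" for s z using \<phi>0 \<phi>K K by (auto simp: \<psi>_def)
 have \<psi>s[measurable]: "\<psi> s \<in> borel_measurable borel" for s by measurable
 define p where "p s = (if 0 \<le> s then \<integral>z. \<psi> s z \<partial>kappa s x else 0)" for s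
 define m where "m s = (LINT z|\<mu>. \<psi> s z)" for s
 have pm[measurable]: "p \<in> borel_measurable borel"
  unfolding p_def by (rule measurable_integral_kappa[OF \<psi>m \<psi>]) auto
 have mm[measurable]: "m \<in> borel_measurable borel" unfolding m_def by (rule mu.borel_measurable_lebesgue_integral) measurable
 have p0: "0 \<le> p s" "p s \<le> Ck * K" for s
  using integral_kappa_le[OF \<psi>s \<psi>, of s x] \<psi> Ck_pos K by (auto simp: p_def intro!: lint_nonneg)
 have m0: "0 \<le> m s" "m s \<le> mass * K" for s
 proof -
  show "0 \<le> m s" unfolding m_def using \<psi> by (intro lint_nonneg) auto
  have "m s \<le> (LINT z|\<mu>. K)" unfolding m_def using \<psi> K by (intro integral_mono integrable_mu[where K=K]) auto
  then show "m s \<le> mass * K" by simp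
 qed
 have pint: "set_integrable lborel {0..t} p"
  unfolding set_integrable_def by (rule integrableI_bounded_set_indicator[where B="Ck * K"]) (use p0 t in auto)
 have mint: "set_integrable lborel {0..t} m"
  unfolding set_integrable_def by (rule integrableI_bounded_set_indicator[where B="mass * K"]) (use m0 t in auto)
 have AE\<psi>: "AE q in nu t x. \<phi> (fst q) (snd q) = \<psi> (fst q) (snd q)"
  using AE_nu[of t x] by eventually_elim (auto simp: \<psi>_def)
 have "(LINT q|nu t x. \<phi> (fst q) (snd q)) = (LINT q|nu t x. \<psi> (fst q) (snd q))"
  by (rule integral_cong_AE) (use AE\<psi> in auto)
 also have "\<dots> = enn2real (\<integral>\<^sup>+q. ennreal (\<psi> (fst q) (snd q)) \<partial>nu t x)"
  by (rule integral_eq_nn_integral) (use \<psi> in auto)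
 also have "(\<integral>\<^sup>+q. ennreal (\<psi> (fst q) (snd q)) \<partial>nu t x) = (\<integral>\<^sup>+s\<in>{0..t}. PP s (\<lambda>z. ennreal (\<psi> s z)) x \<partial>lborel)"
  by (subst nn_integral_nu) auto
 also have "\<dots> = (\<integral>\<^sup>+s. ennreal (indicator {0..t} s *\<^sub>R p s) \<partial>lborel)"
  by (intro nn_integral_cong) (auto simp: p_def ennreal_integral_kappa[OF \<psi>s \<psi>] split: split_indicator)
 also have "\<dots> = ennreal (LINT s:{0..t}|lborel. p s)"
  unfolding set_lebesgue_integral_def using pint p0 by (intro nn_integral_eq_integral) (auto simp: set_integrable_def)
 finally have L: "(LINT q|nu t x. \<phi> (fst q) (snd q)) = (LINT s:{0..t}|lborel. p s)"
  using p0 by (simp add: set_lebesgue_integral_def lint_nonneg)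
 have Mm: "(LINT s:{0..t}|lborel. \<integral>z. \<phi> s z \<partial>\<mu>) = (LINT s:{0..t}|lborel. m s)"
  unfolding set_lebesgue_integral_def by (intro Bochner_Integration.integral_cong) (auto simp: m_def \<psi>_def split: split_indicator)
 have eint: "set_integrable lborel {0..t} (\<lambda>s. H * K * exp (- c * s))"
  by (intro borel_integrable_atLeastAtMost' continuous_intros)
 have "\<bar>(LINT s:{0..t}|lborel. p s) - \<Theta> x * (LINT s:{0..t}|lborel. m s)\<bar> = \<bar>LINT s:{0..t}|lborel. p s - \<Theta> x * m s\<bar>"
  using pint mint by (simp add: set_integral_diff set_integral_mult_right set_integrable_mult_right)
 also have "\<dots> \<le> (LINT s:{0..t}|lborel. \<bar>p s - \<Theta> x * m s\<bar>)"
  using set_integral_norm_bound[of lborel "{0..t}" "\<lambda>s. p s - \<Theta> x * m s"] pint mint by (simp add: set_integral_diff set_integrable_mult_right)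
 also have "\<dots> \<le> (LINT s:{0..t}|lborel. H * K * exp (- c * s))"
 proof (rule set_integral_mono[OF _ eint])
  show "set_integrable lborel {0..t} (\<lambda>s. \<bar>p s - \<Theta> x * m s\<bar>)"
   using pint mint by (intro set_integrable_abs set_integral_diff set_integrable_mult_right) auto
  fix s assume "s \<in> {0..t}"
  then show "\<bar>p s - \<Theta> x * m s\<bar> \<le> H * K * exp (- c * s)"
   using gap_pos[OF \<psi>s \<psi>, of s x] by (simp add: p_def m_def)
 qed
 also have "\<dots> = H * K * (LINT s:{0..t}|lborel. exp (- c * s))" by (rule set_integral_mult_right)
 also have "(LINT s:{0..t}|lborel. exp (- c * s)) = (LINT s|lborel. exp (- c * s) * indicator {0..t} s)"
  by (simp add: set_lebesgue_integral_def mult.commute)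
 also have "\<dots> = (- exp (- c * t) / c) - (- exp (- c * 0) / c)"
  using t c_pos by (intro integral_FTC_Icc_real) (auto intro!: derivative_eq_intros continuous_intros)
 also have "\<dots> \<le> 1 / c" using c_pos by (simp add: field_simps)
 finally have "\<bar>(LINT s:{0..t}|lborel. p s) - \<Theta> x * (LINT s:{0..t}|lborel. m s)\<bar> \<le> H * K * (1 / c)"
  using H_pos K by (auto intro: mult_left_mono)
 then show "\<bar>(LINT p|nu t x. \<phi> (fst p) (snd p)) - \<Theta> x * (LINT s:{0..t}|lborel. \<integral>z. \<phi> s z \<partial>\<mu>)\<bar> \<le> H * K / c"
  by (simp add: L Mm)
 have "(LINT s:{0..t}|lborel. p s) \<le> (LINT s:{0..t}|lborel. Ck * K)"
  using p0 by (intro set_integral_mono pint borel_integrable_atLeastAtMost' continuous_intros) auto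
 then show "(LINT p|nu t x. \<phi> (fst p) (snd p)) \<le> t * Ck * K" using t by (simp add: L set_lebesgue_integral_def mult_ac)
qed

lemma measurable_kappa_integral:
 fixes g :: "real => real"
 assumes g[measurable]: "g \<in> borel_measurable borel" and g0: "\<And>y. 0 \<le> g y" "\<And>y. g y \<le> K" and t: "0 \<le> t"
 shows "(\<lambda>z. \<integral>z'. g z' \<partial>kappa t z) \<in> borel_measurable borel"
proof -
 have "(\<lambda>z. if 0 \<le> t then \<integral>z'. g z' \<partial>kappa t z else 0) \<in> borel_measurable borel"
  by (rule measurable_integral_kappa[where \<phi>="\<lambda>_. g" and K=K and s="\<lambda>_. t" and x="\<lambda>x. x"]) (measurable, rule g0, rule g0, simp_all)
 then show ?thesis using t by simp
qed

lemma kappa_semigroup: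
 fixes g :: "real => real"
 assumes g[measurable]: "g \<in> borel_measurable borel" and g0: "\<And>y. 0 \<le> g y" "\<And>y. g y \<le> K" and s: "0 \<le> s" and t: "0 \<le> t"
 shows "(LINT z|kappa s x. (LINT z'|kappa t z. g z')) = (LINT z|kappa (s + t) x. g z)"
proof -
 have G: "(\<lambda>z. \<integral>z'. g z' \<partial>kappa t z) \<in> borel_measurable borel" by (rule measurable_kappa_integral[OF g g0 t])
 have G0: "0 \<le> (LINT z'|kappa t z. g z')" "(LINT z'|kappa t z. g z') \<le> Ck * K" for z
  using integral_kappa_le[OF g g0 t] g0 by (auto intro!: lint_nonneg)
 have "ennreal (LINT z|kappa s x. (LINT z'|kappa t z. g z')) = PP s (PP t (\<lambda>z. ennreal (g z))) x"
  using ennreal_integral_kappa[OF G G0 s] ennreal_integral_kappa[OF g g0 t] by simp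
 also have "\<dots> = PP (s + t) (\<lambda>z. ennreal (g z)) x"
  using s t g0 by (intro PP_semigroup[symmetric, where D="ennreal K"]) (auto intro: ennreal_leI)
 also have "\<dots> = ennreal (LINT z|kappa (s + t) x. g z)"
  using s t by (intro ennreal_integral_kappa[OF g g0, symmetric]) auto
 finally show ?thesis using g0 G0 by (subst (asm) ennreal_inj) (auto intro!: lint_nonneg)
qed

text \<open>Invariance follows from the gap: P_(n+t) g (0) tends to \<Theta>(0) \<mu>(g), and being
  P_n (P_t g) (0) it also tends to \<Theta>(0) \<mu>(P_t g). Positivity of \<Theta>(0) allows the
  comparison.\<close>

lemma mu_invariant:
 fixes g :: "real => real"
 assumes g[measurable]: "g \<in> borel_measurable borel" and g0: "\<And>y. 0 \<le> g y" "\<And>y. g y \<le> K" and t: "0 \<le> t"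
 shows "(LINT z|\<mu>. (LINT z'|kappa t z. g z')) = (LINT z|\<mu>. g z)"
proof -
 have G: "(\<lambda>z. \<integral>z'. g z' \<partial>kappa t z) \<in> borel_measurable borel" by (rule measurable_kappa_integral[OF g g0 t])
 have G0: "0 \<le> (LINT z'|kappa t z. g z')" "(LINT z'|kappa t z. g z') \<le> Ck * K" for z
  using integral_kappa_le[OF g g0 t] g0 by (auto intro!: lint_nonneg)
 have lim: "(\<lambda>n. \<integral>z. f z \<partial>kappa (real n + r) 0) \<longlonglongrightarrow> \<Theta> 0 * (LINT z|\<mu>. f z)"
  if f: "f \<in> borel_measurable borel" "\<And>y. 0 \<le> f y" "\<And>y. f y \<le> K'" and r: "0 \<le> r" for f K' r
 proof (rule Lim_transform2)
  show "(\<lambda>n. \<Theta> 0 * (LINT z|\<mu>. f z)) \<longlonglongrightarrow> \<Theta> 0 * (LINT z|\<mu>. f z)" by simp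
  show "(\<lambda>n. \<Theta> 0 * (LINT z|\<mu>. f z) - (LINT z|kappa (real n + r) 0. f z)) \<longlonglongrightarrow> 0"
  proof (rule Lim_null_comparison)
   show "eventually (\<lambda>n. norm (\<Theta> 0 * (LINT z|\<mu>. f z) - (LINT z|kappa (real n + r) 0. f z)) \<le> H * K' * exp (- c * (real n + r))) sequentially"
    using gap_pos[OF f] r by (intro always_eventually allI) (auto simp: abs_minus_commute)
   have "filterlim (\<lambda>n. - c * (real n + r)) at_bot sequentially"
    using c_pos by (intro filterlim_tendsto_neg_mult_at_bot[OF tendsto_const]) (auto intro!: filterlim_at_top_add_at_top filterlim_tendsto_add_at_top filterlim_real_sequentially simp: add.commute[of _ r])
   then have "(\<lambda>n. exp (- c * (real n + r))) \<longlonglongrightarrow> 0" by (rule filterlim_compose[OF exp_at_bot])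
   then show "(\<lambda>n. H * K' * exp (- c * (real n + r))) \<longlonglongrightarrow> 0" by (rule tendsto_mult_right_zero)
  qed
 qed
 have "(\<lambda>n. \<integral>z. g z \<partial>kappa (real n + t) 0) \<longlonglongrightarrow> \<Theta> 0 * (LINT z|\<mu>. (LINT z'|kappa t z. g z'))"
  using lim[OF G G0, of 0] kappa_semigroup[OF g g0 _ t, of "real _" 0] by simp
 moreover have "(\<lambda>n. \<integral>z. g z \<partial>kappa (real n + t) 0) \<longlonglongrightarrow> \<Theta> 0 * (LINT z|\<mu>. g z)" by (rule lim[OF g g0 t])
 ultimately have "\<Theta> 0 * (LINT z|\<mu>. (LINT z'|kappa t z. g z')) = \<Theta> 0 * (LINT z|\<mu>. g z)" by (rule LIMSEQ_unique)
 then show ?thesis using Theta_pos[of 0] by simp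
qed

end

section \<open>Growth of the moments\<close>

lemma set_integral_FTC:
 fixes J :: "real => real"
 assumes "0 \<le> t" "\<And>s. 0 \<le> s ==> s \<le> t ==> (J has_real_derivative J' s) (at s)" "continuous_on {0..t} J'"
 shows "(LINT s:{0..t}|lborel. J' s) = J t - J 0"
 unfolding set_lebesgue_integral_def
 by (rule integral_FTC_Icc)
  (use assms in \<open>auto simp: has_real_derivative_iff_has_vector_derivative[symmetric] intro: has_field_derivative_at_within\<close>)

text \<open>The product is replaced one factor at a time. Here \<open>v\<close>, \<open>v'\<close>
  stand for the orders of growth of the two moments and \<open>w\<close> for the relative gain
  sqrt(1 + t), which the product retains.\<close>

lemma abs_product_diff_le:
 fixes m m' l l' :: real
 assumes "0 \<le> m'" "0 \<le> l" "\<bar>m - l\<bar> \<le> p * (v / w)" "m' \<le> q * v'" "l \<le> r * v" "\<bar>m' - l'\<bar> \<le> p' * (v' / w)"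
 shows "\<bar>m * m' - l * l'\<bar> \<le> (p * q + r * p') * ((v * v') / w)"
proof -
 have "m * m' - l * l' = (m - l) * m' + l * (m' - l')" by (simp add: algebra_simps)
 then have "\<bar>m * m' - l * l'\<bar> \<le> \<bar>(m - l) * m'\<bar> + \<bar>l * (m' - l')\<bar>" by (metis abs_triangle_ineq)
 also have "\<dots> = \<bar>m - l\<bar> * m' + l * \<bar>m' - l'\<bar>" using assms(1,2) by (simp add: abs_mult)
 also have "\<dots> \<le> (p * (v / w)) * (q * v') + (r * v) * (p' * (v' / w))"
  using assms by (intro add_mono mult_mono) auto
 also have "\<dots> = (p * q + r * p') * ((v * v') / w)" by (simp add: algebra_simps add_divide_distrib)
 finally show ?thesis .
qed

context critical
begin

definition Bc :: real where "Bc = (LINT y|\<mu>. (\<Theta> y)\<^sup>2 * b y)"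

lemma Theta_nonneg: "0 \<le> \<Theta> x"
 using Theta_pos[of x] by simp

lemma Theta_sq_le: "(\<Theta> y)\<^sup>2 \<le> Tm\<^sup>2"
 using Theta_le[of y] Theta_nonneg[of y] by (intro power_mono) auto

lemma integrable_Theta_sq_b: "integrable \<mu> (\<lambda>y. (\<Theta> y)\<^sup>2 * b y)"
proof (rule integrable_mu[where K="Tm\<^sup>2 * bmax"])
 show "(\<lambda>y. (\<Theta> y)\<^sup>2 * b y) \<in> borel_measurable borel" by measurable
 show "\<bar>(\<Theta> y)\<^sup>2 * b y\<bar> \<le> Tm\<^sup>2 * bmax" for y
  using Theta_sq_le[of y] b_nonneg[of y] bmax by (auto simp: abs_mult intro!: mult_mono)
qed

text \<open>The continuous function under the integral is positive at a point where \<open>b\<close>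
  does not vanish, hence on a nonempty open set, and \<open>\<mu>\<close> charges every such
  set.\<close>

lemma Bc_pos: "0 < Bc"
proof -
 obtain y0 where y0: "b y0 \<noteq> 0" using HV by (auto simp: HV_def)
 have cb: "continuous_on UNIV b" using HV by (auto simp: HV_def)
 have op: "open {y. 0 < (\<Theta> y)\<^sup>2 * b y}"
  using cb Theta_cont by (intro open_Collect_less continuous_intros)
 have y0': "y0 \<in> {y. 0 < (\<Theta> y)\<^sup>2 * b y}" using y0 b_nonneg[of y0] Theta_pos[of y0] by simp
 have n0: "0 \<le> (\<Theta> y)\<^sup>2 * b y" for y using b_nonneg[of y] by simp
 have "\<not> (AE y in \<mu>. (\<Theta> y)\<^sup>2 * b y = 0)"
 proof
  assume "AE y in \<mu>. (\<Theta> y)\<^sup>2 * b y = 0"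
  then have "AE y in \<mu>. y \<notin> {y. 0 < (\<Theta> y)\<^sup>2 * b y}" by eventually_elim auto
  then have "emeasure \<mu> {y. 0 < (\<Theta> y)\<^sup>2 * b y} = 0"
   using op by (subst (asm) AE_iff_measurable[OF _ refl]) auto
  then show False using open_mu[OF op] y0' by auto
 qed
 then have "Bc \<noteq> 0" unfolding Bc_def using integrable_Theta_sq_b n0 by (subst integral_nonneg_eq_0_iff_AE) auto
 moreover have "0 \<le> Bc" unfolding Bc_def using n0 by (intro lint_nonneg) auto
 ultimately show ?thesis by simp
qed

text \<open>Two errors add up: \<open>nu_estimate\<close> replaces the kernel by its projection,
  then the profile \<open>J'\<close> with tolerance \<open>E'\<close> replaces the \<mu>-average of
  \<phi>. Antiderivatives are supplied so that both time integrals are explicit increments.\<close>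

lemma nu_asymp:
 assumes \<phi>m[measurable]: "(\<lambda>(s, z). \<phi> s z) \<in> borel_measurable borel2" and t: "0 \<le> t"
  and \<phi>0: "\<And>s z. 0 \<le> s ==> s \<le> t ==> 0 \<le> \<phi> s z" and \<phi>K: "\<And>s z. 0 \<le> s ==> s \<le> t ==> \<phi> s z \<le> K"
  and J: "\<And>s. 0 \<le> s ==> s \<le> t ==> (J has_real_derivative J' s) (at s)" "continuous_on {0..t} J'"
  and E: "\<And>s. 0 \<le> s ==> s \<le> t ==> (E has_real_derivative E' s) (at s)" "continuous_on {0..t} E'"
  and bd: "\<And>s. 0 \<le> s ==> s \<le> t ==> \<bar>(LINT z|\<mu>. \<phi> s z) - J' s\<bar> \<le> E' s"
 shows "\<bar>(LINT p|nu t x. \<phi> (fst p) (snd p)) - \<Theta> x * (J t - J 0)\<bar> \<le> H * K / c + Tm * (E t - E 0)"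
proof -
 define m where "m s = (LINT z|\<mu>. \<phi> s z)" for s
 have mm[measurable]: "m \<in> borel_measurable borel" unfolding m_def by (rule mu.borel_measurable_lebesgue_integral) measurable
 have Fi: "set_integrable lborel {0..t} J'" and Ei: "set_integrable lborel {0..t} E'"
  using J E by (auto intro!: borel_integrable_atLeastAtMost')
 have JJ: "(LINT s:{0..t}|lborel. J' s) = J t - J 0" by (rule set_integral_FTC[OF t J])
 have EE: "(LINT s:{0..t}|lborel. E' s) = E t - E 0" by (rule set_integral_FTC[OF t E])
 have mi: "set_integrable lborel {0..t} (\<lambda>s. m s - J' s)"
  unfolding set_integrable_def
 proof (rule Bochner_Integration.integrable_bound[OF Ei[unfolded set_integrable_def]])
  have "(\<lambda>s. indicator {0..t} s *\<^sub>R J' s) \<in> borel_measurable lborel"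
   using Fi unfolding set_integrable_def by (rule borel_measurable_integrable)
  moreover have "(\<lambda>s. indicator {0..t} s *\<^sub>R m s) \<in> borel_measurable lborel" by simp
  ultimately show "(\<lambda>s. indicator {0..t} s *\<^sub>R (m s - J' s)) \<in> borel_measurable lborel"
   unfolding scaleR_diff_right by (rule borel_measurable_diff[rotated])
  show "AE s in lborel. norm (indicator {0..t} s *\<^sub>R (m s - J' s)) \<le> norm (indicator {0..t} s *\<^sub>R E' s)"
   using bd by (intro AE_I2) (auto simp: m_def split: split_indicator intro: order_trans[OF _ abs_ge_self])
 qed
 have mi2: "set_integrable lborel {0..t} m" using set_integral_add(1)[OF mi Fi] by simp
 have "\<bar>(LINT s:{0..t}|lborel. m s) - (J t - J 0)\<bar> = \<bar>LINT s:{0..t}|lborel. m s - J' s\<bar>"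
  using mi2 Fi by (simp add: set_integral_diff JJ)
 also have "\<dots> \<le> (LINT s:{0..t}|lborel. \<bar>m s - J' s\<bar>)"
  using set_integral_norm_bound[OF mi] by simp
 also have "\<dots> \<le> (LINT s:{0..t}|lborel. E' s)"
  using bd by (intro set_integral_mono Ei set_integrable_abs mi) (auto simp: m_def)
 finally have "\<Theta> x * \<bar>(LINT s:{0..t}|lborel. m s) - (J t - J 0)\<bar> \<le> Tm * (E t - E 0)"
  unfolding EE using Theta_le[of x] Theta_nonneg[of x] by (intro mult_mono) auto
 then have "\<bar>\<Theta> x * (LINT s:{0..t}|lborel. m s) - \<Theta> x * (J t - J 0)\<bar> \<le> Tm * (E t - E 0)"
  using Theta_nonneg[of x] by (simp add: right_diff_distrib[symmetric] abs_mult)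
 moreover have "\<bar>(LINT p|nu t x. \<phi> (fst p) (snd p)) - \<Theta> x * (LINT s:{0..t}|lborel. m s)\<bar> \<le> H * K / c"
  unfolding m_def by (rule nu_estimate(1)[OF \<phi>m t \<phi>0 \<phi>K])
 moreover have "\<bar>w - v\<bar> \<le> q ==> \<bar>u - w\<bar> \<le> p ==> \<bar>u - v\<bar> \<le> p + q" for u v w p q :: real by linarith
 ultimately show ?thesis by blast
qed

context
 fixes g :: "real => real" and G :: real
 assumes g[measurable]: "g \<in> borel_measurable borel" and g0: "\<And>y. 0 \<le> g y" and gG: "\<And>y. g y \<le> G"
begin

abbreviation "lead n t x \<equiv> fact n * (Bc * t) ^ (n - 1) * (LINT y|\<mu>. g y) ^ n * \<Theta> x"

lemma mean_nonneg: "0 \<le> (LINT y|\<mu>. g y)"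
 using g0 by (intro lint_nonneg) auto

lemma lead_nonneg: "0 \<le> t ==> 0 \<le> lead n t x"
 using mean_nonneg Bc_pos Theta_nonneg[of x] by simp

lemma lead_le:
 assumes "0 \<le> t"
 shows "lead n t x \<le> fact n * Bc ^ (n - 1) * (LINT y|\<mu>. g y) ^ n * Tm * (1 + t) ^ (n - 1)"
proof -
 have "(fact n * Bc ^ (n - 1) * (LINT y|\<mu>. g y) ^ n) * (\<Theta> x * t ^ (n - 1)) \<le>
  (fact n * Bc ^ (n - 1) * (LINT y|\<mu>. g y) ^ n) * (Tm * (1 + t) ^ (n - 1))"
  using assms mean_nonneg Bc_pos Theta_nonneg[of x] Theta_le[of x] Tm_pos
  by (intro mult_left_mono mult_mono power_mono) auto
 then show ?thesis by (simp add: power_mult_distrib mult_ac)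
qed

text \<open>The binomial coefficient cancels the factorials, so the product does not depend on
  \<open>j\<close>. The sum over \<open>j\<close> thus yields the factor n - 1, exactly what
  integrating t^(n-2) divides by; the shape n! (B t)^(n-1) is thereby preserved.\<close>

lemma lead_mult:
 assumes "1 \<le> j" "j < n"
 shows "real (n choose j) * lead j t x * lead (n - j) t x = fact n * (Bc * t) ^ (n - 2) * (LINT y|\<mu>. g y) ^ n * (\<Theta> x)\<^sup>2"
proof -
 have "real (n choose j) * (fact j * fact (n - j)) = fact n"
 proof -
  have "real (fact j * fact (n - j) * (n choose j)) = real (fact n)"
   using binomial_fact_lemma[of j n] assms(2) by (simp del: of_nat_mult)
  then show ?thesis by (simp add: mult.commute)
 qed
 moreover have "(Bc * t) ^ (j - 1) * (Bc * t) ^ (n - j - 1) = (Bc * t) ^ (n - 2)"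
  using assms by (simp flip: power_add)
 moreover have "(LINT y|\<mu>. g y) ^ j * (LINT y|\<mu>. g y) ^ (n - j) = (LINT y|\<mu>. g y) ^ n"
  using assms by (simp flip: power_add)
 moreover have "real (n choose j) * lead j t x * lead (n - j) t x = (real (n choose j) * (fact j * fact (n - j))) *
  ((Bc * t) ^ (j - 1) * (Bc * t) ^ (n - j - 1)) * ((LINT y|\<mu>. g y) ^ j * (LINT y|\<mu>. g y) ^ (n - j)) * (\<Theta> x)\<^sup>2"
  by (simp only: power2_eq_square mult_ac)
 ultimately show ?thesis by simp
qed

text \<open>The relative error 1 / sqrt(1 + t) is chosen because it reproduces itself: integrated
  over \<open>{0..t}\<close> it is of order sqrt(1 + t), that is, (1 + t) times itself. A relative
  error 1 / (1 + t) would pick up a logarithm.\<close>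

lemma moment_asymp:
 assumes "1 \<le> n"
 shows "\<exists>C\<ge>0. \<forall>t\<ge>0. \<forall>x. \<bar>moment n g t x - lead n t x\<bar> \<le> C * ((1 + t) ^ (n - 1) / sqrt (1 + t))"
 using assms
proof (induction n rule: less_induct)
 case (less n)
 have GG: "0 \<le> G" by (rule order_trans[OF g0[of 0] gG[of 0]])
 show ?case
 proof (cases "n = 1")
  case True
  have "\<bar>moment n g t x - lead n t x\<bar> \<le> (H * G * (1 + 1 / c)) * ((1 + t) ^ (n - 1) / sqrt (1 + t))" if t: "0 \<le> t" for t x
  proof -
   have m: "moment n g t x = (LINT z|kappa t x. g z)" using moment_recursion[OF g g0 gG t, of n x] True by simp
   \<comment> \<open>At order 1 the moment is P_t g (x) and the error decays exponentially; it is
     only weakened here to the form used in the induction.\<close>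
   have "1 + c * t \<le> exp (c * t)" by (rule exp_ge_add_one_self)
   then have "1 / exp (c * t) \<le> 1 / (1 + c * t)" using c_pos t by (intro divide_left_mono mult_pos_pos add_pos_nonneg) auto
   then have "(1 + t) * exp (- c * t) \<le> (1 + t) / (1 + c * t)"
    using t mult_left_mono[of "1 / exp (c * t)" "1 / (1 + c * t)" "1 + t"] by (simp add: exp_minus inverse_eq_divide)
   also have "\<dots> \<le> 1 + 1 / c" using c_pos t by (simp add: pos_divide_le_eq add_pos_nonneg) (simp add: algebra_simps)
   finally have "exp (- c * t) \<le> (1 + 1 / c) / (1 + t)" using t by (simp add: field_simps)
   also have "\<dots> \<le> (1 + 1 / c) / sqrt (1 + t)"
    using t c_pos real_sqrt_le_mono[of "1 + t" "(1 + t)\<^sup>2"] self_le_power[of "1 + t" 2] by (intro divide_left_mono) auto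
   finally have "H * G * exp (- c * t) \<le> H * G * ((1 + 1 / c) / sqrt (1 + t))"
    using H_pos GG by (intro mult_left_mono) auto
   then show ?thesis using gap_pos[OF g g0 gG t, of x] m True by (simp add: mult.commute)
  qed
  then show ?thesis using H_pos GG c_pos by (intro exI[of _ "H * G * (1 + 1 / c)"]) auto
 next
  case False
  then obtain k where k: "n = Suc (Suc k)" using less.prems by (cases n; cases "n - 1") auto
  have "\<forall>j\<in>{1..<n}. \<exists>C\<ge>0. \<forall>t\<ge>0. \<forall>x. \<bar>moment j g t x - lead j t x\<bar> \<le> C * ((1 + t) ^ (j - 1) / sqrt (1 + t))"
   using less.IH by auto
  then obtain C where C: "\<And>j. j \<in> {1..<n} ==> 0 \<le> C j"
   "\<And>j t x. j \<in> {1..<n} ==> 0 \<le> t ==> \<bar>moment j g t x - lead j t x\<bar> \<le> C j * ((1 + t) ^ (j - 1) / sqrt (1 + t))"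
   by metis
  define D where "D j = fact j * Bc ^ (j - 1) * (LINT y|\<mu>. g y) ^ j * Tm" for j :: nat
  have D0: "0 \<le> D j" for j unfolding D_def using Bc_pos mean_nonneg Tm_pos by simp
  have w: "1 \<le> sqrt (1 + t)" if "0 \<le> t" for t :: real using that by simp
  have mD: "moment j g t x \<le> (D j + C j) * (1 + t) ^ (j - 1)" if j: "j \<in> {1..<n}" and t: "0 \<le> t" for j t x
  proof -
   have "(1 + t) ^ (j - 1) / sqrt (1 + t) \<le> (1 + t) ^ (j - 1) / 1" using t by (intro divide_left_mono) auto
   then have "C j * ((1 + t) ^ (j - 1) / sqrt (1 + t)) \<le> C j * (1 + t) ^ (j - 1)" using C(1)[OF j] by (intro mult_left_mono) auto
   moreover have "lead j t x \<le> D j * (1 + t) ^ (j - 1)" unfolding D_def by (rule lead_le[OF t])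
   ultimately show ?thesis using C(2)[OF j t, of x] by (simp only: distrib_right)
  qed
  define S where "S t x = (\<Sum>j\<in>{1..<n}. real (n choose j) * moment j g t x * moment (n - j) g t x)" for t x
  \<comment> \<open>The sum of the n - 1 equal leading products, where n = k + 2.\<close>
  define T where "T t x = real (Suc k) * fact n * (Bc * t) ^ k * (LINT y|\<mu>. g y) ^ n * (\<Theta> x)\<^sup>2" for t x
  define KS where "KS = (\<Sum>j\<in>{1..<n}. real (n choose j) * ((D j + C j) * (D (n - j) + C (n - j))))"
  define KE where "KE = (\<Sum>j\<in>{1..<n}. real (n choose j) * (C j * (D (n - j) + C (n - j)) + D j * C (n - j)))"
  have nj: "n - j \<in> {1..<n}" if "j \<in> {1..<n}" for j using that by auto
  have pw: "(1 + t) ^ (j - 1) * (1 + t) ^ (n - j - 1) = (1 + t) ^ k" if "j \<in> {1..<n}" for j and t :: real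
   using that k by (simp flip: power_add)
  have S0: "0 \<le> S t x" for t x unfolding S_def using moment_nonneg[OF g g0 gG] by (intro sum_nonneg mult_nonneg_nonneg) auto
  have KS0: "0 \<le> KS" unfolding KS_def using C(1) D0 nj by (intro sum_nonneg mult_nonneg_nonneg add_nonneg_nonneg) auto
  have KE0: "0 \<le> KE" unfolding KE_def using C(1) D0 nj by (intro sum_nonneg mult_nonneg_nonneg add_nonneg_nonneg) auto
  have SK: "S t x \<le> KS * (1 + t) ^ k" if t: "0 \<le> t" for t x
   unfolding S_def KS_def sum_distrib_right
  proof (rule sum_mono)
   fix j assume j: "j \<in> {1..<n}"
   have "moment j g t x * moment (n - j) g t x \<le> ((D j + C j) * (1 + t) ^ (j - 1)) * ((D (n - j) + C (n - j)) * (1 + t) ^ (n - j - 1))"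
    using mD[OF j t] mD[OF nj[OF j] t] moment_nonneg[OF g g0 gG] C(1)[OF j] D0[of j] t by (intro mult_mono) auto
   also have "\<dots> = ((D j + C j) * (D (n - j) + C (n - j))) * ((1 + t) ^ (j - 1) * (1 + t) ^ (n - j - 1))" by (simp only: mult_ac)
   finally have "real (n choose j) * (moment j g t x * moment (n - j) g t x) \<le> real (n choose j) * (((D j + C j) * (D (n - j) + C (n - j))) * (1 + t) ^ k)"
    unfolding pw[OF j] by (rule mult_left_mono) simp
   then show "real (n choose j) * moment j g t x * moment (n - j) g t x \<le> real (n choose j) * ((D j + C j) * (D (n - j) + C (n - j))) * (1 + t) ^ k"
    by (simp only: mult.assoc)
  qed
  have ST: "\<bar>S t x - T t x\<bar> \<le> KE * ((1 + t) ^ k / sqrt (1 + t))" if t: "0 \<le> t" for t x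
  proof -
   have "(\<Sum>j\<in>{1..<n}. real (n choose j) * lead j t x * lead (n - j) t x) = (\<Sum>j\<in>{1..<n}. fact n * (Bc * t) ^ (n - 2) * (LINT y|\<mu>. g y) ^ n * (\<Theta> x)\<^sup>2)"
    by (intro sum.cong refl lead_mult) auto
   then have T: "T t x = (\<Sum>j\<in>{1..<n}. real (n choose j) * lead j t x * lead (n - j) t x)"
    unfolding T_def by (simp add: k)
   have "\<bar>S t x - T t x\<bar> \<le> (\<Sum>j\<in>{1..<n}. \<bar>real (n choose j) * moment j g t x * moment (n - j) g t x - real (n choose j) * lead j t x * lead (n - j) t x\<bar>)"
    unfolding S_def T sum_subtractf[symmetric] by (rule sum_abs)
   also have "\<dots> \<le> (\<Sum>j\<in>{1..<n}. real (n choose j) * (C j * (D (n - j) + C (n - j)) + D j * C (n - j)) * ((1 + t) ^ k / sqrt (1 + t)))"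
   proof (rule sum_mono)
    fix j assume j: "j \<in> {1..<n}"
    let ?m = "moment j g t x" and ?m' = "moment (n - j) g t x" and ?l = "lead j t x" and ?l' = "lead (n - j) t x"
    have lD: "?l \<le> D j * (1 + t) ^ (j - 1)" unfolding D_def by (rule lead_le[OF t])
    have "\<bar>?m * ?m' - ?l * ?l'\<bar> \<le> (C j * (D (n - j) + C (n - j)) + D j * C (n - j)) * (((1 + t) ^ (j - 1) * (1 + t) ^ (n - j - 1)) / sqrt (1 + t))"
     using abs_product_diff_le[OF moment_nonneg[OF g g0 gG] lead_nonneg[OF t] C(2)[OF j t] mD[OF nj[OF j] t] lD C(2)[OF nj[OF j] t]] by blast
    then have "real (n choose j) * \<bar>?m * ?m' - ?l * ?l'\<bar> \<le> real (n choose j) * ((C j * (D (n - j) + C (n - j)) + D j * C (n - j)) * ((1 + t) ^ k / sqrt (1 + t)))"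
     unfolding pw[OF j] by (rule mult_left_mono) simp
    then show "\<bar>real (n choose j) * ?m * ?m' - real (n choose j) * ?l * ?l'\<bar> \<le> real (n choose j) * (C j * (D (n - j) + C (n - j)) + D j * C (n - j)) * ((1 + t) ^ k / sqrt (1 + t))"
     unfolding mult.assoc right_diff_distrib[symmetric] abs_mult[of "real (n choose j)"] by simp
   qed
   finally show ?thesis by (simp only: KE_def sum_distrib_right)
  qed
  have Sm[measurable]: "(\<lambda>(t, x). S t x) \<in> borel_measurable borel2"
  proof -
   have [measurable]: "(\<lambda>p. moment j g (fst p) (snd p)) \<in> borel_measurable borel2" if "j \<in> {1..<n}" for j
    using measurable_moment[OF g g0 gG, of j] that by (simp add: case_prod_beta)
   show ?thesis unfolding S_def case_prod_beta using nj
    by (intro borel_measurable_sum borel_measurable_times borel_measurable_const) auto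
  qed
  define Cn where "Cn = Ck * G ^ n + H * (bmax * KS) / c + Tm * (2 * (mass * (bmax * KE)))"
  have "\<bar>moment n g t x - lead n t x\<bar> \<le> Cn * ((1 + t) ^ (n - 1) / sqrt (1 + t))" if t: "0 \<le> t" for t x
  proof -
   define \<phi> where "\<phi> s z = b z * S (t - s) z" for s z
   define q where "q = (1 + t) ^ k"
   define w where "w = sqrt (1 + t)"
   have q: "1 \<le> q" and w1: "1 \<le> w" and ww: "w * w = 1 + t" using t by (auto simp: q_def w_def one_le_power)
   have \<phi>m[measurable]: "(\<lambda>(s, z). \<phi> s z) \<in> borel_measurable borel2" unfolding \<phi>_def by measurable
   have qle: "(1 + (t - s)) ^ k \<le> q" if "0 \<le> s" "s \<le> t" for s unfolding q_def using that by (intro power_mono) auto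
   have \<phi>0: "0 \<le> \<phi> s z" for s z unfolding \<phi>_def using b_nonneg S0 by simp
   have \<phi>K: "\<phi> s z \<le> bmax * (KS * q)" if s: "0 \<le> s" "s \<le> t" for s z
   proof -
    have "KS * (1 + (t - s)) ^ k \<le> KS * q" using qle[OF s] KS0 by (rule mult_left_mono)
    then have "S (t - s) z \<le> KS * q" using SK[of "t - s" z] s by simp
    then show ?thesis unfolding \<phi>_def using b_nonneg[of z] bmax S0 by (intro mult_mono) auto
   qed
   \<comment> \<open>With this constant, \<open>A * t ^ Suc k\<close> times
     \<open>\<Theta> x\<close> is the leading term of order \<open>n\<close>; one factor
     \<open>Bc\<close> comes from integrating the square of \<open>\<Theta>\<close> times
     \<open>b\<close>.\<close>
   define A where "A = fact n * Bc ^ Suc k * (LINT y|\<mu>. g y) ^ n"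
   have "\<bar>(LINT p|nu t x. \<phi> (fst p) (snd p)) - \<Theta> x * ((- A * (t - t) ^ Suc k) - (- A * (t - 0) ^ Suc k))\<bar>
    \<le> H * (bmax * (KS * q)) / c + Tm * ((- 2 * (mass * (bmax * KE * q)) * sqrt (1 + t - t)) - (- 2 * (mass * (bmax * KE * q)) * sqrt (1 + t - 0)))"
   \<comment> \<open>The polynomial growth is bounded by its final value \<open>q\<close>; only the
     inverse square root is kept as a function of time and integrated exactly.\<close>
   proof (rule nu_asymp[where J'="\<lambda>s. A * (real (Suc k) * (t - s) ^ k)" and E'="\<lambda>s. mass * (bmax * KE * q) / sqrt (1 + t - s)"])
    show "((\<lambda>s. - A * (t - s) ^ Suc k) has_real_derivative A * (real (Suc k) * (t - s) ^ k)) (at s)" for s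
    proof -
     have "((\<lambda>s. t - s) has_real_derivative - 1) (at s)" by (auto intro!: derivative_eq_intros)
     from DERIV_cmult[OF DERIV_power[OF this, of "Suc k"], of "- A"] show ?thesis by (rule DERIV_cong) simp
    qed
    show "((\<lambda>s. - 2 * (mass * (bmax * KE * q)) * sqrt (1 + t - s)) has_real_derivative mass * (bmax * KE * q) / sqrt (1 + t - s)) (at s)" if "0 \<le> s" "s \<le> t" for s
     using that by (auto intro!: derivative_eq_intros simp: field_simps)
    show "continuous_on {0..t} (\<lambda>s. A * (real (Suc k) * (t - s) ^ k))" "continuous_on {0..t} (\<lambda>s. mass * (bmax * KE * q) / sqrt (1 + t - s))"
     by (auto intro!: continuous_intros)
    fix s assume s: "0 \<le> s" "s \<le> t"
    define e where "e = bmax * KE * q / sqrt (1 + t - s)"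
    have le: "\<bar>\<phi> s z - b z * T (t - s) z\<bar> \<le> e" for z
    proof -
     have "KE * ((1 + (t - s)) ^ k / sqrt (1 + (t - s))) \<le> KE * (q / sqrt (1 + (t - s)))"
      using qle[OF s] KE0 s by (intro mult_left_mono divide_right_mono) auto
     then have "\<bar>S (t - s) z - T (t - s) z\<bar> \<le> KE * (q / sqrt (1 + (t - s)))" using ST[of "t - s" z] s by simp
     then have "b z * \<bar>S (t - s) z - T (t - s) z\<bar> \<le> bmax * (KE * (q / sqrt (1 + (t - s))))"
      using b_nonneg[of z] bmax by (intro mult_mono) auto
     moreover have "\<bar>\<phi> s z - b z * T (t - s) z\<bar> = b z * \<bar>S (t - s) z - T (t - s) z\<bar>"
      unfolding \<phi>_def right_diff_distrib[symmetric] abs_mult using b_nonneg[of z] by simp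
     moreover have "bmax * (KE * (q / sqrt (1 + (t - s)))) = e" unfolding e_def by (simp add: mult.assoc add_diff_eq)
     ultimately show ?thesis by simp
    qed
    have \<phi>i: "integrable \<mu> (\<phi> s)" using \<phi>0 \<phi>K[OF s] by (intro integrable_mu[where K="bmax * (KS * q)"]) auto
    have T: "b z * T (t - s) z = (real (Suc k) * fact n * (Bc * (t - s)) ^ k * (LINT y|\<mu>. g y) ^ n) * ((\<Theta> z)\<^sup>2 * b z)" for z
     unfolding T_def by (simp only: mult_ac)
    have Ti: "integrable \<mu> (\<lambda>z. b z * T (t - s) z)" unfolding T using integrable_Theta_sq_b by (rule integrable_mult_right)
    have "(LINT z|\<mu>. b z * T (t - s) z) = A * (real (Suc k) * (t - s) ^ k)"
    proof -
     have "(LINT z|\<mu>. b z * T (t - s) z) = (real (Suc k) * fact n * (Bc * (t - s)) ^ k * (LINT y|\<mu>. g y) ^ n) * Bc"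
      unfolding T Bc_def by (rule integral_mult_right_zero)
     then show ?thesis by (simp add: A_def power_mult_distrib mult_ac del: of_nat_Suc fact_Suc)
    qed
    then have "\<bar>(LINT z|\<mu>. \<phi> s z) - A * (real (Suc k) * (t - s) ^ k)\<bar> = \<bar>\<integral>z. \<phi> s z - b z * T (t - s) z \<partial>\<mu>\<bar>"
     using \<phi>i Ti by simp
    also have "\<dots> \<le> (LINT z|\<mu>. \<bar>\<phi> s z - b z * T (t - s) z\<bar>)" by (rule integral_abs_bound)
    also have "\<dots> \<le> (LINT z|\<mu>. e)" using le \<phi>i Ti by (intro integral_mono) auto
    finally show "\<bar>(LINT z|\<mu>. \<phi> s z) - A * (real (Suc k) * (t - s) ^ k)\<bar> \<le> mass * (bmax * KE * q) / sqrt (1 + t - s)"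
     by (simp add: e_def)
   qed (use t \<phi>0 \<phi>K in auto)
   note N1 = this
   have N2: "\<Theta> x * ((- A * (t - t) ^ Suc k) - (- A * (t - 0) ^ Suc k)) = lead n t x"
    unfolding A_def k by (simp add: power_mult_distrib mult_ac)
   have N3: "(LINT p|nu t x. \<phi> (fst p) (snd p)) = moment n g t x - (LINT z|kappa t x. g z ^ n)"
    using moment_recursion[OF g g0 gG t less.prems, of x] by (simp add: \<phi>_def S_def)
   have "\<bar>(moment n g t x - (LINT z|kappa t x. g z ^ n)) - lead n t x\<bar> \<le> H * (bmax * (KS * q)) / c + Tm * (2 * (mass * (bmax * KE * q)) * w - 2 * (mass * (bmax * KE * q)))"
    using N1 unfolding N2 N3 w_def by simp
   also have "\<dots> \<le> H * (bmax * (KS * q)) / c + Tm * (2 * (mass * (bmax * KE * q)) * w)"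
    using Tm_pos bmax KE0 q by (intro add_left_mono mult_left_mono) auto
   finally have 1: "\<bar>(moment n g t x - (LINT z|kappa t x. g z ^ n)) - lead n t x\<bar> \<le> (H * (bmax * KS) / c) * q + Tm * (2 * (mass * (bmax * KE))) * (q * w)"
    by (simp add: mult_ac)
   have gn: "(LINT z|kappa t x. g z ^ n) \<le> Ck * G ^ n" "0 \<le> (LINT z|kappa t x. g z ^ n)"
    using g0 gG t by (auto intro!: integral_kappa_le power_mono lint_nonneg)
   have qw: "q \<le> q * w" "1 \<le> q * w" using q w1 mult_mono[of 1 q 1 w] by auto
   have "\<bar>moment n g t x - lead n t x\<bar> \<le> (Ck * G ^ n) * 1 + (H * (bmax * KS) / c) * q + Tm * (2 * (mass * (bmax * KE))) * (q * w)"
    using 1 gn by linarith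
   also have "\<dots> \<le> (Ck * G ^ n) * (q * w) + (H * (bmax * KS) / c) * (q * w) + Tm * (2 * (mass * (bmax * KE))) * (q * w)"
    using qw q Ck_pos GG H_pos c_pos bmax KS0 KE0 Tm_pos by (intro add_mono mult_left_mono) auto
   also have "\<dots> = Cn * (q * w)" by (simp only: Cn_def distrib_right)
   also have "q * w = (1 + t) ^ (n - 1) / sqrt (1 + t)"
   proof -
    have "(1 + t) ^ (n - 1) = q * (w * w)" unfolding ww by (simp add: k q_def)
    then show ?thesis using w1 by (simp add: w_def[symmetric])
   qed
   finally show ?thesis .
  qed
  moreover have "0 \<le> Cn" unfolding Cn_def using Ck_pos GG H_pos c_pos bmax KS0 KE0 Tm_pos by (intro add_nonneg_nonneg mult_nonneg_nonneg divide_nonneg_nonneg) auto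
  ultimately show ?thesis by blast
 qed
qed

end

end

section \<open>The survival probability over time windows\<close>

context critical
begin

definition u :: "real => real => real" where "u t x = enn2real (mort (\<lambda>_. 0) t x)"

lemma ennreal_u: "ennreal (u t x) = mort (\<lambda>_. 0) t x"
 unfolding u_def using mort_le_1[of "\<lambda>_. 0" t x] by (intro ennreal_enn2real) (auto intro: le_less_trans)

lemma u_nonneg [simp]: "0 \<le> u t x" and u_le_1: "u t x \<le> 1"
 using mort_le_1[of "\<lambda>_. 0" t x] by (auto simp: u_def intro: enn2real_leI)

lemma measurable_u [measurable]: "(\<lambda>(t, x). u t x) \<in> borel_measurable borel2"
 unfolding u_def by measurable

lemma measurable_u' [measurable]: "u t \<in> borel_measurable borel"
 using measurable_compose[OF measurable_Pair1'[of t borel borel] measurable_u] by simp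

text \<open>Loss of the semigroup bound over a time window, from the quadratic term of the branching.\<close>

definition deficit :: "real => real => real => real" where
 "deficit t r x = (LINT p|nu r x. b (snd p) * (u (t + r - fst p) (snd p))\<^sup>2)"

lemma deficit_nonneg: "0 \<le> deficit t r x"
 unfolding deficit_def using b_nonneg by (intro lint_nonneg) auto

lemma ennreal_deficit:
 assumes r: "0 \<le> r"
 shows "ennreal (deficit t r x) = clk (\<lambda>s. PP s (\<lambda>z. ennreal (b z) * mort (\<lambda>_. 0) (t + r - s) z ^ 2) x) r"
proof -
 interpret N: finite_measure "nu r x" by (rule finite_measure_nu[OF r])
 have "integrable (nu r x) (\<lambda>p. b (snd p) * (u (t + r - fst p) (snd p))\<^sup>2)"
 proof (rule N.integrable_const_bound[where B=bmax])
  show "AE p in nu r x. norm (b (snd p) * (u (t + r - fst p) (snd p))\<^sup>2) \<le> bmax"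
  proof (rule AE_I2)
   fix p
   have "b (snd p) * (u (t + r - fst p) (snd p))\<^sup>2 \<le> bmax * 1"
    using b_nonneg[of "snd p"] bmax u_le_1 by (intro mult_mono power_le_one) auto
   then show "norm (b (snd p) * (u (t + r - fst p) (snd p))\<^sup>2) \<le> bmax" using b_nonneg[of "snd p"] by simp
  qed
 qed measurable
 then have "ennreal (deficit t r x) = (\<integral>\<^sup>+p. ennreal (b (snd p) * (u (t + r - fst p) (snd p))\<^sup>2) \<partial>nu r x)"
  unfolding deficit_def using b_nonneg by (intro nn_integral_eq_integral[symmetric]) auto
 also have "\<dots> = (\<integral>\<^sup>+p. ennreal (b (snd p)) * mort (\<lambda>_. 0) (t + r - fst p) (snd p) ^ 2 \<partial>nu r x)"
  by (intro nn_integral_cong) (simp add: ennreal_mult b_nonneg ennreal_power[symmetric] ennreal_u[symmetric])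
 also have "\<dots> = clk (\<lambda>s. PP s (\<lambda>z. ennreal (b z) * mort (\<lambda>_. 0) (t + r - s) z ^ 2) x) r"
  by (subst nn_integral_nu) (auto simp: clk_def)
 finally show ?thesis .
qed

text \<open>The Duhamel equation up to \<open>t + r\<close> is compared with the one up to
  \<open>t\<close> propagated by P_r. Both contain the same contribution of branchings in the last
  part of the window, and cancelling it leaves the deficit of the first \<open>r\<close> units of
  time.\<close>

lemma u_flow:
 assumes t: "0 \<le> t" and r: "0 \<le> r"
 shows "u (t + r) x + deficit t r x = (LINT z|kappa r x. u t z)"
proof -
 let ?m = "mort (\<lambda>_. 0)"
 let ?w = "\<lambda>s z. ennreal (b z) * ?m s z ^ 2"
 interpret K: finite_measure "kappa r x" by (rule finite_measure_kappa[OF r])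
 have m1: "?m s z \<le> 1" for s z by (rule mort_le_1)
 have wb: "?w s z \<le> ennreal bmax" for s z
 proof -
  have "?w s z \<le> ennreal bmax * 1 ^ 2" using m1[of s z] bmax by (intro mult_mono power_mono ennreal_leI) auto
  then show ?thesis by simp
 qed
 have d: "?m s z + clk (\<lambda>q. PP q (?w (s - q)) z) s = PP s (\<lambda>_. 1) z" if "0 \<le> s" for s z
  using mort_duhamel[of "\<lambda>_. 0" s z] that by (simp add: clk_def)
 \<comment> \<open>By the semigroup property, the part of the Duhamel integral beyond
   \<open>r\<close> is P_r applied to the complete integral up to \<open>t\<close>.\<close>
 have tail: "clk (\<lambda>q. PP (r + q) (?w (t + r - (r + q))) x) t = PP r (\<lambda>z. clk (\<lambda>q. PP q (?w (t - q)) z) t) x"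
 proof -
  have "clk (\<lambda>q. PP (r + q) (?w (t + r - (r + q))) x) t = (\<integral>\<^sup>+q. (\<integral>\<^sup>+z. PP q (?w (t - q)) z * indicator {0..t} q \<partial>kappa r x) \<partial>lborel)"
   unfolding clk_def
  proof (rule nn_integral_cong)
   fix q :: real
   show "PP (r + q) (?w (t + r - (r + q))) x * indicator {0..t} q = (\<integral>\<^sup>+z. PP q (?w (t - q)) z * indicator {0..t} q \<partial>kappa r x)"
   proof (cases "q \<in> {0..t}")
    case True
    then have "PP (r + q) (?w (t - q)) x = PP r (PP q (?w (t - q))) x"
     using r wb by (intro PP_semigroup[where D="ennreal bmax"]) auto
    also have "\<dots> = (\<integral>\<^sup>+z. PP q (?w (t - q)) z \<partial>kappa r x)" by (rule nn_integral_kappa[symmetric]) measurable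
    finally show ?thesis using True by simp
   qed simp
  qed
  also have "\<dots> = (\<integral>\<^sup>+z. (\<integral>\<^sup>+q. PP q (?w (t - q)) z * indicator {0..t} q \<partial>lborel) \<partial>kappa r x)"
  proof -
   interpret P: pair_sigma_finite lborel "kappa r x" ..
   show ?thesis by (rule P.Fubini'[symmetric]) measurable
  qed
  also have "\<dots> = PP r (\<lambda>z. clk (\<lambda>q. PP q (?w (t - q)) z) t) x"
   unfolding clk_def[symmetric] by (rule nn_integral_kappa) measurable
  finally show ?thesis .
 qed
 have "?m (t + r) x + (clk (\<lambda>q. PP q (?w (t + r - q)) x) r + clk (\<lambda>q. PP (r + q) (?w (t + r - (r + q))) x) t) = PP (r + t) (\<lambda>_. 1) x"
  using d[of "r + t" x] clk_shift[of "\<lambda>q. PP q (?w (t + r - q)) x" r t] r t by (simp add: add.commute[of r t])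
 also have "\<dots> = PP r (PP t (\<lambda>_. 1)) x" using r t by (intro PP_semigroup[where D=1]) auto
 also have "PP t (\<lambda>_. 1) = (\<lambda>z. ?m t z + clk (\<lambda>q. PP q (?w (t - q)) z) t)" using d[OF t] by auto
 also have "PP r \<dots> x = PP r (?m t) x + PP r (\<lambda>z. clk (\<lambda>q. PP q (?w (t - q)) z) t) x" by (rule PP_add) measurable
 finally have eq: "(?m (t + r) x + clk (\<lambda>q. PP q (?w (t + r - q)) x) r) + PP r (\<lambda>z. clk (\<lambda>q. PP q (?w (t - q)) z) t) x
  = PP r (?m t) x + PP r (\<lambda>z. clk (\<lambda>q. PP q (?w (t - q)) z) t) x"
  unfolding tail by (simp add: add.assoc)
 \<comment> \<open>Finiteness of the common term, without which it could not be cancelled.\<close>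
 have "PP r (\<lambda>z. clk (\<lambda>q. PP q (?w (t - q)) z) t) x \<le> ennreal (exp (bmax * r)) * ennreal (exp (bmax * t))"
 proof (rule PP_bound[OF r])
  fix z
  have "clk (\<lambda>q. PP q (?w (t - q)) z) t \<le> PP t (\<lambda>_. 1) z" unfolding d[OF t, symmetric] by simp
  also have "\<dots> \<le> ennreal (exp (bmax * t)) * 1" by (rule PP_bound[OF t]) simp
  finally show "clk (\<lambda>q. PP q (?w (t - q)) z) t \<le> ennreal (exp (bmax * t))" by simp
 qed
 then have "PP r (\<lambda>z. clk (\<lambda>q. PP q (?w (t - q)) z) t) x \<noteq> \<top>" by (auto simp: top_unique ennreal_mult[symmetric])
 with eq have "?m (t + r) x + clk (\<lambda>q. PP q (?w (t + r - q)) x) r = PP r (?m t) x"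
  using ennreal_add_left_cancel[of "PP r (\<lambda>z. clk (\<lambda>q. PP q (?w (t - q)) z) t) x"] by (simp add: add.commute)
 moreover have "PP r (?m t) x = ennreal (LINT z|kappa r x. u t z)"
  by (subst ennreal_integral_kappa[where K=1]) (auto simp: ennreal_u u_le_1 r)
 ultimately have "ennreal (u (t + r) x + deficit t r x) = ennreal (LINT z|kappa r x. u t z)"
  using ennreal_deficit[OF r, of t x] deficit_nonneg[of t r x] by (simp add: ennreal_u)
 then show ?thesis
  using deficit_nonneg[of t r x] by (subst (asm) ennreal_inj) (auto intro!: lint_nonneg add_nonneg_nonneg)
qed

definition y :: "real => real" where "y t = (LINT x|\<mu>. u t x)"

definition \<beta> :: "real => real" where "\<beta> t = (LINT x|\<mu>. b x * (u t x)\<^sup>2)"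

lemma integrable_u [simp]: "integrable \<mu> (u t)"
 using u_le_1 by (intro integrable_mu[where K=1]) auto

lemma b_usq_le: "b x * (u t x)\<^sup>2 \<le> bmax * u t x"
proof -
 have "(u t x)\<^sup>2 \<le> u t x" using u_le_1[of t x] mult_left_le[of "u t x" "u t x"] by (simp add: power2_eq_square)
 then show ?thesis using b_nonneg[of x] bmax by (intro mult_mono) auto
qed

lemma integrable_b_usq [simp]: "integrable \<mu> (\<lambda>x. b x * (u t x)\<^sup>2)"
proof (rule Bochner_Integration.integrable_bound[of _ "\<lambda>x. bmax * u t x"])
 show "AE x in \<mu>. norm (b x * (u t x)\<^sup>2) \<le> norm (bmax * u t x)"
  using b_usq_le b_nonneg bmax by (intro AE_I2) auto
qed auto

lemma y_nonneg: "0 \<le> y t"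
 unfolding y_def by (intro lint_nonneg) auto

lemma beta_nonneg: "0 \<le> \<beta> t"
 unfolding \<beta>_def using b_nonneg by (intro lint_nonneg) auto

lemma measurable_beta [measurable]: "\<beta> \<in> borel_measurable borel"
 unfolding \<beta>_def by (rule mu.borel_measurable_lebesgue_integral) measurable

lemma mu_invariant_PP:
 assumes h[measurable]: "h \<in> borel_measurable borel" and hD: "\<And>x. 0 \<le> h x" "\<And>x. h x \<le> D" and t: "0 \<le> t"
 shows "(\<integral>\<^sup>+x. PP t (\<lambda>z. ennreal (h z)) x \<partial>\<mu>) = ennreal (LINT x|\<mu>. h x)"
proof -
 have "(\<integral>\<^sup>+x. PP t (\<lambda>z. ennreal (h z)) x \<partial>\<mu>) = (\<integral>\<^sup>+x. ennreal (LINT z|kappa t x. h z) \<partial>\<mu>)"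
  using ennreal_integral_kappa[OF h hD t] by simp
 also have "\<dots> = ennreal (LINT x|\<mu>. (LINT z|kappa t x. h z))"
 proof (rule nn_integral_eq_integral)
  show "integrable \<mu> (\<lambda>x. \<integral>z. h z \<partial>kappa t x)"
   using measurable_kappa_integral[OF h hD t] integral_kappa_le[OF h hD t] hD
   by (intro integrable_mu[where K="Ck * D"]) (auto simp: lint_nonneg)
 qed (use hD in \<open>auto intro!: lint_nonneg\<close>)
 finally show ?thesis using mu_invariant[OF h hD t] by simp
qed

text \<open>The Duhamel equation is integrated against \<open>\<mu>\<close>, whose invariance
  removes the kernel. This integrated form of y' = -\<beta> is all that is used later;
  \<open>y\<close> is never differentiated.\<close>

lemma y_clk: "0 \<le> t ==> ennreal (y t) + clk (\<lambda>s. ennreal (\<beta> s)) t = ennreal mass"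
proof -
 assume t: "0 \<le> t"
 let ?m = "mort (\<lambda>_. 0)"
 let ?w = "\<lambda>s z. ennreal (b z) * ?m s z ^ 2"
 have "(\<integral>\<^sup>+x. ?m t x + (\<integral>\<^sup>+s\<in>{0..t}. PP s (?w (t - s)) x \<partial>lborel) \<partial>\<mu>) = (\<integral>\<^sup>+x. PP t (\<lambda>z. ennreal 1) x \<partial>\<mu>)"
  using mort_duhamel[of "\<lambda>_. 0" t] t by simp
 also have "\<dots> = ennreal mass" using mu_invariant_PP[of "\<lambda>_. 1" 1 t] t by simp
 finally have 1: "(\<integral>\<^sup>+x. ?m t x \<partial>\<mu>) + (\<integral>\<^sup>+x. (\<integral>\<^sup>+s\<in>{0..t}. PP s (?w (t - s)) x \<partial>lborel) \<partial>\<mu>) = ennreal mass"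
  by (subst (asm) nn_integral_add) auto
 have "(\<integral>\<^sup>+x. (\<integral>\<^sup>+s\<in>{0..t}. PP s (?w (t - s)) x \<partial>lborel) \<partial>\<mu>) = (\<integral>\<^sup>+s. (\<integral>\<^sup>+x. PP s (?w (t - s)) x * indicator {0..t} s \<partial>\<mu>) \<partial>lborel)"
 proof -
  interpret P: pair_sigma_finite lborel \<mu> ..
  show ?thesis by (rule P.Fubini') measurable
 qed
 also have "\<dots> = (\<integral>\<^sup>+s. ennreal (\<beta> (t - s)) * indicator {0..t} s \<partial>lborel)"
 proof (rule nn_integral_cong)
  fix s :: real
  have w: "?w r z = ennreal (b z * (u r z)\<^sup>2)" for r z
   by (simp add: ennreal_mult b_nonneg ennreal_power[symmetric] ennreal_u[symmetric])
  have "b z * (u r z)\<^sup>2 \<le> bmax" for r z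
   using b_usq_le[of z r] u_le_1[of r z] bmax(1) mult_left_le[of "u r z" bmax] by linarith
  then show "(\<integral>\<^sup>+x. PP s (?w (t - s)) x * indicator {0..t} s \<partial>\<mu>) = ennreal (\<beta> (t - s)) * indicator {0..t} s"
   using mu_invariant_PP[of "\<lambda>z. b z * (u (t - s) z)\<^sup>2" bmax s] b_nonneg
   by (cases "s \<in> {0..t}") (auto simp: w \<beta>_def)
 qed
 also have "\<dots> = (\<integral>\<^sup>+s. ennreal (\<beta> s) * indicator {0..t} s \<partial>lborel)"
  by (subst nn_integral_real_affine[where c="-1" and t=t]) (auto intro!: nn_integral_cong split: split_indicator)
 finally have "(\<integral>\<^sup>+x. ?m t x \<partial>\<mu>) + clk (\<lambda>s. ennreal (\<beta> s)) t = ennreal mass" using 1 by (simp add: clk_def)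
 moreover have "(\<integral>\<^sup>+x. ?m t x \<partial>\<mu>) = ennreal (y t)"
  unfolding y_def ennreal_u[symmetric] by (intro nn_integral_eq_integral) auto
 ultimately show ?thesis by simp
qed

lemma clk_beta_finite: "clk (\<lambda>s. ennreal (\<beta> s)) t < \<top>"
proof (cases "0 \<le> t")
 case True
 have "clk (\<lambda>s. ennreal (\<beta> s)) t \<le> ennreal (y t) + clk (\<lambda>s. ennreal (\<beta> s)) t" by simp
 also have "\<dots> < \<top>" unfolding y_clk[OF True] by simp
 finally show ?thesis .
qed (simp add: clk_nonpos)

lemma y_eq: "0 \<le> t ==> y t = mass - enn2real (clk (\<lambda>s. ennreal (\<beta> s)) t)"
proof -
 assume "0 \<le> t"
 then have "ennreal (y t + enn2real (clk (\<lambda>s. ennreal (\<beta> s)) t)) = ennreal mass"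
  using y_clk[of t] clk_beta_finite[of t] y_nonneg[of t] by (simp add: less_top)
 then show ?thesis using y_nonneg[of t] by (subst (asm) ennreal_inj) auto
qed

lemma y_diff:
 assumes "0 \<le> t" "0 \<le> r"
 shows "ennreal (y t - y (t + r)) = clk (\<lambda>s. ennreal (\<beta> (t + s))) r"
proof -
 have "clk (\<lambda>s. ennreal (\<beta> s)) (t + r) = clk (\<lambda>s. ennreal (\<beta> s)) t + clk (\<lambda>s. ennreal (\<beta> (t + s))) r"
  using assms by (intro clk_shift) auto
 moreover have "clk (\<lambda>s. ennreal (\<beta> (t + s))) r < \<top>"
  using calculation clk_beta_finite[of "t + r"] by (auto simp: less_top)
 ultimately have "enn2real (clk (\<lambda>s. ennreal (\<beta> s)) (t + r)) = enn2real (clk (\<lambda>s. ennreal (\<beta> s)) t) + enn2real (clk (\<lambda>s. ennreal (\<beta> (t + s))) r)"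
  using clk_beta_finite[of t] by (simp add: enn2real_plus)
 then have "y t - y (t + r) = enn2real (clk (\<lambda>s. ennreal (\<beta> (t + s))) r)" using assms by (simp add: y_eq)
 then show ?thesis using \<open>clk (\<lambda>s. ennreal (\<beta> (t + s))) r < \<top>\<close> by simp
qed

lemma y_antimono: "0 \<le> t ==> t \<le> t' ==> y t' \<le> y t"
 using clk_mono[of t t' "\<lambda>s. ennreal (\<beta> s)"] clk_beta_finite by (simp add: y_eq enn2real_mono)

lemma y_diff_le:
 assumes "0 \<le> t" "0 \<le> r" and "\<And>s. 0 \<le> s ==> s \<le> r ==> \<beta> (t + s) \<le> K"
 shows "y t - y (t + r) \<le> r * K"
proof -
 have K: "0 \<le> K" using assms(3)[of 0] assms(2) beta_nonneg[of t] by simp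
 have "ennreal (y t - y (t + r)) \<le> (\<integral>\<^sup>+s. ennreal K * indicator {0..r} s \<partial>lborel)"
  unfolding y_diff[OF assms(1,2)] clk_def using assms by (intro nn_integral_mono) (auto split: split_indicator intro: ennreal_leI)
 also have "\<dots> = ennreal (r * K)" using assms K by (simp add: nn_integral_cmult ennreal_mult[symmetric] mult.commute)
 finally show ?thesis using assms K by (subst (asm) ennreal_le_iff) auto
qed

lemma y_diff_ge:
 assumes "0 \<le> t" "0 \<le> r" "0 \<le> K" and "\<And>s. 0 \<le> s ==> s \<le> r ==> K \<le> \<beta> (t + s)"
 shows "r * K \<le> y t - y (t + r)"
proof -
 have "ennreal (r * K) = (\<integral>\<^sup>+s. ennreal K * indicator {0..r} s \<partial>lborel)"
  using assms by (simp add: nn_integral_cmult ennreal_mult[symmetric] mult.commute)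
 also have "\<dots> \<le> ennreal (y t - y (t + r))"
  unfolding y_diff[OF assms(1,2)] clk_def using assms by (intro nn_integral_mono) (auto split: split_indicator intro: ennreal_leI)
 finally show ?thesis using y_antimono[of t "t + r"] assms by (subst (asm) ennreal_le_iff) auto
qed

definition M :: "real => real" where "M t = (SUP x. u t x)"

text \<open>The uniform distance of the survival probability from its projection onto the
  eigenfunction.\<close>

definition \<rho> :: "real => real" where "\<rho> t = (SUP x. \<bar>u t x - \<Theta> x * y t\<bar>)"

lemma u_le_M: "u t x \<le> M t"
 unfolding M_def using u_le_1 by (intro cSUP_upper bdd_aboveI2[where M=1]) auto

lemma M_le: "(\<And>x. u t x \<le> K) ==> M t \<le> K"
 unfolding M_def by (intro cSUP_least) auto

lemma M_nonneg: "0 \<le> M t" and M_le_1: "M t \<le> 1"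
 using order_trans[OF u_nonneg[of t 0] u_le_M[of t 0]] M_le[OF u_le_1] by auto

lemma Theta_y_le: "\<Theta> x * y t \<le> Tm * y t"
 using Theta_le[of x] y_nonneg[of t] by (rule mult_right_mono)

lemma rho_ge: "\<bar>u t x - \<Theta> x * y t\<bar> \<le> \<rho> t"
proof -
 have "\<bar>u t x - \<Theta> x * y t\<bar> \<le> 1 + Tm * y t" for x
  using u_le_1[of t x] u_nonneg[of t x] Theta_y_le[of x t] mult_nonneg_nonneg[OF Theta_nonneg[of x] y_nonneg[of t]] by linarith
 then show ?thesis unfolding \<rho>_def by (intro cSUP_upper bdd_aboveI2) auto
qed

lemma rho_le: "(\<And>x. \<bar>u t x - \<Theta> x * y t\<bar> \<le> K) ==> \<rho> t \<le> K"
 unfolding \<rho>_def by (intro cSUP_least) auto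

lemma rho_nonneg: "0 \<le> \<rho> t"
 using rho_ge[of t 0] by linarith

lemma M_le_rho: "M t \<le> Tm * y t + \<rho> t"
proof (rule M_le)
 show "u t x \<le> Tm * y t + \<rho> t" for x using rho_ge[of t x] Theta_y_le[of x t] by linarith
qed

lemma rho_le_M: "\<rho> t \<le> M t + Tm * y t"
proof (rule rho_le)
 show "\<bar>u t x - \<Theta> x * y t\<bar> \<le> M t + Tm * y t" for x
  using u_le_M[of t x] u_nonneg[of t x] Theta_y_le[of x t] mult_nonneg_nonneg[OF Theta_nonneg[of x] y_nonneg[of t]] M_nonneg[of t] y_nonneg[of t] Tm_pos
   mult_nonneg_nonneg[of Tm "y t"] by linarith
qed

text \<open>Dropping the deficit bounds u at t + s by P_s applied to u at t. Through
  \<open>Ck\<close> the supremum at the start of a window controls the whole window, however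
  long.\<close>

lemma u_later: "0 \<le> t ==> 0 \<le> s ==> u (t + s) x \<le> Ck * M t"
 using u_flow[of t s x] deficit_nonneg[of t s x] integral_kappa_le[of "u t" "M t" s x] u_le_M[of t] by simp

lemma usq_later: "0 \<le> t ==> 0 \<le> s ==> b x * (u (t + s) x)\<^sup>2 \<le> bmax * (Ck * M t)\<^sup>2"
 using u_later[of t s x] b_nonneg[of x] bmax by (intro mult_mono power_mono) auto

lemma deficit_le:
 assumes t: "0 \<le> t" and r: "0 \<le> r"
 shows "deficit t r x \<le> r * Ck * (bmax * (Ck * M t)\<^sup>2)"
 unfolding deficit_def
proof (rule nu_estimate(2)[where \<phi>="\<lambda>s z. b z * (u (t + r - s) z)\<^sup>2"])
 show "b z * (u (t + r - s) z)\<^sup>2 \<le> bmax * (Ck * M t)\<^sup>2" if "0 \<le> s" "s \<le> r" for s z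
  using usq_later[of t "r - s" z] t that by (simp add: algebra_simps)
qed (use r b_nonneg in auto)

text \<open>\<open>u_flow\<close> averaged over the invariant measure: the loss over a window,
  integrated over the trait, is exactly the drop of \<open>y\<close>. A small drop thus makes the
  deficit small on average.\<close>

lemma deficit_mu:
 assumes t: "0 \<le> t" and r: "0 \<le> r"
 shows "integrable \<mu> (deficit t r)" and "(LINT x|\<mu>. deficit t r x) = y t - y (t + r)"
proof -
 have e: "deficit t r = (\<lambda>x. (LINT z|kappa r x. u t z) - u (t + r) x)"
  using u_flow[OF t r] by (auto simp: eq_diff_eq add.commute)
 have i: "integrable \<mu> (\<lambda>x. \<integral>z. u t z \<partial>kappa r x)"
  using measurable_kappa_integral[of "u t" 1 r] integral_kappa_le[of "u t" 1 r] u_le_1 r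
  by (intro integrable_mu[where K="Ck * 1"]) (auto simp: lint_nonneg)
 show "integrable \<mu> (deficit t r)" unfolding e using i by simp
 show "(LINT x|\<mu>. deficit t r x) = y t - y (t + r)"
  unfolding e using i mu_invariant[of "u t" 1 r] u_le_1 r by (simp add: y_def)
qed

text \<open>In the square of u one factor is bounded by \<open>Ck * M t\<close> and the other
  integrates to \<open>y\<close>. The relative drop of \<open>y\<close> over a window is therefore
  small once \<open>M\<close> is small.\<close>

lemma y_step:
 assumes t: "0 \<le> t" and r: "0 \<le> r"
 shows "y t - y (t + r) \<le> r * (bmax * Ck * M t * y t)"
proof (rule y_diff_le[OF t r])
 fix s :: real assume s: "0 \<le> s" "s \<le> r"
 have "\<beta> (t + s) \<le> (LINT x|\<mu>. (bmax * (Ck * M t)) * u (t + s) x)"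
  unfolding \<beta>_def
 proof (rule integral_mono)
  fix x
  have "u (t + s) x * u (t + s) x \<le> (Ck * M t) * u (t + s) x" using u_later[OF t s(1)] by (rule mult_right_mono) simp
  then have "b x * (u (t + s) x)\<^sup>2 \<le> bmax * ((Ck * M t) * u (t + s) x)"
   using b_nonneg[of x] bmax by (intro mult_mono) (auto simp: power2_eq_square)
  then show "b x * (u (t + s) x)\<^sup>2 \<le> bmax * (Ck * M t) * u (t + s) x" by (simp only: mult.assoc)
 qed auto
 also have "\<dots> = (bmax * (Ck * M t)) * y (t + s)" by (simp add: y_def)
 also have "\<dots> \<le> (bmax * (Ck * M t)) * y t"
  using y_antimono[of t "t + s"] t s bmax Ck_pos M_nonneg[of t] by (intro mult_left_mono) auto
 finally show "\<beta> (t + s) \<le> bmax * Ck * M t * y t" by (simp only: mult.assoc)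
qed

lemma u_gap:
 assumes t: "0 \<le> t" and r: "0 \<le> r"
 shows "\<bar>(LINT z|kappa r x. u t z) - \<Theta> x * y t\<bar> \<le> H * M t * exp (- c * r)"
 unfolding y_def using u_le_M[of t] by (intro gap_pos r) auto

lemma M_step: "0 \<le> t ==> 0 \<le> r ==> M (t + r) \<le> Tm * y t + H * M t * exp (- c * r)"
proof (rule M_le)
 fix x assume a: "0 \<le> t" "0 \<le> r"
 show "u (t + r) x \<le> Tm * y t + H * M t * exp (- c * r)"
  using u_flow[OF a, of x] u_gap[OF a, of x] deficit_nonneg[of t r x] Theta_y_le[of x t] by linarith
qed

text \<open>The difference of \<open>u t\<close> and its projection has \<mu>-mean zero, since
  \<open>\<Theta>\<close> integrates to 1, so P_r shrinks it by the gap. The deficit, quadratic in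
  \<open>M\<close>, enters directly and once more through the drop of \<open>y\<close>, whence
  \<open>1 + Tm * mass\<close>.\<close>

lemma rho_step:
 assumes t: "0 \<le> t" and r: "0 \<le> r"
 shows "\<rho> (t + r) \<le> 3 * H * \<rho> t * exp (- c * r) + (1 + Tm * mass) * (r * Ck * (bmax * (Ck * M t)\<^sup>2))"
proof (rule rho_le)
 fix x
 let ?E = "r * Ck * (bmax * (Ck * M t)\<^sup>2)"
 interpret K: finite_measure "kappa r x" by (rule finite_measure_kappa[OF r])
 have iu: "integrable (kappa r x) (u t)" using u_le_1 r by (intro integrable_kappa[where K=1]) auto
 have iT: "integrable (kappa r x) \<Theta>" "integrable \<mu> \<Theta>" using Theta_le Theta_nonneg r by (auto intro: integrable_kappa[where K=Tm] integrable_mu[where K=Tm])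
 have "\<bar>(LINT z|kappa r x. u t z - \<Theta> z * y t) - \<Theta> x * (LINT z|\<mu>. u t z - \<Theta> z * y t)\<bar> \<le> 3 * H * \<rho> t * exp (- c * r)"
  using rho_ge[of t] by (intro gap_signed r) auto
 moreover have "(LINT z|\<mu>. u t z - \<Theta> z * y t) = 0" using iT mu_Theta by (simp add: y_def)
 moreover have "(LINT z|kappa r x. u t z - \<Theta> z * y t) = (LINT z|kappa r x. u t z) - \<Theta> x * y t"
  using iT iu Theta_inv[OF r, of x] by simp
 ultimately have 1: "\<bar>u (t + r) x + deficit t r x - \<Theta> x * y t\<bar> \<le> 3 * H * \<rho> t * exp (- c * r)"
  using u_flow[OF t r, of x] by simp
 have E: "deficit t r x \<le> ?E" for x by (rule deficit_le[OF t r])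
 have "(LINT x|\<mu>. deficit t r x) \<le> (LINT x|\<mu>. ?E)" using E deficit_mu[OF t r] by (intro integral_mono) auto
 then have "y t - y (t + r) \<le> mass * ?E" unfolding deficit_mu(2)[OF t r] by simp
 then have "\<Theta> x * (y t - y (t + r)) \<le> Tm * (mass * ?E)"
  using Theta_le[of x] Theta_nonneg[of x] y_antimono[of t "t + r"] t r Tm_pos by (intro mult_mono) auto
 moreover have "0 \<le> \<Theta> x * (y t - y (t + r))" using Theta_nonneg[of x] y_antimono[of t "t + r"] t r by (intro mult_nonneg_nonneg) auto
 moreover have "\<Theta> x * (y t - y (t + r)) = \<Theta> x * y t - \<Theta> x * y (t + r)" by (rule right_diff_distrib)
 moreover have "(1 + Tm * mass) * ?E = ?E + Tm * (mass * ?E)" by (simp only: distrib_right mult_1 mult.assoc)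
 ultimately show "\<bar>u (t + r) x - \<Theta> x * y (t + r)\<bar> \<le> 3 * H * \<rho> t * exp (- c * r) + (1 + Tm * mass) * ?E"
  using 1 E[of x] deficit_nonneg[of t r x] unfolding abs_le_iff by linarith
qed

end

section \<open>Decay of the mean survival probability\<close>

text \<open>The level \<open>B0 + 2 * k\<close> is preserved when a value is halved and
  \<open>k\<close> added, so the bound travels from window to window; it is the sum of a geometric
  series.\<close>

lemma bounded_of_halving:
 fixes f :: "real => real"
 assumes r: "0 < r" and half: "\<And>t. t0 \<le> t ==> f (t + r) \<le> f t / 2 + k" and base: "\<And>t. t0 \<le> t ==> t \<le> t0 + r ==> f t \<le> B0"
  and "0 \<le> B0" "0 \<le> k" and t: "t0 \<le> t"
 shows "f t \<le> B0 + 2 * k"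
proof -
 have step: "t0 \<le> t ==> t \<le> t0 + (real n + 1) * r ==> f t \<le> B0 + 2 * k" for n t
 proof (induction n arbitrary: t)
  case 0
  then show ?case using base[of t] assms(4,5) by simp
 next
  case (Suc n)
  show ?case
  proof (cases "t \<le> t0 + r")
   case True
   then show ?thesis using base[of t] Suc.prems(1) assms(4,5) by simp
  next
   case False
   then have "f (t - r) \<le> B0 + 2 * k" using Suc.prems by (intro Suc.IH) (auto simp: algebra_simps)
   then show ?thesis using half[of "t - r"] False assms by simp
  qed
 qed
 obtain n :: nat where "(t - t0) / r < real n" using reals_Archimedean2 by blast
 then have "t \<le> t0 + (real n + 1) * r" using r by (simp add: pos_divide_less_eq algebra_simps)
 then show ?thesis using step[of t n] t by simp
qed

context critical
begin

lemma exp_small: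
 assumes "0 < \<epsilon>"
 obtains r where "0 < r" "exp (- c * r) \<le> \<epsilon>"
proof
 show "0 < 1 + \<bar>ln \<epsilon>\<bar> / c" using c_pos by (simp add: add_pos_nonneg)
 have "- c * (1 + \<bar>ln \<epsilon>\<bar> / c) \<le> ln \<epsilon>" using c_pos by (simp add: distrib_left)
 then have "exp (- c * (1 + \<bar>ln \<epsilon>\<bar> / c)) \<le> exp (ln \<epsilon>)" by (subst exp_le_cancel_iff)
 then show "exp (- c * (1 + \<bar>ln \<epsilon>\<bar> / c)) \<le> \<epsilon>" using assms by simp
qed

lemma mass_pos: "0 < mass"
 using open_mu[of UNIV] by (simp add: mu.emeasure_eq_measure)

lemma y_0: "y 0 = mass"
 by (simp add: y_eq clk_nonpos)

lemma y_le_mass: "0 \<le> t ==> y t \<le> mass"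
 using y_antimono[of 0 t] y_0 by simp

lemma y_halve:
 assumes t: "0 \<le> t" and r: "0 \<le> r" and "r * (bmax * Ck * M t) \<le> 1 / 2"
 shows "y t / 2 \<le> y (t + r)"
proof -
 have "r * (bmax * Ck * M t) * y t \<le> 1 / 2 * y t" using assms(3) y_nonneg by (rule mult_right_mono)
 then show ?thesis using y_step[OF t r] by (simp add: mult.assoc)
qed

text \<open>As \<open>M\<close> is at most 1, there is a fixed window length over which
  \<open>y\<close> loses at most half of its value.\<close>

lemma y_pos: "0 \<le> t ==> 0 < y t"
proof -
 assume t: "0 \<le> t"
 define r where "r = 1 / (2 * (bmax * Ck))"
 have r: "0 < r" using bmax Ck_pos by (simp add: r_def)
 have rr: "r * (bmax * Ck * M s) \<le> 1 / 2" for s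
  using M_le_1[of s] bmax Ck_pos by (simp add: r_def)
 have pos: "0 < y (real n * r)" for n
 proof (induction n)
  case 0
  then show ?case using y_0 mass_pos by simp
 next
  case (Suc n)
  then show ?case using y_halve[OF _ _ rr, of "real n * r"] r by (simp add: distrib_right add.commute)
 qed
 obtain n :: nat where "t / r < real n" using reals_Archimedean2 by blast
 then have "t \<le> real n * r" using r by (simp add: pos_divide_less_eq)
 then show ?thesis using y_antimono[OF t, of "real n * r"] pos[of n] by simp
qed

text \<open>If \<open>y\<close> stayed above \<open>e\<close>, the deficit over a window would become negligible, so \<open>u\<close> would
 be close to \<open>\<Theta> y\<close> and \<open>\<beta>\<close>, whose integral is finite, would be bounded away from 0.\<close>

lemma y_small:
 assumes e: "0 < e"
 shows "\<exists>t\<ge>0. y t < e"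
proof (rule ccontr)
 assume "\<not> (\<exists>t\<ge>0. y t < e)"
 then have ye: "e \<le> y t" if "0 \<le> t" for t using that by (auto simp: not_less)
 define h where "h = bmax * Tm"
 have h: "0 < h" using bmax Tm_pos by (simp add: h_def)
 \<comment> \<open>A window so long that the gap error costs at most an eighth of
   \<open>Bc * e\<close>; the threshold \<eta> allots another eighth to the deficit.\<close>
 obtain r where r: "0 < r" "exp (- c * r) \<le> Bc * e / (8 * (h * mass * H))"
  using exp_small[of "Bc * e / (8 * (h * mass * H))"] Bc_pos e h mass_pos H_pos by auto
 have small: "h * (mass * (H * exp (- c * r))) \<le> Bc * e / 8"
  using r(2) h mass_pos H_pos by (simp add: pos_le_divide_eq mult_ac)
 define \<eta> where "\<eta> = Bc * e / (8 * h)"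
 have \<eta>: "0 < \<eta>" using Bc_pos e h by (simp add: \<eta>_def)
 \<comment> \<open>Being monotone and nonnegative, \<open>y\<close> comes close to its infimum,
   after which it can drop by at most \<eta> over any window.\<close>
 have bdd: "bdd_below (y ` {0..})" using y_nonneg by (intro bdd_belowI2[where m=0])
 obtain t1 where t1: "0 \<le> t1" "y t1 < Inf (y ` {0..}) + \<eta>"
  using cInf_lessD[of "y ` {0..}" "Inf (y ` {0..}) + \<eta>"] \<eta> by auto
 have D: "y t - y (t + r) \<le> \<eta>" if "t1 \<le> t" for t
  using cInf_lower[OF _ bdd, of "y (t + r)"] t1 that r y_antimono[of t1 t] by auto
 have low: "e\<^sup>2 * Bc / 2 \<le> \<beta> (t + r)" if t: "t1 \<le> t" for t
 proof -
  have t0: "0 \<le> t" and r0: "0 \<le> r" using t t1 r by auto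
  let ?\<epsilon> = "H * exp (- c * r)"
  have bT: "0 \<le> b x * \<Theta> x" "b x * \<Theta> x \<le> h" for x
   using b_nonneg[of x] bmax Theta_nonneg[of x] Theta_le[of x] by (auto simp: h_def intro!: mult_mono)
  \<comment> \<open>Expanding the square of \<open>u - e / 2 * \<Theta>\<close> bounds the quadratic
    quantity from below by a linear one, so an averaged estimate of the deficit is enough.\<close>
  have pw: "e * (b x * \<Theta> x) * u (t + r) x - e\<^sup>2 / 4 * ((\<Theta> x)\<^sup>2 * b x) \<le> b x * (u (t + r) x)\<^sup>2" for x
  proof -
   have "0 \<le> b x * (u (t + r) x - e / 2 * \<Theta> x)\<^sup>2" using b_nonneg[of x] by simp
   then show ?thesis by (simp add: power2_eq_square algebra_simps)
  qed
  have lw: "y t * ((\<Theta> x)\<^sup>2 * b x) - h * ?\<epsilon> - h * deficit t r x \<le> (b x * \<Theta> x) * u (t + r) x" for x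
  proof -
   have "?\<epsilon> * M t \<le> ?\<epsilon> * 1" using M_le_1[of t] H_pos by (intro mult_left_mono) auto
   then have "\<Theta> x * y t - ?\<epsilon> - deficit t r x \<le> u (t + r) x"
    using u_flow[OF t0 r0, of x] u_gap[OF t0 r0, of x] by (simp add: mult_ac)
   then have "(b x * \<Theta> x) * (\<Theta> x * y t - ?\<epsilon> - deficit t r x) \<le> (b x * \<Theta> x) * u (t + r) x"
    using bT(1) by (rule mult_left_mono)
   moreover have "(b x * \<Theta> x) * (?\<epsilon> + deficit t r x) \<le> h * (?\<epsilon> + deficit t r x)"
    using bT(2)[of x] H_pos deficit_nonneg[of t r x] by (intro mult_right_mono add_nonneg_nonneg) auto
   moreover have "(b x * \<Theta> x) * (\<Theta> x * y t - ?\<epsilon> - deficit t r x) = y t * ((\<Theta> x)\<^sup>2 * b x) - (b x * \<Theta> x) * (?\<epsilon> + deficit t r x)"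
    by (simp add: power2_eq_square algebra_simps)
   moreover have "h * (?\<epsilon> + deficit t r x) = h * ?\<epsilon> + h * deficit t r x" by (rule distrib_left)
   ultimately show ?thesis by linarith
  qed
  have iu: "integrable \<mu> (\<lambda>x. (b x * \<Theta> x) * u (t + r) x)"
  proof (rule integrable_mu[where K=h])
   fix x
   have "(b x * \<Theta> x) * u (t + r) x \<le> h * 1" using bT[of x] u_le_1 h by (intro mult_mono) auto
   then show "\<bar>(b x * \<Theta> x) * u (t + r) x\<bar> \<le> h" using bT(1)[of x] by simp
  qed measurable
  have "(LINT x|\<mu>. y t * ((\<Theta> x)\<^sup>2 * b x) - h * ?\<epsilon> - h * deficit t r x) \<le> (LINT x|\<mu>. (b x * \<Theta> x) * u (t + r) x)"
   using lw iu integrable_Theta_sq_b deficit_mu(1)[OF t0 r0] by (intro integral_mono) auto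
  then have I: "y t * Bc - mass * (h * ?\<epsilon>) - h * (y t - y (t + r)) \<le> (LINT x|\<mu>. (b x * \<Theta> x) * u (t + r) x)"
   using integrable_Theta_sq_b deficit_mu[OF t0 r0] by (simp add: Bc_def[symmetric] Bochner_Integration.integral_diff)
  have "h * (y t - y (t + r)) \<le> h * \<eta>" using D[OF t] h by (intro mult_left_mono) auto
  moreover have "h * \<eta> = Bc * e / 8" using h by (simp add: \<eta>_def)
  moreover have "e * Bc \<le> y t * Bc" using ye[OF t0] Bc_pos by (intro mult_right_mono) auto
  ultimately have "3 / 4 * (e * Bc) \<le> (LINT x|\<mu>. (b x * \<Theta> x) * u (t + r) x)"
   using I small by (simp add: mult_ac)
  then have "e * (3 / 4 * (e * Bc)) \<le> e * (LINT x|\<mu>. (b x * \<Theta> x) * u (t + r) x)" using e by (intro mult_left_mono) auto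
  moreover have "(LINT x|\<mu>. e * ((b x * \<Theta> x) * u (t + r) x) - e\<^sup>2 / 4 * ((\<Theta> x)\<^sup>2 * b x)) \<le> \<beta> (t + r)"
   unfolding \<beta>_def using pw iu integrable_Theta_sq_b by (intro integral_mono) (auto simp: mult.assoc)
  then have "e * (LINT x|\<mu>. (b x * \<Theta> x) * u (t + r) x) - e\<^sup>2 / 4 * Bc \<le> \<beta> (t + r)"
   using iu integrable_Theta_sq_b by (simp add: Bc_def[symmetric] Bochner_Integration.integral_diff)
  ultimately show ?thesis by (simp add: power2_eq_square)
 qed
 define K where "K = e\<^sup>2 * Bc / 2"
 have K: "0 < K" using e Bc_pos by (simp add: K_def)
 \<comment> \<open>The length of this window is chosen so that losing at rate \<open>K\<close> would
   use up more than the total mass.\<close>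
 have "(mass / K + 1) * K \<le> y (t1 + r) - y (t1 + r + (mass / K + 1))"
 proof (rule y_diff_ge)
  show "K \<le> \<beta> (t1 + r + s)" if "0 \<le> s" for s using low[of "t1 + s"] that by (simp add: K_def add_ac)
 qed (use t1 r K mass_pos in auto)
 then have "mass + K \<le> y (t1 + r)" using K y_nonneg[of "t1 + r + (mass / K + 1)"] by (simp add: distrib_right)
 then show False using y_le_mass[of "t1 + r"] K t1 r by simp
qed

lemma M_small:
 assumes e: "0 < e"
 shows "\<exists>t0\<ge>0. \<forall>t\<ge>t0. M t \<le> e"
proof -
 obtain r where r: "0 < r" "exp (- c * r) \<le> e / (2 * H)" using exp_small[of "e / (2 * H)"] e H_pos by auto
 obtain t1 where t1: "0 \<le> t1" "y t1 < e / (2 * Tm)" using y_small[of "e / (2 * Tm)"] e Tm_pos by auto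
 have "M t \<le> e" if "t1 + r \<le> t" for t
 proof -
  have "M t \<le> Tm * y (t - r) + H * M (t - r) * exp (- c * r)" using M_step[of "t - r" r] that r t1 by simp
  moreover have "Tm * y (t - r) \<le> Tm * (e / (2 * Tm))"
   using y_antimono[of t1 "t - r"] t1 that Tm_pos by (intro mult_left_mono) auto
  moreover have "H * M (t - r) * exp (- c * r) \<le> H * 1 * (e / (2 * H))"
   using r M_le_1 M_nonneg H_pos by (intro mult_mono) auto
  ultimately show ?thesis using Tm_pos H_pos by simp
 qed
 then show ?thesis using t1 r by (intro exI[of _ "t1 + r"]) auto
qed

text \<open>The quotient of \<open>\<rho>\<close> by the k-th power of \<open>y\<close> is halved
  from window to window: \<open>y\<close> loses at most half, which costs 2^k, while
  \<open>\<rho>\<close> gains 2^(k+1). \<open>bounded_of_halving\<close> then applies.\<close>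

lemma rho_bound_power:
 assumes r: "0 < r" and t0: "0 \<le> t0" and K: "0 \<le> K"
  and step: "\<And>t. t0 \<le> t ==> \<rho> (t + r) \<le> \<rho> t / 2 ^ Suc k + K * y t ^ k" and yh: "\<And>t. t0 \<le> t ==> y t / 2 \<le> y (t + r)"
 shows "\<exists>C\<ge>0. \<forall>t\<ge>0. \<rho> t \<le> C * y t ^ k"
proof -
 let ?b = "1 + Tm * mass"
 have b: "\<rho> t \<le> ?b" if "0 \<le> t" for t
  using rho_le_M[of t] M_le_1[of t] mult_left_mono[OF y_le_mass[OF that] less_imp_le[OF Tm_pos]] by linarith
 have b0: "0 \<le> ?b" using Tm_pos by simp
 have base: "\<rho> t / y t ^ k \<le> ?b / y s ^ k" if "0 \<le> t" "t \<le> s" for t s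
  using b[of t] b0 y_pos[of s] y_antimono[of t s] rho_nonneg[of t] that y_pos[of t]
  by (intro frac_le power_mono zero_less_power) auto
 have late: "\<rho> t / y t ^ k \<le> ?b / y (t0 + r) ^ k + 2 * (2 ^ k * K)" if "t0 \<le> t" for t
 proof (rule bounded_of_halving[OF r _ _ _ _ that])
  fix t assume t: "t0 \<le> t"
  have yp: "0 < y t" "0 < y (t + r)" using y_pos t t0 r by auto
  have "(y t / 2) ^ k \<le> y (t + r) ^ k" using yh[OF t] yp by (intro power_mono) auto
  then have "\<rho> (t + r) / y (t + r) ^ k \<le> (\<rho> t / 2 ^ Suc k + K * y t ^ k) / (y t / 2) ^ k"
   using step[OF t] rho_nonneg[of "t + r"] yp by (intro frac_le) auto
  also have "\<dots> = \<rho> t / y t ^ k / 2 + 2 ^ k * K"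
   using yp by (simp add: power_divide field_simps)
  finally show "\<rho> (t + r) / y (t + r) ^ k \<le> \<rho> t / y t ^ k / 2 + 2 ^ k * K" .
 next
  show "\<rho> t / y t ^ k \<le> ?b / y (t0 + r) ^ k" if "t0 \<le> t" "t \<le> t0 + r" for t
   using base[of t "t0 + r"] that t0 by simp
 qed (use Tm_pos K y_pos[of "t0 + r"] t0 r in auto)
 define C where "C = ?b / y (t0 + r) ^ k + 2 * (2 ^ k * K)"
 have "\<rho> t \<le> C * y t ^ k" if t: "0 \<le> t" for t
 proof -
  have "\<rho> t / y t ^ k \<le> C"
  proof (cases "t0 \<le> t")
   case False
   moreover have "0 \<le> 2 * (2 ^ k * K)" using K by simp
   ultimately show ?thesis unfolding C_def using base[of t "t0 + r"] t r by linarith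
  qed (use late in \<open>simp add: C_def\<close>)
  then show ?thesis using y_pos[OF t] by (simp add: pos_divide_le_eq)
 qed
 moreover have "0 \<le> C" unfolding C_def using Tm_pos K y_pos[of "t0 + r"] t0 r by (intro add_nonneg_nonneg divide_nonneg_nonneg) auto
 ultimately show ?thesis by blast
qed

text \<open>A bootstrap. While only \<open>M\<close> small is known, the quadratic loss is absorbed
  linearly, which gives the bound with exponent 1, hence \<open>M\<close> of order \<open>y\<close>;
  the loss is then of order y^2, which gives exponent 2.\<close>

lemma rho_quadratic: "\<exists>K. 0 \<le> K \<and> (\<forall>t\<ge>0. M t \<le> K * y t \<and> \<rho> t \<le> K * (y t)\<^sup>2)"
proof -
 \<comment> \<open>Chosen so that 3 H exp(-c r) is at most 1/8 = 2^(-3), the contraction needed for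
   exponent 2.\<close>
 obtain r where r: "0 < r" "exp (- c * r) \<le> 1 / (24 * H)" using exp_small[of "1 / (24 * H)"] H_pos by auto
 define C2 where "C2 = (1 + Tm * mass) * (r * Ck * (bmax * Ck\<^sup>2))"
 have C2: "0 < C2" unfolding C2_def using Tm_pos mass_pos r Ck_pos bmax by (intro mult_pos_pos add_pos_nonneg) auto
 have step: "\<rho> (t + r) \<le> \<rho> t / 8 + C2 * (M t)\<^sup>2" if t: "0 \<le> t" for t
 proof -
  have "3 * H * \<rho> t * exp (- c * r) \<le> 3 * H * \<rho> t * (1 / (24 * H))"
   using r H_pos rho_nonneg[of t] by (intro mult_left_mono) auto
  also have "\<dots> = \<rho> t / 8" using H_pos by simp
  finally show ?thesis using rho_step[OF t, of r] r by (simp add: C2_def power_mult_distrib mult_ac)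
 qed
 \<comment> \<open>The first bound keeps \<open>y\<close> from losing more than half per window; the
   second makes the quadratic loss at most \<open>M t / 8\<close>, so that the contraction 1/8
   weakens to 1/4, just enough for exponent 1.\<close>
 define e where "e = min (1 / (2 * (r * (bmax * Ck)))) (1 / (8 * C2))"
 have e: "0 < e" using r bmax Ck_pos C2 by (simp add: e_def)
 obtain t0 where t0: "0 \<le> t0" "\<And>t. t0 \<le> t ==> M t \<le> e" using M_small[OF e] by blast
 have yh: "y t / 2 \<le> y (t + r)" if t: "t0 \<le> t" for t
 proof (rule y_halve)
  have "r * (bmax * Ck) * M t \<le> r * (bmax * Ck) * (1 / (2 * (r * (bmax * Ck))))"
   using t0(2)[OF t] r bmax Ck_pos by (intro mult_left_mono) (auto simp: e_def)
  also have "\<dots> = 1 / 2" using r bmax Ck_pos by simp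
  finally show "r * (bmax * Ck * M t) \<le> 1 / 2" by (simp only: mult.assoc)
 qed (use t t0 r in auto)
 have "\<exists>C\<ge>0. \<forall>t\<ge>0. \<rho> t \<le> C * y t ^ 1"
 proof (rule rho_bound_power[OF r(1) t0(1), where K="Tm / 8"])
  fix t assume t: "t0 \<le> t"
  have "C2 * M t \<le> C2 * (1 / (8 * C2))" using t0(2)[OF t] C2 by (intro mult_left_mono) (auto simp: e_def)
  then have "C2 * M t * M t \<le> 1 / 8 * M t" using C2 M_nonneg[of t] by (intro mult_right_mono) auto
  then have "C2 * (M t)\<^sup>2 \<le> (Tm * y t + \<rho> t) / 8" using M_le_rho[of t] by (simp add: power2_eq_square mult.assoc)
  then have "\<rho> (t + r) \<le> \<rho> t / 4 + Tm / 8 * y t" using step[of t] t0 t by (simp add: field_simps)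
  then show "\<rho> (t + r) \<le> \<rho> t / 2 ^ Suc 1 + Tm / 8 * y t ^ 1" by simp
 qed (use yh Tm_pos in auto)
 then obtain C3 where C3: "0 \<le> C3" "\<And>t. 0 \<le> t ==> \<rho> t \<le> C3 * y t" by auto
 have Ml: "M t \<le> (Tm + C3) * y t" if "0 \<le> t" for t using M_le_rho[of t] C3(2)[OF that] by (simp add: distrib_right)
 have "\<exists>C\<ge>0. \<forall>t\<ge>0. \<rho> t \<le> C * y t ^ 2"
 proof (rule rho_bound_power[OF r(1) t0(1), where K="C2 * (Tm + C3)\<^sup>2"])
  fix t assume t: "t0 \<le> t"
  have "(M t)\<^sup>2 \<le> ((Tm + C3) * y t)\<^sup>2" using Ml[of t] M_nonneg[of t] t t0 by (intro power_mono) auto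
  then have "C2 * (M t)\<^sup>2 \<le> C2 * (Tm + C3)\<^sup>2 * (y t)\<^sup>2" using C2 by (simp add: power_mult_distrib)
  then show "\<rho> (t + r) \<le> \<rho> t / 2 ^ Suc 2 + C2 * (Tm + C3)\<^sup>2 * y t ^ 2" using step[of t] t t0 by simp
 qed (use yh C2 in auto)
 then obtain C4 where C4: "0 \<le> C4" "\<And>t. 0 \<le> t ==> \<rho> t \<le> C4 * (y t)\<^sup>2" by auto
 let ?K = "max (Tm + C3) C4"
 have "M t \<le> ?K * y t \<and> \<rho> t \<le> ?K * (y t)\<^sup>2" if t: "0 \<le> t" for t
  using Ml[OF t] C4(2)[OF t] mult_right_mono[of "Tm + C3" ?K "y t"] mult_right_mono[of C4 ?K "(y t)\<^sup>2"] y_nonneg[of t] by auto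
 then show ?thesis using C4(1) by (intro exI[of _ ?K]) auto
qed

text \<open>The difference of squares factors into u - \<Theta> y, of order y^2, and u + \<Theta> y,
  of order y.\<close>

lemma beta_asymp: "\<exists>K. 0 \<le> K \<and> (\<forall>t\<ge>0. \<bar>\<beta> t - Bc * (y t)\<^sup>2\<bar> \<le> K * y t ^ 3)"
proof -
 obtain K where K: "0 \<le> K" "\<And>t. 0 \<le> t ==> M t \<le> K * y t" "\<And>t. 0 \<le> t ==> \<rho> t \<le> K * (y t)\<^sup>2" using rho_quadratic by blast
 have "\<bar>\<beta> t - Bc * (y t)\<^sup>2\<bar> \<le> mass * (bmax * (K * (K + Tm))) * y t ^ 3" if t: "0 \<le> t" for t
 proof -
  have le: "\<bar>b x * (u t x)\<^sup>2 - (y t)\<^sup>2 * ((\<Theta> x)\<^sup>2 * b x)\<bar> \<le> bmax * ((K * (y t)\<^sup>2) * ((K + Tm) * y t))" for x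
  proof -
   have "\<bar>u t x - \<Theta> x * y t\<bar> \<le> K * (y t)\<^sup>2" using rho_ge[of t x] K(3)[OF t] by simp
   moreover have "u t x + \<Theta> x * y t \<le> (K + Tm) * y t" using u_le_M[of t x] K(2)[OF t] Theta_y_le[of x t] by (simp add: distrib_right)
   ultimately have "b x * (\<bar>u t x - \<Theta> x * y t\<bar> * (u t x + \<Theta> x * y t)) \<le> bmax * ((K * (y t)\<^sup>2) * ((K + Tm) * y t))"
    using b_nonneg[of x] bmax K(1) mult_nonneg_nonneg[OF Theta_nonneg[of x] y_nonneg[of t]] by (intro mult_mono add_nonneg_nonneg) auto
   moreover have "b x * (u t x)\<^sup>2 - (y t)\<^sup>2 * ((\<Theta> x)\<^sup>2 * b x) = b x * ((u t x - \<Theta> x * y t) * (u t x + \<Theta> x * y t))"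
    by (simp add: power2_eq_square algebra_simps)
   moreover have "0 \<le> u t x + \<Theta> x * y t" using mult_nonneg_nonneg[OF Theta_nonneg[of x] y_nonneg[of t]] by (intro add_nonneg_nonneg) auto
   ultimately show ?thesis using b_nonneg[of x] by (simp add: abs_mult)
  qed
  have i: "integrable \<mu> (\<lambda>x. (y t)\<^sup>2 * ((\<Theta> x)\<^sup>2 * b x))" using integrable_Theta_sq_b by (rule integrable_mult_right)
  have sq: "(LINT x|\<mu>. (y t)\<^sup>2 * ((\<Theta> x)\<^sup>2 * b x)) = (y t)\<^sup>2 * Bc" unfolding Bc_def by (rule integral_mult_right_zero)
  have "\<bar>\<beta> t - Bc * (y t)\<^sup>2\<bar> = \<bar>\<integral>x. b x * (u t x)\<^sup>2 - (y t)\<^sup>2 * ((\<Theta> x)\<^sup>2 * b x) \<partial>\<mu>\<bar>"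
   unfolding Bochner_Integration.integral_diff[OF integrable_b_usq i] sq by (simp add: \<beta>_def mult.commute)
  also have "\<dots> \<le> (LINT x|\<mu>. \<bar>b x * (u t x)\<^sup>2 - (y t)\<^sup>2 * ((\<Theta> x)\<^sup>2 * b x)\<bar>)" by (rule integral_abs_bound)
  also have "\<dots> \<le> (LINT x|\<mu>. bmax * ((K * (y t)\<^sup>2) * ((K + Tm) * y t)))" using le i by (intro integral_mono) auto
  also have "\<dots> = mass * (bmax * (K * (K + Tm))) * y t ^ 3" by (simp add: power2_eq_square power3_eq_cube mult_ac)
  finally show ?thesis .
 qed
 moreover have "0 \<le> mass * (bmax * (K * (K + Tm)))" using K(1) bmax Tm_pos by simp
 ultimately show ?thesis by blast
qed

lemma measurable_y [measurable]: "y \<in> borel_measurable borel"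
 unfolding y_def by (rule mu.borel_measurable_lebesgue_integral) measurable

lemma nn_integral_window:
 assumes "0 \<le> t" "\<And>s. 0 \<le> s ==> s \<le> t ==> (J has_real_derivative J' s) (at s)" "\<And>s. 0 \<le> s ==> s \<le> t ==> 0 \<le> J' s" "J' \<in> borel_measurable borel"
 shows "(\<integral>\<^sup>+s\<in>{0..t}. ennreal (J' s) \<partial>lborel) = ennreal (J t - J 0)"
 using assms by (intro nn_integral_FTC_Icc) (auto intro: has_field_derivative_at_within)

text \<open>The integrated form of (1/y)' = \<beta> / y^2. As \<open>y\<close> is
  \<open>mass\<close> minus the clock of \<open>\<beta>\<close>, the change of variables for clocks
  replaces the differentiation of an absolutely continuous function.\<close>

lemma inverse_y:
 assumes t: "0 \<le> t"
 shows "(\<integral>\<^sup>+s\<in>{0..t}. ennreal (\<beta> s / (y s)\<^sup>2) \<partial>lborel) = ennreal (1 / y t - 1 / mass)"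
proof -
 let ?\<phi> = "\<lambda>v. ennreal (1 / (mass - enn2real v)\<^sup>2)"
 have "(\<integral>\<^sup>+s\<in>{0..t}. ennreal (\<beta> s / (y s)\<^sup>2) \<partial>lborel) = (\<integral>\<^sup>+s\<in>{0..t}. ?\<phi> (clk (\<lambda>s. ennreal (\<beta> s)) s) * ennreal (\<beta> s) \<partial>lborel)"
 proof (rule nn_integral_cong)
  fix s :: real
  have "ennreal (\<beta> s / (y s)\<^sup>2) = ?\<phi> (clk (\<lambda>s. ennreal (\<beta> s)) s) * ennreal (\<beta> s)" if "0 \<le> s"
   unfolding y_eq[OF that] using beta_nonneg by (subst ennreal_mult[symmetric]) auto
  then show "ennreal (\<beta> s / (y s)\<^sup>2) * indicator {0..t} s = ?\<phi> (clk (\<lambda>s. ennreal (\<beta> s)) s) * ennreal (\<beta> s) * indicator {0..t} s"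
   by (auto split: split_indicator)
 qed
 also have "\<dots> = (\<integral>\<^sup>+v\<in>{0..enn2real (clk (\<lambda>s. ennreal (\<beta> s)) t)}. ?\<phi> (ennreal v) \<partial>lborel)"
  by (rule clk_substitution[OF _ clk_beta_finite t]) measurable
 also have "\<dots> = (\<integral>\<^sup>+v. ennreal (1 / (mass - v)\<^sup>2) * indicator {0..mass - y t} v \<partial>lborel)"
  using y_eq[OF t] by (intro nn_integral_cong) (auto split: split_indicator)
 also have "\<dots> = ennreal (1 / (mass - (mass - y t)) - 1 / (mass - 0))"
 proof (rule nn_integral_window)
  show "((\<lambda>v. 1 / (mass - v)) has_real_derivative 1 / (mass - v)\<^sup>2) (at v)" if "v \<le> mass - y t" for v
   using that y_pos[OF t] by (auto intro!: derivative_eq_intros simp: power2_eq_square)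
 qed (use y_le_mass[OF t] in auto)
 finally show ?thesis by simp
qed

text \<open>Two passes over \<open>inverse_y\<close>. A crude one, with \<beta> / y^2 eventually at
  least Bc / 2, shows that \<open>y\<close> is at most of order 1 / (1 + t); inserted into the error
  K y, this integrates to a logarithm in the second pass.\<close>

lemma y_rate: "\<exists>K L. 0 \<le> K \<and> 0 \<le> L \<and> (\<forall>t\<ge>0. (1 + t) * y t \<le> K \<and> \<bar>1 / y t - Bc * t\<bar> \<le> L * ln (2 + t))"
proof -
 obtain K where K: "0 \<le> K" "\<And>t. 0 \<le> t ==> \<bar>\<beta> t - Bc * (y t)\<^sup>2\<bar> \<le> K * y t ^ 3" using beta_asymp by blast
 have q: "\<bar>\<beta> t / (y t)\<^sup>2 - Bc\<bar> \<le> K * y t" if t: "0 \<le> t" for t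
 proof -
  have "\<bar>\<beta> t / (y t)\<^sup>2 - Bc\<bar> = \<bar>\<beta> t - Bc * (y t)\<^sup>2\<bar> / (y t)\<^sup>2"
  proof -
   have "\<beta> t / (y t)\<^sup>2 - Bc = (\<beta> t - Bc * (y t)\<^sup>2) / (y t)\<^sup>2" using y_pos[OF t] by (simp add: diff_divide_distrib)
   then show ?thesis by (simp add: abs_divide)
  qed
  also have "\<dots> \<le> K * y t ^ 3 / (y t)\<^sup>2" using K(2)[OF t] by (rule divide_right_mono) simp
  finally show ?thesis using y_pos[OF t] by (simp add: power2_eq_square power3_eq_cube)
 qed
 have inv0: "0 \<le> 1 / y t - 1 / mass" if "0 \<le> t" for t
  using y_le_mass[OF that] y_pos[OF that] by (simp add: frac_le)
 \<comment> \<open>From \<open>t1\<close> on the error K y is at most half of \<open>Bc\<close>.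
   Using \<open>K + 1\<close> avoids a division by zero.\<close>
 obtain t1 where t1: "0 \<le> t1" "y t1 < Bc / (2 * (K + 1))" using y_small[of "Bc / (2 * (K + 1))"] Bc_pos K(1) by auto
 have half: "k * (Bc / (2 * k)) = Bc / 2" if "0 < k" for k using that by simp
 have late: "K * y t \<le> Bc / 2" if "t1 \<le> t" for t
 proof -
  have "K * y t \<le> (K + 1) * (Bc / (2 * (K + 1)))"
   using y_antimono[of t1 t] t1 that K(1) y_nonneg[of t] by (intro mult_mono) auto
  also have "(K + 1) * (Bc / (2 * (K + 1))) = Bc / 2" using K(1) by (intro half) simp
  finally show ?thesis .
 qed
 have cst: "(\<integral>\<^sup>+s\<in>{0..q}. ennreal a \<partial>lborel) = ennreal (a * q)" if "0 \<le> q" "0 \<le> a" for a q :: real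
  using that by (simp add: nn_integral_cmult ennreal_mult[symmetric])
 \<comment> \<open>The lower bound on the integrand may fail before \<open>t1\<close>; the constant
   is simply added on \<open>{0..t1}\<close>.\<close>
 have crude: "Bc / 2 * t \<le> 1 / y t + Bc / 2 * t1" if t: "0 \<le> t" for t
 proof -
  have "ennreal (Bc / 2 * t) = (\<integral>\<^sup>+s\<in>{0..t}. ennreal (Bc / 2) \<partial>lborel)"
   using cst[OF t, of "Bc / 2"] Bc_pos by simp
  also have "\<dots> \<le> (\<integral>\<^sup>+s. ennreal (\<beta> s / (y s)\<^sup>2) * indicator {0..t} s + ennreal (Bc / 2) * indicator {0..t1} s \<partial>lborel)"
  proof (rule nn_integral_mono)
   fix s
   have "Bc / 2 \<le> \<beta> s / (y s)\<^sup>2" if "t1 \<le> s" "0 \<le> s" using q[OF that(2)] late[OF that(1)] by linarith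
   then show "ennreal (Bc / 2) * indicator {0..t} s \<le> ennreal (\<beta> s / (y s)\<^sup>2) * indicator {0..t} s + ennreal (Bc / 2) * indicator {0..t1} s"
    by (cases "t1 \<le> s") (auto split: split_indicator intro: ennreal_leI add_increasing2)
  qed
  also have "\<dots> = (\<integral>\<^sup>+s\<in>{0..t}. ennreal (\<beta> s / (y s)\<^sup>2) \<partial>lborel) + (\<integral>\<^sup>+s\<in>{0..t1}. ennreal (Bc / 2) \<partial>lborel)"
   by (rule nn_integral_add) auto
  also have "(\<integral>\<^sup>+s\<in>{0..t1}. ennreal (Bc / 2) \<partial>lborel) = ennreal (Bc / 2 * t1)"
   using cst[OF t1(1), of "Bc / 2"] Bc_pos by simp
  also have "(\<integral>\<^sup>+s\<in>{0..t}. ennreal (\<beta> s / (y s)\<^sup>2) \<partial>lborel) + ennreal (Bc / 2 * t1) = ennreal ((1 / y t - 1 / mass) + Bc / 2 * t1)"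
   unfolding inverse_y[OF t] using inv0[OF t] Bc_pos t1(1) by (intro ennreal_plus[symmetric]) auto
  finally have "Bc / 2 * t \<le> (1 / y t - 1 / mass) + Bc / 2 * t1"
   using inv0[OF t] Bc_pos t1(1) by (subst (asm) ennreal_le_iff) auto
  moreover have "0 \<le> 1 / mass" by simp
  ultimately show ?thesis by linarith
 qed
 define K1 where "K1 = 2 / Bc + (1 + t1) * mass"
 have K1: "0 \<le> K1" using Bc_pos t1 by (simp add: K1_def)
 have yK: "(1 + t) * y t \<le> K1" if t: "0 \<le> t" for t
 proof -
  have yp: "0 < y t" by (rule y_pos[OF t])
  have "(Bc / 2 * t) * y t \<le> (1 / y t + Bc / 2 * t1) * y t" using crude[OF t] yp by (intro mult_right_mono) auto
  then have "Bc / 2 * (t * y t) \<le> 1 + Bc / 2 * (t1 * y t)" using yp by (simp add: distrib_right)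
  then have "t * y t \<le> 2 / Bc + t1 * y t" using Bc_pos by (simp add: field_simps)
  moreover have "(1 + t1) * y t \<le> (1 + t1) * mass" using y_le_mass[OF t] t1 by (intro mult_left_mono) auto
  ultimately show ?thesis by (simp add: K1_def distrib_right)
 qed
 have yKd: "K * y t \<le> K * K1 / (1 + t)" if t: "0 \<le> t" for t
 proof -
  have "y t \<le> K1 / (1 + t)" using yK[OF t] t by (simp add: pos_le_divide_eq mult.commute)
  then show ?thesis using mult_left_mono[of "y t" "K1 / (1 + t)" K] K(1) by simp
 qed
 have lg: "(\<integral>\<^sup>+s\<in>{0..t}. ennreal (K * K1 / (1 + s)) \<partial>lborel) = ennreal (K * K1 * ln (1 + t))" if t: "0 \<le> t" for t
 proof -
  have "(\<integral>\<^sup>+s\<in>{0..t}. ennreal (K * K1 / (1 + s)) \<partial>lborel) = ennreal (K * K1 * ln (1 + t) - K * K1 * ln (1 + 0))"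
  proof (rule nn_integral_window[OF t])
   show "((\<lambda>s. K * K1 * ln (1 + s)) has_real_derivative K * K1 / (1 + s)) (at s)" if "0 \<le> s" for s
    using that by (auto intro!: derivative_eq_intros)
  qed (use K(1) K1 in auto)
  then show ?thesis by simp
 qed
 have cn: "(\<integral>\<^sup>+s\<in>{0..t}. ennreal Bc \<partial>lborel) = ennreal (Bc * t)" if t: "0 \<le> t" for t
  using cst[OF t, of Bc] Bc_pos by simp
 have lin: "\<bar>1 / y t - Bc * t\<bar> \<le> 1 / mass + K * K1 * ln (1 + t)" if t: "0 \<le> t" for t
 proof -
  have ln0: "0 \<le> K * K1 * ln (1 + t)" using K(1) K1 t by simp
  have Bt: "0 \<le> Bc * t" using Bc_pos t by simp
  have "ennreal (1 / y t - 1 / mass) \<le> (\<integral>\<^sup>+s. ennreal Bc * indicator {0..t} s + ennreal (K * K1 / (1 + s)) * indicator {0..t} s \<partial>lborel)"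
   unfolding inverse_y[OF t, symmetric]
  proof (rule nn_integral_mono)
   fix s
   have "ennreal (\<beta> s / (y s)\<^sup>2) \<le> ennreal Bc + ennreal (K * K1 / (1 + s))" if "0 \<le> s"
   proof -
    have "\<beta> s / (y s)\<^sup>2 \<le> Bc + K * K1 / (1 + s)" using q[OF that] yKd[OF that] by linarith
    then have "ennreal (\<beta> s / (y s)\<^sup>2) \<le> ennreal (Bc + K * K1 / (1 + s))" by (rule ennreal_leI)
    also have "\<dots> = ennreal Bc + ennreal (K * K1 / (1 + s))" using Bc_pos K(1) K1 that by (intro ennreal_plus) auto
    finally show ?thesis .
   qed
   then show "ennreal (\<beta> s / (y s)\<^sup>2) * indicator {0..t} s \<le> ennreal Bc * indicator {0..t} s + ennreal (K * K1 / (1 + s)) * indicator {0..t} s"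
    by (auto split: split_indicator)
  qed
  also have "\<dots> = ennreal (Bc * t) + ennreal (K * K1 * ln (1 + t))" unfolding cn[OF t, symmetric] lg[OF t, symmetric] by (rule nn_integral_add) auto
  also have "\<dots> = ennreal (Bc * t + K * K1 * ln (1 + t))" using Bt ln0 by (rule ennreal_plus[symmetric])
  finally have 1: "1 / y t - 1 / mass \<le> Bc * t + K * K1 * ln (1 + t)" using Bt ln0 by (subst (asm) ennreal_le_iff) auto
  have "ennreal (Bc * t) \<le> (\<integral>\<^sup>+s. ennreal (\<beta> s / (y s)\<^sup>2) * indicator {0..t} s + ennreal (K * K1 / (1 + s)) * indicator {0..t} s \<partial>lborel)"
   unfolding cn[OF t, symmetric]
  proof (rule nn_integral_mono)
   fix s
   have "ennreal Bc \<le> ennreal (\<beta> s / (y s)\<^sup>2) + ennreal (K * K1 / (1 + s))" if "0 \<le> s"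
   proof -
    have "Bc \<le> \<beta> s / (y s)\<^sup>2 + K * K1 / (1 + s)" using q[OF that] yKd[OF that] by linarith
    then have "ennreal Bc \<le> ennreal (\<beta> s / (y s)\<^sup>2 + K * K1 / (1 + s))" by (rule ennreal_leI)
    also have "\<dots> = ennreal (\<beta> s / (y s)\<^sup>2) + ennreal (K * K1 / (1 + s))"
     using beta_nonneg[of s] K(1) K1 that by (intro ennreal_plus) auto
    finally show ?thesis .
   qed
   then show "ennreal Bc * indicator {0..t} s \<le> ennreal (\<beta> s / (y s)\<^sup>2) * indicator {0..t} s + ennreal (K * K1 / (1 + s)) * indicator {0..t} s"
    by (auto split: split_indicator)
  qed
  also have "\<dots> = ennreal (1 / y t - 1 / mass) + ennreal (K * K1 * ln (1 + t))" unfolding inverse_y[OF t, symmetric] lg[OF t, symmetric] by (rule nn_integral_add) auto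
  also have "\<dots> = ennreal ((1 / y t - 1 / mass) + K * K1 * ln (1 + t))" using inv0[OF t] ln0 by (rule ennreal_plus[symmetric])
  finally have 2: "Bc * t \<le> (1 / y t - 1 / mass) + K * K1 * ln (1 + t)" using inv0[OF t] ln0 by (subst (asm) ennreal_le_iff) auto
  have "0 \<le> 1 / mass" by simp
  with 1 2 show ?thesis unfolding abs_le_iff by linarith
 qed
 \<comment> \<open>The constant \<open>1 / mass\<close>, the initial value of 1/y, is absorbed into
   the logarithm, which is at least ln 2 at all times.\<close>
 define L' where "L' = 1 / (mass * ln 2) + K * K1"
 have "\<bar>1 / y t - Bc * t\<bar> \<le> L' * ln (2 + t)" if t: "0 \<le> t" for t
 proof -
  have "1 / mass = 1 / (mass * ln 2) * ln 2" by simp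
  also have "\<dots> \<le> 1 / (mass * ln 2) * ln (2 + t)" using t mass_pos by (intro mult_left_mono) auto
  finally have "1 / mass \<le> 1 / (mass * ln 2) * ln (2 + t)" .
  moreover have "K * K1 * ln (1 + t) \<le> K * K1 * ln (2 + t)" using t K(1) K1 by (intro mult_left_mono) auto
  ultimately show ?thesis using lin[OF t] by (simp only: L'_def distrib_right)
 qed
 moreover have "0 \<le> L'" unfolding L'_def using K(1) K1 by (intro add_nonneg_nonneg) auto
 ultimately show ?thesis using yK K1 by blast
qed

text \<open>The error has two sources: the distance of u from \<Theta> y, which contributes order 1
  / (1 + t), and the deviation of (1 + t) y from 1/B, which carries the logarithm of
  \<open>y_rate\<close>.\<close>

theorem survival_rate: "\<exists>C\<ge>0. \<forall>t\<ge>0. \<forall>x. \<bar>(1 + t) * u t x - \<Theta> x / Bc\<bar> \<le> C * ln (2 + t) / (1 + t)"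
proof -
 obtain K2 where K2: "0 \<le> K2" "\<And>t. 0 \<le> t ==> \<rho> t \<le> K2 * (y t)\<^sup>2" using rho_quadratic by blast
 obtain K L' where K: "0 \<le> K" "0 \<le> L'" "\<And>t. 0 \<le> t ==> (1 + t) * y t \<le> K" "\<And>t. 0 \<le> t ==> \<bar>1 / y t - Bc * t\<bar> \<le> L' * ln (2 + t)"
  using y_rate by blast
 define C where "C = K2 * K\<^sup>2 / ln 2 + Tm * (K * (Bc / ln 2 + L')) / Bc"
 have "\<bar>(1 + t) * u t x - \<Theta> x / Bc\<bar> \<le> C * ln (2 + t) / (1 + t)" if t: "0 \<le> t" for t x
 proof -
  let ?l = "ln (2 + t)"
  have l2: "1 \<le> ?l / ln 2" using t by simp
  have yp: "0 < y t" by (rule y_pos[OF t])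
  have "\<bar>(1 + t) * (u t x - \<Theta> x * y t)\<bar> \<le> (1 + t) * (K2 * (y t)\<^sup>2)"
   using rho_ge[of t x] K2(2)[OF t] t by (simp add: abs_mult mult_left_mono)
  also have "\<dots> = K2 * ((1 + t) * y t)\<^sup>2 / (1 + t)" using t by (simp add: power2_eq_square)
  also have "\<dots> \<le> K2 * K\<^sup>2 / (1 + t)"
   using K(3)[OF t] K2(1) t yp by (intro divide_right_mono mult_left_mono power_mono) auto
  also have "\<dots> = K2 * K\<^sup>2 * 1 / (1 + t)" by simp
  also have "\<dots> \<le> K2 * K\<^sup>2 * (?l / ln 2) / (1 + t)"
   using l2 K2(1) t by (intro divide_right_mono mult_left_mono) auto
  finally have 1: "\<bar>(1 + t) * (u t x - \<Theta> x * y t)\<bar> \<le> (K2 * K\<^sup>2 / ln 2) * ?l / (1 + t)" by simp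
  \<comment> \<open>This identity converts the additive estimate of 1/y - B t into one for (1 + t)
    y; the factor \<open>y t\<close> supplies the decay 1 / (1 + t).\<close>
  have "(1 + t) * y t - 1 / Bc = (y t / Bc) * ((Bc * t - 1 / y t) + Bc)" using yp Bc_pos by (simp add: field_simps)
  then have "\<bar>(1 + t) * y t - 1 / Bc\<bar> = (y t / Bc) * \<bar>(Bc * t - 1 / y t) + Bc\<bar>" using yp Bc_pos by (simp add: abs_mult)
  also have "\<dots> \<le> (y t / Bc) * (L' * ?l + Bc * (?l / ln 2))"
  proof (rule mult_left_mono)
   have "Bc * 1 \<le> Bc * (?l / ln 2)" using l2 Bc_pos by (intro mult_left_mono) auto
   then show "\<bar>(Bc * t - 1 / y t) + Bc\<bar> \<le> L' * ?l + Bc * (?l / ln 2)" using K(4)[OF t] Bc_pos by linarith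
  qed (use yp Bc_pos in simp)
  also have "\<dots> = ((1 + t) * y t) * ((Bc / ln 2 + L') * ?l) / Bc / (1 + t)"
  proof -
   have "(y t / Bc) * z = ((1 + t) * y t) * z / Bc / (1 + t)" for z using t by (simp add: divide_simps)
   moreover have "L' * ?l + Bc * (?l / ln 2) = (Bc / ln 2 + L') * ?l" by (simp add: algebra_simps)
   ultimately show ?thesis by simp
  qed
  also have "\<dots> \<le> K * ((Bc / ln 2 + L') * ?l) / Bc / (1 + t)"
   using K(3)[OF t] K(2) Bc_pos t by (intro divide_right_mono mult_right_mono) auto
  finally have "\<bar>(1 + t) * y t - 1 / Bc\<bar> \<le> K * ((Bc / ln 2 + L') * ?l) / Bc / (1 + t)" .
  then have "\<Theta> x * \<bar>(1 + t) * y t - 1 / Bc\<bar> \<le> Tm * (K * ((Bc / ln 2 + L') * ?l) / Bc / (1 + t))"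
   using Theta_le[of x] Theta_nonneg[of x] Tm_pos by (intro mult_mono) auto
  then have "\<bar>\<Theta> x * ((1 + t) * y t - 1 / Bc)\<bar> \<le> (Tm * (K * (Bc / ln 2 + L')) / Bc) * ?l / (1 + t)"
   using Theta_nonneg[of x] by (simp add: abs_mult mult.assoc)
  moreover have "(1 + t) * u t x - \<Theta> x / Bc = (1 + t) * (u t x - \<Theta> x * y t) + \<Theta> x * ((1 + t) * y t - 1 / Bc)"
   by (simp add: algebra_simps)
  moreover have "C * ?l / (1 + t) = (K2 * K\<^sup>2 / ln 2) * ?l / (1 + t) + (Tm * (K * (Bc / ln 2 + L')) / Bc) * ?l / (1 + t)"
   by (simp only: C_def distrib_right add_divide_distrib)
  ultimately show ?thesis using 1 by linarith
 qed
 moreover have "0 \<le> C" unfolding C_def using K K2(1) Tm_pos Bc_pos by (intro add_nonneg_nonneg divide_nonneg_nonneg mult_nonneg_nonneg) auto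
 ultimately show ?thesis by blast
qed

end

section \<open>Signed test functions and conditioning on survival\<close>

lemma alternating_sum_Suc:
 "(\<Sum>j\<le>Suc m. (- 1) ^ j * real (Suc m choose j) * h j) = (\<Sum>j\<le>m. (- 1) ^ j * real (m choose j) * (h j - h (Suc j)))"
proof -
 have "(\<Sum>j\<le>Suc m. (- 1) ^ j * real (Suc m choose j) * h j) =
  (h 0 + (\<Sum>j\<le>m. (- 1) ^ Suc j * real (m choose Suc j) * h (Suc j))) - (\<Sum>j\<le>m. (- 1) ^ j * real (m choose j) * h (Suc j))"
  by (subst sum.atMost_Suc_shift) (simp add: algebra_simps sum.distrib sum_subtractf sum_negf)
 also have "h 0 + (\<Sum>j\<le>m. (- 1) ^ Suc j * real (m choose Suc j) * h (Suc j)) = (\<Sum>j\<le>Suc m. (- 1) ^ j * real (m choose j) * h j)"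
  by (subst sum.atMost_Suc_shift) simp
 finally show ?thesis by (simp add: right_diff_distrib sum_subtractf)
qed

text \<open>The m-th finite difference of a polynomial of degree below m vanishes; by Pascal's rule
  each difference lowers the degree.\<close>

lemma alternating_power_sum:
 "n < m ==> (\<Sum>j\<le>m. (- 1) ^ j * real (m choose j) * (\<alpha> + real j * \<beta>) ^ n) = 0"
proof (induction m arbitrary: n)
 case (Suc m)
 let ?S = "\<lambda>i. \<Sum>j\<le>m. (- 1) ^ j * real (m choose j) * (\<alpha> + real j * \<beta>) ^ i"
 have diff: "(\<alpha> + real j * \<beta>) ^ n - (\<alpha> + real (Suc j) * \<beta>) ^ n = - (\<Sum>i<n. real (n choose i) * (\<alpha> + real j * \<beta>) ^ i * \<beta> ^ (n - i))" for j
 proof -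
  have "(\<alpha> + real (Suc j) * \<beta>) ^ n = ((\<alpha> + real j * \<beta>) + \<beta>) ^ n" by (simp add: algebra_simps)
  also have "\<dots> = (\<Sum>i<Suc n. real (n choose i) * (\<alpha> + real j * \<beta>) ^ i * \<beta> ^ (n - i))"
   unfolding lessThan_Suc_atMost by (rule binomial_ring)
  finally show ?thesis by simp
 qed
 have "(\<Sum>j\<le>Suc m. (- 1) ^ j * real (Suc m choose j) * (\<alpha> + real j * \<beta>) ^ n) =
  (\<Sum>j\<le>m. \<Sum>i<n. - (real (n choose i) * \<beta> ^ (n - i)) * ((- 1) ^ j * real (m choose j) * (\<alpha> + real j * \<beta>) ^ i))"
  unfolding alternating_sum_Suc[of m "\<lambda>j. (\<alpha> + real j * \<beta>) ^ n"] diff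
  by (intro sum.cong refl) (simp add: sum_distrib_left sum_negf[symmetric] mult_ac)
 also have "\<dots> = (\<Sum>i<n. - (real (n choose i) * \<beta> ^ (n - i)) * ?S i)"
  by (subst sum.swap) (simp only: sum_distrib_left)
 also have "\<dots> = 0" using Suc by (intro sum.neutral) auto
 finally show ?case .
qed simp

text \<open>Isolates the term j = 0 of the vanishing difference of order n + 1. With \<alpha> =
  <Z,f> and \<beta> = K N, the remaining arguments are <Z, f + j K> for j at least 1, and these
  functions are nonnegative when f is bounded by K.\<close>

lemma power_as_shifted_powers:
 "\<alpha> ^ n = (\<Sum>j=1..Suc n. (- 1) ^ Suc j * real (Suc n choose j) * (\<alpha> + real j * \<beta>) ^ n)"
proof -
 have "0 = (\<Sum>j\<le>Suc n. (- 1) ^ j * real (Suc n choose j) * (\<alpha> + real j * \<beta>) ^ n)" by (rule alternating_power_sum[symmetric]) simp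
 also have "{..Suc n} = insert 0 {1..Suc n}" by auto
 also have "(\<Sum>j\<in>insert 0 {1..Suc n}. (- 1) ^ j * real (Suc n choose j) * (\<alpha> + real j * \<beta>) ^ n) =
  \<alpha> ^ n + (\<Sum>j=1..Suc n. (- 1) ^ j * real (Suc n choose j) * (\<alpha> + real j * \<beta>) ^ n)"
  by (subst sum.insert) auto
 finally show ?thesis by (simp add: sum_negf eq_neg_iff_add_eq_0)
qed

lemma uniform_measure_integral:
 fixes f :: "'a => real"
 assumes M: "finite_measure M" and A[measurable]: "A \<in> sets M" and f: "integrable M f"
 shows integrable_uniform_measure: "integrable (uniform_measure M A) f"
  and integral_uniform_measure: "0 < measure M A ==> (LINT x|uniform_measure M A. f x) = (LINT x|M. indicator A x * f x) / measure M A"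
proof -
 interpret M: finite_measure M by (rule M)
 have [measurable]: "f \<in> borel_measurable M" using f by simp
 have dens: "uniform_measure M A = density M (\<lambda>x. ennreal (indicator A x / measure M A))" if "0 < measure M A"
  unfolding uniform_measure_def M.emeasure_eq_measure using that
  by (intro arg_cong[where f="density M"] ext) (auto split: split_indicator simp: divide_ennreal ennreal_1[symmetric] simp del: ennreal_1)
 have int: "integrable M (\<lambda>x. indicator A x / measure M A * f x)"
  using integrable_real_mult_indicator[OF A f] by (simp add: mult.commute)
 show "integrable (uniform_measure M A) f"
 proof (cases "0 < measure M A")
  case True
  then show ?thesis unfolding dens[OF True] using int by (subst integrable_density) auto
 next
  \<comment> \<open>Conditioning on a null event gives the zero measure, so every measurable
    function is integrable almost trivially.\<close>
  case False
  then have "AE x in M. x \<notin> A" by (intro AE_not_in) (auto simp: null_sets_def M.emeasure_eq_measure not_less measure_le_0_iff)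
  then have "AE x in uniform_measure M A. 0 = f x" by (intro AE_uniform_measureI A) auto
  moreover have "f \<in> borel_measurable (uniform_measure M A)" by (simp cong: measurable_cong_sets)
  ultimately show ?thesis by (blast intro: integrable_cong_AE_imp[OF Bochner_Integration.integrable_zero])
 qed
 show "(LINT x|uniform_measure M A. f x) = (LINT x|M. indicator A x * f x) / measure M A" if "0 < measure M A"
  unfolding dens[OF that] by (subst integral_density) auto
qed

lemma integral_scale_measure:
 fixes f :: "'a => real"
 assumes "f \<in> borel_measurable M" "0 \<le> r"
 shows "(LINT x|scale_measure (ennreal r) M. f x) = r * (LINT x|M. f x)"
proof -
 have "scale_measure (ennreal r) M = density M (\<lambda>_. ennreal r)"
  by (rule measure_eqI) (auto simp: emeasure_density nn_integral_cmult_indicator)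
 then show ?thesis using assms by (simp add: integral_density)
qed

lemma C0_bounded:
 assumes "f \<in> C0"
 obtains T where "\<And>x. f x \<le> T"
proof -
 have cont: "continuous_on UNIV f" and lim: "(f \<longlongrightarrow> 0) at_infinity" using assms by (auto simp: C0_def)
 from tendstoD[OF lim, of 1] obtain R where R: "\<And>x. R \<le> norm x ==> dist (f x) 0 < 1" by (auto simp: eventually_at_infinity)
 have "bounded (f ` cball 0 R)"
  using cont by (intro compact_imp_bounded compact_continuous_image) (auto intro: continuous_on_subset)
 then obtain K where "\<forall>y\<in>f ` cball 0 R. norm y \<le> K" unfolding bounded_iff by blast
 then have K: "norm (f x) \<le> K" if "norm x \<le> R" for x using that by simp
 have "f x \<le> max 1 K" for x using R[of x] K[of x] by (cases "R \<le> norm x") (auto simp: dist_norm)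
 then show ?thesis by (rule that)
qed

context branching
begin

lemma LINT_rate:
 assumes w: "w \<in> space \<Omega>" and r[measurable]: "r \<in> borel_measurable borel" and r0: "\<And>y. 0 \<le> r y" and fin: "clk (rate r w) t < \<top>"
 shows "set_integrable lborel {0..t} (\<lambda>s. r (Y s w))" and "(LINT s:{0..t}|lborel. r (Y s w)) = enn2real (clk (rate r w) t)"
proof -
 have [measurable]: "(\<lambda>s. Y s w) \<in> borel_measurable borel" using w by measurable
 have eq: "(\<integral>\<^sup>+s. ennreal (indicator {0..t} s *\<^sub>R r (Y s w)) \<partial>lborel) = clk (rate r w) t"
  unfolding clk_def rate_def by (intro nn_integral_cong) (auto split: split_indicator)
 show "set_integrable lborel {0..t} (\<lambda>s. r (Y s w))"
  unfolding set_integrable_def using fin eq r0 by (intro integrableI_nonneg) auto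
 show "(LINT s:{0..t}|lborel. r (Y s w)) = enn2real (clk (rate r w) t)"
  unfolding set_lebesgue_integral_def eq[symmetric] using r0 by (intro integral_eq_nn_integral) auto
qed

text \<open>The bridge between the semigroup of the hypotheses and the kernels: almost surely both
  clocks are finite, so the integral of b - d splits and its exponential is
  \<open>weight\<close>.\<close>

lemma feynman_kac_kappa:
 assumes f[measurable]: "f \<in> borel_measurable borel" and t: "0 \<le> t"
 shows "feynman_kac X Q (\<lambda>y. b y - d y) t f x = (LINT z|kappa t x. f z)"
proof -
 have sp: "space (Q x) = space \<Omega>" by (rule sets_eq_imp_space_eq) simp
 let ?e = "\<lambda>w. \<integral>s. indicator {0..t} s *\<^sub>R (b (Y s w) - d (Y s w)) \<partial>lborel"
 have em[measurable]: "?e \<in> borel_measurable (Q x)"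
  by (rule lborel.borel_measurable_lebesgue_integral) measurable
 have "feynman_kac X Q (\<lambda>y. b y - d y) t f x = (LINT w|Q x. exp (?e w) * f (Y t w))"
  unfolding feynman_kac_def set_lebesgue_integral_def using t
  by (intro Bochner_Integration.integral_cong refl arg_cong2[where f="(*)"] arg_cong[where f=exp]) (auto simp: Y_eq split: split_indicator)
 also have "\<dots> = (LINT w|Q x. enn2real (weight t w) *\<^sub>R f (Y t w))"
 proof (rule integral_cong_AE)
  show "AE w in Q x. exp (?e w) * f (Y t w) = enn2real (weight t w) *\<^sub>R f (Y t w)"
   using AE_clk_rate_d[of x] AE_space
  proof eventually_elim
   case (elim w)
   then have w: "w \<in> space \<Omega>" and fin: "clk (rate d w) t < \<top>" by (auto simp: sp)
   have "?e w = enn2real (clk (rate b w) t) - enn2real (clk (rate d w) t)"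
    using set_integral_diff(2)[OF LINT_rate(1)[OF w b_measurable b_nonneg clk_rate_b_fin, of t] LINT_rate(1)[OF w d_measurable d_nonneg fin]]
    unfolding LINT_rate(2)[OF w b_measurable b_nonneg clk_rate_b_fin, of t] LINT_rate(2)[OF w d_measurable d_nonneg fin]
    by (simp add: set_lebesgue_integral_def)
   moreover have "enn2real (weight t w) = exp (enn2real (clk (rate b w) t) - enn2real (clk (rate d w) t))"
    using fin by (simp add: weight_def expm_def enn2real_mult exp_diff exp_minus divide_inverse mult.commute)
   ultimately show ?case by simp
  qed
 qed measurable
 also have "\<dots> = (LINT w|density (Q x) (\<lambda>w. ennreal (enn2real (weight t w))). f (Y t w))"
  by (subst integral_density) auto
 also have "density (Q x) (\<lambda>w. ennreal (enn2real (weight t w))) = density (Q x) (weight t)"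
  using weight_le[OF t] by (intro arg_cong[where f="density (Q x)"] ext ennreal_enn2real) (metis ennreal_less_top le_less_trans)
 also have "(LINT w|density (Q x) (weight t). f (Y t w)) = (LINT z|kappa t x. f z)"
  unfolding kappa_def by (subst integral_distr) auto
 finally show ?thesis .
qed

lemma pr_shift: "pr (\<lambda>y. f y + k) t om = pr f t om + k * pr (\<lambda>_. 1) t om"
 by (simp add: pr_def pairing_def sum.distrib mult.commute)

lemma pr_eq_0: "\<not> 0 < pop_size X b d (tree om) t ==> pr f t om = 0"
 unfolding pop_size_pos_iff by (auto simp: pr_def pairing_def)

lemma pr_power_shifted:
 "pr f t om ^ n = (\<Sum>j=1..Suc n. (- 1) ^ Suc j * real (Suc n choose j) * pr (\<lambda>y. f y + real j * K) t om ^ n)"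
 unfolding pr_shift mult.assoc[of "real _" K] by (rule power_as_shifted_powers)

end

context critical
begin

lemma survival_prob: "0 \<le> t ==> measure (Pr x) {om \<in> space (Pr x). 0 < pop_size X b d (tree om) t} = u t x"
 using survival_mort[of t x] unfolding ennreal_u[symmetric] by (subst (asm) ennreal_inj) auto

lemma filterlim_add_1_at_top: "filterlim (\<lambda>t::real. 1 + t) at_top at_top"
 by (intro filterlim_tendsto_add_at_top[OF tendsto_const] filterlim_ident)

lemma ln_ratio_tendsto_0: "((\<lambda>t::real. ln (2 + t) / (1 + t)) \<longlongrightarrow> 0) at_top"
proof (rule tendsto_sandwich[OF _ _ tendsto_const])
 have "filterlim (\<lambda>t::real. 2 + t) at_top at_top"
  by (intro filterlim_tendsto_add_at_top[OF tendsto_const] filterlim_ident)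
 then have "((\<lambda>t::real. ln (2 + t) / (2 + t)) \<longlongrightarrow> 0) at_top" by (rule filterlim_compose[OF ln_x_over_x_tendsto_0])
 then show "((\<lambda>t::real. 2 * (ln (2 + t) / (2 + t))) \<longlongrightarrow> 0) at_top" by (rule tendsto_mult_right_zero)
 show "\<forall>\<^sub>F t in at_top. (0::real) \<le> ln (2 + t) / (1 + t)" using eventually_ge_at_top[of 0] by eventually_elim auto
 show "\<forall>\<^sub>F t in at_top. ln (2 + t) / (1 + t) \<le> 2 * (ln (2 + t) / (2 + t :: real))"
  using eventually_ge_at_top[of 0]
 proof eventually_elim
  case (elim t)
  then have "0 \<le> t * ln (2 + t)" by simp
  then show ?case using elim by (simp add: divide_simps)
 qed
qed

lemma survival_limit: "((\<lambda>t. (1 + t) * u t x) \<longlongrightarrow> \<Theta> x / Bc) at_top"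
proof (rule Lim_transform2[OF tendsto_const])
 obtain C where C: "\<And>t x. 0 \<le> t ==> \<bar>(1 + t) * u t x - \<Theta> x / Bc\<bar> \<le> C * ln (2 + t) / (1 + t)" using survival_rate by blast
 have "((\<lambda>t. C * (ln (2 + t) / (1 + t))) \<longlongrightarrow> 0) at_top" by (rule tendsto_mult_right_zero[OF ln_ratio_tendsto_0])
 then show "((\<lambda>t. \<Theta> x / Bc - (1 + t) * u t x) \<longlongrightarrow> 0) at_top"
  by (rule Lim_null_comparison[rotated]) (use eventually_ge_at_top[of 0] in eventually_elim, use C in \<open>simp add: abs_minus_commute\<close>)
qed

lemma moment_limit:
 assumes g: "g \<in> borel_measurable borel" "\<And>y. 0 \<le> g y" "\<And>y. g y \<le> G" and n: "1 \<le> n"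
 shows "((\<lambda>t. moment n g t x / (1 + t) ^ (n - 1)) \<longlongrightarrow> fact n * Bc ^ (n - 1) * (LINT y|\<mu>. g y) ^ n * \<Theta> x) at_top"
proof -
 let ?k = "fact n * Bc ^ (n - 1) * (LINT y|\<mu>. g y) ^ n * \<Theta> x"
 obtain C where C: "0 \<le> C" "\<And>t x. 0 \<le> t ==> \<bar>moment n g t x - fact n * (Bc * t) ^ (n - 1) * (LINT y|\<mu>. g y) ^ n * \<Theta> x\<bar> \<le> C * ((1 + t) ^ (n - 1) / sqrt (1 + t))"
  using moment_asymp[OF g n] by blast
 have 0: "((\<lambda>t::real. 1 - inverse (1 + t)) \<longlongrightarrow> 1) at_top"
  by (rule tendsto_eq_rhs[OF tendsto_diff[OF tendsto_const tendsto_inverse_0_at_top[OF filterlim_add_1_at_top]]]) simp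
 have 1: "((\<lambda>t. ?k * (1 - inverse (1 + t)) ^ (n - 1)) \<longlongrightarrow> ?k * 1 ^ (n - 1)) at_top"
  by (intro tendsto_mult tendsto_power tendsto_const 0)
 have "((\<lambda>t. C * inverse (sqrt (1 + t))) \<longlongrightarrow> 0) at_top"
  by (intro tendsto_mult_right_zero tendsto_inverse_0_at_top filterlim_compose[OF sqrt_at_top] filterlim_add_1_at_top)
 then have 2: "((\<lambda>t. ?k * (1 - inverse (1 + t)) ^ (n - 1) - moment n g t x / (1 + t) ^ (n - 1)) \<longlongrightarrow> 0) at_top"
 proof (rule Lim_null_comparison[rotated])
  show "\<forall>\<^sub>F t in at_top. norm (?k * (1 - inverse (1 + t)) ^ (n - 1) - moment n g t x / (1 + t) ^ (n - 1)) \<le> C * inverse (sqrt (1 + t))"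
   using eventually_ge_at_top[of 0]
  proof eventually_elim
   case (elim t)
   let ?p = "(1 + t) ^ (n - 1)"
   have p: "0 < ?p" using elim by simp
   have "1 - inverse (1 + t) = t / (1 + t)" using elim by (simp add: field_simps)
   then have "?k * (1 - inverse (1 + t)) ^ (n - 1) - moment n g t x / ?p =
    (fact n * (Bc * t) ^ (n - 1) * (LINT y|\<mu>. g y) ^ n * \<Theta> x - moment n g t x) / ?p"
    by (simp add: power_divide power_mult_distrib diff_divide_distrib mult_ac)
   also have "norm \<dots> \<le> C * (?p / sqrt (1 + t)) / ?p"
    using C(2)[OF elim, of x] p by (simp only: real_norm_def abs_divide abs_of_pos abs_minus_commute) (rule divide_right_mono, simp_all)
   also have "\<dots> = C * inverse (sqrt (1 + t))"
   proof -
    have "C * (q / s) / q = C * inverse s" if "0 < q" for q s :: real using that by (simp add: divide_inverse)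
    then show ?thesis using p by blast
   qed
   finally show ?case .
  qed
 qed
 show ?thesis using Lim_transform2[OF 1 2] by simp
qed

context
 fixes f :: "real => real" and K :: real
 assumes f[measurable]: "f \<in> borel_measurable borel" and fK: "\<And>y. \<bar>f y\<bar> \<le> K"
begin

lemma shift_bounds: "1 \<le> j ==> 0 \<le> f z + real j * K" "f z + real j * K \<le> (real j + 1) * K"
proof -
 have "0 \<le> K" using fK[of 0] by simp
 then show "1 \<le> j ==> 0 \<le> f z + real j * K" using mult_right_mono[of 1 "real j" K] fK[of z] by auto
 show "f z + real j * K \<le> (real j + 1) * K" using fK[of z] by (simp add: distrib_right)
qed

lemma signed_moment:
 assumes t: "0 \<le> t"
 shows "integrable (Pr x) (\<lambda>om. pr f t om ^ n)"
  and "(LINT om|Pr x. pr f t om ^ n) = (\<Sum>j=1..Suc n. (- 1) ^ Suc j * real (Suc n choose j) * moment n (\<lambda>y. f y + real j * K) t x)"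
proof -
 have i: "integrable (Pr x) (\<lambda>om. (- 1) ^ Suc j * real (Suc n choose j) * pr (\<lambda>y. f y + real j * K) t om ^ n)" if "j \<in> {1..Suc n}" for j
  using that by (intro integrable_mult_right integrable_pr[OF _ shift_bounds t]) auto
 show "integrable (Pr x) (\<lambda>om. pr f t om ^ n)"
  unfolding pr_power_shifted[of f t _ n K] by (intro Bochner_Integration.integrable_sum i)
 show "(LINT om|Pr x. pr f t om ^ n) = (\<Sum>j=1..Suc n. (- 1) ^ Suc j * real (Suc n choose j) * moment n (\<lambda>y. f y + real j * K) t x)"
  unfolding pr_power_shifted[of f t _ n K] using t
  by (subst Bochner_Integration.integral_sum[OF i]) (auto simp: moment_def intro!: sum.cong)
qed

text \<open>The identity that expands the n-th power over shifted nonnegative functions is linear in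
  the shifted powers, so it is used twice: before the limit on the pairings and after the limit on
  the \<mu>-integrals, where the shift is \<open>K * mass\<close>.\<close>

lemma signed_moment_limit:
 assumes n: "1 \<le> n"
 shows "((\<lambda>t. (LINT om|Pr x. pr f t om ^ n) / (1 + t) ^ (n - 1)) \<longlongrightarrow> fact n * Bc ^ (n - 1) * (LINT y|\<mu>. f y) ^ n * \<Theta> x) at_top"
proof -
 let ?m = "\<lambda>j t. moment n (\<lambda>y. f y + real j * K) t x / (1 + t) ^ (n - 1)"
 let ?l = "\<lambda>j. fact n * Bc ^ (n - 1) * (LINT y|\<mu>. f y + real j * K) ^ n * \<Theta> x"
 have ml: "(?m j \<longlongrightarrow> ?l j) at_top" if "j \<in> {1..Suc n}" for j
  using that n by (intro moment_limit[where G="(real j + 1) * K"] shift_bounds) auto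
 have lim: "((\<lambda>t. \<Sum>j=1..Suc n. (- 1) ^ Suc j * real (Suc n choose j) * ?m j t) \<longlongrightarrow> (\<Sum>j=1..Suc n. (- 1) ^ Suc j * real (Suc n choose j) * ?l j)) at_top"
  by (intro tendsto_sum tendsto_mult tendsto_const ml)
 have "integrable \<mu> f" using fK by (intro integrable_mu) auto
 then have "?l j = (fact n * Bc ^ (n - 1) * \<Theta> x) * ((LINT y|\<mu>. f y) + real j * (K * mass)) ^ n" for j
  by (simp add: mult_ac)
 then have "(\<Sum>j=1..Suc n. (- 1) ^ Suc j * real (Suc n choose j) * ?l j) =
  (fact n * Bc ^ (n - 1) * \<Theta> x) * (\<Sum>j=1..Suc n. (- 1) ^ Suc j * real (Suc n choose j) * ((LINT y|\<mu>. f y) + real j * (K * mass)) ^ n)"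
  unfolding sum_distrib_left by (intro sum.cong) (simp_all only: mult_ac)
 also have "\<dots> = fact n * Bc ^ (n - 1) * (LINT y|\<mu>. f y) ^ n * \<Theta> x"
  unfolding power_as_shifted_powers[symmetric] by (simp only: mult_ac)
 finally have L: "(\<Sum>j=1..Suc n. (- 1) ^ Suc j * real (Suc n choose j) * ?l j) = fact n * Bc ^ (n - 1) * (LINT y|\<mu>. f y) ^ n * \<Theta> x" .
 show ?thesis
  using lim unfolding L
 proof (rule Lim_transform_eventually)
  show "\<forall>\<^sub>F t in at_top. (\<Sum>j=1..Suc n. (- 1) ^ Suc j * real (Suc n choose j) * ?m j t) = (LINT om|Pr x. pr f t om ^ n) / (1 + t) ^ (n - 1)"
   using eventually_ge_at_top[of 0]
   by eventually_elim (simp only: signed_moment(2) sum_divide_distrib times_divide_eq_right)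
 qed
qed

text \<open>The conditional moment is the moment divided by the survival probability: the former
  grows like (1 + t)^(n-1), the latter decays like 1 / (1 + t), and together they match the
  normalisation (1 + t)^n. The eigenfunction cancels.\<close>

lemma conditioned_moment:
 fixes x :: real
 defines "S \<equiv> \<lambda>t. {om \<in> space (Pr x). 0 < pop_size X b d (tree om) t}"
 assumes n: "1 \<le> n"
 shows "0 \<le> t ==> integrable (uniform_measure (Pr x) (S t)) (\<lambda>om. (pr f t om / ((t + 1) * mass * Bc)) ^ n)"
  and "((\<lambda>t. \<integral>om. (pr f t om / ((t + 1) * mass * Bc)) ^ n \<partial>uniform_measure (Pr x) (S t)) \<longlongrightarrow> ((LINT y|\<mu>. f y) / mass) ^ n * fact n) at_top"
proof -
 interpret P: prob_space "Pr x" by (rule prob_space_Pr)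
 have S[measurable]: "S t \<in> sets (Pr x)" for t
  unfolding S_def pop_size_def by measurable
 have i: "integrable (Pr x) (\<lambda>om. (pr f t om / ((t + 1) * mass * Bc)) ^ n)" if "0 \<le> t" for t
  unfolding power_divide using signed_moment(1)[OF that] by (rule integrable_divide)
 show "0 \<le> t ==> integrable (uniform_measure (Pr x) (S t)) (\<lambda>om. (pr f t om / ((t + 1) * mass * Bc)) ^ n)"
  by (rule integrable_uniform_measure[OF P.finite_measure_axioms S i])
 have T0: "0 < \<Theta> x / Bc" using Theta_pos Bc_pos by simp
 have lim: "((\<lambda>t. ((LINT om|Pr x. pr f t om ^ n) / (1 + t) ^ (n - 1)) / ((mass * Bc) ^ n * ((1 + t) * u t x))) \<longlongrightarrow>
  (fact n * Bc ^ (n - 1) * (LINT y|\<mu>. f y) ^ n * \<Theta> x) / ((mass * Bc) ^ n * (\<Theta> x / Bc))) at_top"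
  using T0 mass_pos Bc_pos by (intro tendsto_divide tendsto_mult tendsto_const signed_moment_limit n survival_limit) auto
 \<comment> \<open>The n - 1 factors \<open>Bc\<close> from the moment and the one from the survival
   probability cancel the power in the normalisation.\<close>
 have "Bc ^ n = Bc ^ (n - 1) * Bc" using n by (cases n) auto
 then have L: "(fact n * Bc ^ (n - 1) * (LINT y|\<mu>. f y) ^ n * \<Theta> x) / ((mass * Bc) ^ n * (\<Theta> x / Bc)) = ((LINT y|\<mu>. f y) / mass) ^ n * fact n"
  using Theta_pos[of x] Bc_pos mass_pos by (simp add: power_mult_distrib power_divide field_simps)
 show "((\<lambda>t. \<integral>om. (pr f t om / ((t + 1) * mass * Bc)) ^ n \<partial>uniform_measure (Pr x) (S t)) \<longlongrightarrow> ((LINT y|\<mu>. f y) / mass) ^ n * fact n) at_top"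
  using lim unfolding L
 proof (rule Lim_transform_eventually)
  show "\<forall>\<^sub>F t in at_top. ((LINT om|Pr x. pr f t om ^ n) / (1 + t) ^ (n - 1)) / ((mass * Bc) ^ n * ((1 + t) * u t x)) =
   (LINT om|uniform_measure (Pr x) (S t). (pr f t om / ((t + 1) * mass * Bc)) ^ n)"
   using eventually_ge_at_top[of 0] order_tendstoD(1)[OF survival_limit T0]
  proof eventually_elim
   case (elim t)
   have m: "measure (Pr x) (S t) = u t x" unfolding S_def by (rule survival_prob[OF elim(1)])
   have up: "0 < u t x" using elim by (simp add: zero_less_mult_iff)
   have "(LINT om|uniform_measure (Pr x) (S t). (pr f t om / ((t + 1) * mass * Bc)) ^ n) = (LINT om|Pr x. indicator (S t) om * (pr f t om / ((t + 1) * mass * Bc)) ^ n) / u t x"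
    using integral_uniform_measure[OF P.finite_measure_axioms S i[OF elim(1)]] up by (simp add: m)
   \<comment> \<open>Off the survival event the pairing is 0, and since \<open>n\<close> is at least
     1 so is its power; the indicator may be dropped.\<close>
   also have "(LINT om|Pr x. indicator (S t) om * (pr f t om / ((t + 1) * mass * Bc)) ^ n) = (LINT om|Pr x. pr f t om ^ n / ((t + 1) * mass * Bc) ^ n)"
    using n by (intro Bochner_Integration.integral_cong refl) (auto simp: S_def power_divide pr_eq_0 split: split_indicator)
   also have "\<dots> = (LINT om|Pr x. pr f t om ^ n) / ((t + 1) * mass * Bc) ^ n" by simp
   also have "((t + 1) * mass * Bc) ^ n = (1 + t) ^ (n - 1) * (1 + t) * (mass * Bc) ^ n"
    using n by (cases n) (auto simp: power_mult_distrib mult_ac add.commute)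
   finally show ?case by (simp add: mult_ac)
  qed
 qed
qed

end

lemma survival_tendsto:
 "((\<lambda>t. (t + 1) * measure (Pr x) {om \<in> space (Pr x). pop_size X b d (\<lambda>u. L u om) t > 0})
  \<longlongrightarrow> 1 / (LINT y|\<mu>. (\<Theta> y)\<^sup>2 * b y) * \<Theta> x) at_top"
proof -
 have "((\<lambda>t. (1 + t) * u t x) \<longlongrightarrow> 1 / Bc * \<Theta> x) at_top" using survival_limit[of x] by simp
 then show ?thesis unfolding Bc_def
 proof (rule Lim_transform_eventually)
  show "\<forall>\<^sub>F t in at_top. (1 + t) * u t x = (t + 1) * measure (Pr x) {om \<in> space (Pr x). pop_size X b d (tree om) t > 0}"
   using eventually_ge_at_top[of 0] by eventually_elim (simp only: survival_prob add.commute)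
 qed
qed

lemma survival_sup_norm:
 "\<exists>C::real. \<forall>t\<ge>0. sup_norm (\<lambda>x. (1 + t) * measure (Pr x) {om \<in> space (Pr x). pop_size X b d (\<lambda>u. L u om) t > 0}
   - 1 / (LINT y|\<mu>. (\<Theta> y)\<^sup>2 * b y) * \<Theta> x) \<le> ennreal (C * ln (2 + t) / (1 + t))"
proof -
 obtain C where C: "\<And>t x. 0 \<le> t ==> \<bar>(1 + t) * u t x - \<Theta> x / Bc\<bar> \<le> C * ln (2 + t) / (1 + t)" using survival_rate by blast
 show ?thesis
 proof (intro exI[of _ C] allI impI)
  fix t :: real assume t: "0 \<le> t"
  show "sup_norm (\<lambda>x. (1 + t) * measure (Pr x) {om \<in> space (Pr x). pop_size X b d (tree om) t > 0}
   - 1 / (LINT y|\<mu>. (\<Theta> y)\<^sup>2 * b y) * \<Theta> x) \<le> ennreal (C * ln (2 + t) / (1 + t))"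
   unfolding sup_norm_def survival_prob[OF t] Bc_def[symmetric] using C[OF t] by (intro SUP_least ennreal_leI) simp
 qed
qed

end

theorem theorem3p5:
  fixes \<Omega> :: "'a measure" and F :: "real \<Rightarrow> 'a measure"
    and X :: "real \<Rightarrow> 'a \<Rightarrow> real" and Q :: "real \<Rightarrow> 'a measure"
    and b d V :: "real \<Rightarrow> real"
    and P :: "real \<Rightarrow> (real \<Rightarrow> real) \<Rightarrow> real \<Rightarrow> real"
    and Pr :: "real \<Rightarrow> 'w measure" and L :: "nat list \<Rightarrow> 'w \<Rightarrow> 'a life"
    and Z :: "real \<Rightarrow> 'w \<Rightarrow> (real \<Rightarrow> real) \<Rightarrow> real" and N :: "real \<Rightarrow> 'w \<Rightarrow> real"
    and \<Theta>\<^sub>0 :: "real \<Rightarrow> real" and lam\<^sub>0 :: real and \<mu>\<^sub>0 \<nu> :: "real measure" and A B :: real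
    and S :: "'s measure" and \<xi> :: "'s \<Rightarrow> real"
  assumes V_eq: "V = (\<lambda>y. b y - d y)"
    and HV: "HV b d"
    and motion: "markov_process \<Omega> F X Q"
    and V_integrable: "\<And>x. AE w in Q x. \<forall>t\<ge>0. set_integrable lborel {0..t} (\<lambda>s. V (X s w))"
    and P_eq: "P = feynman_kac X Q V"
    and branching: "branching_markov_process \<Omega> X Q b Pr L"
    and Z_eq: "\<And>t \<omega>. Z t \<omega> = pairing X b d (\<lambda>u. L u \<omega>) t"
    and N_eq: "\<And>t \<omega>. N t \<omega> = pop_size X b d (\<lambda>u. L u \<omega>) t"
    and HP1: "HP1 P \<Theta>\<^sub>0 lam\<^sub>0"
    and HP2: "HP2 P \<Theta>\<^sub>0 lam\<^sub>0 \<mu>\<^sub>0"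
    and HP3: "HP3 P"
    and HP4: "HP4 P"
    and HP5: "HP5 X b d Pr L"
    and critical: "lam\<^sub>0 = 0"
    and \<nu>_eq: "\<nu> = scale_measure (1 / emeasure \<mu>\<^sub>0 UNIV) \<mu>\<^sub>0"
    and A_eq: "A = (\<integral>y. 1 \<partial>\<mu>\<^sub>0)"
    and B_eq: "B = (\<integral>y. (\<Theta>\<^sub>0 y)\<^sup>2 * b y \<partial>\<mu>\<^sub>0)"
    and S: "prob_space S"
    and \<xi>: "distributed S lborel \<xi> (\<lambda>y. ennreal (exponential_density 1 y))"
  shows "(\<forall>x. ((\<lambda>t. (t + 1) * measure (Pr x) {\<omega> \<in> space (Pr x). N t \<omega> > 0})
                \<longlongrightarrow> 1 / B * \<Theta>\<^sub>0 x) at_top) \<and>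
         (\<exists>C::real. \<forall>t\<ge>0.
            sup_norm (\<lambda>x. (1 + t) * measure (Pr x) {\<omega> \<in> space (Pr x). N t \<omega> > 0} - 1 / B * \<Theta>\<^sub>0 x)
              \<le> ennreal (C * ln (2 + t) / (1 + t))) \<and>
         (\<forall>f\<in>Cb. \<forall>n\<ge>1. \<forall>x.
            (\<forall>t\<ge>0. integrable (uniform_measure (Pr x) {\<omega> \<in> space (Pr x). N t \<omega> > 0})
                      (\<lambda>\<omega>. (Z t \<omega> f / ((t + 1) * A * B)) ^ n)) \<and>
            ((\<lambda>t. \<integral>\<omega>. (Z t \<omega> f / ((t + 1) * A * B)) ^ n
                    \<partial>uniform_measure (Pr x) {\<omega> \<in> space (Pr x). N t \<omega> > 0})
               \<longlongrightarrow> (\<integral>y. f y \<partial>\<nu>) ^ n * (\<integral>s. \<xi> s ^ n \<partial>S)) at_top)"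
proof -
 interpret br: branching \<Omega> F X Q b d Pr L
  using HV motion V_integrable branching by unfold_locales (auto simp: V_eq)
 have Th: "\<Theta>\<^sub>0 \<in> C0" "\<And>x. 0 < \<Theta>\<^sub>0 x" "\<And>t x. 0 \<le> t ==> P t \<Theta>\<^sub>0 x = \<Theta>\<^sub>0 x" using HP1 critical by (auto simp: HP1_def)
 have contT: "continuous_on UNIV \<Theta>\<^sub>0" using Th(1) by (simp add: C0_def)
 obtain Tm where Tm: "\<And>x. \<Theta>\<^sub>0 x \<le> Tm" using C0_bounded[OF Th(1)] by blast
 have mu: "sets \<mu>\<^sub>0 = sets borel" "finite_measure \<mu>\<^sub>0" "\<And>U. open U ==> U \<noteq> {} ==> 0 < emeasure \<mu>\<^sub>0 U" "(LINT y|\<mu>\<^sub>0. \<Theta>\<^sub>0 y) = 1"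
  using HP2 by (auto simp: HP2_def)
 obtain c H where c: "0 < c" and H: "0 < H"
  and gap: "\<And>g t. g \<in> Cb ==> 0 \<le> t ==> sup_norm (\<lambda>x. P t g x - \<Theta>\<^sub>0 x * (LINT y|\<mu>\<^sub>0. g y)) \<le> ennreal H * sup_norm g * ennreal (exp (- c * t))"
  using HP2 critical by (auto simp: HP2_def)
 have Pk: "P t g x = (LINT z|br.kappa t x. g z)" if "continuous_on UNIV g" "0 \<le> t" for g t x
  unfolding P_eq V_eq using that by (intro br.feynman_kac_kappa borel_measurable_continuous_onI)
 \<comment> \<open>With \<open>lam0 = 0\<close> the bound in the sup norm becomes, at each trait,
   the pointwise gap condition for any bound \<open>K\<close> on the test function.\<close>
 have cr: "critical \<Omega> F X Q b d Pr L \<Theta>\<^sub>0 \<mu>\<^sub>0 H c Tm"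
 proof (intro critical.intro critical_axioms.intro br.branching_axioms)
  show "(LINT z|br.kappa t x. \<Theta>\<^sub>0 z) = \<Theta>\<^sub>0 x" if "0 \<le> t" for t x by (rule trans[OF Pk[OF contT that, symmetric] Th(3)[OF that]])
  show "\<bar>(LINT z|br.kappa t x. g z) - \<Theta>\<^sub>0 x * (LINT y|\<mu>\<^sub>0. g y)\<bar> \<le> H * K * exp (- c * t)"
   if g: "continuous_on UNIV g" "\<And>y. \<bar>g y\<bar> \<le> K" and t: "0 \<le> t" for g t x K
  proof -
   have K: "0 \<le> K" using g(2)[of 0] by simp
   have "g \<in> Cb" using g by (auto simp: Cb_def intro!: boundedI[where B=K])
   have "ennreal \<bar>P t g x - \<Theta>\<^sub>0 x * (LINT y|\<mu>\<^sub>0. g y)\<bar> \<le> sup_norm (\<lambda>x. P t g x - \<Theta>\<^sub>0 x * (LINT y|\<mu>\<^sub>0. g y))"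
    unfolding sup_norm_def by (rule SUP_upper) simp
   also have "\<dots> \<le> ennreal H * sup_norm g * ennreal (exp (- c * t))" by (rule gap[OF \<open>g \<in> Cb\<close> t])
   also have "\<dots> \<le> ennreal H * ennreal K * ennreal (exp (- c * t))"
    unfolding sup_norm_def using g(2) by (intro mult_right_mono mult_left_mono SUP_least ennreal_leI) auto
   also have "ennreal H * ennreal K * ennreal (exp (- c * t)) = ennreal (H * K * exp (- c * t))" using H K by (simp add: ennreal_mult)
   finally show ?thesis unfolding Pk[OF g(1) t] using H K by (subst (asm) ennreal_le_iff) (auto simp: mult_left_mono mult_right_mono)
  qed
 qed (fact mu contT Th(2) Tm c H | (rule mu contT Th(2) Tm c H; assumption))+
 have A: "A = measure \<mu>\<^sub>0 UNIV" unfolding A_eq using sets_eq_imp_space_eq[OF mu(1)] by simp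
 \<comment> \<open>The standard exponential law is the Erlang law of shape 1, whose n-th moment is
   n!, the factorial found in the limit.\<close>
 have mom: "(LINT s|S. \<xi> s ^ n) = fact n" for n
  using prob_space.erlang_ith_moment[OF S _ \<xi>, of n] by simp
 have nu: "(LINT y|\<nu>. f y) = (LINT y|\<mu>\<^sub>0. f y) / measure \<mu>\<^sub>0 UNIV" if "f \<in> borel_measurable borel" for f
 proof -
  have "1 / emeasure \<mu>\<^sub>0 UNIV = ennreal (1 / measure \<mu>\<^sub>0 UNIV)"
   using critical.mass_pos[OF cr] by (simp add: finite_measure.emeasure_eq_measure[OF mu(2)] divide_ennreal ennreal_1[symmetric] del: ennreal_1)
  moreover have "f \<in> borel_measurable \<mu>\<^sub>0" using that mu(1) by (simp cong: measurable_cong_sets)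
  ultimately show ?thesis unfolding \<nu>_eq by (simp add: integral_scale_measure)
 qed
 have 3: "(\<forall>t\<ge>0. integrable (uniform_measure (Pr x) {om \<in> space (Pr x). N t om > 0}) (\<lambda>om. (Z t om f / ((t + 1) * A * B)) ^ n)) \<and>
   ((\<lambda>t. \<integral>om. (Z t om f / ((t + 1) * A * B)) ^ n \<partial>uniform_measure (Pr x) {om \<in> space (Pr x). N t om > 0})
    \<longlongrightarrow> (LINT y|\<nu>. f y) ^ n * (LINT s|S. \<xi> s ^ n)) at_top"
  if f: "f \<in> Cb" and n: "1 \<le> n" for f n x
 proof -
  have fm: "f \<in> borel_measurable borel" using f by (auto simp: Cb_def intro: borel_measurable_continuous_onI)
  obtain K where K: "\<And>y. \<bar>f y\<bar> \<le> K" using f by (auto simp: Cb_def bounded_iff)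
  show ?thesis
   using critical.conditioned_moment(1)[OF cr fm K n, where x=x] critical.conditioned_moment(2)[OF cr fm K n, where x=x]
   unfolding Z_eq N_eq A B_eq mom nu[OF fm] critical.Bc_def[OF cr] br.pr_def by blast
 qed
 show ?thesis
  using critical.survival_tendsto[OF cr] critical.survival_sup_norm[OF cr] 3 unfolding N_eq B_eq by blast
qed

end
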